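(* Let $n\ge2$, $\gamma>0$, $|\Omega|<\gamma$, $\kappa\in\{1,-1\}$, $c>0$. Let $G:\mathbb{R}^n\times\mathbb{R}_+\to\mathbb{R}_+$ be continuous and differentiable, with $G(x,0)=0$, such that for some constant $C'>0$ and some $1\le p<1+\frac4{n-2}$, $$|\partial_vG(x,v)|\le C'\big(1+v^{\frac{p-1}{2}}\big)\quad\text{for all }x\in\mathbb{R}^n,\ v\ge0 .$$ Suppose one of the following holds: (a) $\kappa=1$ and $1<p<1+\frac4n$; (b) $\kappa=1$, $p=1+\frac4n$ and $c<\|Q_{\lambda,1}\|_2$, where $\lambda=\frac{n+2}{n}C$, $C>0$ is a constant with $0\le G(x,v)\le C(v+v^{\frac{p+1}{2}})$ for all $x,v$, and $Q_{\lambda,1}\in H^1(\mathbb{R}^n)$ is the unique positive radial solution of $-\frac12\Delta Q-\lambda|Q|^{4/n}Q=-Q$; (c) $\kappa=-1$ and $1<p<1+\frac4{n-2}$. Then the set $$Z_c=\{u\in\Sigma:\ E_{\Omega,\gamma}(u)=I_c,\ \|u\|_2=c\}$$ is orbitally stable for $$ i u_t=-\tfrac12\Delta u+\tfrac{\gamma^2}{2}|x|^2u-\kappa\,\partial_vG(x,|u|^2)\,u-\Omega L_zu,\qquad u(0)=u_0\in\Sigma.\qquad(\ast)$$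
   Context: $\Sigma=\{f\in H^1(\mathbb{R}^n;\mathbb{C}):|x|f\in L^2\}$ with norm (up to equivalence) given by $\|f\|_\Sigma^2=\|\nabla f\|_2^2+\|xf\|_2^2+\|f\|_2^2$; $L_z=i(x_2\partial_{x_1}-x_1\partial_{x_2})$; $\mathbb{R}_+=[0,\infty)$; $1+\frac4{n-2}=+\infty$ if $n=2$. The energy is $E_{\Omega,\gamma}(u)=\int(\frac12|\nabla u|^2+\frac{\gamma^2}{2}|x|^2|u|^2-\kappa G(x,|u|^2)-\Omega\bar uL_zu)\,dx$, and $I_c=\inf\{E_{\Omega,\gamma}(u):u\in\Sigma,\ \|u\|_2=c\}$. The local theory is taken as part of the setting: for every $u_0\in\Sigma$ there is a unique maximal (Duhamel) solution $u\in C(I,\Sigma)$ of $(\ast)$, $I=(-T_{min},T_{max})$, with $\|u(t)\|_\Sigma\to\infty$ at a finite endpoint, and $\|u(t)\|_2=\|u_0\|_2$, $E_{\Omega,\gamma}(u(t))=E_{\Omega,\gamma}(u_0)$ on $I$; $u(t,\cdot)$ denotes this solution. $Z_c$ is called orbitally stable if for every $\varphi\in Z_c$ and every $\varepsilon>0$ there exists $\delta>0$ such that $\|u_0-\varphi\|_\Sigma<\delta$ implies $\sup_t\inf_{\phi\in Z_c}\|u(t,\cdot)-\phi\|_\Sigma<\varepsilon$. *)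

theory Defs
  imports "HOL-Analysis.Analysis"
begin

subsection \<open>Sobolev spaces\<close>

text \<open>Elements of function spaces are represented by Borel functions
  \<open>real ^ 'n \<Rightarrow> complex\<close>; equality of such elements is equality almost everywhere.\<close>

definition partial_deriv :: "'n::finite \<Rightarrow> (real ^ 'n \<Rightarrow> complex) \<Rightarrow> real ^ 'n \<Rightarrow> complex" where
  "partial_deriv j f x = frechet_derivative f (at x) (axis j 1)"

primrec Ck :: "nat \<Rightarrow> (real ^ 'n::finite \<Rightarrow> complex) \<Rightarrow> bool" where
  "Ck 0 f \<longleftrightarrow> continuous_on UNIV f"
| "Ck (Suc k) f \<longleftrightarrow> (\<forall>x. f differentiable (at x)) \<and> (\<forall>j. Ck k (partial_deriv j f))"

definition test_function :: "(real ^ 'n::finite \<Rightarrow> complex) \<Rightarrow> bool" where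
  "test_function \<phi> \<longleftrightarrow> (\<forall>k. Ck k \<phi>) \<and> compact (closure {x. \<phi> x \<noteq> 0})"

definition laplacian :: "(real ^ 'n::finite \<Rightarrow> complex) \<Rightarrow> real ^ 'n \<Rightarrow> complex" where
  "laplacian \<phi> x = (\<Sum>j\<in>UNIV. partial_deriv j (partial_deriv j \<phi>) x)"

definition L2 :: "(real ^ 'n::finite \<Rightarrow> complex) set" where
  "L2 = {f. f \<in> borel_measurable lborel \<and> integrable lborel (\<lambda>x. (cmod (f x))\<^sup>2)}"

definition L2_norm :: "(real ^ 'n::finite \<Rightarrow> complex) \<Rightarrow> real" where
  "L2_norm f = sqrt (\<integral>x. (cmod (f x))\<^sup>2 \<partial>lborel)"

definition is_weak_partial ::
  "'n::finite \<Rightarrow> (real ^ 'n \<Rightarrow> complex) \<Rightarrow> (real ^ 'n \<Rightarrow> complex) \<Rightarrow> bool" where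
  "is_weak_partial j f g \<longleftrightarrow>
     (\<forall>\<phi>. test_function \<phi> \<longrightarrow>
        (\<integral>x. f x * partial_deriv j \<phi> x \<partial>lborel) = - (\<integral>x. g x * \<phi> x \<partial>lborel))"

definition H1 :: "(real ^ 'n::finite \<Rightarrow> complex) set" where
  "H1 = {f \<in> L2. \<forall>j. \<exists>g\<in>L2. is_weak_partial j f g}"

text \<open>On \<^const>\<open>H1\<close> the weak derivative is determined up to a null set, so none of the
  integrals below depends on the choice.\<close>

definition weak_partial :: "'n::finite \<Rightarrow> (real ^ 'n \<Rightarrow> complex) \<Rightarrow> real ^ 'n \<Rightarrow> complex" where
  "weak_partial j f = (SOME g. g \<in> L2 \<and> is_weak_partial j f g)"

definition weak_grad :: "(real ^ 'n::finite \<Rightarrow> complex) \<Rightarrow> real ^ 'n \<Rightarrow> complex ^ 'n" where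
  "weak_grad f x = (\<chi> j. weak_partial j f x)"

definition Sigma_space :: "(real ^ 'n::finite \<Rightarrow> complex) set" where
  "Sigma_space = {f \<in> H1. (\<lambda>x. complex_of_real (norm x) * f x) \<in> L2}"

definition Sigma_norm :: "(real ^ 'n::finite \<Rightarrow> complex) \<Rightarrow> real" where
  "Sigma_norm f = sqrt ((\<integral>x. (norm (weak_grad f x))\<^sup>2 \<partial>lborel)
     + (L2_norm (\<lambda>x. complex_of_real (norm x) * f x))\<^sup>2 + (L2_norm f)\<^sup>2)"


subsection \<open>Energy and constrained minimisers\<close>

text \<open>In the following, \<open>e1 \<noteq> e2 :: 'n\<close> are the indices of the coordinates called
  \<open>x\<^sub>1\<close> and \<open>x\<^sub>2\<close>, that is, of the plane of rotation.\<close>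

definition Lz ::
  "'n::finite \<Rightarrow> 'n \<Rightarrow> (real ^ 'n \<Rightarrow> complex) \<Rightarrow> real ^ 'n \<Rightarrow> complex" where
  "Lz e1 e2 f x = \<i> * (complex_of_real (x $ e2) * weak_partial e1 f x
                       - complex_of_real (x $ e1) * weak_partial e2 f x)"

text \<open>The operator \<^const>\<open>Lz\<close> is symmetric, so the complex integral is real for \<open>f\<close> in
  \<^const>\<open>Sigma_space\<close>; the real part only adjusts the type.\<close>

definition energy ::
  "'n::finite \<Rightarrow> 'n \<Rightarrow> real \<Rightarrow> real \<Rightarrow> real \<Rightarrow> (real ^ 'n \<Rightarrow> real \<Rightarrow> real)
     \<Rightarrow> (real ^ 'n \<Rightarrow> complex) \<Rightarrow> real" where
  "energy e1 e2 \<Omega> \<gamma> \<kappa> G f =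
     Re (\<integral>x. complex_of_real (1/2 * (norm (weak_grad f x))\<^sup>2
                + \<gamma>\<^sup>2/2 * (norm x)\<^sup>2 * (cmod (f x))\<^sup>2
                - \<kappa> * G x ((cmod (f x))\<^sup>2))
              - complex_of_real \<Omega> * cnj (f x) * Lz e1 e2 f x \<partial>lborel)"

definition min_energy ::
  "'n::finite \<Rightarrow> 'n \<Rightarrow> real \<Rightarrow> real \<Rightarrow> real \<Rightarrow> (real ^ 'n \<Rightarrow> real \<Rightarrow> real) \<Rightarrow> real \<Rightarrow> ereal" where
  "min_energy e1 e2 \<Omega> \<gamma> \<kappa> G c =
     (INF f \<in> {f \<in> Sigma_space. L2_norm f = c}. ereal (energy e1 e2 \<Omega> \<gamma> \<kappa> G f))"

definition minimizers ::
  "'n::finite \<Rightarrow> 'n \<Rightarrow> real \<Rightarrow> real \<Rightarrow> real \<Rightarrow> (real ^ 'n \<Rightarrow> real \<Rightarrow> real) \<Rightarrow> real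
     \<Rightarrow> (real ^ 'n \<Rightarrow> complex) set" where
  "minimizers e1 e2 \<Omega> \<gamma> \<kappa> G c =
     {f \<in> Sigma_space. ereal (energy e1 e2 \<Omega> \<gamma> \<kappa> G f) = min_energy e1 e2 \<Omega> \<gamma> \<kappa> G c
                        \<and> L2_norm f = c}"


subsection \<open>Duhamel solutions\<close>

definition deriv_v :: "(real ^ 'n::finite \<Rightarrow> real \<Rightarrow> real) \<Rightarrow> real ^ 'n \<Rightarrow> real \<Rightarrow> real" where
  "deriv_v G x v = vector_derivative (G x) (at v within {0..})"

definition nonlinearity ::
  "(real ^ 'n::finite \<Rightarrow> real \<Rightarrow> real) \<Rightarrow> (real ^ 'n \<Rightarrow> complex) \<Rightarrow> real ^ 'n \<Rightarrow> complex" where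
  "nonlinearity G f x = complex_of_real (deriv_v G x ((cmod (f x))\<^sup>2)) * f x"

text \<open>The linear Hamiltonian \<open>H = -\<Delta>/2 + \<gamma>\<^sup>2|x|\<^sup>2/2 - \<Omega> L\<^sub>z\<close>, used on test functions only.\<close>

definition hamiltonian ::
  "'n::finite \<Rightarrow> 'n \<Rightarrow> real \<Rightarrow> real \<Rightarrow> (real ^ 'n \<Rightarrow> complex) \<Rightarrow> real ^ 'n \<Rightarrow> complex" where
  "hamiltonian e1 e2 \<Omega> \<gamma> \<phi> x =
     - (1/2) * laplacian \<phi> x + complex_of_real (\<gamma>\<^sup>2/2 * (norm x)\<^sup>2) * \<phi> x
     - complex_of_real \<Omega> * Lz e1 e2 \<phi> x"

text \<open>\<open>U t = exp (-i t H)\<close>, as the strongly continuous unitary group on \<^const>\<open>L2\<close> whose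
  generator extends \<open>-i H\<close> on test functions. For \<open>|\<Omega>| < \<gamma>\<close> the operator \<open>H\<close> is essentially
  self-adjoint there, so \<open>U\<close> exists and is unique up to null sets.\<close>

definition schroedinger_group ::
  "'n::finite \<Rightarrow> 'n \<Rightarrow> real \<Rightarrow> real
     \<Rightarrow> (real \<Rightarrow> (real ^ 'n \<Rightarrow> complex) \<Rightarrow> real ^ 'n \<Rightarrow> complex) \<Rightarrow> bool" where
  "schroedinger_group e1 e2 \<Omega> \<gamma> U \<longleftrightarrow>
     (\<forall>t. \<forall>f\<in>L2. U t f \<in> L2 \<and> L2_norm (U t f) = L2_norm f) \<and>
     (\<forall>t. \<forall>f\<in>L2. \<forall>g\<in>L2. \<forall>\<alpha> \<beta>.
        AE x in lborel. U t (\<lambda>y. \<alpha> * f y + \<beta> * g y) x = \<alpha> * U t f x + \<beta> * U t g x) \<and>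
     (\<forall>f\<in>L2. AE x in lborel. U 0 f x = f x) \<and>
     (\<forall>s t. \<forall>f\<in>L2. AE x in lborel. U (s + t) f x = U s (U t f) x) \<and>
     (\<forall>f\<in>L2. ((\<lambda>t. L2_norm (\<lambda>x. U t f x - f x)) \<longlongrightarrow> 0) (at 0)) \<and>
     (\<forall>\<phi>. test_function \<phi> \<longrightarrow>
        ((\<lambda>t. L2_norm (\<lambda>x. (U t \<phi> x - \<phi> x) / complex_of_real t
                            + \<i> * hamiltonian e1 e2 \<Omega> \<gamma> \<phi> x)) \<longlongrightarrow> 0) (at 0))"

definition time_interval :: "ereal \<Rightarrow> ereal \<Rightarrow> real set" where
  "time_interval Tmin Tmax = {t. - Tmin < ereal t \<and> ereal t < Tmax}"

text \<open>A solution satisfies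
  \<open>u t = U t u\<^sub>0 + i \<kappa> \<integral>\<^sub>0\<^sup>t U (t - s) (\<partial>\<^sub>vG(x,|u s|\<^sup>2) u s) ds\<close>.
  For \<open>u s\<close> in \<^const>\<open>Sigma_space\<close> the nonlinearity need not be square integrable, only an element
  of the dual space, so the integral is taken in the weak sense: the formula is paired with a
  test function \<open>\<phi>\<close> and \<open>U (t - s)\<close> is moved to \<open>\<phi>\<close> as its adjoint \<open>U (s - t)\<close>.\<close>

definition is_solution ::
  "real \<Rightarrow> (real ^ 'n \<Rightarrow> real \<Rightarrow> real)
     \<Rightarrow> (real \<Rightarrow> (real ^ 'n \<Rightarrow> complex) \<Rightarrow> real ^ 'n \<Rightarrow> complex)
     \<Rightarrow> (real ^ 'n::finite \<Rightarrow> complex) \<Rightarrow> ereal \<Rightarrow> ereal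
     \<Rightarrow> (real \<Rightarrow> real ^ 'n \<Rightarrow> complex) \<Rightarrow> bool" where
  "is_solution \<kappa> G U u0 Tmin Tmax u \<longleftrightarrow>
     0 < Tmin \<and> 0 < Tmax \<and>
     (\<forall>t\<in>time_interval Tmin Tmax. u t \<in> Sigma_space \<and>
        ((\<lambda>s. Sigma_norm (\<lambda>x. u s x - u t x)) \<longlongrightarrow> 0) (at t)) \<and>
     (AE x in lborel. u 0 x = u0 x) \<and>
     (\<forall>\<phi>. test_function \<phi> \<longrightarrow> (\<forall>t\<in>time_interval Tmin Tmax.
        (\<forall>s\<in>time_interval Tmin Tmax.
           integrable lborel (\<lambda>x. nonlinearity G (u s) x * cnj (U (s - t) \<phi> x))) \<and>
        interval_lebesgue_integrable lborel 0 (ereal t)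
          (\<lambda>s. \<integral>x. nonlinearity G (u s) x * cnj (U (s - t) \<phi> x) \<partial>lborel) \<and>
        (\<integral>x. u t x * cnj (\<phi> x) \<partial>lborel) =
          (\<integral>x. U t u0 x * cnj (\<phi> x) \<partial>lborel)
          + \<i> * complex_of_real \<kappa> *
            (LBINT s=0..ereal t. \<integral>x. nonlinearity G (u s) x * cnj (U (s - t) \<phi> x) \<partial>lborel)))"

definition maximal_solution ::
  "real \<Rightarrow> (real ^ 'n \<Rightarrow> real \<Rightarrow> real)
     \<Rightarrow> (real \<Rightarrow> (real ^ 'n \<Rightarrow> complex) \<Rightarrow> real ^ 'n \<Rightarrow> complex)
     \<Rightarrow> (real ^ 'n::finite \<Rightarrow> complex) \<Rightarrow> ereal \<Rightarrow> ereal
     \<Rightarrow> (real \<Rightarrow> real ^ 'n \<Rightarrow> complex) \<Rightarrow> bool" where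
  "maximal_solution \<kappa> G U u0 Tmin Tmax u \<longleftrightarrow>
     is_solution \<kappa> G U u0 Tmin Tmax u \<and>
     (\<forall>Smin Smax w. is_solution \<kappa> G U u0 Smin Smax w \<and> Tmin \<le> Smin \<and> Tmax \<le> Smax \<and>
        (\<forall>t\<in>time_interval Tmin Tmax. AE x in lborel. w t x = u t x)
        \<longrightarrow> Smin = Tmin \<and> Smax = Tmax)"

text \<open>The local theory: existence and uniqueness of the maximal solution for every initial datum
  in \<^const>\<open>Sigma_space\<close>, the blow-up alternative, and conservation of mass and energy.\<close>

definition local_theory ::
  "'n::finite \<Rightarrow> 'n \<Rightarrow> real \<Rightarrow> real \<Rightarrow> real \<Rightarrow> (real ^ 'n \<Rightarrow> real \<Rightarrow> real)
     \<Rightarrow> (real \<Rightarrow> (real ^ 'n \<Rightarrow> complex) \<Rightarrow> real ^ 'n \<Rightarrow> complex) \<Rightarrow> bool" where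
  "local_theory e1 e2 \<Omega> \<gamma> \<kappa> G U \<longleftrightarrow>
     (\<forall>u0\<in>Sigma_space. \<exists>Tmin Tmax u.
        maximal_solution \<kappa> G U u0 Tmin Tmax u \<and>
        (\<forall>Smin Smax w. maximal_solution \<kappa> G U u0 Smin Smax w \<longrightarrow>
           Smin = Tmin \<and> Smax = Tmax \<and>
           (\<forall>t\<in>time_interval Tmin Tmax. AE x in lborel. w t x = u t x)) \<and>
        (\<forall>T. Tmax = ereal T \<longrightarrow> filterlim (\<lambda>t. Sigma_norm (u t)) at_top (at_left T)) \<and>
        (\<forall>T. Tmin = ereal T \<longrightarrow> filterlim (\<lambda>t. Sigma_norm (u t)) at_top (at_right (- T))) \<and>
        (\<forall>t\<in>time_interval Tmin Tmax. L2_norm (u t) = L2_norm u0 \<and>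
           energy e1 e2 \<Omega> \<gamma> \<kappa> G (u t) = energy e1 e2 \<Omega> \<gamma> \<kappa> G u0))"

definition orbitally_stable ::
  "real \<Rightarrow> (real ^ 'n \<Rightarrow> real \<Rightarrow> real)
     \<Rightarrow> (real \<Rightarrow> (real ^ 'n \<Rightarrow> complex) \<Rightarrow> real ^ 'n \<Rightarrow> complex)
     \<Rightarrow> (real ^ 'n::finite \<Rightarrow> complex) set \<Rightarrow> bool" where
  "orbitally_stable \<kappa> G U Z \<longleftrightarrow>
     (\<forall>\<phi>\<in>Z. \<forall>\<epsilon>>0. \<exists>\<delta>>0. \<forall>u0\<in>Sigma_space.
        Sigma_norm (\<lambda>x. u0 x - \<phi> x) < \<delta> \<longrightarrow>
        (\<forall>Tmin Tmax u. maximal_solution \<kappa> G U u0 Tmin Tmax u \<longrightarrow>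
           (SUP t\<in>time_interval Tmin Tmax. INF \<psi>\<in>Z. ereal (Sigma_norm (\<lambda>x. u t x - \<psi> x)))
             < ereal \<epsilon>))"


subsection \<open>Exponents and the ground state\<close>

definition energy_critical :: "nat \<Rightarrow> ereal" where
  "energy_critical n = (if n = 2 then \<infinity> else ereal (1 + 4 / (real n - 2)))"

text \<open>Positive radial solutions in \<^const>\<open>H1\<close>, in the sense of distributions, of
  \<open>-\<Delta>Q/2 - \<mu> |Q|\<^bsup>4/n\<^esup> Q = -Q\<close>.\<close>

definition positive_radial_solution :: "real \<Rightarrow> (real ^ 'n::finite \<Rightarrow> real) \<Rightarrow> bool" where
  "positive_radial_solution \<mu> Q \<longleftrightarrow>
     (\<lambda>x. complex_of_real (Q x)) \<in> H1 \<and>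
     (\<forall>x. 0 < Q x) \<and>
     (\<forall>x y. norm x = norm y \<longrightarrow> Q x = Q y) \<and>
     (\<forall>\<phi>. test_function \<phi> \<longrightarrow>
        - (1/2) * (\<integral>x. complex_of_real (Q x) * laplacian \<phi> x \<partial>lborel)
        - complex_of_real \<mu> *
          (\<integral>x. complex_of_real (\<bar>Q x\<bar> powr (4 / real CARD('n)) * Q x) * \<phi> x \<partial>lborel)
        = - (\<integral>x. complex_of_real (Q x) * \<phi> x \<partial>lborel))"

definition is_ground_state :: "real \<Rightarrow> (real ^ 'n::finite \<Rightarrow> real) \<Rightarrow> bool" where
  "is_ground_state \<mu> Q \<longleftrightarrow> positive_radial_solution \<mu> Q \<and>
     (\<forall>Q'. positive_radial_solution \<mu> Q' \<longrightarrow> (AE x in lborel. Q' x = Q x))"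

end

theory Submission
imports Defs "HOL-Computational_Algebra.Polynomial" "HOL-Complex_Analysis.Great_Picard"
begin

text \<open>Completing the square with the vector potential \<open>A = \<Omega> (-x\<^sub>2, x\<^sub>1)\<close> turns the quadratic part of the
 energy into \<open>1/2 \<parallel>(\<nabla> - i A) u\<parallel>\<^sup>2\<close> plus a trap that is positive definite for \<open>|\<Omega>| < \<gamma>\<close>. If the energy is
 coercive near mass \<open>c\<close>, minimising sequences are tight, hence compact in \<open>L\<^sup>2\<close>; the nonlinear term is
 continuous there, and the parallelogram law upgrades convergence to the energy space. Stability follows from the
 conservation laws. Coercivity is clear if \<open>\<kappa> = -1\<close> and follows from subcritical bounds on level sets if
 \<open>p < 1 + 4/n\<close>. For \<open>p = 1 + 4/n\<close> it needs the sharp Gagliardo--Nirenberg constant for \<open>|u|\<close>, by the diamagnetic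
 inequality. A minimiser of \<open>1/2 \<parallel>\<nabla>u\<parallel>\<^sup>2 + \<parallel>u\<parallel>\<^sup>2\<close> under \<open>\<integral>|u|\<^bsup>2 + 4/n\<^esup> = 1\<close> exists
 among functions made radially decreasing by polarization; it is positive, so it is a multiple of \<open>Q\<close>.\<close>

text \<open>Weak gradients are known only through pairings, so |u|, polarizations and a.e. limits
  come with no gradient to compute with. Regularity is therefore read off translations:
  \<open>shift_dist f z\<close> grows at most linearly in |z| exactly on \<open>H1\<close>, and its
  mean square over small balls recovers the Dirichlet integral with the exact factor
  \<open>ball_moment\<close>. The diamagnetic inequality, polarization and lower semicontinuity
  become pointwise statements about |f(y) - f(x)|, while averages over balls yield local compactness
  and the decay of level sets. Only the growth of the derivative of G in v is bounded, so weak
  convergence would not control the nonlinear term; strong L2 convergence on bounded sets of H1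
  does. Perturbed data have mass near c rather than equal to c, hence coercivity is asked for on
  masses reaching beyond c. In the critical case Q is accessible only through uniqueness among
  positive radial solutions, so an extremal function has to be produced that solves the equation and
  is radial and positive at every point. With \<theta> = n/(n + 2) one has \<theta>\<lambda> = C;
  this is how the given \<lambda> turns the best constant into C times a power of the norm of
  Q.\<close>

notation LIMSEQ ("((_)/ ----> (_))" [60, 60] 60)

abbreviation cor :: "real => complex" where
  "cor == complex_of_real"

abbreviation nn_lborel :: "('a::euclidean_space => ennreal) => ennreal" (binder "NN " 10) where
  "nn_lborel f == nn_integral lborel f"

section \<open>Square integrable functions\<close>

lemma L2_measurable: "f \<in> L2 ==> f \<in> borel_measurable borel"
 and L2_integrable: "f \<in> L2 ==> integrable lborel (%x. (cmod (f x))^2)"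
 by (auto simp: L2_def)

lemma L2_norm_nonneg [simp]: "0 <= L2_norm f"
 by (simp add: L2_norm_def)

lemma L2_norm_sq: "(L2_norm f)^2 = (LBINT x. (cmod (f x))^2)"
 by (simp add: L2_norm_def)

lemma L2_iff:
 "f \<in> L2 \<longleftrightarrow> f \<in> borel_measurable borel \<and> (NN x. ennreal ((cmod (f x))^2)) < \<infinity>"
 unfolding L2_def by (auto simp: integrable_iff_bounded)

lemma nn_integral_L2:
 "f \<in> L2 ==> (NN x. ennreal ((cmod (f x))^2)) = ennreal ((L2_norm f)^2)"
 unfolding L2_norm_sq by (rule nn_integral_eq_integral) (auto simp: L2_def)

lemma L2_norm_cong_AE:
 assumes "f \<in> borel_measurable borel" "g \<in> borel_measurable borel"
  "AE x in lborel. cmod (f x) = cmod (g x)"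
 shows "L2_norm f = L2_norm g"
 unfolding L2_norm_def
 by (intro arg_cong[where f=sqrt] integral_cong_AE) (use assms in auto)

lemma L2_norm_leI:
 assumes "f \<in> borel_measurable borel" "0 <= K"
  "(NN x. ennreal ((cmod (f x))^2)) <= ennreal (K^2)"
 shows "f \<in> L2" "L2_norm f <= K"
proof -
 show f: "f \<in> L2"
  using assms by (auto simp: L2_iff intro: le_less_trans)
 have "(L2_norm f)^2 <= K^2"
  using assms(3) by (simp add: nn_integral_L2[OF f])
 then show "L2_norm f <= K"
  using assms(2) power2_le_imp_le by blast
qed

lemma L2_dominated:
 assumes "g \<in> L2" "f \<in> borel_measurable borel" "AE x in lborel. cmod (f x) <= K * cmod (g x)" "0 <= K"
 shows "f \<in> L2" "L2_norm f <= K * L2_norm g"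
proof -
 have *: "(NN x. ennreal ((cmod (f x))^2)) <= ennreal ((K * L2_norm g)^2)"
 proof -
  have "(NN x. ennreal ((cmod (f x))^2)) <= (NN x. ennreal (K^2) * ennreal ((cmod (g x))^2))"
   by (rule nn_integral_mono_AE, use assms(3) in eventually_elim)
    (simp add: ennreal_mult[symmetric] power_mult_distrib[symmetric] power_mono ennreal_leI)
  also have "... = ennreal (K^2) * ennreal ((L2_norm g)^2)"
   using L2_measurable[OF assms(1)] by (subst nn_integral_cmult) (auto simp: nn_integral_L2[OF assms(1)])
  finally show ?thesis
   by (simp add: ennreal_mult[symmetric] power_mult_distrib)
 qed
 have "0 <= K * L2_norm g"
  using assms(4) by simp
 from L2_norm_leI[OF assms(2) this *] show "f \<in> L2" "L2_norm f <= K * L2_norm g"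
  by auto
qed

lemma L2_cong_AE:
 assumes "g \<in> L2" "f \<in> borel_measurable borel" "AE x in lborel. f x = g x"
 shows "f \<in> L2"
 by (rule L2_dominated(1)[OF assms(1,2), where K=1]) (use assms(3) in auto)

lemma L2_zero [simp]: "(%x. 0) \<in> L2"
 by (simp add: L2_def)

lemma L2_norm_zero [simp]: "L2_norm (%x. 0) = 0"
 by (simp add: L2_norm_def)

lemma L2_cmult: "f \<in> L2 ==> (%x. c * f x) \<in> L2"
 by (rule L2_dominated(1)[where K="cmod c" and g=f]) (auto simp: norm_mult dest: L2_measurable)

lemma L2_norm_cmult: "L2_norm (%x. c * f x) = cmod c * L2_norm f"
 by (simp add: L2_norm_def norm_mult power_mult_distrib real_sqrt_mult)

lemma L2_add:
 assumes "f \<in> L2" "g \<in> L2"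
 shows "(%x. f x + g x) \<in> L2"
proof -
 have "integrable lborel (%x. 2 * (cmod (f x))^2 + 2 * (cmod (g x))^2)"
  using assms by (auto simp: L2_def)
 moreover have "(cmod (f x + g x))^2 <= 2 * (cmod (f x))^2 + 2 * (cmod (g x))^2" for x
 proof -
  have "(cmod (f x + g x))^2 <= (cmod (f x) + cmod (g x))^2"
   by (simp add: norm_triangle_ineq power_mono)
  also have "... <= 2 * (cmod (f x))^2 + 2 * (cmod (g x))^2"
   using sum_squares_bound[of "cmod (f x)" "cmod (g x)"] by (simp add: power2_sum)
  finally show ?thesis .
 qed
 moreover have "(%x. (cmod (f x + g x))^2) \<in> borel_measurable lborel"
  using assms[THEN L2_measurable] by measurable
 ultimately have "integrable lborel (%x. (cmod (f x + g x))^2)"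
  by (rule_tac Bochner_Integration.integrable_bound) auto
 then show ?thesis
  using assms by (auto simp: L2_def)
qed

lemma L2_uminus: "f \<in> L2 ==> (%x. - f x) \<in> L2"
 using L2_cmult[of f "-1"] by simp

lemma L2_diff: "f \<in> L2 ==> g \<in> L2 ==> (%x. f x - g x) \<in> L2"
 using L2_add[of f "%x. - g x"] L2_uminus[of g] by simp

lemma L2_cnj: "f \<in> L2 ==> (%x. cnj (f x)) \<in> L2"
 by (simp add: L2_def) (use borel_measurable_continuous_onI[OF continuous_on_cnj[OF continuous_on_id]] measurable_compose in blast)

lemma L2_sum: "(!!i. i \<in> I ==> f i \<in> L2) ==> (%x. \<Sum>i\<in>I. f i x) \<in> L2"
 by (induction I rule: infinite_finite_induct) (auto intro: L2_add)

lemma L2_norm_cnj: "L2_norm (%x. cnj (f x)) = L2_norm f"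
 by (simp add: L2_norm_def)

lemma L2_norm_uminus: "L2_norm (%x. - f x) = L2_norm f"
 by (simp add: L2_norm_def)

lemma L2_norm_minus_commute: "L2_norm (%x. f x - g x) = L2_norm (%x. g x - f x)"
 by (simp add: L2_norm_def norm_minus_commute)

lemma L2_norm_cmod: "L2_norm (%x. cor (cmod (f x))) = L2_norm f"
 by (simp add: L2_norm_def)

lemma L2_cmod:
 assumes "f \<in> L2"
 shows "(%x. cor (cmod (f x))) \<in> L2"
proof (rule L2_dominated(1)[OF assms, where K=1])
 show "(%x. cor (cmod (f x))) \<in> borel_measurable borel"
  using L2_measurable[OF assms] by measurable
qed auto

lemma integrable_L2_cmod_mult:
 assumes "f \<in> L2" "g \<in> L2"
 shows "integrable lborel (%x. cmod (f x) * cmod (g x))"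
proof (rule Bochner_Integration.integrable_bound)
 show "integrable lborel (%x. (cmod (f x))^2 + (cmod (g x))^2)"
  using assms by (auto simp: L2_def)
 show "(%x. cmod (f x) * cmod (g x)) \<in> borel_measurable lborel"
  using assms by (auto dest!: L2_measurable)
 have "0 <= a * b ==> a * b <= a^2 + b^2" for a b :: real
  using sum_squares_bound[of a b] by auto
 then show "AE x in lborel. norm (cmod (f x) * cmod (g x)) <= norm ((cmod (f x))^2 + (cmod (g x))^2)"
  by (simp add: abs_mult)
qed

lemma integrable_L2_mult:
 assumes "f \<in> L2" "g \<in> L2"
 shows "integrable lborel (%x. f x * g x)"
 by (rule Bochner_Integration.integrable_bound[OF integrable_L2_cmod_mult[OF assms]])
  (use assms in "auto dest!: L2_measurable simp: norm_mult")

lemma quadratic_nonneg_discriminant: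
 fixes a b c :: real
 assumes pos: "!!t. 0 <= t^2 * a - 2 * t * b + c" and "0 <= a" "0 <= b"
 shows "b^2 <= a * c"
proof (cases "a = 0")
 case True
 have "b = 0"
 proof (rule ccontr)
  assume "b ~= 0"
  then have "0 < b" using assms by simp
  \<comment> \<open>For \<open>a = 0\<close> the quadratic is affine in t, and this t gives it the
    value -1.\<close>
  with pos[of "(c + 1) / (2 * b)"] True show False
   by (simp add: field_simps)
 qed
 then show ?thesis by (simp add: True)
next
 case False
 then have a: "a > 0" using assms by simp
 have "0 <= a * ((b / a)^2 * a - 2 * (b / a) * b + c)"
  using pos[of "b / a"] a by simp
 also have "... = a * c - b^2"
  using a by (simp add: power2_eq_square field_simps)
 finally show ?thesis by simp
qed

lemma L2_Cauchy_Schwarz_cmod: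
 assumes f: "f \<in> L2" and g: "g \<in> L2"
 shows "(LBINT x. cmod (f x) * cmod (g x)) <= L2_norm f * L2_norm g"
proof -
 let ?a = "(L2_norm f)^2" and ?c = "(L2_norm g)^2" and ?b = "LBINT x. cmod (f x) * cmod (g x)"
 have b0: "0 <= ?b"
  by (rule integral_nonneg_AE) simp
 note [simp] = L2_integrable[OF f] L2_integrable[OF g] integrable_L2_cmod_mult[OF f g]
 have pos: "0 <= t^2 * ?a - 2 * t * ?b + ?c" for t
 proof -
  have "0 <= (LBINT x. (t * cmod (f x) - cmod (g x))^2)"
   by (rule integral_nonneg_AE) simp
  also have "(%x. (t * cmod (f x) - cmod (g x))^2) =
    (%x. t^2 * (cmod (f x))^2 - 2 * t * (cmod (f x) * cmod (g x)) + (cmod (g x))^2)"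
   by (simp add: power2_diff power_mult_distrib algebra_simps)
  also have "integral\<^sup>L lborel ... = t^2 * ?a - 2 * t * ?b + ?c"
   by (simp add: L2_norm_sq)
  finally show ?thesis .
 qed
 have "?b^2 <= ?a * ?c"
  using quadratic_nonneg_discriminant[OF pos _ b0] by simp
 then have "?b^2 <= (L2_norm f * L2_norm g)^2"
  by (simp add: power_mult_distrib)
 then show ?thesis
  by (rule power2_le_imp_le) simp
qed

lemma L2_Cauchy_Schwarz:
 assumes "f \<in> L2" "g \<in> L2"
 shows "cmod (LBINT x. f x * g x) <= L2_norm f * L2_norm g"
proof -
 have "cmod (LBINT x. f x * g x) <= (LBINT x. cmod (f x * g x))"
  by (rule integral_norm_bound)
 with L2_Cauchy_Schwarz_cmod[OF assms] show ?thesis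
  by (simp add: norm_mult)
qed

lemma L2_norm_add_sq:
 assumes "f \<in> L2" "g \<in> L2"
 shows "(L2_norm (%x. f x + g x))^2 =
  (L2_norm f)\<^sup>2 + 2 * Re (LBINT x. f x * cnj (g x)) + (L2_norm g)^2"
proof -
 have i: "integrable lborel (%x. f x * cnj (g x))"
  by (rule integrable_L2_mult[OF assms(1) L2_cnj[OF assms(2)]])
 have eq: "(cmod (f x + g x))^2 = (cmod (f x))^2 + 2 * Re (f x * cnj (g x)) + (cmod (g x))^2" for x
  unfolding cmod_power2 by (simp add: power2_eq_square algebra_simps)
 show ?thesis
  unfolding L2_norm_sq eq using L2_integrable[OF assms(1)] L2_integrable[OF assms(2)] i
  by (simp del: times_complex.sel)
qed

lemma L2_norm_diff_sq:
 assumes "f \<in> L2" "g \<in> L2"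
 shows "(L2_norm (%x. f x - g x))^2 =
  (L2_norm f)\<^sup>2 - 2 * Re (LBINT x. f x * cnj (g x)) + (L2_norm g)^2"
 using L2_norm_add_sq[OF assms(1) L2_uminus[OF assms(2)]] by (simp add: L2_norm_uminus)

lemma L2_parallelogram:
 assumes "f \<in> L2" "g \<in> L2"
 shows "(L2_norm (%x. f x + g x))^2 + (L2_norm (%x. f x - g x))^2 = 2 * (L2_norm f)^2 + 2 * (L2_norm g)^2"
 using L2_norm_add_sq[OF assms] L2_norm_diff_sq[OF assms] by simp

lemma L2_triangle:
 assumes f: "f \<in> L2" and g: "g \<in> L2"
 shows "L2_norm (%x. f x + g x) <= L2_norm f + L2_norm g"
proof (rule power2_le_imp_le)
 have "Re (LBINT x. f x * cnj (g x)) <= L2_norm f * L2_norm g"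
  using complex_Re_le_cmod L2_Cauchy_Schwarz[OF f L2_cnj[OF g]] unfolding L2_norm_cnj by (rule order_trans)
 then show "(L2_norm (%x. f x + g x))^2 <= (L2_norm f + L2_norm g)^2"
  by (simp add: L2_norm_add_sq[OF f g] power2_sum)
qed simp

lemma L2_triangle_diff:
 assumes "f \<in> L2" "g \<in> L2"
 shows "L2_norm (%x. f x - g x) <= L2_norm f + L2_norm g"
 using L2_triangle[OF assms(1) L2_uminus[OF assms(2)]] by (simp add: L2_norm_uminus)

lemma L2_triangle3:
 assumes "f \<in> L2" "g \<in> L2" "h \<in> L2"
 shows "L2_norm (%x. f x - h x) <= L2_norm (%x. f x - g x) + L2_norm (%x. g x - h x)"
 using L2_triangle[OF L2_diff[OF assms(1,2)] L2_diff[OF assms(2,3)]] by simp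

lemma L2_triangle_rev:
 assumes "f \<in> L2" "g \<in> L2"
 shows "\<bar>L2_norm f - L2_norm g\<bar> <= L2_norm (%x. f x - g x)"
 using L2_triangle3[OF assms(1,2) L2_zero] L2_triangle3[OF assms(2,1) L2_zero]
 by (simp add: L2_norm_minus_commute[of g f])

lemma L2_norm_tendsto:
 assumes "!!k. F k \<in> L2" "f \<in> L2" "((%k. L2_norm (%x. F k x - f x)) \<longlongrightarrow> 0) net"
 shows "((%k. L2_norm (F k)) \<longlongrightarrow> L2_norm f) net"
 by (rule LIM_zero_cancel, rule Lim_null_comparison[OF _ assms(3)])
  (use L2_triangle_rev[OF assms(1,2)] in auto)

lemma L2_norm_eq_0:
 assumes "f \<in> L2"
 shows "L2_norm f = 0 \<longleftrightarrow> (AE x in lborel. f x = 0)"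
proof -
 have "L2_norm f = 0 \<longleftrightarrow> (LBINT x. (cmod (f x))^2) = 0"
  by (simp add: L2_norm_def)
 also have "... \<longleftrightarrow> (AE x in lborel. (cmod (f x))^2 = 0)"
  by (rule integral_nonneg_eq_0_iff_AE) (use assms in "auto simp: L2_def")
 finally show ?thesis by simp
qed

lemma L2_mult_tendsto:
 assumes F: "!!k. F k \<in> L2" and f: "f \<in> L2" and g: "g \<in> L2"
  and lim: "((%k. L2_norm (%x. F k x - f x)) \<longlongrightarrow> 0) net"
 shows "((%k. \<integral>x. F k x * g x \<partial>lborel) \<longlongrightarrow> (LBINT x. f x * g x)) net"
proof -
 have "((%k. (LBINT x. F k x * g x) - (LBINT x. f x * g x)) \<longlongrightarrow> 0) net"
 proof (rule Lim_null_comparison)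
  show "((%k. L2_norm (%x. F k x - f x) * L2_norm g) \<longlongrightarrow> 0) net"
   using tendsto_mult_right[OF lim, of "L2_norm g"] by simp
  have "cmod ((LBINT x. F k x * g x) - (LBINT x. f x * g x)) <= L2_norm (%x. F k x - f x) * L2_norm g" for k
  proof -
   have "(LBINT x. F k x * g x) - (LBINT x. f x * g x) = (LBINT x. (F k x - f x) * g x)"
    using integrable_L2_mult[OF F g] integrable_L2_mult[OF f g]
    by (simp add: left_diff_distrib)
   then show ?thesis
    using L2_Cauchy_Schwarz[OF L2_diff[OF F[of k] f] g] by simp
  qed
  then show "\<forall>\<^sub>F k in net. norm ((LBINT x. F k x * g x) - (LBINT x. f x * g x)) <= L2_norm (%x. F k x - f x) * L2_norm g"
   by simp
 qed
 then show ?thesis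
  by (rule LIM_zero_cancel)
qed

text \<open>Riesz-Fischer. Along a subsequence with increments below 2^-j the increments are
  summable at almost every point; Fatou's lemma then gives norm convergence of the whole sequence.
  The a.e. convergent subsequence is part of the result because limits are identified through it
  later.\<close>

lemma L2_complete:
 fixes F :: "nat => real ^ 'n::finite => complex"
 assumes F: "!!k. F k \<in> L2"
  and Cau: "!!e. e > 0 ==> \<exists>N. \<forall>m\<ge>N. \<forall>k\<ge>N. L2_norm (%x. F m x - F k x) < e"
 obtains f r where "f \<in> L2" "(%k. L2_norm (%x. F k x - f x)) ----> 0"
  "strict_mono (r :: nat => nat)" "AE x in lborel. (%k. F (r k) x) ----> f x"
proof -
 have "\<forall>j. \<exists>N. \<forall>m\<ge>N. \<forall>k\<ge>N. L2_norm (%x. F m x - F k x) < (1/2)^j"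
  using Cau by simp
 then obtain M where M: "!!j m k. m >= M j ==> k >= M j ==> L2_norm (%x. F m x - F k x) < (1/2)^j"
  by metis
 define r where "r = rec_nat (M 0) (%j rj. max (Suc rj) (M (Suc j)))"
 have r_Suc: "r (Suc j) = max (Suc (r j)) (M (Suc j))" for j
  by (simp add: r_def)
 have r: "strict_mono r"
  by (rule strict_monoI_Suc) (simp add: r_Suc)
 have rM: "M j <= r j" for j
  by (cases j) (simp_all add: r_def)
 have [measurable]: "F k \<in> borel_measurable borel" for k
  using F L2_measurable by blast
 define d where "d j x = F (r (Suc j)) x - F (r j) x" for j x
 have dL: "d j \<in> L2" for j
  unfolding d_def using L2_diff F by blast
 then have [measurable]: "d j \<in> borel_measurable borel" for j
  using L2_measurable by blast
 have d: "L2_norm (d j) < (1/2)^j" for j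
  unfolding d_def by (rule M) (use rM[of j] r[THEN strict_monoD, of j "Suc j"] in auto)
 \<comment> \<open>The integral of 2^j |d_j|^2 is at most 2^j 4^-j, so the weighted series is finite
   a.e. The weight 2^j gives |d_j(x)| = O(2^(-j/2)), which makes the increments themselves summable,
   not only their squares.\<close>
 have "(NN x. (\<Sum>j. ennreal (2^j * (cmod (d j x))^2))) = (\<Sum>j. \<integral>\<^sup>+x. ennreal (2^j * (cmod (d j x))^2) \<partial>lborel)"
  by (rule nn_integral_suminf) auto
 also have "... <= (\<Sum>j. ennreal ((1/2)^j))"
 proof (rule suminf_le)
  fix j
  have "(NN x. ennreal (2^j * (cmod (d j x))^2)) = ennreal (2^j) * ennreal ((L2_norm (d j))^2)"
   unfolding nn_integral_L2[OF dL, symmetric]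
   by (subst nn_integral_cmult[symmetric]) (auto simp: ennreal_mult)
  also have "... = ennreal (2^j * (L2_norm (d j))^2)"
   by (simp add: ennreal_mult)
  also have "... <= ennreal (2^j * ((1/2)^j)^2)"
   using d[of j] by (intro ennreal_leI mult_left_mono power_mono) auto
  also have "(2::real)^j * ((1/2)^j)^2 = (1/2)^j"
   by (simp add: power2_eq_square power_divide)
  finally show "(NN x. ennreal (2^j * (cmod (d j x))^2)) <= ennreal ((1/2)^j)" .
 qed auto
 also have "(\<Sum>j. ennreal ((1/2)^j)) = ennreal 2"
  by (rule suminf_ennreal_eq) (use geometric_sums[of "1/2::real"] in auto)
 finally have "(NN x. (\<Sum>j. ennreal (2^j * (cmod (d j x))^2))) ~= \<infinity>"
  by (auto simp: top_unique)
 then have "AE x in lborel. (\<Sum>j. ennreal (2^j * (cmod (d j x))^2)) ~= \<infinity>"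
  by (intro nn_integral_PInf_AE) auto
 then have conv: "AE x in lborel. convergent (%k. F (r k) x)"
 proof eventually_elim
  case (elim x)
  then have sm: "summable (%j. 2^j * (cmod (d j x))^2)"
   by (intro summable_suminf_not_top) auto
  then have "Bseq (%j. 2^j * (cmod (d j x))^2)"
   by (intro convergent_imp_Bseq) (auto intro: convergentI dest: summable_LIMSEQ_zero)
  then obtain B where B: "B > 0" "!!j. norm (2^j * (cmod (d j x))^2) <= B"
   by (auto simp: Bseq_def)
  have sq: "((sqrt (1/2))^j)^2 = (1/2::real)^j" for j
   by (metis power_mult mult.commute real_sqrt_pow2 zero_le_divide_1_iff zero_le_numeral)
  have "cmod (d j x) <= sqrt B * (sqrt (1/2))^j" for j
  proof (rule power2_le_imp_le)
   have "2^j * (cmod (d j x))^2 <= B"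
    using B(2)[of j] by simp
   then have "(cmod (d j x))^2 <= B * (1/2)^j"
    by (simp add: field_simps power_divide)
   also have "... = (sqrt B * (sqrt (1/2))^j)^2"
    using B(1) by (simp add: power_mult_distrib sq)
   finally show "(cmod (d j x))^2 <= (sqrt B * (sqrt (1/2))^j)^2" .
  qed (use B(1) in simp)
  note dx = this
  have "norm (sqrt (1/2::real)) < 1"
   using real_sqrt_less_mono[of "1/2" 1] by simp
  from summable_comparison_test'[OF summable_mult[OF summable_geometric[OF this], of "sqrt B"], of 0 "%j. d j x"]
  have "summable (%j. d j x)"
   using dx by blast
  then have "convergent (%n. \<Sum>j<n. d j x)"
   by (simp add: summable_iff_convergent)
  then have "convergent (%n. F (r 0) x + (\<Sum>j<n. d j x))"
   by (rule convergent_add[OF convergent_const])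
  moreover have "F (r 0) x + (\<Sum>j<n. d j x) = F (r n) x" for n
   using sum_lessThan_telescope[of "%j. F (r j) x" n] by (simp add: d_def)
  ultimately show ?case by simp
 qed
 define f where "f x = lim (%k. F (r k) x)" for x
 have fm [measurable]: "f \<in> borel_measurable borel"
  unfolding f_def by (rule borel_measurable_lim_metric) auto
 have ae: "AE x in lborel. (%k. F (r k) x) ----> f x"
  using conv by eventually_elim (simp add: f_def convergent_LIMSEQ_iff)
 \<comment> \<open>Fatou's lemma in the second index along \<open>r\<close>, with m fixed; it yields
   membership of the limit and the rate at once.\<close>
 have fat: "(%x. F m x - f x) \<in> L2 \<and> L2_norm (%x. F m x - f x) <= e"
  if e: "e > 0" and N: "\<forall>m\<ge>N. \<forall>k\<ge>N. L2_norm (%x. F m x - F k x) < e" and m: "m >= N" for e N m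
 proof -
  have "(NN x. ennreal ((cmod (F m x - f x))^2)) = (NN x. liminf (%k. ennreal ((cmod (F m x - F (r k) x))^2)))"
   by (rule nn_integral_cong_AE, use ae in eventually_elim)
    (intro lim_imp_Liminf[symmetric] tendsto_ennrealI tendsto_intros; simp)
  also have "... <= liminf (%k. \<integral>\<^sup>+x. ennreal ((cmod (F m x - F (r k) x))^2) \<partial>lborel)"
   by (rule nn_integral_liminf) auto
  also have "... <= liminf (%k. ennreal (e^2))"
  proof (rule Liminf_mono)
   have "\<forall>\<^sub>F k in sequentially. k >= N" by (rule eventually_ge_at_top)
   then show "\<forall>\<^sub>F k in sequentially. (NN x. ennreal ((cmod (F m x - F (r k) x))^2)) <= ennreal (e^2)"
   proof eventually_elim
    case (elim k)
    then have "r k >= N" using seq_suble[OF r, of k] by simp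
    then have "L2_norm (%x. F m x - F (r k) x) <= e"
     using N m by (simp add: less_imp_le)
    then show ?case
     unfolding nn_integral_L2[OF L2_diff[OF F F]] by (intro ennreal_leI power_mono) auto
   qed
  qed
  finally have *: "(NN x. ennreal ((cmod (F m x - f x))^2)) <= ennreal (e^2)"
   by (simp add: Liminf_const)
  show ?thesis
   using L2_norm_leI[OF _ less_imp_le[OF e] *] by auto
 qed
 have fL: "f \<in> L2"
 proof -
  obtain N where N: "\<forall>m\<ge>N. \<forall>k\<ge>N. L2_norm (%x. F m x - F k x) < 1"
   using Cau[of 1] by auto
  have "(%x. F N x - f x) \<in> L2"
   using fat[OF _ N] by auto
  from L2_diff[OF F[of N] this] show ?thesis by simp
 qed
 have "(%k. L2_norm (%x. F k x - f x)) ----> 0"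
 proof (rule LIMSEQ_I)
  fix e :: real assume e: "0 < e"
  obtain N where N: "\<forall>m\<ge>N. \<forall>k\<ge>N. L2_norm (%x. F m x - F k x) < e/2"
   using Cau[of "e/2"] e by auto
  have "norm (L2_norm (%x. F m x - f x) - 0) < e" if "m >= N" for m
   using fat[OF _ N that] e by simp
  then show "\<exists>no. \<forall>n\<ge>no. norm (L2_norm (%x. F n x - f x) - 0) < e" by blast
 qed
 then show ?thesis
  using that fL r ae by blast
qed

lemma L2_tendsto_AE_subseq:
 fixes F :: "nat => real ^ 'n::finite => complex"
 assumes F: "!!k. F k \<in> L2" and f: "f \<in> L2" and lim: "(%k. L2_norm (%x. F k x - f x)) ----> 0"
 obtains r where "strict_mono (r :: nat => nat)" "AE x in lborel. (%k. F (r k) x) ----> f x"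
proof -
 have Cau: "\<exists>N. \<forall>m\<ge>N. \<forall>k\<ge>N. L2_norm (%x. F m x - F k x) < e" if "e > 0" for e
 proof -
  obtain N where N: "!!k. k >= N ==> L2_norm (%x. F k x - f x) < e/2"
   using LIMSEQ_D[OF lim, of "e/2"] \<open>e > 0\<close> by auto
  have "L2_norm (%x. F m x - F k x) < e" if "m >= N" "k >= N" for m k
   using L2_triangle3[OF F[of m] f F[of k]] N[OF that(1)] N[OF that(2)]
   by (simp add: L2_norm_minus_commute[of f])
  then show ?thesis by blast
 qed
 obtain g r where g: "g \<in> L2" "(%k. L2_norm (%x. F k x - g x)) ----> 0"
  "strict_mono (r :: nat => nat)" "AE x in lborel. (%k. F (r k) x) ----> g x"
  using L2_complete[OF F Cau] by blast
 have "(%k. L2_norm (%x. F k x - f x) + L2_norm (%x. F k x - g x)) ----> 0 + 0"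
  by (intro tendsto_add lim g)
 then have "L2_norm (%x. f x - g x) <= 0 + 0"
  by (rule LIMSEQ_le_const) (use L2_triangle3[OF f F g(1)] in "auto simp: L2_norm_minus_commute[of f]")
 then have "L2_norm (%x. f x - g x) = 0"
  using L2_norm_nonneg[of "%x. f x - g x"] by simp
 then have "AE x in lborel. f x = g x"
  using L2_norm_eq_0[OF L2_diff[OF f g(1)]] by simp
 with g(4) have "AE x in lborel. (%k. F (r k) x) ----> f x"
  by eventually_elim simp
 with g(3) that show ?thesis by blast
qed

section \<open>Measure preserving maps and test functions\<close>

definition preserves_lborel :: "('a::euclidean_space => 'a) => bool" where
 "preserves_lborel T \<longleftrightarrow> T \<in> borel_measurable borel \<and> distr lborel borel T = lborel"

lemma preserves_lborel_measurable: "preserves_lborel T ==> T \<in> borel_measurable borel"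
 by (simp add: preserves_lborel_def)

lemma preserves_lborel_nn_integral:
 assumes "preserves_lborel T" "f \<in> borel_measurable borel"
 shows "(NN x. f (T x)) = (NN x. f x)"
proof -
 have "(\<integral>\<^sup>+x. f x \<partial>distr lborel borel T) = (NN x. f (T x))"
  by (rule nn_integral_distr) (use assms in "auto simp: preserves_lborel_def")
 then show ?thesis using assms by (simp add: preserves_lborel_def)
qed

lemma preserves_lborel_integral:
 fixes f :: "'a::euclidean_space => 'b::{banach, second_countable_topology}"
 assumes "preserves_lborel T" "f \<in> borel_measurable borel"
 shows "(LBINT x. f (T x)) = (LBINT x. f x)"
proof -
 have "(\<integral>x. f x \<partial>distr lborel borel T) = (LBINT x. f (T x))"
  by (rule integral_distr) (use assms in "auto simp: preserves_lborel_def")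
 then show ?thesis using assms by (simp add: preserves_lborel_def)
qed

lemma preserves_lborel_integrable:
 fixes f :: "'a::euclidean_space => 'b::{banach, second_countable_topology}"
 assumes "preserves_lborel T" "f \<in> borel_measurable borel"
 shows "integrable lborel (%x. f (T x)) \<longleftrightarrow> integrable lborel f"
proof -
 have "integrable (distr lborel borel T) f \<longleftrightarrow> integrable lborel (%x. f (T x))"
  by (rule integrable_distr_eq) (use assms in "auto simp: preserves_lborel_def")
 then show ?thesis using assms by (simp add: preserves_lborel_def)
qed

lemma preserves_lborel_AE:
 assumes T: "preserves_lborel T" and ae: "AE x in lborel. P x"
 shows "AE x in lborel. P (T x)"
proof -
 from ae obtain N where N: "{x \<in> space lborel. \<not> P x} \<subseteq> N" "emeasure lborel N = 0" "N \<in> sets lborel"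
  by (rule AE_E)
 have "emeasure lborel (T -` N) = 0"
  using emeasure_distr[of T lborel borel N] T N(2,3) by (auto simp: preserves_lborel_def)
 moreover have "T -` N \<in> sets lborel"
  using measurable_sets[OF preserves_lborel_measurable[OF T], of N] N(3) by simp
 ultimately show ?thesis
  by (rule_tac AE_I[where N="T -` N"]) (use N(1) in auto)
qed

lemma preserves_lborel_L2:
 assumes "preserves_lborel T" "f \<in> L2"
 shows "(%x. f (T x)) \<in> L2"
proof -
 have [measurable]: "T \<in> borel_measurable borel" "f \<in> borel_measurable borel"
  using assms preserves_lborel_measurable L2_measurable by blast+
 have "integrable lborel (%x. (cmod (f (T x)))^2)"
  using L2_integrable[OF assms(2)] by (subst preserves_lborel_integrable[OF assms(1)]) auto
 then show ?thesis
  by (simp add: L2_def)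
qed

lemma preserves_lborel_L2_norm:
 assumes "preserves_lborel T" "f \<in> borel_measurable borel"
 shows "L2_norm (%x. f (T x)) = L2_norm f"
 using assms(2) by (simp add: L2_norm_def preserves_lborel_integral[OF assms(1), of "%x. (cmod (f x))^2"])

lemma preserves_lborel_add: "preserves_lborel (%x. x + a)"
 using lborel_distr_plus[of a] by (simp add: preserves_lborel_def add.commute[of _ a])

lemma preserves_lborel_diff: "preserves_lborel (%x. x - a)"
 using preserves_lborel_add[of "- a"] by simp

lemma preserves_lborel_compose:
 assumes "preserves_lborel S" "preserves_lborel T"
 shows "preserves_lborel (%x. S (T x))"
proof -
 have "distr lborel borel (%x. S (T x)) = distr (distr lborel borel T) borel S"
  by (subst distr_distr) (use assms in "auto simp: preserves_lborel_def comp_def")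
 moreover have "(%x. S (T x)) \<in> borel_measurable borel"
  using assms[THEN preserves_lborel_measurable] by measurable
 ultimately show ?thesis
  using assms by (simp add: preserves_lborel_def)
qed

text \<open>Uniqueness of Haar measure: both orders of integration in
 \<open>\<integral>\<integral> 1\<^sub>A (\<rho> x + y) 1\<^sub>B y\<close>, for \<open>B\<close> the unit ball, give the measure of \<open>B\<close> as a factor.\<close>

lemma preserves_lborel_isometry:
 fixes \<rho> \<rho>' :: "'a::euclidean_space => 'a"
 assumes lin: "linear \<rho>" and iso: "!!x. norm (\<rho> x) = norm x" and inv: "!!x. \<rho> (\<rho>' x) = x"
 shows "preserves_lborel \<rho>"
proof -
 have [measurable]: "\<rho> \<in> borel_measurable borel"
  by (intro borel_measurable_continuous_onI linear_continuous_on linear_conv_bounded_linear[THEN iffD1] lin)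
 have add: "\<rho> (x + y) = \<rho> x + \<rho> y" "\<rho> (x - y) = \<rho> x - \<rho> y" for x y
  using lin by (simp_all add: linear_add linear_diff)
 define B :: "'a set" where "B = ball 0 1"
 have [measurable]: "B \<in> sets borel" by (simp add: B_def)
 have B0: "emeasure lborel B ~= 0" "emeasure lborel B ~= \<infinity>"
  using unit_ball_vol_pos[of "real DIM('a)"] by (simp_all add: B_def emeasure_ball order_less_imp_not_eq2)
 have "emeasure lborel (\<rho> -` A) = emeasure lborel A" if [measurable]: "A \<in> sets borel" for A
 proof -
  have "emeasure lborel (\<rho> -` A) * emeasure lborel B =
    (NN y. emeasure lborel (\<rho> -` A) * indicator B y)"
   by (simp add: nn_integral_cmult_indicator)
  also have "... = (NN y. (NN x. indicator A (\<rho> x + y) * indicator B y))"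
  proof (rule nn_integral_cong)
   fix y
   \<comment> \<open>The shift by y is absorbed into the argument of \<rho> through the right
     inverse, after which translation invariance removes it.\<close>
   have "(NN x. indicator A (\<rho> x + y)) = (NN x. indicator A (\<rho> (x + \<rho>' y)))"
    by (simp add: add inv)
   also have "... = (NN x. indicator A (\<rho> x))"
    by (rule preserves_lborel_nn_integral[OF preserves_lborel_add]) measurable
   also have "... = (NN x. indicator (\<rho> -` A) x)"
    by (intro nn_integral_cong) (auto split: split_indicator)
   also have "... = emeasure lborel (\<rho> -` A)"
    using measurable_sets_borel[of \<rho> borel A] by simp
   finally show "emeasure lborel (\<rho> -` A) * indicator B y = (NN x. indicator A (\<rho> x + y) * indicator B y)"
    by (simp add: nn_integral_multc)
  qed
  also have "... = (NN x. (NN y. indicator A (\<rho> x + y) * indicator B y))"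
   by (rule lborel_pair.Fubini') measurable
  also have "... = (NN x. (NN y. indicator A y * indicator B (y - \<rho> x)))"
  proof (rule nn_integral_cong)
   fix x
   have "(NN y. indicator A ((y + \<rho> x)) * indicator B ((y + \<rho> x) - \<rho> x)) = (NN y. indicator A y * indicator B (y - \<rho> x))"
    by (rule preserves_lborel_nn_integral[OF preserves_lborel_add]) measurable
   then show "(NN y. indicator A (\<rho> x + y) * indicator B y) = (NN y. indicator A y * indicator B (y - \<rho> x))"
    by (simp add: add.commute)
  qed
  also have "... = (NN y. (NN x. indicator A y * indicator B (y - \<rho> x)))"
   by (rule lborel_pair.Fubini'[symmetric]) measurable
  also have "... = (NN y. indicator A y * emeasure lborel B)"
  proof (rule nn_integral_cong)
   fix y
   have "(NN x. indicator B (y - \<rho> x)) = (NN x. indicator B (x - \<rho>' y))"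
   proof (intro nn_integral_cong)
    fix x
    have "norm (y - \<rho> x) = norm (x - \<rho>' y)"
     by (metis add(2) inv iso norm_minus_commute)
    then show "(indicator B (y - \<rho> x) :: ennreal) = indicator B (x - \<rho>' y)"
     by (auto simp: B_def split: split_indicator)
   qed
   also have "... = (NN x. indicator B x)"
    by (rule preserves_lborel_nn_integral[OF preserves_lborel_diff]) measurable
   finally show "(NN x. indicator A y * indicator B (y - \<rho> x)) = indicator A y * emeasure lborel B"
    by (simp add: nn_integral_cmult)
  qed
  also have "... = emeasure lborel A * emeasure lborel B"
   by (simp add: nn_integral_multc)
  finally have eq: "emeasure lborel (\<rho> -` A) * emeasure lborel B = emeasure lborel A * emeasure lborel B" .
  have "emeasure lborel B ~= top"
   using B0(2) by simp
  note div = ennreal_mult_divide_eq[OF B0(1) this]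
  show ?thesis
   using arg_cong[OF eq, of "%z. z / emeasure lborel B"] unfolding div .
 qed
 then have "distr lborel borel \<rho> = lborel"
  by (intro measure_eqI) (auto simp: emeasure_distr)
 then show ?thesis by (simp add: preserves_lborel_def)
qed

lemma nn_integral_lborel_scale:
 fixes f :: "'a::euclidean_space => ennreal"
 assumes [measurable]: "f \<in> borel_measurable borel" and "b > 0"
 shows "(NN x. f (b *\<^sub>R x)) = ennreal (inverse b ^ DIM('a)) * (NN x. f x)"
proof -
 have "(NN x. f x) = (\<integral>\<^sup>+x. f x \<partial>density (distr lborel borel (%x. 0 + b *\<^sub>R x)) (%_. ennreal (\<bar>b\<bar> ^ DIM('a))))"
  using lborel_affine[of b "0::'a"] assms(2) by simp
 also have "... = ennreal (b ^ DIM('a)) * (NN x. f (b *\<^sub>R x))"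
  using assms(2) by (simp add: nn_integral_density nn_integral_distr nn_integral_cmult)
 finally show ?thesis
  using assms(2) by (simp add: mult.assoc[symmetric] ennreal_mult[symmetric] power_mult_distrib[symmetric])
qed

section \<open>Calculus of functions of class \<open>Ck\<close>\<close>

lemma partial_deriv_eqI:
 "(f has_derivative D) (at x) ==> partial_deriv j f x = D (axis j 1)"
 unfolding partial_deriv_def using frechet_derivative_at by metis

lemma Ck_continuous: "Ck k f ==> continuous_on UNIV f"
 by (cases k) (auto intro!: continuous_at_imp_continuous_on differentiable_imp_continuous_within)

lemma Ck_SucD: "Ck (Suc k) f ==> Ck k f"
proof (induction k arbitrary: f)
 case 0
 then show ?case using Ck_continuous[OF 0] by simp
next
 case (Suc k)
 then show ?case by (metis Ck.simps(2))
qed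

lemma Ck_SucI:
 assumes "!!x. (f has_derivative D x) (at x)" "!!j. Ck k (%x. D x (axis j 1))"
 shows "Ck (Suc k) f"
proof -
 have "partial_deriv j f = (%x. D x (axis j 1))" for j
  using partial_deriv_eqI[OF assms(1)] by auto
 then show ?thesis
  using assms by (auto simp: differentiable_def)
qed

lemma Ck_Suc_has_derivative:
 "Ck (Suc k) f ==> (f has_derivative frechet_derivative f (at x)) (at x)"
 by (simp add: frechet_derivative_works[symmetric])

lemma frechet_eq_partial_deriv: "frechet_derivative f (at x) (axis j 1) = partial_deriv j f x"
 by (simp add: partial_deriv_def)

lemma Ck_const: "Ck k (%x. c)"
proof (induction k arbitrary: c)
 case (Suc k)
 show ?case by (rule Ck_SucI[where D="%_ _. 0"]) (use Suc in auto)
qed simp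

lemma Ck_add: "Ck k f ==> Ck k g ==> Ck k (%x. f x + g x)"
proof (induction k arbitrary: f g)
 case (Suc k)
 show ?case
  by (rule Ck_SucI, rule has_derivative_add[OF Ck_Suc_has_derivative[OF Suc.prems(1)] Ck_Suc_has_derivative[OF Suc.prems(2)]])
   (use Suc in "auto simp: frechet_eq_partial_deriv")
qed (auto intro: continuous_on_add)

lemma Ck_mult: "Ck k f ==> Ck k g ==> Ck k (%x. f x * g x)"
proof (induction k arbitrary: f g)
 case (Suc k)
 have "Ck k f" "Ck k g" using Suc.prems Ck_SucD by auto
 then show ?case
  by (intro Ck_SucI, rule_tac has_derivative_mult[OF Ck_Suc_has_derivative[OF Suc.prems(1)] Ck_Suc_has_derivative[OF Suc.prems(2)]])
   (use Suc in "auto simp: frechet_eq_partial_deriv intro!: Ck_add")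
qed (auto intro: continuous_on_mult)

lemma Ck_sum: "(!!i. i \<in> I ==> Ck k (f i)) ==> Ck k (%x. \<Sum>i\<in>I. f i x)"
 by (induction I rule: infinite_finite_induct) (auto intro: Ck_add Ck_const)

lemma Ck_prod: "(!!i. i \<in> I ==> Ck k (f i)) ==> Ck k (%x. \<Prod>i\<in>I. f i x)"
 by (induction I rule: infinite_finite_induct) (auto intro: Ck_mult Ck_const)

lemma has_derivative_shift:
 assumes "(f has_derivative D) (at (x + a))"
 shows "((%x. f (x + a)) has_derivative D) (at x)"
proof -
 have "((%x. x + a) has_derivative (%h. h)) (at x)"
  by (auto intro!: derivative_eq_intros)
 from has_derivative_compose[OF this assms] show ?thesis .
qed

lemma Ck_shift: "Ck k f ==> Ck k (%x. f (x + a))"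
proof (induction k arbitrary: f)
 case 0
 then show ?case by (auto intro!: continuous_intros continuous_on_compose2[of UNIV f])
next
 case (Suc k)
 show ?case
  by (rule Ck_SucI, rule has_derivative_shift[OF Ck_Suc_has_derivative[OF Suc.prems]])
   (use Suc in "auto simp: frechet_eq_partial_deriv")
qed

lemma Ck_coord: "Ck k (%x. cor (x $ i))"
proof (cases k)
 case (Suc k)
 show ?thesis unfolding Suc
 proof (rule Ck_SucI)
  show "((%x. cor (x $ i)) has_derivative (%h. cor (h $ i))) (at x)" for x
   by (intro bounded_linear_imp_has_derivative bounded_linear_compose[OF bounded_linear_of_real bounded_linear_vec_nth])
 qed (rule Ck_const)
qed (auto intro!: continuous_intros)

lemma Ck_cnj: "Ck k f ==> Ck k (%x. cnj (f x))"
proof (induction k arbitrary: f)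
 case (Suc k)
 show ?case
  by (rule Ck_SucI, rule bounded_linear.has_derivative[OF bounded_linear_cnj Ck_Suc_has_derivative[OF Suc.prems]])
   (use Suc in "auto simp: frechet_eq_partial_deriv")
qed (auto intro: continuous_on_cnj)

lemma has_derivative_expi:
 "((%x. exp (\<i> * cor (a \<bullet> x))) has_derivative
  (%h. exp (\<i> * cor (a \<bullet> x)) * (\<i> * cor (a \<bullet> h)))) (at x)"
proof -
 have "((%x. \<i> * cor (a \<bullet> x)) has_derivative (%h. \<i> * cor (a \<bullet> h))) (at x)"
  by (intro bounded_linear_imp_has_derivative bounded_linear_const_mult
    bounded_linear_compose[OF bounded_linear_of_real] bounded_linear_inner_right)
 from has_derivative_compose[OF this DERIV_exp[unfolded has_field_derivative_def]] show ?thesis .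
qed

lemma Ck_expi: "Ck k (%x. exp (\<i> * cor (a \<bullet> x)))"
proof (induction k)
 case (Suc k)
 show ?case
  by (rule Ck_SucI[OF has_derivative_expi]) (use Suc in "auto intro!: Ck_mult Ck_const")
qed (auto intro!: continuous_intros)

text \<open>The functions \<open>p (1/t) e\<^bsup>-1/t\<^esup>\<close>, extended by zero, form a class of smooth functions
 closed under differentiation.\<close>

definition flat_exp :: "real poly => real => real" where
 "flat_exp p t = (if t > 0 then poly p (1/t) * exp (- (1/t)) else 0)"

text \<open>With s = 1/t the derivative in t is -s^2 times the derivative in s, and applied to p(s)
  exp(-s) this gives s^2 (p - p')(s) exp(-s).\<close>

definition flat_exp_deriv :: "real poly => real poly" where
 "flat_exp_deriv p = [:0, 0, 1:] * (p - pderiv p)"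

lemma tendsto_poly_exp_0: "((%s. poly p s * exp (- s)) \<longlongrightarrow> (0::real)) at_top"
proof -
 have "((%s. \<Sum>i\<le>degree p. coeff p i * (s ^ i / exp s)) \<longlongrightarrow> (\<Sum>i\<le>degree p. coeff p i * 0)) at_top"
  by (intro tendsto_sum tendsto_mult tendsto_const tendsto_power_div_exp_0)
 moreover have "(\<Sum>i\<le>degree p. coeff p i * (s ^ i / exp s)) = poly p s * exp (- s)" for s
  by (simp add: poly_altdef sum_distrib_right exp_minus divide_inverse mult.assoc)
 ultimately show ?thesis by simp
qed

lemma flat_exp_has_derivative:
 "(flat_exp p has_real_derivative flat_exp (flat_exp_deriv p) t) (at t)"
proof -
 consider "t > 0" | "t < 0" | "t = 0" by linarith
 then show ?thesis
 proof cases
  case 1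
  have "((%t. poly p (1/t) * exp (- (1/t))) has_real_derivative flat_exp (flat_exp_deriv p) t) (at t)"
   using 1 by (auto intro!: derivative_eq_intros simp: flat_exp_def flat_exp_deriv_def field_simps power2_eq_square)
  then show ?thesis
   by (rule has_field_derivative_transform_within[where d=t]) (use 1 in "auto simp: flat_exp_def dist_real_def")
 next
  case 2
  have "((%t. 0) has_real_derivative 0) (at t)" by simp
  then have "(flat_exp p has_real_derivative 0) (at t)"
   by (rule has_field_derivative_transform_within[where d="-t"]) (use 2 in "auto simp: flat_exp_def dist_real_def")
  then show ?thesis using 2 by (simp add: flat_exp_def)
 next
  case 3
  \<comment> \<open>The difference quotient at 0 from the right is s p(s) exp(-s) with s = 1/t;
    \<open>pCons 0 p\<close> is the polynomial s p(s).\<close>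
  have "((%t. poly (pCons 0 p) (inverse t) * exp (- inverse t)) \<longlongrightarrow> 0) (at_right 0)"
   using filterlim_compose[OF tendsto_poly_exp_0[of "pCons 0 p"] filterlim_inverse_at_top_right] by simp
  then have "((%h. (flat_exp p (0 + h) - flat_exp p 0) / h) \<longlongrightarrow> 0) (at_right 0)"
   by (rule Lim_transform_eventually) (auto simp: eventually_at_right_field flat_exp_def field_simps intro!: exI[of _ 1])
  moreover have "((%h. (flat_exp p (0 + h) - flat_exp p 0) / h) \<longlongrightarrow> 0) (at_left 0)"
   by (rule Lim_transform_eventually[OF tendsto_const])
    (auto simp: eventually_at_left_field flat_exp_def intro!: exI[of _ "-1"])
  ultimately have "((%h. (flat_exp p (0 + h) - flat_exp p 0) / h) \<longlongrightarrow> 0) (at 0)"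
   using filterlim_split_at by blast
  then show ?thesis
   by (simp add: 3 DERIV_def flat_exp_def)
 qed
qed

lemma Ck_flat_exp:
 fixes g :: "real ^ 'n::finite => real"
 assumes g: "!!k. Ck k (%x. cor (g x))"
 shows "Ck k (%x. cor (flat_exp p (g x)))"
proof (induction k arbitrary: p)
 case 0
 have "isCont (flat_exp p) t" for t
  using flat_exp_has_derivative DERIV_isCont by blast
 moreover have "continuous_on UNIV g"
  using continuous_on_Re[OF Ck_continuous[OF g[of 0]]] by simp
 moreover have "continuous_on UNIV (flat_exp p)" if "!!t. isCont (flat_exp p) t"
  using that by (simp add: continuous_at_imp_continuous_on)
 ultimately have "continuous_on UNIV (%x. flat_exp p (g x))"
  using continuous_on_compose2[of UNIV "flat_exp p" UNIV g] by blast
 then show ?case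
  by (simp add: continuous_on_of_real)
next
 case (Suc k)
 define D where "D x = frechet_derivative (%x. cor (g x)) (at x)" for x
 have D: "((%x. cor (g x)) has_derivative D x) (at x)" for x
  unfolding D_def using Ck_Suc_has_derivative[OF g] by blast
 have Dre: "(g has_derivative (%h. Re (D x h))) (at x)" for x
  using bounded_linear.has_derivative[OF bounded_linear_Re D] by simp
 have Dim: "((%x. 0) has_derivative (%h. Im (D x h))) (at x)" for x
  using bounded_linear.has_derivative[OF bounded_linear_Im D] by simp
 \<comment> \<open>The derivative of a real-valued function is real, so the real chain rule for
   \<open>flat_exp p\<close> composed with g can be rewritten with the complex derivative
   \<open>D\<close>, whose components are known to be \<open>Ck\<close>.\<close>
 have im: "Im (D x h) = 0" for x h
  using has_derivative_unique[OF Dim[of x] has_derivative_const] by (simp add: fun_eq_iff)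
 have re: "cor (Re (D x h)) = D x h" for x h
  by (simp add: complex_eq_iff im)
 have "((%x. cor (flat_exp p (g x))) has_derivative
   (%h. cor (flat_exp (flat_exp_deriv p) (g x)) * D x h)) (at x)" for x
 proof -
  have "((%x. flat_exp p (g x)) has_derivative (%h. flat_exp (flat_exp_deriv p) (g x) * Re (D x h))) (at x)"
   by (rule has_derivative_compose[OF Dre flat_exp_has_derivative[unfolded has_field_derivative_def]])
  then have "((%x. cor (flat_exp p (g x))) has_derivative
    (%h. cor (flat_exp (flat_exp_deriv p) (g x) * Re (D x h)))) (at x)"
   by (rule has_derivative_of_real)
  then show ?thesis
   by (simp add: re)
 qed
 moreover have "Ck k (%x. D x (axis j 1))" for j
  using g[of "Suc k"] by (simp add: D_def frechet_eq_partial_deriv)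
 ultimately show ?case
  by (intro Ck_SucI) (auto intro!: Ck_mult Suc)
qed

section \<open>Closure properties and bounds of test functions\<close>

lemma test_functionI:
 assumes "!!k. Ck k \<phi>" "!!x. \<phi> x ~= 0 ==> norm x <= R"
 shows "test_function \<phi>"
proof -
 have "bounded {x. \<phi> x ~= 0}"
  using assms(2) by (auto simp: bounded_iff)
 then show ?thesis
  using assms(1) by (auto simp: test_function_def compact_closure)
qed

lemma test_function_Ck: "test_function \<phi> ==> Ck k \<phi>"
 by (simp add: test_function_def)

lemma test_function_support:
 assumes "test_function \<phi>"
 obtains R where "R > 0" "!!x. \<phi> x ~= 0 ==> norm x <= R"
proof -
 have "bounded {x. \<phi> x ~= 0}"
  using assms by (simp add: test_function_def compact_closure)
 then show ?thesis
  using that by (auto simp: bounded_pos)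
qed

lemma test_function_mult:
 assumes "test_function \<phi>" "!!k. Ck k \<psi>"
 shows "test_function (%x. \<psi> x * \<phi> x)"
proof -
 obtain R where "!!x. \<phi> x ~= 0 ==> norm x <= R"
  using test_function_support[OF assms(1)] by blast
 then show ?thesis
  using assms by (intro test_functionI[where R=R]) (auto intro: Ck_mult test_function_Ck)
qed

lemma test_function_cmult: "test_function \<phi> ==> test_function (%x. c * \<phi> x)"
 by (rule test_function_mult) (auto intro: Ck_const)

lemma test_function_add:
 assumes "test_function \<phi>" "test_function \<psi>"
 shows "test_function (%x. \<phi> x + \<psi> x)"
proof -
 obtain R where R: "!!x. \<phi> x ~= 0 ==> norm x <= R"
  using test_function_support[OF assms(1)] by blast
 obtain S where S: "!!x. \<psi> x ~= 0 ==> norm x <= S"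
  using test_function_support[OF assms(2)] by blast
 show ?thesis
 proof (rule test_functionI)
  show "norm x <= max R S" if "\<phi> x + \<psi> x ~= 0" for x
   using R[of x] S[of x] that by (cases "\<phi> x = 0") auto
 qed (use assms in "auto intro: Ck_add test_function_Ck")
qed

lemma test_function_zero: "test_function (%x. 0)"
 by (rule test_functionI[where R=0]) (auto intro: Ck_const)

lemma test_function_cnj: "test_function \<phi> ==> test_function (%x. cnj (\<phi> x))"
 by (auto simp: test_function_def intro: Ck_cnj)

lemma test_function_shift:
 assumes "test_function \<phi>"
 shows "test_function (%x. \<phi> (x + a))"
proof -
 obtain R where R: "!!x. \<phi> x ~= 0 ==> norm x <= R"
  using test_function_support[OF assms(1)] by blast
 show ?thesis
 proof (rule test_functionI[where R="R + norm a"])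
  fix x assume "\<phi> (x + a) ~= 0"
  then have "norm (x + a) <= R" by (rule R)
  moreover have "norm x <= norm (x + a) + norm a"
   using norm_triangle_ineq4[of "x + a" a] by simp
  ultimately show "norm x <= R + norm a" by simp
 qed (use assms in "auto intro: Ck_shift test_function_Ck")
qed

lemma test_function_differentiable: "test_function \<phi> ==> \<phi> differentiable (at x)"
 using test_function_Ck[of \<phi> "Suc 0"] by simp

lemma partial_deriv_eq_0:
 assumes "test_function \<phi>" and R: "!!x. \<phi> x ~= 0 ==> norm x <= R" and x: "norm x > R"
 shows "partial_deriv j \<phi> x = 0"
proof -
 have "((%x. 0::complex) has_derivative (%h. 0)) (at x)" by simp
 moreover have "open {x::real^'a. norm x > R}"
  by (rule open_Collect_less) (auto intro: continuous_intros)
 ultimately have "(\<phi> has_derivative (%h. 0)) (at x)"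
  by (rule has_derivative_transform_within_open) (use x R in force)+
 from partial_deriv_eqI[OF this] show ?thesis by simp
qed

lemma test_function_partial_deriv:
 assumes "test_function \<phi>"
 shows "test_function (partial_deriv j \<phi>)"
proof -
 obtain R where R: "!!x. \<phi> x ~= 0 ==> norm x <= R"
  using test_function_support[OF assms(1)] by blast
 show ?thesis
 proof (rule test_functionI)
  show "Ck k (partial_deriv j \<phi>)" for k
   using test_function_Ck[OF assms, of "Suc k"] by simp
  show "partial_deriv j \<phi> x ~= 0 ==> norm x <= R" for x
   using partial_deriv_eq_0[OF assms R] by force
 qed
qed

lemma test_function_continuous: "test_function \<phi> ==> continuous_on UNIV \<phi>"
 using Ck_continuous test_function_Ck by blast

lemma test_function_measurable: "test_function \<phi> ==> \<phi> \<in> borel_measurable borel"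
 by (rule borel_measurable_continuous_onI[OF test_function_continuous])

lemma test_function_bounded:
 assumes "test_function \<phi>"
 obtains B where "B > 0" "!!x. cmod (\<phi> x) <= B"
proof -
 obtain R where R: "!!x. \<phi> x ~= 0 ==> norm x <= R"
  using test_function_support[OF assms(1)] by blast
 have "compact (\<phi> ` cball 0 R)"
  using test_function_continuous[OF assms] by (intro compact_continuous_image) (auto intro: continuous_on_subset)
 then obtain B where B: "B > 0" "!!y. y \<in> \<phi> ` cball 0 R ==> norm y <= B"
  using compact_imp_bounded bounded_pos by metis
 have "cmod (\<phi> x) <= B" for x
  by (cases "\<phi> x = 0") (use B R in auto)
 with B(1) that show ?thesis by blast
qed

lemma test_function_L2:
 fixes \<phi> :: "real ^ 'n::finite => complex"
 assumes "test_function \<phi>"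
 shows "\<phi> \<in> L2"
proof -
 obtain R where R: "!!x. \<phi> x ~= 0 ==> norm x <= R"
  using test_function_support[OF assms(1)] by blast
 obtain B where B: "B > 0" "!!x. cmod (\<phi> x) <= B"
  using test_function_bounded[OF assms] by blast
 have "integrable lborel (indicator (cball (0::real^'n) R) :: _ => real)"
  by (intro integrable_real_indicator emeasure_bounded_finite) auto
 then have "integrable lborel (%x::real^'n. B^2 * indicator (cball 0 R) x)"
  by (rule integrable_mult_right)
 then have "integrable lborel (%x. (cmod (\<phi> x))^2)"
  by (rule Bochner_Integration.integrable_bound)
   (use test_function_measurable[OF assms] B R in "auto simp: indicator_def power_mono")
 then show ?thesis
  using test_function_measurable[OF assms] by (simp add: L2_def)
qed

section \<open>Test functions determine elements of L2\<close>

lemma indicator_L2: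
 assumes "A \<in> sets borel" "bounded A"
 shows "(%x::real^'n::finite. cor (indicator A x)) \<in> L2"
proof -
 have "integrable lborel (indicator A :: real^'n => real)"
  using assms by (intro integrable_real_indicator emeasure_bounded_finite) auto
 moreover have "(cmod (cor (indicator A x)))^2 = indicator A x" for x
  by (auto split: split_indicator)
 ultimately show ?thesis
  using assms(1) by (auto simp: L2_def)
qed

text \<open>The positive and negative parts are densities of two measures that agree on boxes, an
  intersection-stable generator of the Borel sets on which both are finite. Equal measures have a.e.
  equal densities, and the two parts of f can coincide only where f = 0.\<close>

lemma AE_zero_if_box_integrals_zero:
 fixes f :: "real^'n::finite => real"
 assumes [measurable]: "f \<in> borel_measurable borel"
  and int: "!!a b. integrable lborel (%x. f x * indicator (box a b) x)"
  and zero: "!!a b. (LBINT x. f x * indicator (box a b) x) = 0"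
 shows "AE x in lborel. f x = 0"
proof -
 define fp where "fp x = max 0 (f x)" for x
 define fm where "fm x = max 0 (- f x)" for x
 have [measurable]: "fp \<in> borel_measurable borel" "fm \<in> borel_measurable borel"
  by (simp_all add: fp_def[abs_def] fm_def[abs_def])
 have ip: "integrable lborel (%x. fp x * indicator (box a b) x)" for a b
  by (rule Bochner_Integration.integrable_bound[OF int[of a b]]) (auto simp: fp_def split: split_indicator)
 have im: "integrable lborel (%x. fm x * indicator (box a b) x)" for a b
  by (rule Bochner_Integration.integrable_bound[OF int[of a b]]) (auto simp: fm_def split: split_indicator)
 have ep: "emeasure (density lborel (%x. ennreal (fp x))) (box a b) = ennreal (LBINT x. fp x * indicator (box a b) x)" for a b
  by (subst nn_integral_eq_integral[OF ip, symmetric])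
   (auto simp: emeasure_density fp_def intro!: nn_integral_cong split: split_indicator)
 have em: "emeasure (density lborel (%x. ennreal (fm x))) (box a b) = ennreal (LBINT x. fm x * indicator (box a b) x)" for a b
  by (subst nn_integral_eq_integral[OF im, symmetric])
   (auto simp: emeasure_density fm_def intro!: nn_integral_cong split: split_indicator)
 have "(LBINT x. fp x * indicator (box a b) x) - (LBINT x. fm x * indicator (box a b) x) = 0" for a b
 proof -
  have "fp x * indicator (box a b) x - fm x * indicator (box a b) x = f x * indicator (box a b) x" for x
   by (auto simp: fp_def fm_def split: split_indicator)
  then show ?thesis
   using zero[of a b] Bochner_Integration.integral_diff[OF ip[of a b] im[of a b]] by simp
 qed
 then have eq: "emeasure (density lborel (%x. ennreal (fp x))) (box a b) = emeasure (density lborel (%x. ennreal (fm x))) (box a b)" for a b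
  by (simp add: ep em)
 have "density lborel (%x. ennreal (fp x)) = density lborel (%x. ennreal (fm x))"
 proof (rule measure_eqI_generator_eq)
  let ?E = "range (%(a, b). box a b::(real^'n) set)"
  show "Int_stable ?E"
   by (auto simp: Int_stable_def box_Int_box)
  show "?E \<subseteq> Pow UNIV" "sets (density lborel (%x. ennreal (fp x))) = sigma_sets UNIV ?E"
   "sets (density lborel (%x. ennreal (fm x))) = sigma_sets UNIV ?E"
   by (simp_all add: borel_eq_box)
  let ?A = "%n::nat. box (- (real n *\<^sub>R One)) (real n *\<^sub>R One) :: (real^'n) set"
  show "range ?A \<subseteq> ?E" "(\<Union>i. ?A i) = UNIV"
   unfolding UN_box_eq_UNIV by auto
  show "emeasure (density lborel (%x. ennreal (fp x))) (?A i) ~= \<infinity>" for i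
   by (simp add: ep)
  show "emeasure (density lborel (%x. ennreal (fp x))) X = emeasure (density lborel (%x. ennreal (fm x))) X" if "X \<in> ?E" for X
   using that eq by auto
 qed
 then have "AE x in lborel. ennreal (fp x) = ennreal (fm x)"
  by (subst (asm) sigma_finite_measure.density_unique_iff[OF sigma_finite_lborel]) auto
 then show ?thesis
  by eventually_elim (auto simp: fp_def fm_def max_def split: if_splits)
qed

text \<open>Each factor is exp(-1/(m d)) with d the distance to a face, and tends to 1 as m grows.
  The bumps thus approach the indicator of the open box from below without leaving the box, so |F|
  on the box is a dominating function.\<close>

definition box_bump :: "real^'n::finite => real^'n => real => real^'n => real" where
 "box_bump a b m x = (\<Prod>i\<in>UNIV. flat_exp 1 (m * (x $ i - a $ i)) * flat_exp 1 (m * (b $ i - x $ i)))"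

lemma flat_exp_1: "flat_exp 1 t = (if t > 0 then exp (- (1/t)) else 0)"
 by (simp add: flat_exp_def)

lemma flat_exp_1_bounds: "0 <= flat_exp 1 t" "flat_exp 1 t <= 1"
 by (auto simp: flat_exp_1)

lemma mem_box_iff: "x \<in> box a b \<longleftrightarrow> (\<forall>i. a $ i < x $ i \<and> x $ i < (b $ i :: real))"
 by (auto simp: mem_box_cart)

lemma box_bump_bounds: "m > 0 ==> 0 <= box_bump a b m x \<and> box_bump a b m x <= indicator (box a b) x"
proof -
 assume m: "m > 0"
 have "0 <= box_bump a b m x"
  unfolding box_bump_def by (intro prod_nonneg) (simp add: flat_exp_1_bounds)
 moreover have "box_bump a b m x <= 1"
  unfolding box_bump_def by (intro prod_le_1) (simp add: flat_exp_1_bounds mult_le_one)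
 moreover have "box_bump a b m x = 0" if "x \<notin> box a b"
 proof -
  from that obtain i where "\<not> (a $ i < x $ i \<and> x $ i < b $ i)" by (auto simp: mem_box_iff)
  then have "flat_exp 1 (m * (x $ i - a $ i)) * flat_exp 1 (m * (b $ i - x $ i)) = 0"
   using m by (auto simp: flat_exp_1 zero_less_mult_iff)
  then show ?thesis
   unfolding box_bump_def by (intro prod_zero) auto
 qed
 ultimately show ?thesis by (auto split: split_indicator)
qed

lemma box_bump_tendsto: "(%m. box_bump a b (real (Suc m)) x) ----> indicator (box a b) x"
proof (cases "x \<in> box a b")
 case True
 have lim: "(%m. flat_exp 1 (real (Suc m) * c)) ----> 1" if "c > 0" for c
 proof -
  have "(%m. exp (- ((1/c) * inverse (real (Suc m))))) ----> exp (- ((1/c) * 0))"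
   by (intro tendsto_intros LIMSEQ_inverse_real_of_nat)
  moreover have "exp (- ((1/c) * inverse (real (Suc m)))) = flat_exp 1 (real (Suc m) * c)" for m
  proof -
   have "real (Suc m) * c > 0" using that by simp
   then show ?thesis using that by (simp add: flat_exp_1 inverse_eq_divide del: of_nat_Suc)
  qed
  ultimately show ?thesis by simp
 qed
 have "(%m. box_bump a b (real (Suc m)) x) ----> (\<Prod>i\<in>(UNIV::'a set). 1 * 1)"
  unfolding box_bump_def using True by (intro tendsto_prod tendsto_mult lim) (auto simp: mem_box_iff)
 then show ?thesis using True by simp
next
 case False
 then have "box_bump a b (real (Suc m)) x = 0" for m
  using box_bump_bounds[of "real (Suc m)" a b x] by simp
 then show ?thesis using False by simp
qed

lemma test_function_box_bump: 
 assumes "m > 0"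
 shows "test_function (%x. cor (box_bump a b m x))"
proof -
 have coord: "Ck k (%x::real^'a. cor (m * (x $ i - a $ i)))" for k i a
 proof -
  have "Ck k (%x. cor m * cor (x $ i) + cor (- m * a $ i))"
   by (intro Ck_add Ck_mult Ck_const Ck_coord)
  then show ?thesis by (simp add: algebra_simps)
 qed
 have coord': "Ck k (%x::real^'a. cor (m * (a $ i - x $ i)))" for k i a
 proof -
  have "Ck k (%x. cor (-m) * cor (x $ i) + cor (m * a $ i))"
   by (intro Ck_add Ck_mult Ck_const Ck_coord)
  then show ?thesis by (simp add: algebra_simps)
 qed
 have ck: "Ck k (%x. cor (box_bump a b m x))" for k
  unfolding box_bump_def of_real_prod of_real_mult
  by (intro Ck_prod Ck_mult Ck_flat_exp coord coord')
 obtain R where R: "!!x. x \<in> box a b ==> norm x <= R"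
  using bounded_box[of a b] by (auto simp: bounded_iff)
 show ?thesis
 proof (rule test_functionI[OF ck])
  fix x assume "cor (box_bump a b m x) ~= 0"
  then have "x \<in> box a b"
   using box_bump_bounds[OF assms, of a b x] by (cases "x \<in> box a b") auto
  then show "norm x <= R" by (rule R)
 qed
qed

text \<open>The functions \<open>box_bump\<close> carry the vanishing of pairings over to integrals
  over boxes, and box integrals determine a locally integrable function.\<close>

lemma test_annihilator:
 fixes F :: "real^'n::finite => complex"
 assumes F: "F \<in> L2" and zero: "!!\<phi>. test_function \<phi> ==> (LBINT x. F x * \<phi> x) = 0"
 shows "AE x in lborel. F x = 0"
proof -
 have [measurable]: "F \<in> borel_measurable borel" using F L2_measurable by blast
 have int: "integrable lborel (%x. F x * cor (indicator (box a b) x))" for a b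
  by (intro integrable_L2_mult F indicator_L2) auto
 have I: "(LBINT x. F x * cor (indicator (box a b) x)) = 0" for a b
 proof -
  have "(%m. \<integral>x. F x * cor (box_bump a b (real (Suc m)) x) \<partial>lborel) ---->
    (LBINT x. F x * cor (indicator (box a b) x))"
  proof (rule integral_dominated_convergence[where w="%x. cmod (F x * cor (indicator (box a b) x))"])
   show "integrable lborel (%x. cmod (F x * cor (indicator (box a b) x)))"
    using int by (rule integrable_norm)
   show "(%x. F x * cor (box_bump a b (real (Suc m)) x)) \<in> borel_measurable lborel" for m
    using test_function_measurable[OF test_function_box_bump[of "real (Suc m)" a b]] by simp
   show "AE x in lborel. (%m. F x * cor (box_bump a b (real (Suc m)) x)) ----> F x * cor (indicator (box a b) x)"
    by (intro AE_I2 tendsto_mult tendsto_const tendsto_of_real box_bump_tendsto)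
   show "AE x in lborel. norm (F x * cor (box_bump a b (real (Suc m)) x)) <= cmod (F x * cor (indicator (box a b) x))" for m
    using box_bump_bounds[of "real (Suc m)" a b] by (intro AE_I2) (auto simp: norm_mult intro!: mult_left_mono)
  qed simp
  moreover have "(LBINT x. F x * cor (box_bump a b (real (Suc m)) x)) = 0" for m
   by (rule zero[OF test_function_box_bump]) simp
  ultimately show ?thesis
   using LIMSEQ_unique[OF _ tendsto_const] by (simp add: LIMSEQ_const_iff)
 qed
 have "AE x in lborel. Re (F x) = 0"
 proof (rule AE_zero_if_box_integrals_zero)
  show "integrable lborel (%x. Re (F x) * indicator (box a b) x)" for a b
   using integrable_Re[OF int[of a b]] by simp
  show "(LBINT x. Re (F x) * indicator (box a b) x) = 0" for a b
   using integral_Re[OF int[of a b]] I[of a b] by simp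
 qed simp
 moreover have "AE x in lborel. Im (F x) = 0"
 proof (rule AE_zero_if_box_integrals_zero)
  show "integrable lborel (%x. Im (F x) * indicator (box a b) x)" for a b
   using integrable_Im[OF int[of a b]] by simp
  show "(LBINT x. Im (F x) * indicator (box a b) x) = 0" for a b
   using integral_Im[OF int[of a b]] I[of a b] by simp
 qed simp
 ultimately show ?thesis
  by eventually_elim (simp add: complex_eq_iff)
qed

lemma linear_le_quadratic_imp_zero:
 fixes a b :: real
 assumes "!!s. 2 * s * a <= s^2 * b" "0 <= b"
 shows "a = 0"
proof -
 \<comment> \<open>At s = a/(b + 1) the hypothesis reads 2 a^2/(b + 1) <= a^2 b/(b + 1)^2, and the
   right side is at most a^2/(b + 1). The summand 1 covers b = 0.\<close>
 have "2 * (a / (b + 1)) * a <= (a / (b + 1))^2 * b" by (rule assms)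
 also have "... = (a^2 / (b + 1)) * (b / (b + 1))"
  by (simp add: power2_eq_square)
 also have "... <= (a^2 / (b + 1)) * 1"
  using assms(2) by (intro mult_left_mono) auto
 finally have "a^2 / (b + 1) <= 0"
  by (simp add: power2_eq_square)
 then show ?thesis
  using assms(2) by (simp add: divide_le_0_iff)
qed

text \<open>The representing element maximises \<open>2 Re T \<phi> - \<parallel>\<phi>\<parallel>\<^sup>2\<close>; by the parallelogram law
 every maximising sequence of test functions is Cauchy.\<close>

lemma L2_riesz_test:
 fixes T :: "(real^'n::finite => complex) => complex"
 assumes add: "!!\<phi> \<psi>. test_function \<phi> ==> test_function \<psi> ==> T (%x. \<phi> x + \<psi> x) = T \<phi> + T \<psi>"
  and scale: "!!c \<phi>. test_function \<phi> ==> T (%x. c * \<phi> x) = c * T \<phi>"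
  and bound: "!!\<phi>. test_function \<phi> ==> cmod (T \<phi>) <= K * L2_norm \<phi>"
 obtains g \<theta> where "g \<in> L2" "!!\<phi>. test_function \<phi> ==> T \<phi> = (LBINT x. g x * \<phi> x)"
  "!!k::nat. test_function (\<theta> k)" "(%k. L2_norm (%x. \<theta> k x - g x)) ----> 0"
proof -
 define J where "J \<phi> = 2 * Re (T \<phi>) - (L2_norm \<phi>)^2" for \<phi>
 have J_le: "J \<phi> <= K^2" if "test_function \<phi>" for \<phi>
 proof -
  have "Re (T \<phi>) <= K * L2_norm \<phi>"
   using complex_Re_le_cmod bound[OF that] by (rule order_trans)
  then have "J \<phi> <= 2 * (K * L2_norm \<phi>) - (L2_norm \<phi>)^2"
   by (simp add: J_def)
  also have "... <= K^2"
   using sum_squares_bound[of K "L2_norm \<phi>"] by simp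
  finally show ?thesis .
 qed
 define S where "S = (SUP \<phi>\<in>{\<phi>. test_function \<phi>}. J \<phi>)"
 have bdd: "bdd_above (J ` {\<phi>. test_function \<phi>})"
  using J_le by (intro bdd_aboveI[of _ "K^2"]) auto
 have J_S: "J \<phi> <= S" if "test_function \<phi>" for \<phi>
  unfolding S_def by (rule cSUP_upper[OF _ bdd]) (use that in simp)
 have "\<exists>\<phi>. test_function \<phi> \<and> S - inverse (real (Suc k)) < J \<phi>" for k
 proof -
  have "S - inverse (real (Suc k)) < S" by simp
  then show ?thesis
   unfolding S_def by (subst (asm) less_cSUP_iff[OF _ bdd]) (use test_function_zero in auto)
 qed
 then obtain \<phi> where \<phi>: "!!k. test_function (\<phi> k)" "!!k. S - inverse (real (Suc k)) < J (\<phi> k)"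
  by metis
 have \<phi>L: "\<phi> k \<in> L2" for k using \<phi>(1) test_function_L2 by blast
 \<comment> \<open>The mean of two members is a test function, so its value of \<open>J\<close> is
   at most S; both members being within 1/(k + 1) of S, the parallelogram law leaves only these
   defects.\<close>
 have mid: "(L2_norm (%x. \<phi> m x - \<phi> k x))^2 <= 2 * inverse (real (Suc m)) + 2 * inverse (real (Suc k))" for m k
 proof -
  have t: "test_function (%x. \<phi> m x + \<phi> k x)" by (intro test_function_add \<phi>)
  have "J (%x. (1/2) * (\<phi> m x + \<phi> k x)) <= S"
   by (intro J_S test_function_cmult t)
  then have "Re (T (\<phi> m)) + Re (T (\<phi> k)) - (L2_norm (%x. \<phi> m x + \<phi> k x))^2 / 4 <= S"
   unfolding J_def scale[OF t] add[OF \<phi>(1)[of m] \<phi>(1)[of k]] L2_norm_cmult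
   by (simp add: power_mult_distrib power_divide add_divide_distrib)
  then show ?thesis
   using \<phi>(2)[of m] \<phi>(2)[of k] L2_parallelogram[OF \<phi>L[of m] \<phi>L[of k]] by (simp add: J_def)
 qed
 have Cau: "\<exists>N. \<forall>m\<ge>N. \<forall>k\<ge>N. L2_norm (%x. \<phi> m x - \<phi> k x) < e" if "e > 0" for e
 proof -
  have "e^2 / 4 > 0" using that by simp
  then obtain N where N: "inverse (real (Suc N)) < e^2 / 4"
   using reals_Archimedean by blast
  have "L2_norm (%x. \<phi> m x - \<phi> k x) < e" if mk: "m >= N" "k >= N" for m k
  proof (rule power_less_imp_less_base)
   have "inverse (real (Suc j)) <= inverse (real (Suc N))" if "j >= N" for j
    using that by (simp add: le_imp_inverse_le)
   then have "inverse (real (Suc m)) < e^2 / 4" "inverse (real (Suc k)) < e^2 / 4"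
    using mk N by (meson le_less_trans)+
   then show "(L2_norm (%x. \<phi> m x - \<phi> k x))^2 < e^2"
    using mid[of m k] by linarith
  qed (use \<open>e > 0\<close> in simp)
  then show ?thesis by blast
 qed
 obtain G where G: "G \<in> L2" "(%k. L2_norm (%x. \<phi> k x - G x)) ----> 0"
  using L2_complete[of \<phi>, OF \<phi>L Cau] by blast
 \<comment> \<open>First variation at the maximum. Since G need not be a test function, the
   variation is made at \<phi>_k, where the defect 1/(k + 1) appears, and k tends to infinity
   afterwards with s fixed.\<close>
 have re: "Re (T \<psi>) = Re (LBINT x. \<psi> x * cnj (G x))" if \<psi>: "test_function \<psi>" for \<psi>
 proof -
  have \<psi>L: "\<psi> \<in> L2" using \<psi> test_function_L2 by blast
  have "2 * s * (Re (T \<psi>) - Re (LBINT x. \<psi> x * cnj (G x))) <= s^2 * (L2_norm \<psi>)^2" for s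
  proof -
   have ineq: "2 * s * (Re (T \<psi>) - Re (LBINT x. \<psi> x * cnj (\<phi> k x))) <= s^2 * (L2_norm \<psi>)^2 + inverse (real (Suc k))" for k
   proof -
    let ?s = "cor s"
    have t: "test_function (%x. ?s * \<psi> x)" by (intro test_function_cmult \<psi>)
    have "J (%x. ?s * \<psi> x + \<phi> k x) <= S"
     by (intro J_S test_function_add t \<phi>)
    moreover have "T (%x. ?s * \<psi> x + \<phi> k x) = ?s * T \<psi> + T (\<phi> k)"
     using add[OF t \<phi>(1)[of k]] scale[OF \<psi>] by simp
    moreover have "(L2_norm (%x. ?s * \<psi> x + \<phi> k x))^2 =
      s\<^sup>2 * (L2_norm \<psi>)^2 + 2 * s * Re (LBINT x. \<psi> x * cnj (\<phi> k x)) + (L2_norm (\<phi> k))^2"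
     using L2_norm_add_sq[OF L2_cmult[OF \<psi>L, of ?s] \<phi>L[of k]]
     by (simp add: L2_norm_cmult power_mult_distrib mult.assoc)
    ultimately show ?thesis
     using \<phi>(2)[of k] by (simp add: J_def algebra_simps)
   qed
   have l1: "(%k. \<integral>x. \<psi> x * cnj (\<phi> k x) \<partial>lborel) ----> (LBINT x. \<psi> x * cnj (G x))"
   proof -
    have "L2_norm (%x. cnj (\<phi> k x) - cnj (G x)) = L2_norm (%x. \<phi> k x - G x)" for k
     using L2_norm_cnj[of "%x. \<phi> k x - G x"] by simp
    then have "(%k. \<integral>x. cnj (\<phi> k x) * \<psi> x \<partial>lborel) ----> (LBINT x. cnj (G x) * \<psi> x)"
     using G by (intro L2_mult_tendsto L2_cnj \<phi>L \<psi>L) auto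
    then show ?thesis by (simp add: mult.commute)
   qed
   show ?thesis
   proof (rule LIMSEQ_le)
    show "(%k. 2 * s * (Re (T \<psi>) - Re (LBINT x. \<psi> x * cnj (\<phi> k x)))) ----> 2 * s * (Re (T \<psi>) - Re (LBINT x. \<psi> x * cnj (G x)))"
     by (intro tendsto_intros l1)
    show "(%k. s^2 * (L2_norm \<psi>)^2 + inverse (real (Suc k))) ----> s\<^sup>2 * (L2_norm \<psi>)^2"
     using tendsto_add[OF tendsto_const LIMSEQ_inverse_real_of_nat] by simp
    show "\<exists>N. \<forall>k\<ge>N. 2 * s * (Re (T \<psi>) - Re (LBINT x. \<psi> x * cnj (\<phi> k x))) <= s^2 * (L2_norm \<psi>)^2 + inverse (real (Suc k))"
     using ineq by blast
   qed
  qed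
  then have "Re (T \<psi>) - Re (LBINT x. \<psi> x * cnj (G x)) = 0"
   by (rule linear_le_quadratic_imp_zero) simp
  then show ?thesis by simp
 qed
 have "T \<psi> = (LBINT x. cnj (G x) * \<psi> x)" if \<psi>: "test_function \<psi>" for \<psi>
 proof -
  \<comment> \<open>Only real parts have been compared; complex linearity applied to
    \<open>\<i> * \<psi>\<close> supplies the imaginary part.\<close>
  have "Re (T (%x. \<i> * \<psi> x)) = Re (LBINT x. \<i> * \<psi> x * cnj (G x))"
   by (rule re[OF test_function_cmult[OF \<psi>]])
  then have "Im (T \<psi>) = Im (LBINT x. \<psi> x * cnj (G x))"
   by (simp add: scale[OF \<psi>] mult.assoc)
  with re[OF \<psi>] show ?thesis
   by (simp add: complex_eq_iff mult.commute)
 qed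
 moreover have "(%k. L2_norm (%x. cnj (\<phi> k x) - cnj (G x))) ----> 0"
 proof -
  have "L2_norm (%x. cnj (\<phi> k x) - cnj (G x)) = L2_norm (%x. \<phi> k x - G x)" for k
   using L2_norm_cnj[of "%x. \<phi> k x - G x"] by simp
  then show ?thesis using G(2) by simp
 qed
 ultimately show ?thesis
  using that[of "%x. cnj (G x)" "%k x. cnj (\<phi> k x)"] L2_cnj[OF G(1)] test_function_cnj[OF \<phi>(1)] by blast
qed

text \<open>Density of test functions comes out of the representation: the element representing the
  pairing with F is a limit of test functions \<theta>_k, and it equals F a.e. Testing the bound
  with the conjugates of \<theta>_k and passing to the limit gives |F|^2 <= K |F| for the
  norms.\<close>

lemma L2_norm_le_by_duality:
 fixes F :: "real^'n::finite => complex"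
 assumes F: "F \<in> L2" and bound: "!!\<phi>. test_function \<phi> ==> cmod (LBINT x. F x * \<phi> x) <= K * L2_norm \<phi>"
  and K: "0 <= K"
 shows "L2_norm F <= K"
proof -
 have add: "(LBINT x. F x * (\<phi> x + \<psi> x)) = (LBINT x. F x * \<phi> x) + (LBINT x. F x * \<psi> x)"
  if "test_function \<phi>" "test_function \<psi>" for \<phi> \<psi> :: "real^'n => complex"
  using integrable_L2_mult[OF F test_function_L2[OF that(1)]] integrable_L2_mult[OF F test_function_L2[OF that(2)]]
  by (simp add: distrib_left)
 have scale: "(LBINT x. F x * (c * \<phi> x)) = c * (LBINT x. F x * \<phi> x)" if "test_function \<phi>" for c and \<phi> :: "real^'n => complex"
  by (simp add: mult.left_commute)
 obtain g \<theta> where g: "g \<in> L2" "!!\<phi>. test_function \<phi> ==> (LBINT x. F x * \<phi> x) = (LBINT x. g x * \<phi> x)"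
  and \<theta>: "!!k::nat. test_function (\<theta> k)" "(%k. L2_norm (%x. \<theta> k x - g x)) ----> 0"
  by (rule L2_riesz_test[of "%\<phi>. \<integral>x. F x * \<phi> x \<partial>lborel", OF add scale bound]) blast+
 have "AE x in lborel. F x - g x = 0"
 proof (rule test_annihilator[OF L2_diff[OF F g(1)]])
  fix \<phi> :: "real^'n => complex" assume "test_function \<phi>"
  then show "(LBINT x. (F x - g x) * \<phi> x) = 0"
   using integrable_L2_mult[OF F test_function_L2] integrable_L2_mult[OF g(1) test_function_L2] g(2)
   by (simp add: left_diff_distrib)
 qed
 then have ae: "AE x in lborel. F x = g x" by simp
 then have nFg: "L2_norm F = L2_norm g"
  using L2_measurable[OF F] L2_measurable[OF g(1)] by (intro L2_norm_cong_AE) auto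
 have \<theta>L: "\<theta> k \<in> L2" for k using \<theta>(1) test_function_L2 by blast
 have "(%k. cmod (LBINT x. cnj (\<theta> k x) * F x)) ----> cmod (LBINT x. cnj (g x) * F x)"
 proof (rule tendsto_norm[OF L2_mult_tendsto[OF L2_cnj[OF \<theta>L] L2_cnj[OF g(1)] F]])
  show "(%k. L2_norm (%x. cnj (\<theta> k x) - cnj (g x))) ----> 0"
   using \<theta>(2) L2_norm_cnj[of "%x. \<theta> k x - g x" for k] by simp
 qed
 moreover have "(%k. K * L2_norm (\<theta> k)) ----> K * L2_norm g"
  by (intro tendsto_intros L2_norm_tendsto \<theta>L g(1) \<theta>(2))
 moreover have "cmod (LBINT x. cnj (\<theta> k x) * F x) <= K * L2_norm (\<theta> k)" for k
  using bound[OF test_function_cnj[OF \<theta>(1)[of k]]] by (simp add: L2_norm_cnj mult.commute)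
 ultimately have "cmod (LBINT x. cnj (g x) * F x) <= K * L2_norm g"
  by (intro LIMSEQ_le) auto
 moreover have "(LBINT x. cnj (g x) * F x) = of_real ((L2_norm g)^2)"
 proof -
  have "(LBINT x. cnj (g x) * F x) = (LBINT x. cor ((cmod (g x))^2))"
  proof (rule integral_cong_AE)
   show "(%x. cnj (g x) * F x) \<in> borel_measurable lborel"
    using L2_measurable[OF L2_cnj[OF g(1)]] L2_measurable[OF F] by measurable
   show "(%x. cor ((cmod (g x))^2)) \<in> borel_measurable lborel"
    using L2_measurable[OF g(1)] by measurable
   show "AE x in lborel. cnj (g x) * F x = cor ((cmod (g x))^2)"
    using ae by eventually_elim (metis complex_norm_square mult.commute of_real_power)
  qed
  then show ?thesis by (simp only: L2_norm_sq integral_complex_of_real)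
 qed
 ultimately have "(L2_norm g)^2 <= K * L2_norm g"
  by (simp add: norm_power)
 moreover have "L2_norm g > 0" if "L2_norm g ~= 0"
  using that L2_norm_nonneg[of g] by linarith
 ultimately show ?thesis
  using K nFg by (cases "L2_norm g = 0") (auto simp: power2_eq_square)
qed

section \<open>Magnetic translations\<close>

text \<open>The transpose of the magnetic translation by r z with phase covector r a. The group is
  made to act on the test function, so that its derivative in r is classical while f stays merely
  square integrable.\<close>

definition twist :: "real^'n::finite => real^'n => (real^'n => complex) => real => real^'n => complex" where
 "twist a z \<phi> r y = exp (\<i> * cor ((- r *\<^sub>R a) \<bullet> y)) * \<phi> (y - r *\<^sub>R z)"

definition dtwist :: "real^'n::finite => real^'n => (real^'n => complex) => real => real^'n => complex" where
 "dtwist a z \<phi> r y = exp (\<i> * cor ((- r *\<^sub>R a) \<bullet> y)) *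
  (- \<i> * cor (a \<bullet> y) * \<phi> (y - r *\<^sub>R z) - (\<Sum>j\<in>UNIV. cor (z $ j) * partial_deriv j \<phi> (y - r *\<^sub>R z)))"

lemma cmod_twist: "cmod (twist a z \<phi> r y) = cmod (\<phi> (y - r *\<^sub>R z))"
 by (simp add: twist_def norm_mult)

lemma test_function_twist: "test_function \<phi> ==> test_function (twist a z \<phi> r)"
 unfolding twist_def[abs_def]
 using test_function_mult[OF test_function_shift[of \<phi> "- r *\<^sub>R z"] Ck_expi[of _ "- r *\<^sub>R a"]] by simp

lemma frechet_derivative_cart:
 fixes \<phi> :: "real^'n::finite => complex"
 assumes "\<phi> differentiable (at x)"
 shows "frechet_derivative \<phi> (at x) h = (\<Sum>j\<in>UNIV. cor (h $ j) * partial_deriv j \<phi> x)"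
proof -
 have lin: "linear (frechet_derivative \<phi> (at x))"
  by (rule linear_frechet_derivative[OF assms])
 have "h = (\<Sum>j\<in>UNIV. h $ j *\<^sub>R axis j 1)"
  using basis_expansion[of h] by (simp add: scalar_mult_eq_scaleR)
 then have "frechet_derivative \<phi> (at x) h = frechet_derivative \<phi> (at x) (\<Sum>j\<in>UNIV. h $ j *\<^sub>R axis j 1)"
  by simp
 also have "... = (\<Sum>j\<in>UNIV. cor (h $ j) * partial_deriv j \<phi> x)"
  by (simp add: linear_sum[OF lin] linear_scale[OF lin] frechet_eq_partial_deriv, simp add: scaleR_conv_of_real)
 finally show ?thesis .
qed

lemma twist_has_vector_derivative:
 fixes \<phi> :: "real^'n::finite => complex"
 assumes "test_function \<phi>"
 shows "((%r. twist a z \<phi> r y) has_vector_derivative dtwist a z \<phi> r y) (at r)"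
proof -
 let ?e = "%r. exp (\<i> * cor ((- r *\<^sub>R a) \<bullet> y))"
 have "((%r. \<i> * cor ((- r *\<^sub>R a) \<bullet> y)) has_derivative (%h. \<i> * cor ((- h *\<^sub>R a) \<bullet> y))) (at r)"
  by (intro bounded_linear_imp_has_derivative bounded_linear_const_mult bounded_linear_compose[OF bounded_linear_of_real]
    bounded_linear_compose[OF bounded_linear_inner_left] bounded_linear_compose[OF bounded_linear_scaleR_left] bounded_linear_minus bounded_linear_ident)
 from has_derivative_compose[OF this DERIV_exp[unfolded has_field_derivative_def]]
 have "(?e has_derivative (%h. ?e r * (\<i> * cor ((- h *\<^sub>R a) \<bullet> y)))) (at r)" .
 moreover have "(%h. ?e r * (\<i> * cor ((- h *\<^sub>R a) \<bullet> y))) = (%h. h *\<^sub>R (?e r * (- \<i> * cor (a \<bullet> y))))"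
  by (simp add: fun_eq_iff scaleR_conv_of_real[where 'a=complex])
 ultimately have 1: "(?e has_vector_derivative (?e r * (- \<i> * cor (a \<bullet> y)))) (at r)"
  by (simp add: has_vector_derivative_def)
 have diff: "\<phi> differentiable (at (y - r *\<^sub>R z))" by (rule test_function_differentiable[OF assms])
 have "((%r. y - r *\<^sub>R z) has_derivative (%h. - h *\<^sub>R z)) (at r)"
  by (auto intro!: derivative_eq_intros)
 from has_derivative_compose[OF this diff[unfolded frechet_derivative_works]]
 have "((%r. \<phi> (y - r *\<^sub>R z)) has_derivative (%h. frechet_derivative \<phi> (at (y - r *\<^sub>R z)) (- h *\<^sub>R z))) (at r)" .
 moreover have "(%h. frechet_derivative \<phi> (at (y - r *\<^sub>R z)) (- h *\<^sub>R z)) =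
  (%h. h *\<^sub>R (- (\<Sum>j\<in>UNIV. cor (z $ j) * partial_deriv j \<phi> (y - r *\<^sub>R z))))"
  by (auto simp: fun_eq_iff frechet_derivative_cart[OF diff] scaleR_conv_of_real[where 'a=complex] sum_distrib_left mult.assoc sum_negf)
 ultimately have 2: "((%r. \<phi> (y - r *\<^sub>R z)) has_vector_derivative
   (- (\<Sum>j\<in>UNIV. cor (z $ j) * partial_deriv j \<phi> (y - r *\<^sub>R z)))) (at r)"
  by (simp add: has_vector_derivative_def)
 show ?thesis
  using has_vector_derivative_mult[OF 1 2] by (simp add: twist_def[abs_def] dtwist_def algebra_simps)
qed

text \<open>Orthogonality of a and z kills the term in which the phase is differentiated along z.
  The generator then acts on the twisted function itself, which is again a test function and can be
  inserted into the definition of the weak derivatives.\<close>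

lemma dtwist_eq:
 assumes "test_function \<phi>" "a \<bullet> z = 0"
 shows "dtwist a z \<phi> r y = - \<i> * cor (a \<bullet> y) * twist a z \<phi> r y
  - (\<Sum>j\<in>UNIV. cor (z $ j) * partial_deriv j (twist a z \<phi> r) y)"
proof -
 let ?e = "exp (\<i> * cor ((- r *\<^sub>R a) \<bullet> y))"
 have pd: "partial_deriv j (twist a z \<phi> r) y =
   ?e * partial_deriv j \<phi> (y - r *\<^sub>R z) + ?e * (\<i> * cor (- r * a $ j)) * \<phi> (y - r *\<^sub>R z)" for j
 proof -
  have "\<phi> differentiable (at (y + (- r *\<^sub>R z)))" by (rule test_function_differentiable[OF assms(1)])
  then have "((%x. \<phi> (x + (- r *\<^sub>R z))) has_derivative frechet_derivative \<phi> (at (y + (- r *\<^sub>R z)))) (at y)"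
   by (intro has_derivative_shift) (simp add: frechet_derivative_works[symmetric])
  from has_derivative_mult[OF has_derivative_expi[of "- r *\<^sub>R a" y] this]
  have "(twist a z \<phi> r has_derivative (%h. ?e * frechet_derivative \<phi> (at (y - r *\<^sub>R z)) h +
    ?e * (\<i> * cor ((- r *\<^sub>R a) \<bullet> h)) * \<phi> (y - r *\<^sub>R z))) (at y)"
   by (simp add: twist_def[abs_def])
  from partial_deriv_eqI[OF this] show ?thesis
   by (simp add: frechet_eq_partial_deriv inner_axis)
 qed
 have "(\<Sum>j\<in>UNIV. cor (z $ j) * (?e * (\<i> * cor (- r * a $ j)) * \<phi> (y - r *\<^sub>R z))) =
   (\<Sum>j\<in>UNIV. cor (a $ j * z $ j)) * (?e * (\<i> * cor (- r)) * \<phi> (y - r *\<^sub>R z))"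
  unfolding sum_distrib_right by (rule sum.cong) (simp_all add: mult_ac)
 also have "... = cor (a \<bullet> z) * (?e * (\<i> * cor (- r)) * \<phi> (y - r *\<^sub>R z))"
  by (simp add: inner_vec_def)
 finally have z: "(\<Sum>j\<in>UNIV. cor (z $ j) * (?e * (\<i> * cor (- r * a $ j)) * \<phi> (y - r *\<^sub>R z))) = 0"
  using assms(2) by simp
 have "(\<Sum>j\<in>UNIV. cor (z $ j) * partial_deriv j (twist a z \<phi> r) y) =
   ?e * (\<Sum>j\<in>UNIV. cor (z $ j) * partial_deriv j \<phi> (y - r *\<^sub>R z))"
  unfolding pd distrib_left sum.distrib z by (simp add: sum_distrib_left mult.left_commute)
 then show ?thesis
  by (simp add: dtwist_def twist_def algebra_simps)
qed

text \<open>A dominating function for difference quotients. The range |r| <= 2 leaves room for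
  increments up to 1 about any point of [-1, 1], and the support then stays within radius R + 2
  |z|.\<close>

lemma dtwist_bound:
 fixes \<phi> :: "real^'n::finite => complex"
 assumes \<phi>: "test_function \<phi>"
 obtains B R where "B >= 0" "!!r y. \<bar>r\<bar> <= 2 ==> cmod (dtwist a z \<phi> r y) <= B * indicator (cball 0 R) y"
proof -
 obtain R where R: "R > 0" "!!x. \<phi> x ~= 0 ==> norm x <= R"
  using test_function_support[OF \<phi>] by blast
 obtain B0 where B0: "B0 > 0" "!!x. cmod (\<phi> x) <= B0"
  using test_function_bounded[OF \<phi>] by blast
 have "\<forall>j. \<exists>B>0. \<forall>x. cmod (partial_deriv j \<phi> x) <= B"
  using test_function_bounded[OF test_function_partial_deriv[OF \<phi>]] by metis
 then obtain B1 where B1: "!!j. B1 j > 0" "!!j x. cmod (partial_deriv j \<phi> x) <= B1 j"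
  by metis
 define R' where "R' = R + 2 * norm z"
 define B where "B = norm a * R' * B0 + (\<Sum>j\<in>UNIV. \<bar>z $ j\<bar> * B1 j)"
 have "0 <= R'" using R(1) by (simp add: R'_def)
 then have B_pos: "B >= 0"
  using B0 B1 R(1) by (auto simp: B_def less_imp_le intro!: add_nonneg_nonneg sum_nonneg mult_nonneg_nonneg)
 have "cmod (dtwist a z \<phi> r y) <= B * indicator (cball 0 R') y" if r: "\<bar>r\<bar> <= 2" for r y
 proof (cases "norm y <= R'")
  case True
  have "cmod (dtwist a z \<phi> r y) = cmod (- \<i> * cor (a \<bullet> y) * \<phi> (y - r *\<^sub>R z) - (\<Sum>j\<in>UNIV. cor (z $ j) * partial_deriv j \<phi> (y - r *\<^sub>R z)))"
   by (simp add: dtwist_def norm_mult)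
  also have "... <= cmod (- \<i> * cor (a \<bullet> y) * \<phi> (y - r *\<^sub>R z)) + cmod (\<Sum>j\<in>UNIV. cor (z $ j) * partial_deriv j \<phi> (y - r *\<^sub>R z))"
   by (rule norm_triangle_ineq4)
  also have "... <= norm a * R' * B0 + (\<Sum>j\<in>UNIV. \<bar>z $ j\<bar> * B1 j)"
  proof (rule add_mono)
   have "\<bar>a \<bullet> y\<bar> <= norm a * R'"
    using Cauchy_Schwarz_ineq2[of a y] True by (meson mult_left_mono norm_ge_zero order_trans)
   then show "cmod (- \<i> * cor (a \<bullet> y) * \<phi> (y - r *\<^sub>R z)) <= norm a * R' * B0"
    using B0(2) \<open>0 <= R'\<close> by (auto simp: norm_mult intro!: mult_mono)
   show "cmod (\<Sum>j\<in>UNIV. cor (z $ j) * partial_deriv j \<phi> (y - r *\<^sub>R z)) <= (\<Sum>j\<in>UNIV. \<bar>z $ j\<bar> * B1 j)"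
    by (intro sum_norm_le) (auto simp: norm_mult intro!: mult_left_mono B1)
  qed
  finally show ?thesis using True by (simp add: B_def)
 next
  case False
  have "norm y <= norm (y - r *\<^sub>R z) + norm (r *\<^sub>R z)"
   using norm_triangle_ineq[of "y - r *\<^sub>R z" "r *\<^sub>R z"] by simp
  moreover have "norm (r *\<^sub>R z) <= 2 * norm z"
   using r by (simp add: mult_right_mono)
  ultimately have far: "norm (y - r *\<^sub>R z) > R"
   using False by (simp add: R'_def)
  then have "\<phi> (y - r *\<^sub>R z) = 0" using R(2) by force
  moreover have "partial_deriv j \<phi> (y - r *\<^sub>R z) = 0" for j
   using partial_deriv_eq_0[OF \<phi> R(2) far] .
  ultimately show ?thesis using False by (simp add: dtwist_def)
 qed
 with B_pos that show ?thesis by blast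
qed

lemma vector_derivative_bound:
 fixes f :: "real => 'b::real_normed_vector"
 assumes "!!x. x \<in> closed_segment a b ==> (f has_vector_derivative f' x) (at x)"
  and "!!x. x \<in> closed_segment a b ==> norm (f' x) <= B"
 shows "norm (f b - f a) <= B * \<bar>b - a\<bar>"
proof -
 have "norm (f b - f a) <= B * norm (b - a)"
 proof (rule differentiable_bound[where S="closed_segment a b" and f'="%x h. h *\<^sub>R f' x"])
  show "(f has_derivative (%h. h *\<^sub>R f' x)) (at x within closed_segment a b)" if "x \<in> closed_segment a b" for x
   using assms(1)[OF that] unfolding has_vector_derivative_def by (rule has_derivative_at_withinI)
  show "onorm (%h. h *\<^sub>R f' x) <= B" if "x \<in> closed_segment a b" for x
  proof (rule onorm_bound)
   show "0 <= B" using assms(2)[OF that] norm_ge_zero order_trans by blast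
   show "norm (h *\<^sub>R f' x) <= B * norm h" for h
    using mult_left_mono[OF assms(2)[OF that], of "\<bar>h\<bar>"] by (simp add: mult.commute)
  qed
 qed auto
 then show ?thesis by simp
qed

text \<open>Differentiation under the integral sign. The mean value inequality bounds the remainder
  quotients \<open>q\<close> by a constant on a fixed ball, and this times |f| is
  integrable.\<close>

lemma twist_pairing_has_vector_derivative:
 fixes f :: "real^'n::finite => complex"
 assumes f: "f \<in> L2" and \<phi>: "test_function \<phi>" and r: "\<bar>r\<bar> <= 1"
 shows "((%r. \<integral>y. f y * twist a z \<phi> r y \<partial>lborel) has_vector_derivative (LBINT y. f y * dtwist a z \<phi> r y)) (at r)"
proof -
 have [measurable]: "f \<in> borel_measurable borel" using f L2_measurable by blast
 obtain B R where B: "B >= 0" "!!r y. \<bar>r\<bar> <= 2 ==> cmod (dtwist a z \<phi> r y) <= B * indicator (cball 0 R) y"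
  using dtwist_bound[OF \<phi>, where a=a and z=z] by blast
 have [measurable]: "twist a z \<phi> s \<in> borel_measurable borel" for s
  using test_function_measurable[OF test_function_twist[OF \<phi>]] by blast
 have twL: "twist a z \<phi> s \<in> L2" for s
  using test_function_L2[OF test_function_twist[OF \<phi>]] by blast
 have [measurable]: "dtwist a z \<phi> s \<in> borel_measurable borel" for s
 proof -
  have [measurable]: "\<phi> \<in> borel_measurable borel" "partial_deriv j \<phi> \<in> borel_measurable borel" for j
   using test_function_measurable \<phi> test_function_partial_deriv by blast+
  have [measurable]: "(%y. exp (\<i> * cor ((- s *\<^sub>R a) \<bullet> y))) \<in> borel_measurable borel"
   by (rule borel_measurable_continuous_onI[OF Ck_continuous[OF Ck_expi]])
  show ?thesis unfolding dtwist_def[abs_def] by measurable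
 qed
 have indL: "(%y. cor (indicator (cball 0 R) y)) \<in> L2"
  by (rule indicator_L2) auto
 have dtL: "dtwist a z \<phi> r \<in> L2"
  by (rule L2_dominated(1)[OF indL, where K=B]) (use B r in "auto split: split_indicator")
 define w where "w y = 2 * B * (cmod (f y) * cmod (cor (indicator (cball 0 R) y)))" for y
 have w: "integrable lborel w"
  unfolding w_def by (intro integrable_mult_right integrable_L2_cmod_mult f indL)
 define q where "q s y = (twist a z \<phi> (r + s) y - twist a z \<phi> r y - s *\<^sub>R dtwist a z \<phi> r y) /\<^sub>R \<bar>s\<bar>" for s y
 have [measurable]: "q s \<in> borel_measurable borel" for s
  unfolding q_def[abs_def] by measurable
 have norm_q: "norm (q s y) = norm (twist a z \<phi> (r + s) y - twist a z \<phi> r y - s *\<^sub>R dtwist a z \<phi> r y) / norm s" for s y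
  unfolding q_def by (simp add: divide_inverse mult.commute)
 have q_lim: "((%s. q s y) \<longlongrightarrow> 0) (at 0)" for y
 proof (rule tendsto_norm_zero_cancel)
  show "((%s. norm (q s y)) \<longlongrightarrow> 0) (at 0)"
   using twist_has_vector_derivative[OF \<phi>, of a z y r] unfolding has_vector_derivative_def has_derivative_at norm_q
   by simp
 qed
 have q_bound: "cmod (q s y) <= 2 * B * indicator (cball 0 R) y" if s: "s ~= 0" "\<bar>s\<bar> <= 1" for s y
 proof -
  let ?b = "B * indicator (cball 0 R) y"
  have b: "cmod (dtwist a z \<phi> x y) <= ?b" if "x \<in> closed_segment r (r + s)" for x
   using that s r B(2)[of x y] by (auto simp: closed_segment_eq_real_ivl split: if_splits)
  have "cmod (twist a z \<phi> (r + s) y - twist a z \<phi> r y) <= ?b * \<bar>s\<bar>"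
   using vector_derivative_bound[of r "r + s", OF twist_has_vector_derivative[OF \<phi>, of a z y] b] by simp
  moreover have "cmod (s *\<^sub>R dtwist a z \<phi> r y) <= ?b * \<bar>s\<bar>"
   using mult_left_mono[OF b[of r], of "\<bar>s\<bar>"] by (simp add: mult.commute)
  ultimately have "cmod (twist a z \<phi> (r + s) y - twist a z \<phi> r y - s *\<^sub>R dtwist a z \<phi> r y) <= 2 * ?b * \<bar>s\<bar>"
   using norm_triangle_ineq4[of "twist a z \<phi> (r + s) y - twist a z \<phi> r y" "s *\<^sub>R dtwist a z \<phi> r y"] by linarith
  then show ?thesis
   using s(1) by (simp add: norm_q pos_divide_le_eq mult_ac)
 qed
 have "((%s. \<integral>y. f y * q s y \<partial>lborel) \<longlongrightarrow> 0) (at 0)"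
  unfolding tendsto_at_iff_sequentially comp_def
 proof (intro allI impI)
  fix X :: "nat => real" assume X: "\<forall>i. X i \<in> UNIV - {0}" "X ----> 0"
  obtain N where N: "!!i. i >= N ==> \<bar>X i\<bar> < 1"
   using LIMSEQ_D[OF X(2), of 1] by auto
  have Xq: "(%i. q (X i) y) ----> 0" for y
   using q_lim[of y, unfolded tendsto_at_iff_sequentially] X by (auto simp: comp_def)
  have "(%i. \<integral>y. f y * q (X (i + N)) y \<partial>lborel) ----> (\<integral>y. (0::complex) \<partial>(lborel :: (real^'n) measure))"
  proof (rule integral_dominated_convergence[OF _ _ w])
   show "AE y in lborel. (%i. f y * q (X (i + N)) y) ----> 0"
    using tendsto_mult[OF tendsto_const LIMSEQ_ignore_initial_segment[OF Xq]] by auto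
   show "AE y in lborel. norm (f y * q (X (i + N)) y) <= w y" for i
   proof (rule AE_I2)
    fix y
    have "cmod (q (X (i + N)) y) <= 2 * B * indicator (cball 0 R) y"
     using X(1) N[of "i + N"] by (intro q_bound) auto
    then show "norm (f y * q (X (i + N)) y) <= w y"
     using mult_left_mono[of "cmod (q (X (i + N)) y)" "2 * B * indicator (cball 0 R) y" "cmod (f y)"]
     by (simp add: norm_mult w_def algebra_simps)
   qed
  qed auto
  then show "(%i. \<integral>y. f y * q (X i) y \<partial>lborel) ----> 0"
   by (simp add: LIMSEQ_offset)
 qed
 moreover have "(LBINT y. f y * q s y) = ((LBINT y. f y * twist a z \<phi> (r + s) y) - (LBINT y. f y * twist a z \<phi> r y) - s *\<^sub>R (LBINT y. f y * dtwist a z \<phi> r y)) /\<^sub>R \<bar>s\<bar>" for s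
 proof -
  have "f y * q s y = (f y * twist a z \<phi> (r + s) y - f y * twist a z \<phi> r y - s *\<^sub>R (f y * dtwist a z \<phi> r y)) /\<^sub>R \<bar>s\<bar>" for y
   by (simp add: q_def algebra_simps)
  then show ?thesis
   using integrable_L2_mult[OF f twL] integrable_L2_mult[OF f dtL] by simp
 qed
 ultimately have "((%s. ((LBINT y. f y * twist a z \<phi> (r + s) y) - (LBINT y. f y * twist a z \<phi> r y) - s *\<^sub>R (LBINT y. f y * dtwist a z \<phi> r y)) /\<^sub>R \<bar>s\<bar>) \<longlongrightarrow> 0) (at 0)"
  by simp
 then show ?thesis
  unfolding has_vector_derivative_def has_derivative_at
  using tendsto_norm_zero by (fastforce simp: bounded_linear_scaleR_left divide_inverse mult.commute)
qed

lemma twist_pairing_eq: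
 fixes f :: "real^'n::finite => complex"
 assumes f: "f \<in> L2" and \<phi>: "test_function \<phi>" and az: "a \<bullet> z = 0"
 shows "(LBINT y. f y * twist a z \<phi> r y) =
  (LBINT x. exp (\<i> * cor ((- r *\<^sub>R a) \<bullet> x)) * f (x + r *\<^sub>R z) * \<phi> x)"
proof -
 have [measurable]: "f \<in> borel_measurable borel" using f L2_measurable by blast
 have [measurable]: "twist a z \<phi> r \<in> borel_measurable borel"
  using test_function_measurable[OF test_function_twist[OF \<phi>]] by blast
 have "(LBINT y. f y * twist a z \<phi> r y) = (LBINT x. f (x + r *\<^sub>R z) * twist a z \<phi> r (x + r *\<^sub>R z))"
  by (rule preserves_lborel_integral[OF preserves_lborel_add, symmetric]) measurable
 also have "... = (LBINT x. exp (\<i> * cor ((- r *\<^sub>R a) \<bullet> x)) * f (x + r *\<^sub>R z) * \<phi> x)"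
  using az by (simp add: twist_def inner_add_right mult_ac)
 finally show ?thesis .
qed

lemma is_weak_partial_sum:
 fixes f :: "real^'n::finite => complex"
 assumes f: "f \<in> L2" and g: "!!j. g j \<in> L2" "!!j. is_weak_partial j f (g j)" and \<phi>: "test_function \<phi>"
 shows "(LBINT x. f x * (\<Sum>j\<in>UNIV. cor (z $ j) * partial_deriv j \<phi> x)) =
  - (LBINT x. (\<Sum>j\<in>UNIV. cor (z $ j) * g j x) * \<phi> x)"
proof -
 have i1: "integrable lborel (%x. f x * partial_deriv j \<phi> x)" for j
  by (intro integrable_L2_mult f test_function_L2 test_function_partial_deriv \<phi>)
 have i2: "integrable lborel (%x. g j x * \<phi> x)" for j
  by (intro integrable_L2_mult g test_function_L2 \<phi>)
 have "(LBINT x. f x * (\<Sum>j\<in>UNIV. cor (z $ j) * partial_deriv j \<phi> x)) =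
   (LBINT x. (\<Sum>j\<in>UNIV. cor (z $ j) * (f x * partial_deriv j \<phi> x)))"
  by (simp add: sum_distrib_left mult.left_commute)
 also have "... = (\<Sum>j\<in>UNIV. cor (z $ j) * - (LBINT x. g j x * \<phi> x))"
  using i1 g(2) \<phi> by (subst Bochner_Integration.integral_sum) (auto simp: is_weak_partial_def)
 also have "... = - (LBINT x. (\<Sum>j\<in>UNIV. cor (z $ j) * (g j x * \<phi> x)))"
  using i2 by (subst Bochner_Integration.integral_sum) (auto simp: sum_negf)
 finally show ?thesis
  by (simp add: sum_distrib_right mult.assoc)
qed

text \<open>The generator of the magnetic translations \<open>f \<mapsto> e\<^bsup>-ir a\<cdot>x\<^esup> f (x + r z)\<close> is
 \<open>z \<cdot> \<nabla> - i a \<cdot> x\<close>.\<close>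

lemma magnetic_translation_le:
 fixes f :: "real^'n::finite => complex"
 assumes f: "f \<in> L2" and g: "!!j. g j \<in> L2" "!!j. is_weak_partial j f (g j)" and az: "a \<bullet> z = 0"
  and h: "(%x. (\<Sum>j\<in>UNIV. cor (z $ j) * g j x) - \<i> * cor (a \<bullet> x) * f x) \<in> L2"
 shows "L2_norm (%x. exp (- \<i> * cor (a \<bullet> x)) * f (x + z) - f x) \<le>
  L2_norm (%x. (\<Sum>j\<in>UNIV. cor (z $ j) * g j x) - \<i> * cor (a \<bullet> x) * f x)"
  (is "_ <= L2_norm ?h")
proof (rule L2_norm_le_by_duality)
 have [measurable]: "f \<in> borel_measurable borel" using f L2_measurable by blast
 have [measurable]: "(%y. exp (- \<i> * cor (a \<bullet> y))) \<in> borel_measurable borel"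
  using borel_measurable_continuous_onI[OF Ck_continuous[OF Ck_expi[of 0 "- a"]]] by simp
 have shL: "(%x. f (x + z)) \<in> L2"
  by (rule preserves_lborel_L2[OF preserves_lborel_add f])
 have eL: "(%x. exp (- \<i> * cor (a \<bullet> x)) * f (x + z)) \<in> L2"
 proof (rule L2_dominated(1)[OF shL, where K=1])
  show "AE x in lborel. cmod (exp (- \<i> * cor (a \<bullet> x)) * f (x + z)) <= 1 * cmod (f (x + z))"
   using norm_exp_i_times[of "- (a \<bullet> x)" for x] by (simp add: norm_mult)
 qed simp_all
 then show "(%x. exp (- \<i> * cor (a \<bullet> x)) * f (x + z) - f x) \<in> L2"
  by (rule L2_diff[OF _ f])
 show "0 <= L2_norm ?h" by simp
 fix \<phi> :: "real^'n => complex" assume \<phi>: "test_function \<phi>"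
 let ?I = "%r. \<integral>y. f y * twist a z \<phi> r y \<partial>lborel"
 have der: "(LBINT y. f y * dtwist a z \<phi> r y) = (LBINT y. ?h y * twist a z \<phi> r y)" for r
 proof -
  note t = test_function_twist[OF \<phi>, of a z r]
  let ?p = "%y. \<i> * cor (a \<bullet> y) * f y"
  have sL: "(%x. \<Sum>j\<in>UNIV. cor (z $ j) * g j x) \<in> L2"
   by (intro L2_sum L2_cmult g)
  then have pL: "?p \<in> L2" using L2_diff[OF sL h] by simp
  have dL: "(%y. \<Sum>j\<in>UNIV. cor (z $ j) * partial_deriv j (twist a z \<phi> r) y) \<in> L2"
   by (intro L2_sum L2_cmult test_function_L2 test_function_partial_deriv t)
  have "(LBINT y. f y * dtwist a z \<phi> r y) = (LBINT y. - (?p y * twist a z \<phi> r y)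
    - f y * (\<Sum>j\<in>UNIV. cor (z $ j) * partial_deriv j (twist a z \<phi> r) y))"
   by (intro Bochner_Integration.integral_cong refl) (simp add: dtwist_eq[OF \<phi> az] algebra_simps)
  also have "... = - (LBINT y. ?p y * twist a z \<phi> r y)
   - (LBINT y. f y * (\<Sum>j\<in>UNIV. cor (z $ j) * partial_deriv j (twist a z \<phi> r) y))"
   using integrable_L2_mult[OF pL test_function_L2[OF t]] integrable_L2_mult[OF f dL]
   by (subst Bochner_Integration.integral_diff) simp_all
  also have "... = (LBINT x. (\<Sum>j\<in>UNIV. cor (z $ j) * g j x) * twist a z \<phi> r x) - (LBINT y. ?p y * twist a z \<phi> r y)"
   by (simp add: is_weak_partial_sum[OF f g t])
  also have "... = (LBINT y. ?h y * twist a z \<phi> r y)"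
   using integrable_L2_mult[OF sL test_function_L2[OF t]] integrable_L2_mult[OF pL test_function_L2[OF t]]
   by (simp add: left_diff_distrib)
  finally show ?thesis .
 qed
 have tw_norm: "L2_norm (twist a z \<phi> r) = L2_norm \<phi>" for r
 proof -
  have "L2_norm (twist a z \<phi> r) = L2_norm (%y. \<phi> (y - r *\<^sub>R z))"
   by (simp add: L2_norm_def cmod_twist)
  then show ?thesis
   using preserves_lborel_L2_norm[OF preserves_lborel_diff test_function_measurable[OF \<phi>]] by simp
 qed
 \<comment> \<open>The translation is joined to the identity by r in [0, 1]. At each r the
   derivative is the pairing of \<open>?h\<close> with a twisted \<phi> of the same norm, so the
   bound does not depend on r.\<close>
 have "cmod (?I 1 - ?I 0) <= (L2_norm ?h * L2_norm \<phi>) * \<bar>1 - 0\<bar>"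
 proof (rule vector_derivative_bound)
  fix x :: real assume "x \<in> closed_segment 0 1"
  then have "\<bar>x\<bar> <= 1" by (auto simp: closed_segment_eq_real_ivl)
  from twist_pairing_has_vector_derivative[OF f \<phi> this]
  show "(?I has_vector_derivative (LBINT y. f y * dtwist a z \<phi> x y)) (at x)" .
  show "cmod (LBINT y. f y * dtwist a z \<phi> x y) <= L2_norm ?h * L2_norm \<phi>"
   unfolding der using L2_Cauchy_Schwarz[OF h test_function_L2[OF test_function_twist[OF \<phi>, of a z x]]]
   by (simp add: tw_norm)
 qed
 moreover have "?I 1 - ?I 0 = (LBINT x. (exp (- \<i> * cor (a \<bullet> x)) * f (x + z) - f x) * \<phi> x)"
  using integrable_L2_mult[OF eL test_function_L2[OF \<phi>]] integrable_L2_mult[OF f test_function_L2[OF \<phi>]]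
  by (simp add: twist_pairing_eq[OF f \<phi> az] left_diff_distrib)
 ultimately show "cmod (LBINT x. (exp (- \<i> * cor (a \<bullet> x)) * f (x + z) - f x) * \<phi> x) <= L2_norm ?h * L2_norm \<phi>"
  by simp
qed

lemma translation_le:
 fixes f :: "real^'n::finite => complex"
 assumes "f \<in> L2" "!!j. g j \<in> L2" "!!j. is_weak_partial j f (g j)"
 shows "L2_norm (%x. f (x + z) - f x) <= L2_norm (%x. \<Sum>j\<in>UNIV. cor (z $ j) * g j x)"
proof -
 have "(%x. \<Sum>j\<in>UNIV. cor (z $ j) * g j x) \<in> L2"
  by (intro L2_sum L2_cmult assms)
 then show ?thesis
  using magnetic_translation_le[OF assms, of 0 z] by simp
qed

text \<open>The unimodular phase may be inserted before taking the modulus, so differences of |f|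
  are dominated by magnetic differences of f. This is the diamagnetic inequality in a form that
  never differentiates |f|.\<close>

lemma diamagnetic_translation_le:
 fixes f :: "real^'n::finite => complex"
 assumes f: "f \<in> L2" and g: "!!j. g j \<in> L2" "!!j. is_weak_partial j f (g j)" and az: "a \<bullet> z = 0"
  and h: "(%x. (\<Sum>j\<in>UNIV. cor (z $ j) * g j x) - \<i> * cor (a \<bullet> x) * f x) \<in> L2"
 shows "L2_norm (%x. cor (cmod (f (x + z))) - cor (cmod (f x))) \<le>
  L2_norm (%x. (\<Sum>j\<in>UNIV. cor (z $ j) * g j x) - \<i> * cor (a \<bullet> x) * f x)"
proof -
 have [measurable]: "f \<in> borel_measurable borel" using f L2_measurable by blast
 have [measurable]: "(%y. exp (- \<i> * cor (a \<bullet> y))) \<in> borel_measurable borel"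
  using borel_measurable_continuous_onI[OF Ck_continuous[OF Ck_expi[of 0 "- a"]]] by simp
 have n1: "cmod (exp (- \<i> * cor (a \<bullet> x))) = 1" for x
  using norm_exp_i_times[of "- (a \<bullet> x)"] by simp
 have shL: "(%x. f (x + z)) \<in> L2"
  by (rule preserves_lborel_L2[OF preserves_lborel_add f])
 have eL: "(%x. exp (- \<i> * cor (a \<bullet> x)) * f (x + z)) \<in> L2"
  by (rule L2_dominated(1)[OF shL, where K=1]) (simp_all add: norm_mult n1)
 have "L2_norm (%x. cor (cmod (f (x + z))) - cor (cmod (f x))) \<le>
   1 * L2_norm (%x. exp (- \<i> * cor (a \<bullet> x)) * f (x + z) - f x)"
 proof (rule L2_dominated(2)[OF L2_diff[OF eL f]])
  show "AE x in lborel. cmod (cor (cmod (f (x + z))) - cor (cmod (f x))) \<le>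
    1 * cmod (exp (- \<i> * cor (a \<bullet> x)) * f (x + z) - f x)"
  proof (rule AE_I2)
   fix x
   show "cmod (cor (cmod (f (x + z))) - cor (cmod (f x))) \<le>
    1 * cmod (exp (- \<i> * cor (a \<bullet> x)) * f (x + z) - f x)"
    using norm_triangle_ineq3[of "exp (- \<i> * cor (a \<bullet> x)) * f (x + z)" "f x"]
    by (simp add: norm_mult n1 del: of_real_diff add: of_real_diff[symmetric])
  qed
 qed simp_all
 with magnetic_translation_le[OF f g az h] show ?thesis by simp
qed

text \<open>Difference quotients bounded along a single null sequence of step sizes already bound
  the distributional derivative: the derivative of the pairing at r = 0 may be computed along that
  sequence.\<close>

lemma directional_derivative_le:
 fixes f :: "real^'n::finite => complex"
 assumes f: "f \<in> L2" and \<phi>: "test_function \<phi>"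
  and s: "!!k. 0 < s k" "s ----> (0::real)" "!!k. L2_norm (%x. f (x + s k *\<^sub>R z) - f x) <= K * s k"
 shows "cmod (LBINT x. f x * (\<Sum>j\<in>UNIV. cor (z $ j) * partial_deriv j \<phi> x)) <= K * L2_norm \<phi>"
proof -
 let ?I = "%r. \<integral>y. f y * twist 0 z \<phi> r y \<partial>lborel"
 let ?D = "LBINT y. f y * dtwist 0 z \<phi> 0 y"
 have shL: "(%x. f (x + w)) \<in> L2" for w
  by (rule preserves_lborel_L2[OF preserves_lborel_add f])
 have "(?I has_vector_derivative ?D) (at 0)"
  by (rule twist_pairing_has_vector_derivative[OF f \<phi>]) simp
 then have lim: "((%h. norm (?I h - ?I 0 - h *\<^sub>R ?D) / norm h) \<longlongrightarrow> 0) (at 0)"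
  unfolding has_vector_derivative_def has_derivative_at by simp
 have s0: "filterlim s (at 0) sequentially"
  using s(1,2) by (auto simp: filterlim_at less_imp_neq[THEN not_sym])
 have bound: "norm ?D <= K * L2_norm \<phi> + norm (?I (s k) - ?I 0 - s k *\<^sub>R ?D) / norm (s k)" for k
 proof -
  have "?I (s k) - ?I 0 = (LBINT x. (f (x + s k *\<^sub>R z) - f x) * \<phi> x)"
   using integrable_L2_mult[OF shL[of "s k *\<^sub>R z"] test_function_L2[OF \<phi>]] integrable_L2_mult[OF f test_function_L2[OF \<phi>]]
   by (simp add: twist_pairing_eq[OF f \<phi>] left_diff_distrib)
  then have "norm (?I (s k) - ?I 0) <= L2_norm (%x. f (x + s k *\<^sub>R z) - f x) * L2_norm \<phi>"
   using L2_Cauchy_Schwarz[OF L2_diff[OF shL f] test_function_L2[OF \<phi>], of "s k *\<^sub>R z"] by simp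
  also have "... <= (K * s k) * L2_norm \<phi>"
   by (intro mult_right_mono s) simp
  finally have 1: "norm (?I (s k) - ?I 0) <= s k * (K * L2_norm \<phi>)" by (simp add: mult_ac)
  have "s k * norm ?D = norm (s k *\<^sub>R ?D)" using s(1)[of k] by simp
  also have "... <= norm (?I (s k) - ?I 0) + norm (?I (s k) - ?I 0 - s k *\<^sub>R ?D)"
   using norm_triangle_ineq4[of "?I (s k) - ?I 0" "?I (s k) - ?I 0 - s k *\<^sub>R ?D"] by simp
  also have "... <= s k * (K * L2_norm \<phi>) + norm (?I (s k) - ?I 0 - s k *\<^sub>R ?D)" using 1 by simp
  finally show ?thesis
   using s(1)[of k] by (simp add: field_simps)
 qed
 have "norm ?D <= K * L2_norm \<phi> + 0"
  by (rule LIMSEQ_le_const[OF tendsto_add[OF tendsto_const filterlim_compose[OF lim s0]]]) (use bound in blast)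
 moreover have "?D = - (LBINT x. f x * (\<Sum>j\<in>UNIV. cor (z $ j) * partial_deriv j \<phi> x))"
  by (simp add: dtwist_def)
 ultimately show ?thesis by simp
qed

section \<open>A nonlocal Dirichlet form\<close>

lemma L2_shift: "f \<in> L2 ==> (%x. f (x + z)) \<in> L2"
 by (rule preserves_lborel_L2[OF preserves_lborel_add, where f=f])

lemma L2_norm_shift: "f \<in> L2 ==> L2_norm (%x. f (x + z)) = L2_norm f"
 by (rule preserves_lborel_L2_norm[OF preserves_lborel_add L2_measurable, where f=f])

section \<open>Weak derivatives and the Dirichlet integral\<close>

lemma weak_partial_unique:
 fixes f :: "real^'n::finite => complex"
 assumes "g \<in> L2" "is_weak_partial j f g" "h \<in> L2" "is_weak_partial j f h"
 shows "AE x in lborel. g x = h x"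
proof -
 have "AE x in lborel. g x - h x = 0"
 proof (rule test_annihilator[OF L2_diff[OF assms(1,3)]])
  fix \<phi> :: "real^'n => complex" assume \<phi>: "test_function \<phi>"
  have "(LBINT x. g x * \<phi> x) = (LBINT x. h x * \<phi> x)"
   using assms(2)[unfolded is_weak_partial_def, rule_format, OF \<phi>] assms(4)[unfolded is_weak_partial_def, rule_format, OF \<phi>]
   by simp
  then show "(LBINT x. (g x - h x) * \<phi> x) = 0"
   using integrable_L2_mult[OF assms(1) test_function_L2[OF \<phi>]] integrable_L2_mult[OF assms(3) test_function_L2[OF \<phi>]]
   by (simp add: left_diff_distrib)
 qed
 then show ?thesis by simp
qed

lemma H1_L2: "f \<in> H1 ==> f \<in> L2"
 by (simp add: H1_def)

lemma H1_weak_partial: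
 assumes "f \<in> H1"
 shows "weak_partial j f \<in> L2" "is_weak_partial j f (weak_partial j f)"
proof -
 have "\<exists>g. g \<in> L2 \<and> is_weak_partial j f g"
  using assms by (auto simp: H1_def)
 then have "weak_partial j f \<in> L2 \<and> is_weak_partial j f (weak_partial j f)"
  unfolding weak_partial_def by (rule someI_ex)
 then show "weak_partial j f \<in> L2" "is_weak_partial j f (weak_partial j f)" by auto
qed

lemma H1I:
 assumes "f \<in> L2" "!!j. g j \<in> L2" "!!j. is_weak_partial j f (g j)"
 shows "f \<in> H1"
 using assms by (auto simp: H1_def)

lemma weak_partial_AE:
 assumes "f \<in> L2" "g \<in> L2" "is_weak_partial j f g"
 shows "AE x in lborel. weak_partial j f x = g x" "weak_partial j f \<in> L2"
proof -
 have "\<exists>g. g \<in> L2 \<and> is_weak_partial j f g"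
  using assms by auto
 then have *: "weak_partial j f \<in> L2 \<and> is_weak_partial j f (weak_partial j f)"
  unfolding weak_partial_def by (rule someI_ex)
 then show "AE x in lborel. weak_partial j f x = g x"
  using weak_partial_unique assms by blast
 show "weak_partial j f \<in> L2" using * by blast
qed

lemma is_weak_partial_lincomb:
 fixes f :: "real^'n::finite => complex"
 assumes "f \<in> L2" "g \<in> L2" "f' \<in> L2" "g' \<in> L2" "is_weak_partial j f f'" "is_weak_partial j g g'"
 shows "is_weak_partial j (%x. a * f x + b * g x) (%x. a * f' x + b * g' x)"
 unfolding is_weak_partial_def
proof (intro allI impI)
 fix \<phi> :: "real^'n => complex" assume \<phi>: "test_function \<phi>"
 note d = test_function_L2[OF test_function_partial_deriv[OF \<phi>, of j]]
 have "(LBINT x. (a * f x + b * g x) * partial_deriv j \<phi> x) =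
   a * (LBINT x. f x * partial_deriv j \<phi> x) + b * (LBINT x. g x * partial_deriv j \<phi> x)"
  using integrable_L2_mult[OF assms(1) d] integrable_L2_mult[OF assms(2) d]
  by (simp add: distrib_right mult.assoc)
 moreover have "(LBINT x. (a * f' x + b * g' x) * \<phi> x) =
   a * (LBINT x. f' x * \<phi> x) + b * (LBINT x. g' x * \<phi> x)"
  using integrable_L2_mult[OF assms(3) test_function_L2[OF \<phi>]] integrable_L2_mult[OF assms(4) test_function_L2[OF \<phi>]]
  by (simp add: distrib_right mult.assoc)
 ultimately show "(LBINT x. (a * f x + b * g x) * partial_deriv j \<phi> x) = - (LBINT x. (a * f' x + b * g' x) * \<phi> x)"
  using assms(5,6) \<phi> by (simp add: is_weak_partial_def)
qed

lemma H1_lincomb: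
 fixes f :: "real^'n::finite => complex"
 assumes "f \<in> H1" "g \<in> H1"
 shows "(%x. a * f x + b * g x) \<in> H1"
  and "AE x in lborel. weak_partial j (%x. a * f x + b * g x) x = a * weak_partial j f x + b * weak_partial j g x"
proof -
 note w = is_weak_partial_lincomb[OF H1_L2[OF assms(1)] H1_L2[OF assms(2)] H1_weak_partial(1)[OF assms(1)]
   H1_weak_partial(1)[OF assms(2)] H1_weak_partial(2)[OF assms(1)] H1_weak_partial(2)[OF assms(2)]]
 have L: "(%x. a * f x + b * g x) \<in> L2" "(%x. a * weak_partial i f x + b * weak_partial i g x) \<in> L2" for i
  by (intro L2_add L2_cmult H1_L2 H1_weak_partial assms)+
 show "(%x. a * f x + b * g x) \<in> H1"
  by (rule H1I[OF L w])
 show "AE x in lborel. weak_partial j (%x. a * f x + b * g x) x = a * weak_partial j f x + b * weak_partial j g x"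
  by (rule weak_partial_AE(1)[OF L w])
qed

definition dirichlet :: "(real^'n::finite => complex) => real" where
 "dirichlet f = (LBINT x. (norm (weak_grad f x))^2)"

lemma norm_vec_sq: "(norm (v :: complex^'n::finite))^2 = (\<Sum>j\<in>UNIV. (cmod (v $ j))^2)"
 unfolding norm_vec_def L2_set_def by (simp add: sum_nonneg)

lemma dirichlet_eq:
 assumes "f \<in> H1"
 shows "dirichlet f = (\<Sum>j\<in>UNIV. (L2_norm (weak_partial j f))^2)"
 unfolding dirichlet_def norm_vec_sq weak_grad_def L2_norm_sq
 using L2_integrable[OF H1_weak_partial(1)[OF assms]] by simp

lemma dirichlet_nonneg: "0 <= dirichlet f"
 unfolding dirichlet_def by (rule integral_nonneg_AE) simp

lemma dirichlet_eqI:
 assumes "f \<in> L2" "!!j. g j \<in> L2" "!!j. is_weak_partial j f (g j)"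
 shows "dirichlet f = (\<Sum>j\<in>UNIV. (L2_norm (g j))^2)"
proof -
 have "L2_norm (weak_partial j f) = L2_norm (g j)" for j
 proof (rule L2_norm_cong_AE)
  show "AE x in lborel. cmod (weak_partial j f x) = cmod (g j x)"
   using weak_partial_AE(1)[OF assms(1) assms(2,3)[of j]] by eventually_elim simp
 qed (intro L2_measurable weak_partial_AE(2)[OF assms(1) assms(2,3)[of j]] assms(2))+
 then show ?thesis
  by (simp add: dirichlet_eq[OF H1I[OF assms]])
qed

section \<open>Translation differences and their averages\<close>

definition shift_dist :: "(real^'n::finite => complex) => real^'n => real" where
 "shift_dist f z = L2_norm (%x. f (x + z) - f x)"

lemma shift_dist_nonneg: "0 <= shift_dist f z"
 by (simp add: shift_dist_def)

lemma shift_dist_add: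
 assumes "f \<in> L2"
 shows "shift_dist f (y + z) <= shift_dist f y + shift_dist f z"
proof -
 have "L2_norm (%x. f (x + (y + z)) - f x) <= L2_norm (%x. f (x + (y + z)) - f (x + y)) + L2_norm (%x. f (x + y) - f x)"
  by (rule L2_triangle3[OF L2_shift[OF assms] L2_shift[OF assms] assms])
 moreover have "L2_norm (%x. f (x + (y + z)) - f (x + y)) = L2_norm (%x. f (x + z) - f x)"
  using L2_norm_shift[OF L2_diff[OF L2_shift[OF assms, of z] assms], of y] by (simp add: add_ac)
 ultimately show ?thesis by (simp add: shift_dist_def)
qed

lemma shift_dist_nn:
 assumes "f \<in> L2"
 shows "ennreal ((shift_dist f z)^2) = (NN x. ennreal ((cmod (f (x + z) - f x))^2))"
 unfolding shift_dist_def by (rule nn_integral_L2[OF L2_diff[OF L2_shift[OF assms] assms], symmetric])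

lemma shift_dist_measurable [measurable]:
 fixes f :: "real^'n::finite => complex"
 assumes "f \<in> L2"
 shows "(%w. ennreal ((shift_dist f (e *\<^sub>R w))^2)) \<in> borel_measurable borel"
proof -
 have [measurable]: "f \<in> borel_measurable borel" using assms L2_measurable by blast
 have "(%w. \<integral>\<^sup>+x. ennreal ((cmod (f (x + e *\<^sub>R w) - f x))^2) \<partial>lborel) \<in> borel_measurable lborel"
  by (rule lborel.borel_measurable_nn_integral) measurable
 then show ?thesis by (simp add: shift_dist_nn[OF assms])
qed

text \<open>Comparable with the Dirichlet integral from both sides, and, unlike the weak gradient, visibly
 nonincreasing under \<open>f \<mapsto> |f|\<close> and under polarization.\<close>

definition nonlocal_form :: "real => (real^'n::finite => complex) => ennreal" where
 "nonlocal_form e f = (NN w. indicator (ball 0 1) w * (ennreal ((shift_dist f (e *\<^sub>R w))^2) * ennreal (1 / e^2)))"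

text \<open>The factor between the integral of |w . g|^2 over the unit ball and |g|^2. Its value is
  the same for all j; the index serves to name the dimension.\<close>

definition ball_moment :: "'n::finite => real" where
 "ball_moment j = (LBINT w. indicator (ball 0 1) w * ((w :: real^'n) $ j)^2)"

text \<open>Signed permutations of the coordinates: the symmetries of the ball that make its matrix
  of second moments a multiple of the identity.\<close>

lemma preserves_lborel_coord_linear:
 fixes T :: "real^'n::finite => real^'n"
 assumes "!!w i. T w $ i = s i * w $ p i" "!!i. s i * s i = 1" "bij p"
 shows "preserves_lborel T" "norm (T w) = norm w"
proof -
 have s1: "\<bar>s i\<bar> = 1" for i
  using assms(2)[of i] by (metis abs_1 abs_mult abs_mult_self_eq power2_eq_1_iff power2_eq_square abs_minus)
 show iso: "norm (T w) = norm w" for w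
 proof -
  have "(norm (T w))^2 = (\<Sum>i\<in>UNIV. (w $ p i)^2)"
   unfolding norm_vec_def L2_set_def using s1 by (simp add: sum_nonneg assms(1) abs_mult)
  also have "... = (\<Sum>i\<in>UNIV. (w $ i)^2)"
   by (rule sum.reindex_bij_betw[OF assms(3)])
  also have "... = (norm w)^2"
   unfolding norm_vec_def L2_set_def by (simp add: sum_nonneg)
  finally show ?thesis by simp
 qed
 have lin: "linear T"
  by (rule linearI) (auto simp: vec_eq_iff assms(1) algebra_simps)
 show "preserves_lborel T"
 proof (rule preserves_lborel_isometry[OF lin iso])
  fix x
  show "T (\<chi> i. s (inv p i) * x $ inv p i) = x"
  proof (subst vec_eq_iff, intro allI)
   fix i
   have "T (\<chi> i. s (inv p i) * x $ inv p i) $ i = (s i * s i) * x $ i"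
    using assms(3) by (simp add: assms(1) bij_is_inj)
   then show "T (\<chi> i. s (inv p i) * x $ inv p i) $ i = x $ i" by (simp add: assms(2))
  qed
 qed
qed

lemma ball_sets_borel [measurable]: "ball a r \<in> sets borel"
 by simp

lemma vec_nth_borel_measurable [measurable]: "(%x::real^'n::finite. x $ i) \<in> borel_measurable borel"
 by (rule borel_measurable_continuous_onI) (intro continuous_intros)

lemma integrable_ball_mult:
 fixes f :: "real^'n::finite => real"
 assumes [measurable]: "f \<in> borel_measurable borel" and "!!w. norm w < 1 ==> \<bar>f w\<bar> <= B"
 shows "integrable lborel (%w. indicator (ball 0 1) w * f w)"
proof (rule Bochner_Integration.integrable_bound)
 show "integrable lborel (%w::real^'n. B * indicator (ball 0 1) w)"
  by (intro integrable_mult_right integrable_real_indicator emeasure_bounded_finite) auto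
 show "AE w in lborel. norm (indicator (ball 0 1) w * f w) <= norm (B * indicator (ball 0 1) w)"
  using assms(2) by (intro AE_I2) (force split: split_indicator simp: abs_le_iff)
 show "(%w. indicator (ball 0 1) w * f w) \<in> borel_measurable lborel"
  by measurable
qed

lemma ball_coord_bound: "norm (w::real^'n::finite) < 1 ==> \<bar>w $ i * w $ j\<bar> <= 1"
 unfolding abs_mult using component_le_norm_cart[of w i] component_le_norm_cart[of w j] by (intro mult_le_one) auto

lemma integrable_ball_coord: "integrable lborel (%w::real^'n::finite. indicator (ball 0 1) w * (w $ i * w $ j))"
 by (rule integrable_ball_mult[where B=1], measurable) (rule ball_coord_bound)

lemma ball_moment_off_diagonal:
 assumes "i ~= j"
 shows "(LBINT w. indicator (ball 0 1) w * ((w::real^'n::finite) $ i * w $ j)) = 0"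
proof -
 define T where "T w = (\<chi> k. (if k = i then -1 else 1) * (w::real^'n) $ k)" for w
 have T: "preserves_lborel T" "!!w. norm (T w) = norm w"
  by (rule preserves_lborel_coord_linear[where p=id and s="%k. if k = i then -1 else 1"]; simp add: T_def)+
 have "(LBINT w. indicator (ball 0 1) w * ((w::real^'n) $ i * w $ j)) =
   (LBINT w. indicator (ball 0 1) (T w) * ((T w) $ i * (T w) $ j))"
  by (rule preserves_lborel_integral[OF T(1), symmetric]) measurable
 also have "... = (LBINT w. - (indicator (ball 0 1) w * ((w::real^'n) $ i * w $ j)))"
 proof (rule Bochner_Integration.integral_cong[OF refl])
  fix w
  have "indicator (ball 0 1) (T w) = (indicator (ball 0 1) w :: real)"
   using T(2)[of w] by (auto split: split_indicator)
  then show "indicator (ball 0 1) (T w) * ((T w) $ i * (T w) $ j) = - (indicator (ball 0 1) w * (w $ i * w $ j) :: real)"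
   using assms by (simp add: T_def)
 qed
 finally show ?thesis by simp
qed

lemma ball_moment_eq: "ball_moment (i :: 'n) = ball_moment (j :: 'n::finite)"
proof -
 define p where "p k = (if k = i then j else if k = j then i else k)" for k
 have "p (p k) = k" for k by (auto simp: p_def)
 then have p: "bij p" by (intro o_bij[of p]) auto
 define T where "T w = (\<chi> k. (w::real^'n) $ p k)" for w
 have T: "preserves_lborel T" "!!w. norm (T w) = norm w"
  by (rule preserves_lborel_coord_linear[where p=p and s="%k. 1"]; simp add: T_def p)+
 have "ball_moment i = (LBINT w. indicator (ball 0 1) (T w) * ((T w) $ i)^2)"
  unfolding ball_moment_def by (rule preserves_lborel_integral[OF T(1), symmetric]) measurable
 also have "... = ball_moment j"
  unfolding ball_moment_def
 proof (rule Bochner_Integration.integral_cong[OF refl])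
  fix w
  have "indicator (ball 0 1) (T w) = (indicator (ball 0 1) w :: real)"
   using T(2)[of w] by (auto split: split_indicator)
  then show "indicator (ball 0 1) (T w) * (T w $ i)^2 = (indicator (ball 0 1) w * (w $ j)^2 :: real)"
   by (simp add: T_def p_def)
 qed
 finally show ?thesis .
qed

lemma ball_moment_pos: "ball_moment (j :: 'n::finite) > 0"
proof -
 have nn: "ball_moment i >= 0" for i :: 'n
  unfolding ball_moment_def by (rule integral_nonneg_AE) auto
 have int: "integrable lborel (%w::real^'n. indicator (ball 0 1) w * (w $ i)^2)" for i
  using integrable_ball_coord[of i i] by (simp add: power2_eq_square)
 have "ball_moment j ~= 0"
 proof
  assume "ball_moment j = 0"
  then have "ball_moment i = 0" for i :: 'n using ball_moment_eq[of i j] by simp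
  then have "AE w in lborel. indicator (ball 0 1) (w::real^'n) * (w $ i)^2 = 0" for i
   unfolding ball_moment_def by (subst (asm) integral_nonneg_eq_0_iff_AE[OF int]) auto
  then have "AE w in lborel. \<forall>i. indicator (ball 0 1) (w::real^'n) * (w $ i)^2 = 0"
   unfolding AE_all_countable by blast
  moreover have "AE w in lborel. w ~= (0::real^'n)"
   by (rule AE_lborel_singleton)
  ultimately have "AE w in lborel. w \<notin> ball (0::real^'n) 1"
  proof eventually_elim
   case (elim w)
   then obtain i where "w $ i ~= 0" by (auto simp: vec_eq_iff)
   with elim(1) show ?case by (auto split: split_indicator_asm)
  qed
  then have "emeasure lborel (ball (0::real^'n) 1) = 0"
   by (subst (asm) AE_iff_measurable[where N="ball 0 1"]) auto
  then show False
   using unit_ball_vol_pos[of "real DIM(real^'n)"] by (simp add: emeasure_ball order_less_imp_not_eq2 del: unit_ball_vol_pos)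
 qed
 with nn[of j] show ?thesis by simp
qed

lemma L2_norm_combination_sq:
 fixes g :: "'n::finite => real^'m::finite => complex"
 assumes g: "!!j. g j \<in> L2"
 shows "(L2_norm (%x. \<Sum>j\<in>UNIV. cor (w $ j) * g j x))^2 =
  (\<Sum>i\<in>UNIV. \<Sum>j\<in>UNIV. w $ i * w $ j * Re (LBINT x. g i x * cnj (g j x)))"
proof -
 have int: "integrable lborel (%x. g i x * cnj (g j x))" for i j
  by (intro integrable_L2_mult L2_cnj g)
 have "(cmod (\<Sum>j\<in>UNIV. cor (w $ j) * g j x))^2 =
   (\<Sum>i\<in>UNIV. \<Sum>j\<in>UNIV. w $ i * w $ j * Re (g i x * cnj (g j x)))" for x
 proof -
  let ?s = "\<Sum>j\<in>UNIV. cor (w $ j) * g j x"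
  have "cor ((cmod ?s)^2) = ?s * cnj ?s"
   by (rule complex_norm_square)
  also have "... = (\<Sum>i\<in>UNIV. \<Sum>j\<in>UNIV. cor (w $ i * w $ j) * (g i x * cnj (g j x)))"
   by (simp add: sum_product mult_ac)
  finally have "Re (cor ((cmod ?s)^2)) = Re (\<Sum>i\<in>UNIV. \<Sum>j\<in>UNIV. cor (w $ i * w $ j) * (g i x * cnj (g j x)))"
   by simp
  then have "(cmod ?s)^2 = Re (\<Sum>i\<in>UNIV. \<Sum>j\<in>UNIV. cor (w $ i * w $ j) * (g i x * cnj (g j x)))"
   unfolding Re_complex_of_real .
  then show ?thesis by simp
 qed
 then show ?thesis
  unfolding L2_norm_sq using int by (simp del: times_complex.sel)
qed

text \<open>Isotropy of the ball: in the expanded square the mixed moments vanish by reflecting one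
  coordinate, and the diagonal ones agree by exchanging two coordinates.\<close>

lemma nn_integral_ball_combination:
 fixes g :: "'n::finite => real^'n => complex"
 assumes g: "!!j. g j \<in> L2"
 shows "(NN w. indicator (ball 0 1) w * ennreal ((L2_norm (%x. \<Sum>j\<in>UNIV. cor (w $ j) * g j x))^2))
  = ennreal (ball_moment (k::'n) * (\<Sum>j\<in>UNIV. (L2_norm (g j))^2))"
proof -
 define R where "R i j = Re (LBINT x. g i x * cnj (g j x))" for i j
 have Rii: "R i i = (L2_norm (g i))^2" for i
 proof -
  have "g i x * cnj (g i x) = cor ((cmod (g i x))^2)" for x
   by (rule complex_norm_square[symmetric])
  then show ?thesis by (simp add: R_def L2_norm_sq del: of_real_power)
 qed
 let ?q = "%w. \<Sum>i\<in>UNIV. \<Sum>j\<in>UNIV. R i j * (indicator (ball 0 1) w * (w $ i * w $ j)) :: real"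
 have q: "?q w = indicator (ball 0 1) w * (L2_norm (%x. \<Sum>j\<in>UNIV. cor (w $ j) * g j x))^2" for w
  unfolding L2_norm_combination_sq[OF g] R_def by (simp add: sum_distrib_left mult_ac)
 have int: "integrable lborel ?q"
  by (intro Bochner_Integration.integrable_sum integrable_mult_right integrable_ball_coord)
 have "(NN w. indicator (ball 0 1) w * ennreal ((L2_norm (%x. \<Sum>j\<in>UNIV. cor (w $ j) * g j x))^2))
   = (NN w. ennreal (?q w))"
  unfolding q by (intro nn_integral_cong) (auto split: split_indicator)
 also have "... = ennreal (LBINT w. ?q w)"
  by (rule nn_integral_eq_integral[OF int]) (simp add: q)
 also have "(LBINT w. ?q w) = (\<Sum>i\<in>UNIV. \<Sum>j\<in>UNIV. R i j * (LBINT w. indicator (ball 0 1) w * ((w::real^'n) $ i * w $ j)))"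
  by (simp add: Bochner_Integration.integral_sum Bochner_Integration.integrable_sum integrable_ball_coord)
 also have "... = (\<Sum>i\<in>UNIV. \<Sum>j\<in>UNIV. if j = i then R i i * ball_moment k else 0)"
 proof (intro sum.cong refl)
  fix i j :: 'n
  show "R i j * (LBINT w. indicator (ball 0 1) w * ((w::real^'n) $ i * w $ j)) = (if j = i then R i i * ball_moment k else 0)"
   using ball_moment_off_diagonal[of i j] ball_moment_eq[of i k]
   by (cases "i = j") (simp_all add: ball_moment_def power2_eq_square)
 qed
 also have "... = ball_moment k * (\<Sum>j\<in>UNIV. (L2_norm (g j))^2)"
  by (simp add: Rii sum_distrib_left mult.commute)
 finally show ?thesis .
qed

lemma L2_norm_combination_le:
 fixes g :: "'n::finite => real^'m::finite => complex"
 assumes g: "!!j. g j \<in> L2"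
 shows "L2_norm (%x. \<Sum>j\<in>UNIV. cor (w $ j) * g j x) <= sqrt (\<Sum>j\<in>UNIV. (L2_norm (g j))^2) * norm w"
proof -
 have tri: "L2_norm (%x. \<Sum>j\<in>I. cor (w $ j) * g j x) <= (\<Sum>j\<in>I. \<bar>w $ j\<bar> * L2_norm (g j))" for I
 proof (induction I rule: infinite_finite_induct)
  case (insert j I)
  have "L2_norm (%x. \<Sum>j\<in>insert j I. cor (w $ j) * g j x) \<le>
    L2_norm (%x. cor (w $ j) * g j x) + L2_norm (%x. \<Sum>j\<in>I. cor (w $ j) * g j x)"
   using L2_triangle[OF L2_cmult[OF g] L2_sum[OF L2_cmult[OF g]]] insert(1,2) by simp
  then show ?case using insert by (simp add: L2_norm_cmult)
 qed auto
 have "(\<Sum>j\<in>UNIV. \<bar>w $ j\<bar> * L2_norm (g j)) = (\<chi> j. \<bar>w $ j\<bar>) \<bullet> (\<chi> j. L2_norm (g j))"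
  by (simp add: inner_vec_def)
 also have "... <= norm (\<chi> j. \<bar>w $ j\<bar>) * norm (\<chi> j. L2_norm (g j))"
  by (rule norm_cauchy_schwarz)
 also have "... = norm w * sqrt (\<Sum>j\<in>UNIV. (L2_norm (g j))^2)"
  by (simp add: norm_vec_def L2_set_def)
 finally show ?thesis using tri[of UNIV] by (simp add: mult.commute)
qed

text \<open>The field h need not be the gradient of f. With h the weak gradient this bounds the form
  by the Dirichlet integral; with h the magnetic gradient of some u and f = |u| it becomes the
  diamagnetic inequality.\<close>

lemma nonlocal_form_le:
 fixes f :: "real^'n::finite => complex" and h :: "'n => real^'n => complex"
 assumes f: "f \<in> L2" and h: "!!j. h j \<in> L2" and e: "e > 0"
  and le: "!!z. shift_dist f z <= L2_norm (%x. \<Sum>j\<in>UNIV. cor (z $ j) * h j x)"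
 shows "nonlocal_form e f <= ennreal (ball_moment (k::'n) * (\<Sum>j\<in>UNIV. (L2_norm (h j))^2))"
proof -
 have "(shift_dist f (e *\<^sub>R w))^2 * (1 / e^2) <= (L2_norm (%x. \<Sum>j\<in>UNIV. cor (w $ j) * h j x))^2" for w
 proof -
  have "shift_dist f (e *\<^sub>R w) <= L2_norm (%x. cor e * (\<Sum>j\<in>UNIV. cor (w $ j) * h j x))"
   using le[of "e *\<^sub>R w"] by (simp add: sum_distrib_left mult.assoc)
  also have "... = e * L2_norm (%x. \<Sum>j\<in>UNIV. cor (w $ j) * h j x)"
   using e by (simp add: L2_norm_cmult)
  finally have "(shift_dist f (e *\<^sub>R w))^2 <= (e * L2_norm (%x. \<Sum>j\<in>UNIV. cor (w $ j) * h j x))^2"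
   using shift_dist_nonneg by (rule power_mono)
  then show ?thesis using e by (simp add: power_mult_distrib pos_divide_le_eq mult.commute)
 qed
 then have "nonlocal_form e f <= (NN w. indicator (ball 0 1) w * ennreal ((L2_norm (%x. \<Sum>j\<in>UNIV. cor (w $ j) * h j x))^2))"
  unfolding nonlocal_form_def by (intro nn_integral_mono mult_left_mono) (auto simp: ennreal_mult[symmetric] intro!: ennreal_leI)
 then show ?thesis unfolding nn_integral_ball_combination[OF h, where k=k] .
qed

lemma nonlocal_form_le_dirichlet:
 fixes f :: "real^'n::finite => complex"
 assumes "f \<in> H1" "e > 0"
 shows "nonlocal_form e f <= ennreal (ball_moment (k::'n) * dirichlet f)"
 unfolding dirichlet_eq[OF assms(1)]
 by (rule nonlocal_form_le[OF H1_L2[OF assms(1)] H1_weak_partial(1)[OF assms(1)] assms(2)])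
  (use translation_le[OF H1_L2 H1_weak_partial] assms(1) in "auto simp: shift_dist_def")

lemma H1_shift_dist_le:
 assumes "f \<in> H1"
 shows "shift_dist f z <= sqrt (dirichlet f) * norm z"
 unfolding dirichlet_eq[OF assms] shift_dist_def
 by (rule order_trans[OF translation_le[OF H1_L2[OF assms] H1_weak_partial[OF assms]] L2_norm_combination_le[OF H1_weak_partial(1)[OF assms]]])

lemma shift_dist_double:
 assumes "f \<in> L2"
 shows "shift_dist f (2 *\<^sub>R z) <= 2 * shift_dist f z"
 using shift_dist_add[OF assms, of z z] by (simp add: scaleR_2)

text \<open>Subadditivity of \<open>shift_dist\<close> makes the quotients \<open>q\<close>
  nondecreasing along e = 2^-m, so monotone convergence applies to their averages. Their supremum
  dominates the norm of the directional derivative in the direction w, and averaging over w restores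
  the Dirichlet integral with no loss in the constant.\<close>

lemma dirichlet_le_nonlocal_form:
 fixes f :: "real^'n::finite => complex"
 assumes f: "f \<in> H1" and K: "0 <= K"
  and le: "!!e. e > 0 ==> nonlocal_form e f <= ennreal (ball_moment (k::'n) * K)"
 shows "dirichlet f <= K"
proof -
 note fL = H1_L2[OF f]
 define e where "e m = (1/2::real)^m" for m :: nat
 have e0: "e m > 0" "e (Suc m) = e m / 2" for m by (simp_all add: e_def)
 define M where "M w = L2_norm (%x. \<Sum>j\<in>UNIV. cor (w $ j) * weak_partial j f x)" for w :: "real^'n"
 define q where "q m w = shift_dist f (e m *\<^sub>R w) / e m" for m w
 have q_nonneg: "0 <= q m w" for m w using e0 by (simp add: q_def shift_dist_nonneg less_imp_le)
 have q_Suc: "q m w <= q (Suc m) w" for m w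
 proof -
  have em: "e m = 2 * e (Suc m)" using e0(2)[of m] by simp
  then have eq: "e m *\<^sub>R w = 2 *\<^sub>R (e (Suc m) *\<^sub>R w)" by simp
  have "shift_dist f (e m *\<^sub>R w) <= 2 * shift_dist f (e (Suc m) *\<^sub>R w)"
   unfolding eq by (rule shift_dist_double[OF fL])
  then have "q m w <= (2 * shift_dist f (e (Suc m) *\<^sub>R w)) / e m"
   unfolding q_def using e0(1)[of m] by (intro divide_right_mono) auto
  also have "... = q (Suc m) w"
   unfolding q_def em by simp
  finally show ?thesis .
 qed
 have q_inc: "incseq (%m. q m w)" for w by (rule incseq_SucI) (rule q_Suc)
 have M_le: "M w <= K'" if K': "!!m. q m w <= K'" for w K'
 proof -
  have K0: "0 <= K'" using q_nonneg[of 0 w] K'[of 0] by simp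
  have "L2_norm (%x. \<Sum>j\<in>UNIV. cor (w $ j) * weak_partial j f x) <= K'"
  proof (rule L2_norm_le_by_duality[OF L2_sum[OF L2_cmult[OF H1_weak_partial(1)[OF f]]] _ K0])
   fix \<phi> :: "real^'n => complex" assume \<phi>: "test_function \<phi>"
   have "cmod (LBINT x. f x * (\<Sum>j\<in>UNIV. cor (w $ j) * partial_deriv j \<phi> x)) <= K' * L2_norm \<phi>"
   proof (rule directional_derivative_le[OF fL \<phi>, where s=e])
    show "e ----> 0" unfolding e_def by (rule LIMSEQ_power_zero) simp
    show "L2_norm (%x. f (x + e m *\<^sub>R w) - f x) <= K' * e m" for m
     using K'[of m] e0[of m] by (simp add: q_def shift_dist_def pos_divide_le_eq)
   qed (rule e0)
   then show "cmod (LBINT x. (\<Sum>j\<in>UNIV. cor (w $ j) * weak_partial j f x) * \<phi> x) <= K' * L2_norm \<phi>"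
    by (simp add: is_weak_partial_sum[OF fL H1_weak_partial[OF f] \<phi>])
  qed
  then show ?thesis by (simp add: M_def)
 qed
 \<comment> \<open>The real supremum is meaningful only for bounded quotients; otherwise some
   quotient already exceeds \<open>M w\<close>.\<close>
 have M_SUP: "ennreal ((M w)^2) <= (SUP m. ennreal ((q m w)^2))" for w
 proof (cases "bdd_above (range (%m. q m w))")
  case True
  have "q m w <= (SUP m. q m w)" for m by (rule cSUP_upper[OF _ True]) simp
  then have "M w <= (SUP m. q m w)" by (rule M_le)
  moreover have "0 <= M w" by (simp add: M_def)
  ultimately have "(M w)^2 <= (SUP m. q m w)^2" by (intro power_mono)
  then have 1: "ennreal ((M w)^2) <= ennreal ((SUP m. q m w)^2)" by (rule ennreal_leI)
  have "(%m. q m w) ----> (SUP m. q m w)"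
   by (rule LIMSEQ_incseq_SUP[OF True q_inc])
  then have "(%m. ennreal ((q m w)^2)) ----> ennreal ((SUP m. q m w)^2)"
   by (intro tendsto_ennrealI tendsto_power)
  then have "ennreal ((SUP m. q m w)^2) <= (SUP m. ennreal ((q m w)^2))"
   by (rule LIMSEQ_le_const2) (intro exI allI impI SUP_upper UNIV_I)
  with 1 show ?thesis by (rule order_trans)
 next
  case False
  have "ennreal ((M w)^2) <= ennreal ((q m w)^2)" if "M w <= q m w" for m
   using that by (intro ennreal_leI power_mono) (auto simp: M_def)
  moreover obtain m where "M w <= q m w"
   using False by (auto simp: bdd_above_def not_le) (meson less_imp_le)
  ultimately show ?thesis by (meson SUP_upper2 UNIV_I)
 qed
 have "ennreal (ball_moment k * dirichlet f) = (NN w. indicator (ball 0 1) w * ennreal ((M w)^2))"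
  unfolding M_def nn_integral_ball_combination[OF H1_weak_partial(1)[OF f], where k=k] dirichlet_eq[OF f] ..
 also have "... <= (NN w. (SUP m. indicator (ball 0 1) w * ennreal ((q m w)^2)))"
  by (intro nn_integral_mono) (use M_SUP in "auto split: split_indicator")
 also have "... = (SUP m. \<integral>\<^sup>+w. indicator (ball 0 1) w * ennreal ((q m w)^2) \<partial>lborel)"
 proof (rule nn_integral_monotone_convergence_SUP)
  show "incseq (%m w. indicator (ball 0 1) w * ennreal ((q m w)^2))"
   by (rule incseq_SucI) (auto simp: le_fun_def intro!: mult_left_mono ennreal_leI power_mono q_Suc q_nonneg)
  show "(%w. indicator (ball 0 1) w * ennreal ((q m w)^2)) \<in> borel_measurable lborel" for m
  proof -
   have "(%w. indicator (ball 0 1) w * (ennreal ((shift_dist f (e m *\<^sub>R w))^2) * ennreal (1 / (e m)^2))) \<in> borel_measurable lborel"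
    using shift_dist_measurable[OF fL] by measurable
   moreover have "ennreal ((shift_dist f (e m *\<^sub>R w))^2) * ennreal (1 / (e m)^2) = ennreal ((q m w)^2)" for w
    by (simp add: ennreal_mult[symmetric] q_def power_divide)
   ultimately show ?thesis by simp
  qed
 qed
 also have "... = (SUP m. nonlocal_form (e m) f)"
  unfolding nonlocal_form_def q_def by (intro SUP_cong refl nn_integral_cong) (simp add: ennreal_mult[symmetric] power_divide)
 also have "... <= ennreal (ball_moment k * K)"
  by (intro SUP_least le e0)
 finally have "ball_moment k * dirichlet f <= ball_moment k * K"
  using K ball_moment_pos[of k] by (simp add: ennreal_le_iff)
 then show ?thesis using ball_moment_pos[of k] by simp
qed

text \<open>Bounded difference quotients make the distributional derivative a bounded functional on
  test functions, and its L2 representative is the weak derivative.\<close>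

lemma H1_if_shift_dist_le:
 fixes f :: "real^'n::finite => complex"
 assumes f: "f \<in> L2" and K: "!!z. shift_dist f z <= K * norm z"
 shows "f \<in> H1"
proof -
 have "\<exists>g\<in>L2. is_weak_partial j f g" for j
 proof -
  let ?T = "%\<phi>. - (LBINT x. f x * partial_deriv j \<phi> x)"
  have pd: "partial_deriv j \<phi> \<in> L2" if "test_function \<phi>" for \<phi>
   using that by (intro test_function_L2 test_function_partial_deriv)
  have hd: "(\<phi> has_derivative frechet_derivative \<phi> (at x)) (at x)" if "test_function \<phi>" for \<phi> x
   using test_function_differentiable[OF that] by (simp add: frechet_derivative_works[symmetric])
  have add: "?T (%x. \<phi> x + \<psi> x) = ?T \<phi> + ?T \<psi>" if "test_function \<phi>" "test_function \<psi>" for \<phi> \<psi>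
  proof -
   have "partial_deriv j (%x. \<phi> x + \<psi> x) x = partial_deriv j \<phi> x + partial_deriv j \<psi> x" for x
    using partial_deriv_eqI[OF has_derivative_add[OF hd[OF that(1)] hd[OF that(2)]]] by (simp add: frechet_eq_partial_deriv)
   then show ?thesis
    using integrable_L2_mult[OF f pd[OF that(1)]] integrable_L2_mult[OF f pd[OF that(2)]] by (simp add: distrib_left)
  qed
  have scale: "?T (%x. c * \<phi> x) = c * ?T \<phi>" if "test_function \<phi>" for c \<phi>
  proof -
   have "partial_deriv j (%x. c * \<phi> x) x = c * partial_deriv j \<phi> x" for x
    using partial_deriv_eqI[OF has_derivative_mult_right[OF hd[OF that]]] by (simp add: frechet_eq_partial_deriv)
   then show ?thesis by (simp add: mult.left_commute)
  qed
  have bound: "cmod (?T \<phi>) <= K * L2_norm \<phi>" if "test_function \<phi>" for \<phi>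
  proof -
   have "cmod (LBINT x. f x * (\<Sum>i\<in>UNIV. cor (axis j 1 $ i) * partial_deriv i \<phi> x)) <= K * L2_norm \<phi>"
   proof (rule directional_derivative_le[OF f that, where s="%m. inverse (real (Suc m))"])
    show "L2_norm (%x. f (x + inverse (real (Suc m)) *\<^sub>R axis j 1) - f x) <= K * inverse (real (Suc m))" for m
     using K[of "inverse (real (Suc m)) *\<^sub>R axis j 1"] by (simp add: shift_dist_def norm_axis_1)
   qed (auto intro: LIMSEQ_inverse_real_of_nat simp del: of_nat_Suc)
   moreover have "(\<Sum>i\<in>UNIV. cor (axis j 1 $ i) * partial_deriv i \<phi> x) = partial_deriv j \<phi> x" for x
   proof -
    have "(\<Sum>i\<in>UNIV. cor (axis j 1 $ i) * partial_deriv i \<phi> x) = (\<Sum>i\<in>UNIV. if i = j then partial_deriv i \<phi> x else 0)"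
     by (intro sum.cong refl) (auto simp: axis_def)
    then show ?thesis by simp
   qed
   ultimately show ?thesis by simp
  qed
  obtain g \<theta> where g: "g \<in> L2" "!!\<phi>. test_function \<phi> ==> ?T \<phi> = (LBINT x. g x * \<phi> x)"
   by (rule L2_riesz_test[of ?T, OF add scale bound]) blast+
  have "is_weak_partial j f g"
   unfolding is_weak_partial_def
  proof (intro allI impI)
   fix \<phi> :: "real^'n => complex" assume "test_function \<phi>"
   from g(2)[OF this] show "(LBINT x. f x * partial_deriv j \<phi> x) = - (LBINT x. g x * \<phi> x)"
    by (simp add: minus_equation_iff[of "LBINT x. f x * partial_deriv j \<phi> x"] eq_commute)
  qed
  with g(1) show ?thesis by blast
 qed
 then show ?thesis using f by (simp add: H1_def)
qed

text \<open>Pointwise bounds of difference quotients follow from the averaged ones by writing a translation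
 as a composition of two translations averaged over a ball.\<close>

lemma shift_dist_le_nonlocal_form:
 fixes f :: "real^'n::finite => complex"
 assumes f: "f \<in> L2" and K: "0 <= K" and le: "!!e. e > 0 ==> nonlocal_form e f <= ennreal K"
 obtains C where "C >= 0" "!!z. shift_dist f z <= C * norm z"
proof -
 define v where "v = measure lborel (ball (0::real^'n) (1/2))"
 have v: "v > 0" unfolding v_def by (rule content_ball_pos) simp
 have bound: "(shift_dist f z)^2 * v <= 4 * K * (norm z)^2" if "z ~= 0" for z
 proof -
  define e where "e = norm z"
  have e: "e > 0" using that by (simp add: e_def)
  define u where "u = z /\<^sub>R e"
  have u: "norm u = 1" "e *\<^sub>R u = z" using e by (simp_all add: u_def e_def)
  \<comment> \<open>This ball lies in the unit ball and is invariant under w -> u - w. For w in it,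
    both parts of z = e w + e (u - w) are therefore seen by the average, while its volume v does not
    depend on z.\<close>
  let ?B = "ball (u /\<^sub>R 2) (1/2)"
  let ?S = "%w. ennreal ((shift_dist f (e *\<^sub>R w))^2)"
  have sub: "norm w < 1" if "w \<in> ?B" for w
  proof -
   have "norm w <= norm (u /\<^sub>R 2) + norm (w - u /\<^sub>R 2)"
    using norm_triangle_ineq[of "u /\<^sub>R 2" "w - u /\<^sub>R 2"] by simp
   then show ?thesis using that u(1) by (simp add: dist_norm norm_minus_commute)
  qed
  have sub': "norm (u - w) < 1" if "w \<in> ?B" for w
  proof (rule sub)
   have "u = u /\<^sub>R 2 + u /\<^sub>R 2"
    by (simp flip: scaleR_add_left)
   then have neg: "u /\<^sub>R 2 - (u - w) = - (u /\<^sub>R 2 - w)"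
    by (metis add_diff_cancel_left diff_diff_eq2 minus_diff_eq diff_add_eq_diff_diff_swap add_diff_cancel_right')
   show "u - w \<in> ?B" using that unfolding mem_ball dist_norm neg norm_minus_cancel .
  qed
  have pt: "(shift_dist f z)^2 <= 2 * (shift_dist f (e *\<^sub>R w))^2 + 2 * (shift_dist f (e *\<^sub>R (u - w)))^2" for w
  proof -
   have "z = e *\<^sub>R w + e *\<^sub>R (u - w)" using u(2) by (simp add: scaleR_diff_right)
   then have "shift_dist f z <= shift_dist f (e *\<^sub>R w) + shift_dist f (e *\<^sub>R (u - w))"
    using shift_dist_add[OF f, of "e *\<^sub>R w" "e *\<^sub>R (u - w)"] by simp
   then have "(shift_dist f z)^2 <= (shift_dist f (e *\<^sub>R w) + shift_dist f (e *\<^sub>R (u - w)))^2"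
    by (rule power_mono) (rule shift_dist_nonneg)
   also have "... <= 2 * (shift_dist f (e *\<^sub>R w))^2 + 2 * (shift_dist f (e *\<^sub>R (u - w)))^2"
    using sum_squares_bound[of "shift_dist f (e *\<^sub>R w)" "shift_dist f (e *\<^sub>R (u - w))"] by (simp add: power2_sum)
   finally show ?thesis .
  qed
  have Sm: "?S \<in> borel_measurable borel" by (rule shift_dist_measurable[OF f])
  have S_le: "(NN w. indicator (ball 0 1) w * ?S w) <= ennreal (e^2 * K)"
  proof -
   have "(NN w. indicator (ball 0 1) w * ?S w) = ennreal (e^2) * nonlocal_form e f"
    unfolding nonlocal_form_def using e Sm
    by (subst nn_integral_cmult[symmetric]) (auto intro!: nn_integral_cong simp: ennreal_mult[symmetric] split: split_indicator)
   also have "... <= ennreal (e^2) * ennreal K" by (intro mult_left_mono le e) simp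
   finally show ?thesis using K by (simp add: ennreal_mult)
  qed
  have m1: "(%w. indicator (ball 0 1) w * ?S w) \<in> borel_measurable borel" using Sm by measurable
  have S_le': "(NN w. indicator (ball 0 1) (u - w) * ?S (u - w)) <= ennreal (e^2 * K)"
  proof -
   have pu: "preserves_lborel (%w::real^'n. - w)"
    by (rule preserves_lborel_isometry[where \<rho>'="%w. - w"]) (auto simp: linear_iff)
   have p: "preserves_lborel (%w::real^'n. u - w)"
    using preserves_lborel_compose[OF preserves_lborel_add[of u] pu] by simp
   show ?thesis
    using preserves_lborel_nn_integral[OF p m1] S_le by simp
  qed
  have m2: "(%w. indicator (ball 0 1) (u - w) * ?S (u - w)) \<in> borel_measurable lborel"
   using measurable_compose[OF _ m1, of "%w. u - w" borel] by simp
  have "ennreal ((shift_dist f z)^2 * v) = (NN w. ennreal ((shift_dist f z)^2) * indicator ?B w)"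
  proof -
   have "emeasure lborel ?B = ennreal v"
    unfolding v_def using emeasure_bounded_finite[of ?B] by (simp add: emeasure_eq_ennreal_measure content_ball)
   then show ?thesis using v by (subst nn_integral_cmult_indicator) (simp_all add: ennreal_mult)
  qed
  also have "... <= (NN w. 2 * (indicator (ball 0 1) w * ?S w) + 2 * (indicator (ball 0 1) (u - w) * ?S (u - w)))"
  proof (rule nn_integral_mono)
   fix w
   show "ennreal ((shift_dist f z)^2) * indicator ?B w <= 2 * (indicator (ball 0 1) w * ?S w) + 2 * (indicator (ball 0 1) (u - w) * ?S (u - w))"
   proof (cases "w \<in> ?B")
    case True
    have "ennreal ((shift_dist f z)^2) <= ennreal (2 * (shift_dist f (e *\<^sub>R w))^2 + 2 * (shift_dist f (e *\<^sub>R (u - w)))^2)"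
     by (rule ennreal_leI[OF pt])
    also have "... = 2 * ?S w + 2 * ?S (u - w)"
     by (simp add: ennreal_mult)
    finally show ?thesis using True sub[OF True] sub'[OF True] by simp
   qed simp
  qed
  also have "... = 2 * (NN w. indicator (ball 0 1) w * ?S w) + 2 * (NN w. indicator (ball 0 1) (u - w) * ?S (u - w))"
   using m1 m2 by (subst nn_integral_add) (auto simp: nn_integral_cmult)
  also have "... <= 2 * ennreal (e^2 * K) + 2 * ennreal (e^2 * K)"
   by (intro add_mono mult_left_mono S_le S_le') auto
  also have "... = ennreal (4 * K * e^2)"
   using K by (simp add: ennreal_plus[symmetric] ennreal_mult'[symmetric] mult_ac flip: ennreal_numeral)
  finally show ?thesis using K v by (simp add: ennreal_le_iff e_def)
 qed
 define C where "C = sqrt (4 * K / v)"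
 have C: "C >= 0" using K v by (simp add: C_def)
 have "shift_dist f z <= C * norm z" for z
 proof (cases "z = 0")
  case False
  show ?thesis
  proof (rule power2_le_imp_le)
   have "(shift_dist f z)^2 <= 4 * K * (norm z)^2 / v"
    using bound[OF False] v by (simp add: pos_le_divide_eq)
   then show "(shift_dist f z)^2 <= (C * norm z)^2"
    using K v by (simp add: C_def power_mult_distrib)
  qed (use C in simp)
 qed (simp add: shift_dist_def)
 with C that show ?thesis by blast
qed

text \<open>The regularity criterion for moduli, polarizations, dilations and a.e. limits; keeping
  the exact K matters for the sharp constant.\<close>

lemma H1_if_nonlocal_form_le:
 fixes f :: "real^'n::finite => complex"
 assumes f: "f \<in> L2" and K: "0 <= K"
  and le: "!!e. e > 0 ==> nonlocal_form e f <= ennreal (ball_moment (k::'n) * K)"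
 shows "f \<in> H1" "dirichlet f <= K"
proof -
 have "0 <= ball_moment k * K" using K ball_moment_pos[of k] by simp
 then obtain C where "!!z. shift_dist f z <= C * norm z"
  using shift_dist_le_nonlocal_form[OF f _ le] by blast
 then show "f \<in> H1" by (rule H1_if_shift_dist_le[OF f])
 then show "dirichlet f <= K" by (rule dirichlet_le_nonlocal_form[OF _ K le])
qed

section \<open>Higher integrability and compactness\<close>

text \<open>Lipschitz continuity of translations in L2: a quantitative H1 bound that passes to
  truncations of the modulus and does not mention the chosen weak derivatives.\<close>

definition lip2 :: "real => (real^'n::finite => complex) => bool" where
 "lip2 K f \<longleftrightarrow> f \<in> L2 \<and> 0 <= K \<and> (\<forall>z. shift_dist f z <= K * norm z)"

lemma lip2_L2: "lip2 K f ==> f \<in> L2"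
 and lip2_nonneg: "lip2 K f ==> 0 <= K"
 and lip2_shift_dist: "lip2 K f ==> shift_dist f z <= K * norm z"
 by (auto simp: lip2_def)

lemma lip2_mono: "lip2 K f ==> K <= K' ==> lip2 K' f"
 unfolding lip2_def by (meson mult_right_mono norm_ge_zero order_trans)

lemma lip2_H1: "f \<in> H1 ==> lip2 (sqrt (dirichlet f)) f"
 by (simp add: lip2_def H1_L2 H1_shift_dist_le dirichlet_nonneg)

text \<open>Substituting y = x + e w turns the form into a double integral with a fixed radial
  kernel, where Fubini, Fatou and reflections of x and y separately can act.\<close>

lemma nonlocal_form_kernel:
 fixes f :: "real^'n::finite => complex"
 assumes f: "f \<in> L2" and e: "e > 0"
 shows "nonlocal_form e f = ennreal (inverse e ^ CARD('n) * (1 / e^2)) *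
  (NN x. (NN y. indicator (ball 0 e) (y - x) * ennreal ((cmod (f y - f x))^2)))"
proof -
 have [measurable]: "f \<in> borel_measurable borel" using f by (rule L2_measurable)
 let ?g = "%x y. indicator (ball 0 e) (y - x) * ennreal ((cmod (f y - f x))^2)"
 have sc: "(NN w. indicator (ball 0 1) w * ennreal ((cmod (f (x + e *\<^sub>R w) - f x))^2)) =
   ennreal (inverse e ^ CARD('n)) * (NN y. ?g x y)" for x
 proof -
  have i: "indicator (ball 0 1) w = (indicator (ball 0 e) (e *\<^sub>R w) :: ennreal)" for w :: "real^'n"
   using e by (auto simp: mult_less_cancel_left2 split: split_indicator)
  have "(NN w. indicator (ball 0 1) w * ennreal ((cmod (f (x + e *\<^sub>R w) - f x))^2)) =
    ennreal (inverse e ^ DIM(real^'n)) * (NN y. indicator (ball 0 e) y * ennreal ((cmod (f (x + y) - f x))^2))"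
   unfolding i by (rule nn_integral_lborel_scale[OF _ e]) measurable
  also have "(NN y. indicator (ball 0 e) y * ennreal ((cmod (f (x + y) - f x))^2)) = (NN y. ?g x y)"
   using preserves_lborel_nn_integral[OF preserves_lborel_add[of x], of "?g x"] by (simp add: add.commute)
  finally show ?thesis by simp
 qed
 have "nonlocal_form e f = (NN w. (NN x. ennreal (1 / e^2) * (indicator (ball 0 1) w * ennreal ((cmod (f (x + e *\<^sub>R w) - f x))^2))))"
  unfolding nonlocal_form_def shift_dist_nn[OF f]
  by (rule nn_integral_cong) (simp add: nn_integral_cmult mult_ac)
 also have "... = (NN x. (NN w. ennreal (1 / e^2) * (indicator (ball 0 1) w * ennreal ((cmod (f (x + e *\<^sub>R w) - f x))^2))))"
  by (rule lborel_pair.Fubini') measurable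
 also have "... = (NN x. (ennreal (1 / e^2) * ennreal (inverse e ^ CARD('n))) * (NN y. ?g x y))"
  by (rule nn_integral_cong) (simp add: nn_integral_cmult sc mult.assoc)
 also have "... = (ennreal (1 / e^2) * ennreal (inverse e ^ CARD('n))) * (NN x. (NN y. ?g x y))"
  by (rule nn_integral_cmult) measurable
 also have "ennreal (1 / e^2) * ennreal (inverse e ^ CARD('n)) = ennreal (inverse e ^ CARD('n) * (1 / e^2))"
  using e by (subst ennreal_mult[symmetric]) (auto simp: mult.commute)
 finally show ?thesis .
qed

definition ball_integral :: "real => (real^'n::finite => complex) => real^'n => complex" where
 "ball_integral e f x = (LBINT y. cor (indicator (ball x e) y) * f y)"

lemma ball_indicator_L2: "(%y. cor (indicator (ball x e) y)) \<in> L2"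
 by (rule indicator_L2) auto

lemma ball_indicator_L2_norm:
 "(L2_norm (%y::real^'n::finite. cor (indicator (ball x e) y)))^2 = measure lborel (ball x e)"
proof -
 have "(cmod (cor (indicator (ball x e) y)))^2 = indicator (ball x e) y" for y :: "real^'n"
  by (simp split: split_indicator)
 then show ?thesis by (simp add: L2_norm_sq)
qed

lemma ball_integral_measurable [measurable]:
 fixes f :: "real^'n::finite => complex"
 assumes [measurable]: "f \<in> borel_measurable borel"
 shows "ball_integral e f \<in> borel_measurable borel"
proof -
 have [measurable]: "Measurable.pred (borel \<Otimes>\<^sub>M borel) (%z. snd z \<in> ball (fst z :: real^'n) e)"
  unfolding mem_ball by measurable
 have "(%x. \<integral>y. (if y \<in> ball x e then 1 else 0) * f y \<partial>lborel) \<in> borel_measurable borel"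
  by measurable
 moreover have "(if y \<in> ball x e then 1 else 0 :: complex) = cor (indicator (ball x e) y)" for x y :: "real^'n"
  by simp
 ultimately show ?thesis by (simp add: ball_integral_def[abs_def])
qed

text \<open>By Cauchy-Schwarz on the ball about x, the squared deviation of the average from f(x) is
  at most the mean of |f(y) - f(x)|^2 there; integrating in x gives the form back, with a factor e^2
  divided by the volume of the unit ball.\<close>

lemma ball_average_error:
 fixes f :: "real^'n::finite => complex"
 assumes f: "f \<in> L2" and e: "e > 0" and K: "0 <= K" and le: "nonlocal_form e f <= ennreal K"
 shows "(%x. ball_integral e f x / cor (measure lborel (ball (0::real^'n) e)) - f x) \<in> L2"
  "L2_norm (%x. ball_integral e f x / cor (measure lborel (ball (0::real^'n) e)) - f x)
   <= e * sqrt (K / measure lborel (ball (0::real^'n) 1))"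
proof -
 note [measurable] = L2_measurable[OF f]
 define V where "V = measure lborel (ball (0::real^'n) e)"
 define V1 where "V1 = measure lborel (ball (0::real^'n) 1)"
 have V1: "V1 > 0" unfolding V1_def by (rule content_ball_pos) simp
 have Ve: "V = e ^ CARD('n) * V1" unfolding V_def V1_def using content_ball_conv_unit_ball[of e "0::real^'n"] e by simp
 then have V: "V > 0" using V1 e by simp
 have Vx: "measure lborel (ball x e) = V" for x :: "real^'n"
  unfolding V_def using content_ball_conv_unit_ball[of e x] content_ball_conv_unit_ball[of e "0::real^'n"] e by simp
 let ?k = "%x y. indicator (ball 0 e) (y - x :: real^'n) * ennreal ((cmod (f y - f x))^2)"
 have pt: "ennreal ((cmod (ball_integral e f x / cor V - f x))^2) <= ennreal (1 / V) * (NN y. ?k x y)" for x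
 proof -
  let ?i = "%y. cor (indicator (ball x e) y)"
  let ?F = "%y. ?i y * (f y - f x)"
  have iL: "?i \<in> L2" by (rule ball_indicator_L2)
  have fi: "(%y. ?i y * f y) \<in> L2"
   by (rule L2_dominated(1)[OF f, where K=1]) (auto split: split_indicator)
  have FL: "?F \<in> L2"
   using L2_diff[OF fi L2_cmult[OF iL, of "f x"]] by (simp add: algebra_simps)
  have ii: "?i y * ?i y = ?i y" for y by (auto split: split_indicator)
  have int1: "(LBINT y. ?i y) = cor V"
   by (simp add: integral_complex_of_real Vx)
  have "(LBINT y. ?F y * ?i y) = (LBINT y. ?i y * f y - f x * ?i y)"
   by (rule Bochner_Integration.integral_cong) (auto split: split_indicator simp: algebra_simps)
  also have "... = ball_integral e f x - f x * cor V"
   unfolding ball_integral_def int1[symmetric] integral_mult_right_zero[symmetric]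
  proof (rule Bochner_Integration.integral_diff)
   show "integrable lborel (%y. ?i y * f y)" by (rule integrable_L2_mult[OF iL f])
   show "integrable lborel (%y. f x * ?i y)" using integrable_L2_mult[OF iL iL] unfolding ii by simp
  qed
  finally have "ball_integral e f x - f x * cor V = (LBINT y. ?F y * ?i y)" ..
  then have "cmod (ball_integral e f x - f x * cor V) <= L2_norm ?F * L2_norm ?i"
   using L2_Cauchy_Schwarz[OF FL iL] by simp
  then have "(cmod (ball_integral e f x - f x * cor V))^2 <= (L2_norm ?F)^2 * V"
   unfolding Vx[of x, symmetric] ball_indicator_L2_norm[symmetric] power_mult_distrib[symmetric] by (rule power_mono) simp
  moreover have "ball_integral e f x / cor V - f x = (ball_integral e f x - f x * cor V) / cor V"
   using V by (simp add: field_simps)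
  ultimately have "(cmod (ball_integral e f x / cor V - f x))^2 <= (1 / V) * (L2_norm ?F)^2"
   using V by (simp add: norm_divide power_divide power2_eq_square[of V] divide_le_eq mult_ac)
  then have "ennreal ((cmod (ball_integral e f x / cor V - f x))^2) <= ennreal (1 / V) * ennreal ((L2_norm ?F)^2)"
   using V by (simp add: ennreal_mult[symmetric] ennreal_leI)
  also have "ennreal ((L2_norm ?F)^2) = (NN y. ?k x y)"
   unfolding nn_integral_L2[OF FL, symmetric]
   by (intro nn_integral_cong) (auto simp: dist_norm norm_minus_commute split: split_indicator)
  finally show ?thesis .
 qed
 have c: "ennreal (e ^ CARD('n) * e^2) * ennreal (inverse e ^ CARD('n) * (1 / e^2)) = 1"
  using e by (subst ennreal_mult[symmetric]) (auto simp: field_simps)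
 have "(NN x. ennreal ((cmod (ball_integral e f x / cor V - f x))^2))
   <= (NN x. ennreal (1 / V) * (NN y. ?k x y))" by (rule nn_integral_mono) (rule pt)
 also have "... = ennreal (1 / V) * (NN x. (NN y. ?k x y))" by (rule nn_integral_cmult) measurable
 also have "(NN x. (NN y. ?k x y)) = ennreal (e ^ CARD('n) * e^2) * nonlocal_form e f"
  unfolding nonlocal_form_kernel[OF f e] mult.assoc[symmetric] c by simp
 also have "ennreal (1 / V) * ... <= ennreal (1 / V) * (ennreal (e ^ CARD('n) * e^2) * ennreal K)"
  by (intro mult_left_mono le) auto
 also have "... = ennreal (1 / V * (e ^ CARD('n) * e^2 * K))"
  using V e K by (simp add: ennreal_mult[symmetric])
 also have "1 / V * (e ^ CARD('n) * e^2 * K) = (e * sqrt (K / V1))^2"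
  using e V1 K by (simp add: Ve power_mult_distrib)
 finally have m: "(NN x. ennreal ((cmod (ball_integral e f x / cor V - f x))^2)) <= ennreal ((e * sqrt (K / V1))^2)" .
 have "0 <= e * sqrt (K / V1)" using e V1 K by simp
 note L2_norm_leI[OF _ this m]
 then show "(%x. ball_integral e f x / cor (measure lborel (ball (0::real^'n) e)) - f x) \<in> L2"
  "L2_norm (%x. ball_integral e f x / cor (measure lborel (ball (0::real^'n) e)) - f x)
   <= e * sqrt (K / measure lborel (ball (0::real^'n) 1))"
  unfolding V_def V1_def by simp_all
qed

lemma lip2_nonlocal_form_le:
 fixes f :: "real^'n::finite => complex"
 assumes f: "lip2 K f" and e: "e > 0"
 shows "nonlocal_form e f <= ennreal (K^2 * measure lborel (ball (0::real^'n) 1))"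
proof -
 have K: "0 <= K" using lip2_nonneg[OF f] .
 have "nonlocal_form e f <= (NN w. ennreal (K^2) * indicator (ball (0::real^'n) 1) w)"
  unfolding nonlocal_form_def
 proof (rule nn_integral_mono)
  fix w :: "real^'n"
  show "indicator (ball 0 1) w * (ennreal ((shift_dist f (e *\<^sub>R w))^2) * ennreal (1 / e^2)) <= ennreal (K^2) * indicator (ball 0 1) w"
  proof (cases "norm w < 1")
   case True
   have "shift_dist f (e *\<^sub>R w) <= K * (e * norm w)" using lip2_shift_dist[OF f, of "e *\<^sub>R w"] e by simp
   also have "... <= K * (e * 1)" using K e True by (intro mult_left_mono) auto
   finally have "(shift_dist f (e *\<^sub>R w))^2 <= (K * e)^2" by (intro power_mono shift_dist_nonneg) simp
   then have "(shift_dist f (e *\<^sub>R w))^2 * (1 / e^2) <= K^2" using e by (simp add: power_mult_distrib divide_le_eq)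
   then show ?thesis using True by (simp add: ennreal_mult[symmetric] ennreal_leI)
  qed simp
 qed
 also have "... = ennreal (K^2) * ennreal (measure lborel (ball (0::real^'n) 1))"
  using emeasure_bounded_finite[of "ball (0::real^'n) 1"] by (simp add: nn_integral_cmult_indicator emeasure_eq_ennreal_measure)
 finally show ?thesis by (simp add: ennreal_mult)
qed

lemma lip2_ball_average_error:
 fixes f :: "real^'n::finite => complex"
 assumes f: "lip2 K f" and e: "e > 0"
 shows "(%x. ball_integral e f x / cor (measure lborel (ball (0::real^'n) e)) - f x) \<in> L2"
  "L2_norm (%x. ball_integral e f x / cor (measure lborel (ball (0::real^'n) e)) - f x) <= e * K"
proof -
 have V1: "measure lborel (ball (0::real^'n) 1) > 0" by (rule content_ball_pos) simp
 have "sqrt (K^2 * measure lborel (ball (0::real^'n) 1) / measure lborel (ball (0::real^'n) 1)) = K"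
  using V1 lip2_nonneg[OF f] by simp
 with ball_average_error[OF lip2_L2[OF f] e _ lip2_nonlocal_form_le[OF f e]]
 show "(%x. ball_integral e f x / cor (measure lborel (ball (0::real^'n) e)) - f x) \<in> L2"
  "L2_norm (%x. ball_integral e f x / cor (measure lborel (ball (0::real^'n) e)) - f x) <= e * K" by simp_all
qed

lemma ball_indicator_L2_norm_eq:
 "e > 0 ==> L2_norm (%y::real^'n::finite. cor (indicator (ball x e) y)) = sqrt (measure lborel (ball (0::real^'n) e))"
 using ball_indicator_L2_norm[of x e] content_ball_conv_unit_ball[of e x] content_ball_conv_unit_ball[of e "0::real^'n"]
 by (metis L2_norm_nonneg less_imp_le real_sqrt_unique)

lemma ball_integral_bound:
 fixes f :: "real^'n::finite => complex"
 assumes "f \<in> L2" "e > 0"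
 shows "cmod (ball_integral e f x) <= sqrt (measure lborel (ball (0::real^'n) e)) * L2_norm f"
 using L2_Cauchy_Schwarz[OF ball_indicator_L2 assms(1), of x e]
 unfolding ball_integral_def ball_indicator_L2_norm_eq[OF assms(2)] .

lemma ball_integral_lipschitz:
 fixes f :: "real^'n::finite => complex"
 assumes f: "lip2 K f" and e: "e > 0"
 shows "cmod (ball_integral e f (x + z) - ball_integral e f x) <= sqrt (measure lborel (ball (0::real^'n) e)) * K * norm z"
proof -
 note fL = lip2_L2[OF f]
 note [measurable] = L2_measurable[OF fL]
 let ?i = "%y. cor (indicator (ball x e) y)"
 have "ball_integral e f (x + z) = (LBINT y. cor (indicator (ball (x + z) e) (y + z)) * f (y + z))"
  unfolding ball_integral_def by (rule preserves_lborel_integral[OF preserves_lborel_add, symmetric]) measurable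
 also have "(%y. cor (indicator (ball (x + z) e) (y + z)) * f (y + z)) = (%y. ?i y * f (y + z))"
  by (auto simp: fun_eq_iff dist_norm split: split_indicator)
 finally have "ball_integral e f (x + z) - ball_integral e f x = (LBINT y. ?i y * f (y + z)) - (LBINT y. ?i y * f y)"
  by (simp add: ball_integral_def)
 also have "... = (LBINT y. ?i y * (f (y + z) - f y))"
  unfolding right_diff_distrib
  by (rule Bochner_Integration.integral_diff[symmetric]; rule integrable_L2_mult[OF ball_indicator_L2]; intro L2_shift fL)
 also have "cmod ... <= L2_norm ?i * L2_norm (%y. f (y + z) - f y)"
  by (rule L2_Cauchy_Schwarz[OF ball_indicator_L2 L2_diff[OF L2_shift[OF fL] fL]])
 also have "L2_norm ?i = sqrt (measure lborel (ball (0::real^'n) e))" by (rule ball_indicator_L2_norm_eq[OF e])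
 also have "sqrt (measure lborel (ball (0::real^'n) e)) * L2_norm (%y. f (y + z) - f y) <= sqrt (measure lborel (ball (0::real^'n) e)) * (K * norm z)"
  using lip2_shift_dist[OF f, of z] by (intro mult_left_mono) (auto simp: shift_dist_def)
 finally show ?thesis by (simp add: mult.assoc)
qed

section \<open>Truncation, decay of level sets and higher integrability\<close>

definition cut :: "real => (real^'n::finite => complex) => real^'n => complex" where
 "cut l f x = (if l < cmod (f x) then f x else 0)"

text \<open>\<open>cut\<close> measures the part of f above a level but destroys translation bounds;
  \<open>trunc\<close> is a 1-Lipschitz function of |f| and keeps them. Both are used, and compared
  below.\<close>

definition trunc :: "real => (real^'n::finite => complex) => real^'n => complex" where
 "trunc l f x = cor (max 0 (cmod (f x) - l))"

lemma cut_L2: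
 assumes f: "f \<in> L2"
 shows "cut l f \<in> L2" "L2_norm (cut l f) <= L2_norm f"
proof -
 have [measurable]: "f \<in> borel_measurable borel" using f by (rule L2_measurable)
 have m: "cut l f \<in> borel_measurable borel" unfolding cut_def[abs_def] by measurable
 have ae: "AE x in lborel. cmod (cut l f x) <= 1 * cmod (f x)"
  by (intro AE_I2) (simp add: cut_def)
 show "cut l f \<in> L2" "L2_norm (cut l f) <= L2_norm f"
  using L2_dominated[OF f m ae] by auto
qed

lemma trunc_L2:
 assumes f: "f \<in> L2" and l: "0 <= l"
 shows "trunc l f \<in> L2" "L2_norm (trunc l f) <= L2_norm (cut l f)"
proof -
 have [measurable]: "f \<in> borel_measurable borel" using f by (rule L2_measurable)
 have m: "trunc l f \<in> borel_measurable borel" unfolding trunc_def[abs_def] by measurable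
 have ae: "AE x in lborel. cmod (trunc l f x) <= 1 * cmod (cut l f x)"
  using l by (intro AE_I2) (auto simp: cut_def trunc_def)
 show "trunc l f \<in> L2" "L2_norm (trunc l f) <= L2_norm (cut l f)"
  using L2_dominated[OF cut_L2(1)[OF f] m ae] by auto
qed

lemma trunc_lip2:
 assumes f: "lip2 K f" and l: "0 <= l"
 shows "lip2 K (trunc l f)"
proof -
 note fL = lip2_L2[OF f]
 note tL = trunc_L2(1)[OF fL l]
 have "shift_dist (trunc l f) z <= 1 * shift_dist f z" for z
  unfolding shift_dist_def
 proof (rule L2_dominated(2)[OF L2_diff[OF L2_shift[OF fL] fL]])
  show "(%x. trunc l f (x + z) - trunc l f x) \<in> borel_measurable borel"
   by (rule L2_measurable[OF L2_diff[OF L2_shift[OF tL] tL]])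
  have "cmod (trunc l f (x + z) - trunc l f x) <= cmod (f (x + z) - f x)" for x
  proof -
   have "cmod (trunc l f (x + z) - trunc l f x) = \<bar>max 0 (cmod (f (x + z)) - l) - max 0 (cmod (f x) - l)\<bar>"
    unfolding trunc_def of_real_diff[symmetric] norm_of_real ..
   also have "... <= \<bar>cmod (f (x + z)) - cmod (f x)\<bar>" by linarith
   also have "... <= cmod (f (x + z) - f x)" by (rule norm_triangle_ineq3)
   finally show ?thesis .
  qed
  then show "AE x in lborel. cmod (trunc l f (x + z) - trunc l f x) <= 1 * cmod (f (x + z) - f x)" by simp
 qed simp
 then show ?thesis
  using f tL by (auto simp: lip2_def intro: order_trans)
qed

text \<open>Where |f| > 2 l, the excess |f| - l is larger than l and larger than |f|/2.\<close>

lemma cut_le_cut_trunc: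
 assumes f: "f \<in> L2" and l: "0 < l"
 shows "L2_norm (cut (2 * l) f) <= 2 * L2_norm (cut l (trunc l f))"
proof (rule L2_dominated(2)[OF cut_L2(1)[OF trunc_L2(1)[OF f less_imp_le[OF l]]] L2_measurable[OF cut_L2(1)[OF f]]])
 show "AE x in lborel. cmod (cut (2 * l) f x) <= 2 * cmod (cut l (trunc l f) x)"
  using l by (intro AE_I2) (auto simp: cut_def trunc_def max_def simp del: of_real_diff)
qed simp

text \<open>The factor 2 comes from comparing a point value with its deviation from the average, the
  power of the unit volume from solving for the radius in \<open>cut_level_bound\<close>.\<close>

definition level_const :: "'n::finite itself => real" where
 "level_const _ = 2 * measure lborel (ball (0::real^'n) 1) powr (- 1 / real CARD('n))"

text \<open>Choosing the radius so that the ball averages stay below \<open>l/2\<close>, a point value above \<open>l\<close>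
 is at most twice the deviation from the average.\<close>

lemma cut_level_bound:
 fixes f :: "real^'n::finite => complex"
 assumes f: "lip2 K f" and l: "0 < l"
 shows "L2_norm (cut l f) <= level_const TYPE('n) * K * (2 * L2_norm f / l) powr (2 / real CARD('n))"
proof (cases "L2_norm f = 0")
 case True
 then show ?thesis
  using cut_L2(2)[OF lip2_L2[OF f], of l] L2_norm_nonneg[of "cut l f"] by simp
next
 case False
 let ?n = "real CARD('n)" and ?V1 = "measure lborel (ball (0::real^'n) 1)"
 note fL = lip2_L2[OF f]
 have V1: "?V1 > 0" by (rule content_ball_pos) simp
 have f0: "L2_norm f > 0" using False L2_norm_nonneg[of f] by linarith
 \<comment> \<open>This radius gives the ball the volume (2 |f| / l)^2, with |f| the L2 norm;
   Cauchy-Schwarz bounds the averages by |f| over the root of the volume, which is l/2.\<close>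
 define h where "h = (2 * L2_norm f / l) powr (2 / ?n) * ?V1 powr (- 1 / ?n)"
 have h: "h > 0" using f0 l V1 by (simp add: h_def)
 let ?V = "measure lborel (ball (0::real^'n) h)"
 have "h ^ CARD('n) = h powr ?n" using h by (simp add: powr_realpow)
 also have "... = (2 * L2_norm f / l) powr 2 * ?V1 powr (- 1)"
  unfolding h_def using f0 l V1 by (simp add: powr_mult powr_powr)
 also have "... = (2 * L2_norm f / l)^2 / ?V1"
  using f0 l V1 by (simp add: powr_numeral powr_minus divide_inverse)
 finally have V: "?V = (2 * L2_norm f / l)^2"
  using content_ball_conv_unit_ball[of h "0::real^'n"] h V1 by simp
 let ?A = "%x. ball_integral h f x / cor ?V"
 have small: "cmod (?A x) <= l / 2" for x
 proof -
  have "cmod (ball_integral h f x) <= (2 * L2_norm f / l) * L2_norm f"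
   using ball_integral_bound[OF fL h, of x] f0 l by (simp add: V)
  then show ?thesis using f0 l by (simp add: V norm_divide norm_power power2_eq_square norm_mult field_simps)
 qed
 have "L2_norm (cut l f) <= 2 * L2_norm (%x. ?A x - f x)"
 proof (rule L2_dominated(2)[OF lip2_ball_average_error(1)[OF f h] L2_measurable[OF cut_L2(1)[OF fL]]])
  have "cmod (cut l f x) <= 2 * cmod (?A x - f x)" for x
   using small[of x] norm_triangle_ineq2[of "f x" "?A x"] l norm_minus_commute[of "f x" "?A x"]
   by (auto simp: cut_def)
  then show "AE x in lborel. cmod (cut l f x) <= 2 * cmod (?A x - f x)" by simp
 qed simp
 also have "... <= 2 * (h * K)"
  by (intro mult_left_mono lip2_ball_average_error(2)[OF f h]) simp
 finally show ?thesis by (simp add: level_const_def h_def mult_ac)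
qed

lemma level_const_nonneg: "0 <= level_const T"
 by (simp add: level_const_def)

text \<open>Bootstrapping \<open>cut_level_bound\<close> on the truncations \<open>(|f| - l)\<^sub>+\<close> improves the decay
 exponent from \<open>b\<close> to \<open>(2/n) (b + 1)\<close>.\<close>

lemma cut_decay_step:
 assumes b: "\<forall>f :: real^'n::finite => complex. lip2 M f --> L2_norm f <= M --> (\<forall>l>0. L2_norm (cut l f) <= C * l powr (- b))"
  and C: "0 <= C"
 shows "\<exists>C'\<ge>0. \<forall>f :: real^'n => complex. lip2 M f --> L2_norm f <= M \<longrightarrow>
  (\<forall>l>0. L2_norm (cut l f) <= C' * l powr (- ((2 / real CARD('n)) * (b + 1))))"
proof (cases "0 <= M")
 case False
 then show ?thesis
  using L2_norm_nonneg order_trans by (intro exI[of _ 0]) blast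
next
 case M: True
 let ?r = "2 / real CARD('n)"
 let ?L = "level_const TYPE('n)"
 define C' where "C' = 2 * (?L * M * ((2 * C) powr ?r * (1/2) powr (- ?r * (b + 1))))"
 have C': "0 <= C'"
  unfolding C'_def using level_const_nonneg[of "TYPE('n)"] M by simp
 have "L2_norm (cut l f) <= C' * l powr (- (?r * (b + 1)))"
  if f: "lip2 M f" and fM: "L2_norm f <= M" and l: "0 < l" for f :: "real^'n => complex" and l
 proof -
  define m where "m = l / 2"
  have m: "m > 0" "l = 2 * m" using l by (simp_all add: m_def)
  note fL = lip2_L2[OF f]
  have g: "L2_norm (trunc m f) <= C * m powr (- b)"
   using trunc_L2(2)[OF fL less_imp_le[OF m(1)]] b f fM m(1) by (meson order_trans)
  have "L2_norm (cut l f) <= 2 * L2_norm (cut m (trunc m f))"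
   unfolding m(2) by (rule cut_le_cut_trunc[OF fL m(1)])
  also have "... <= 2 * (?L * M * (2 * L2_norm (trunc m f) / m) powr ?r)"
   by (intro mult_left_mono cut_level_bound[OF trunc_lip2[OF f less_imp_le[OF m(1)]] m(1)]) simp
  also have "... <= 2 * (?L * M * (2 * (C * m powr (- b)) / m) powr ?r)"
   using g m(1) M level_const_nonneg[of "TYPE('n)"] by (intro mult_left_mono powr_mono2 divide_right_mono) auto
  also have "2 * (C * m powr (- b)) / m = (2 * C) * m powr (- (b + 1))"
  proof -
   have "m powr (- (b + 1)) = m powr (- b) / m"
    using m(1) by (simp add: powr_diff powr_minus_divide powr_add)
   then show ?thesis by simp
  qed
  also have "((2 * C) * m powr (- (b + 1))) powr ?r = (2 * C) powr ?r * (m powr (- (b + 1))) powr ?r"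
   using C by (simp add: powr_mult)
  also have "(m powr (- (b + 1))) powr ?r = m powr (- ?r * (b + 1))"
   by (simp only: powr_powr mult_minus_left mult_minus_right mult.commute)
  also have "m powr (- ?r * (b + 1)) = (1/2) powr (- ?r * (b + 1)) * l powr (- ?r * (b + 1))"
  proof -
   have "m = (1/2) * l" by (simp add: m_def)
   then show ?thesis using l by (simp only: powr_mult)
  qed
  finally show ?thesis by (simp add: C'_def mult_ac)
 qed
 with C' show ?thesis by blast
qed

text \<open>The density |f|^(s + 2), kept as a square times a power because the part of f above each
  level is measured in L2.\<close>

definition pw :: "real => (real^'n::finite => complex) => real^'n => real" where
 "pw s f x = (cmod (f x))^2 * cmod (f x) powr s"

lemma pw_nonneg: "0 <= pw s f x"
 by (simp add: pw_def)

lemma pw_measurable: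
 assumes [measurable]: "f \<in> borel_measurable borel"
 shows "pw s f \<in> borel_measurable borel"
 unfolding pw_def[abs_def] by measurable

lemma powr_sq: "(x powr u)^2 = (x::real) powr (2 * u)"
 by (simp add: power2_eq_square powr_add[symmetric])

lemma dyadic_level:
 fixes a l :: real
 assumes "0 < l" "l < a"
 obtains k :: nat where "2 ^ k * l < a" "a <= 2 ^ Suc k * l"
proof -
 obtain k where "a / l < 2 ^ k"
  using real_arch_pow[of 2 "a / l"] by auto
 then have "a < 2 ^ k * l"
  using assms(1) by (simp add: pos_divide_less_eq)
 moreover have "0 < 2 ^ k * l" using assms(1) by simp
 ultimately have "a <= 2 ^ Suc k * l" by simp
 then have ex: "\<exists>k. a <= 2 ^ Suc k * l" by blast
 define k where "k = (LEAST k. a <= 2 ^ Suc k * l)"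
 have k1: "a <= 2 ^ Suc k * l" unfolding k_def by (rule LeastI_ex[OF ex])
 have "2 ^ k * l < a"
 proof (cases k)
  case 0 then show ?thesis using assms by simp
 next
  case (Suc j)
  then have "\<not> a <= 2 ^ Suc j * l"
   unfolding k_def using not_less_Least[of j "%k. a <= 2 ^ Suc k * l"] by simp
  then show ?thesis by (simp add: Suc)
 qed
 with k1 that show ?thesis by blast
qed

lemma ennreal_le_suminf: "(t :: nat => ennreal) k <= (\<Sum>k. t k)"
 using sum_le_suminf[of t "{k}"] by simp

text \<open>On the shell 2^k l < |f| <= 2^(k + 1) l the power is at most (2^(k + 1) l)^s and the L2
  mass at most D (2^k l)^(-2 b). The products form a geometric series of ratio 2^(s - 2 b) <
  1.\<close>

lemma dyadic_tail_bound:
 fixes f :: "real^'n::finite => complex"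
 assumes f: "f \<in> L2" and l: "0 < l" and D: "0 <= D" and s: "0 <= s" "s < 2 * b"
  and dec: "!!m. l <= m ==> (L2_norm (cut m f))^2 <= D * m powr (- 2 * b)"
 shows "(NN x. ennreal (pw s f x) * indicator {x. l < cmod (f x)} x) \<le>
  ennreal (D * 2 powr s * l powr (s - 2 * b) / (1 - 2 powr (s - 2 * b)))"
proof -
 have [measurable]: "f \<in> borel_measurable borel" using f by (rule L2_measurable)
 have [measurable]: "cut m f \<in> borel_measurable borel" for m using L2_measurable[OF cut_L2(1)[OF f]] .
 let ?w = "%k. (2 ^ Suc k * l) powr s"
 let ?\<rho> = "2 powr (s - 2 * b)"
 have \<rho>: "0 < ?\<rho>" "?\<rho> < 1" using s powr_less_mono[of "s - 2 * b" 0 2] by simp_all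
 have pt: "ennreal (pw s f x) * indicator {x. l < cmod (f x)} x <= (\<Sum>k. ennreal (?w k * (cmod (cut (2 ^ k * l) f x))^2))" for x
 proof (cases "l < cmod (f x)")
  case True
  obtain k where k: "2 ^ k * l < cmod (f x)" "cmod (f x) <= 2 ^ Suc k * l"
   using dyadic_level[OF l True] .
  have "pw s f x <= ?w k * (cmod (cut (2 ^ k * l) f x))^2"
  proof -
   have "cut (2 ^ k * l) f x = f x" using k(1) by (simp add: cut_def)
   moreover have "cmod (f x) powr s <= ?w k" by (intro powr_mono2 s k) simp
   ultimately show ?thesis
    unfolding pw_def by (subst mult.commute) (simp add: mult_right_mono)
  qed
  then have "ennreal (pw s f x) <= ennreal (?w k * (cmod (cut (2 ^ k * l) f x))^2)" by (rule ennreal_leI)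
  also have "... <= (\<Sum>k. ennreal (?w k * (cmod (cut (2 ^ k * l) f x))^2))"
   by (rule ennreal_le_suminf)
  finally show ?thesis using True by simp
 qed simp
 have "(NN x. ennreal (pw s f x) * indicator {x. l < cmod (f x)} x) \<le>
   (NN x. (\<Sum>k. ennreal (?w k * (cmod (cut (2 ^ k * l) f x))^2)))"
  by (intro nn_integral_mono pt)
 also have "... = (\<Sum>k. \<integral>\<^sup>+x. ennreal (?w k * (cmod (cut (2 ^ k * l) f x))^2) \<partial>lborel)"
  by (rule nn_integral_suminf) measurable
 also have "... <= (\<Sum>k. ennreal (D * 2 powr s * l powr (s - 2 * b) * ?\<rho> ^ k))"
 proof (rule suminf_le)
  fix k
  have m: "0 < 2 ^ k * l" "l <= 2 ^ k * l" using l by auto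
  have "(NN x. ennreal (?w k * (cmod (cut (2 ^ k * l) f x))^2)) = ennreal (?w k) * ennreal ((L2_norm (cut (2 ^ k * l) f))^2)"
   unfolding nn_integral_L2[OF cut_L2(1)[OF f], symmetric]
   by (subst nn_integral_cmult[symmetric]) (auto simp: ennreal_mult)
  also have "... = ennreal (?w k * (L2_norm (cut (2 ^ k * l) f))^2)"
   by (simp add: ennreal_mult)
  also have "... <= ennreal (?w k * (D * (2 ^ k * l) powr (- 2 * b)))"
   by (intro ennreal_leI mult_left_mono dec m) simp
  also have "?w k * (D * (2 ^ k * l) powr (- 2 * b)) = D * 2 powr s * l powr (s - 2 * b) * ?\<rho> ^ k"
  proof -
   have "?w k = 2 powr s * (2 ^ k * l) powr s"
    using l by (simp add: powr_mult[symmetric] mult.assoc)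
   then have "?w k * (D * (2 ^ k * l) powr (- 2 * b)) = D * 2 powr s * ((2 ^ k * l) powr s * (2 ^ k * l) powr (- 2 * b))"
    by (simp only: mult_ac)
   also have "(2 ^ k * l) powr s * (2 ^ k * l) powr (- 2 * b) = (2 ^ k * l) powr (s - 2 * b)"
    by (simp add: powr_add[symmetric])
   also have "... = (2 ^ k) powr (s - 2 * b) * l powr (s - 2 * b)"
    using l by (simp add: powr_mult)
   also have "(2 ^ k :: real) powr (s - 2 * b) = ?\<rho> ^ k"
    by (simp add: powr_realpow[symmetric] powr_powr mult.commute powr_power)
   finally show ?thesis by (simp add: mult_ac)
  qed
  finally show "(NN x. ennreal (?w k * (cmod (cut (2 ^ k * l) f x))^2)) <= ennreal (D * 2 powr s * l powr (s - 2 * b) * ?\<rho> ^ k)" .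
 qed auto
 also have "... = ennreal (D * 2 powr s * l powr (s - 2 * b) * (1 / (1 - ?\<rho>)))"
 proof (rule suminf_ennreal_eq)
  show "(%k. D * 2 powr s * l powr (s - 2 * b) * ?\<rho> ^ k) sums (D * 2 powr s * l powr (s - 2 * b) * (1 / (1 - ?\<rho>)))"
   using \<rho> by (intro sums_mult geometric_sums) simp
 qed (use D in simp)
 finally show ?thesis by simp
qed

text \<open>The exponents produced by \<open>cut_decay_step\<close>. For n > 2 they increase to the
  fixed point 2/(n - 2), whose double is the critical 4/(n - 2); for n = 2 the k-th one is k. A tail
  of |f|^(s + 2) is summable once s is below twice the exponent, so finitely many steps suffice for
  each subcritical s.\<close>

primrec decay_exponent :: "nat => nat => real" where
 "decay_exponent n 0 = 0"
| "decay_exponent n (Suc k) = (2 / real n) * (decay_exponent n k + 1)"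

definition subcritical :: "nat => real => bool" where
 "subcritical n s \<longleftrightarrow> 2 <= n \<and> 0 < s \<and> (n = 2 \<or> s < 4 / (real n - 2))"

lemma decay_exponent_large:
 assumes "subcritical n s"
 obtains k where "s < 2 * decay_exponent n k"
proof (cases "n = 2")
 case True
 have "decay_exponent n k = real k" for k by (induction k) (simp_all add: True)
 moreover obtain k where "s < real k" using reals_Archimedean2 by blast
 ultimately show ?thesis using that[of k] by simp
next
 case False
 then have n: "real n > 2" and s: "s < 4 / (real n - 2)" using assms by (auto simp: subcritical_def)
 define \<rho> where "\<rho> = 2 / real n"
 define \<beta> where "\<beta> = 2 / (real n - 2)"
 have \<rho>\<beta>: "\<rho> * (\<beta> + 1) = \<beta>"
  using n by (simp add: \<rho>_def \<beta>_def field_simps)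
 \<comment> \<open>The recursion is affine with slope \<rho> < 1 and fixed point \<beta>, started at
   0.\<close>
 have "decay_exponent n k = \<beta> * (1 - \<rho> ^ k)" for k
 proof (induction k)
  case (Suc k)
  have "decay_exponent n (Suc k) = \<rho> * (\<beta> * (1 - \<rho> ^ k) + 1)"
   by (simp add: Suc \<rho>_def)
  also have "... = \<rho> * (\<beta> + 1) - \<beta> * \<rho> ^ Suc k"
   by (simp add: algebra_simps)
  finally show ?case unfolding \<rho>\<beta> by (simp add: algebra_simps)
 qed simp
 then have eq: "decay_exponent n k = (2 / (real n - 2)) * (1 - (2 / real n) ^ k)" for k
  unfolding \<rho>_def \<beta>_def .
 have "(%k. 2 * ((2 / (real n - 2)) * (1 - (2 / real n) ^ k))) ----> 2 * ((2 / (real n - 2)) * (1 - 0))"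
  using n by (intro tendsto_intros LIMSEQ_power_zero) auto
 then have "\<forall>\<^sub>F k in sequentially. s < 2 * ((2 / (real n - 2)) * (1 - (2 / real n) ^ k))"
  by (rule order_tendstoD) (use s in simp)
 then obtain k where "s < 2 * ((2 / (real n - 2)) * (1 - (2 / real n) ^ k))"
  using eventually_happens'[OF sequentially_bot] by blast
 then show ?thesis using that[of k] by (simp add: eq)
qed

lemma cut_decay:
 "\<exists>C\<ge>0. \<forall>f :: real^'n::finite => complex. lip2 M f --> L2_norm f <= M \<longrightarrow>
  (\<forall>l>0. L2_norm (cut l f) <= C * l powr (- decay_exponent CARD('n) k))"
proof (induction k)
 case 0
 have "\<forall>f :: real^'n => complex. lip2 M f --> L2_norm f <= M --> (\<forall>l>0. L2_norm (cut l f) <= max 0 M * l powr (- decay_exponent CARD('n) 0))"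
 proof (intro allI impI)
  fix f :: "real^'n => complex" and l :: real
  assume "lip2 M f" "L2_norm f <= M" "l > 0"
  then show "L2_norm (cut l f) <= max 0 M * l powr (- decay_exponent CARD('n) 0)"
   using cut_L2(2)[OF lip2_L2, of M f l] by simp
 qed
 then show ?case by (intro exI[of _ "max 0 M"]) simp
next
 case (Suc k)
 then show ?case using cut_decay_step[of M _ "decay_exponent CARD('n) k"] by (simp del: mult_minus_left) blast
qed

text \<open>Equi-integrability at high values, uniform on bounded sets of H1. It takes the place of
  the Sobolev embedding: together with L2 convergence it gives convergence of the integrals of
  |f|^(s + 2).\<close>

lemma uniform_tail:
 assumes sub: "subcritical CARD('n::finite) s" and \<eta>: "0 < \<eta>"
 obtains l where "l > 0" "!!f :: real^'n => complex. lip2 M f ==> L2_norm f <= M \<Longrightarrow>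
  (NN x. ennreal (pw s f x) * indicator {x. l < cmod (f x)} x) <= ennreal \<eta>"
proof -
 obtain k where k: "s < 2 * decay_exponent CARD('n) k"
  using decay_exponent_large[OF sub] .
 define b where "b = decay_exponent CARD('n) k"
 obtain C where C: "C >= 0" "!!(f :: real^'n => complex) l. lip2 M f ==> L2_norm f <= M ==> l > 0 ==> L2_norm (cut l f) <= C * l powr (- b)"
  using cut_decay[of M k, where 'n='n] by (auto simp: b_def)
 have s: "0 <= s" "s < 2 * b" using sub k by (auto simp: subcritical_def b_def)
 let ?c = "%l. C^2 * 2 powr s * l powr (s - 2 * b) / (1 - 2 powr (s - 2 * b))"
 have "(?c \<longlongrightarrow> C\<^sup>2 * 2 powr s * 0 / (1 - 2 powr (s - 2 * b))) at_top"
  using s powr_less_mono[of "s - 2 * b" 0 2] by (intro tendsto_intros tendsto_neg_powr) (auto simp: filterlim_ident)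
 then have "\<forall>\<^sub>F l in at_top. ?c l < \<eta>"
  by (rule order_tendstoD) (use \<eta> in simp)
 then have "\<forall>\<^sub>F l in at_top. ?c l < \<eta> \<and> 0 < l"
  by (rule eventually_conj[OF _ eventually_gt_at_top])
 then obtain l where l: "?c l < \<eta>" "0 < l"
  using eventually_happens'[OF trivial_limit_at_top_linorder] by blast
 have "(NN x. ennreal (pw s f x) * indicator {x. l < cmod (f x)} x) <= ennreal \<eta>"
  if f: "lip2 M f" and fM: "L2_norm f <= M" for f :: "real^'n => complex"
 proof -
  have "(NN x. ennreal (pw s f x) * indicator {x. l < cmod (f x)} x) <= ennreal (?c l)"
  proof (rule dyadic_tail_bound[OF lip2_L2[OF f] l(2) _ s])
   fix m assume "l <= m"
   then have m: "0 < m" using l(2) by simp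
   have "(L2_norm (cut m f))^2 <= (C * m powr (- b))^2"
    by (rule power_mono[OF C(2)[OF f fM m]]) simp
   also have "... = C^2 * m powr (- 2 * b)"
    by (simp add: power_mult_distrib powr_sq)
   finally show "(L2_norm (cut m f))^2 <= C^2 * m powr (- 2 * b)" .
  qed simp
  also have "... <= ennreal \<eta>" using l(1) by (intro ennreal_leI) simp
  finally show ?thesis .
 qed
 with l(2) that show ?thesis by blast
qed

lemma pw_split:
 fixes f :: "real^'n::finite => complex"
 assumes f: "f \<in> L2" and s: "0 <= s" and l: "0 < l"
 shows "(NN x. ennreal (pw s f x)) <= ennreal (l powr s * (L2_norm f)^2) +
  (NN x. ennreal (pw s f x) * indicator {x. l < cmod (f x)} x)"
proof -
 have [measurable]: "f \<in> borel_measurable borel" using f by (rule L2_measurable)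
 note [measurable] = pw_measurable[OF this]
 have "(NN x. ennreal (pw s f x)) \<le>
   (NN x. ennreal (l powr s) * ennreal ((cmod (f x))^2) + ennreal (pw s f x) * indicator {x. l < cmod (f x)} x)"
 proof (rule nn_integral_mono)
  fix x
  show "ennreal (pw s f x) <= ennreal (l powr s) * ennreal ((cmod (f x))^2) + ennreal (pw s f x) * indicator {x. l < cmod (f x)} x"
  proof (cases "l < cmod (f x)")
   case False
   then have "cmod (f x) powr s <= l powr s" using s by (intro powr_mono2) auto
   then have "pw s f x <= l powr s * (cmod (f x))^2"
    unfolding pw_def by (subst mult.commute) (rule mult_right_mono, auto)
   then show ?thesis using False by (simp add: ennreal_mult[symmetric] ennreal_leI)
  qed simp
 qed
 also have "... = (NN x. ennreal (l powr s) * ennreal ((cmod (f x))^2)) + (NN x. ennreal (pw s f x) * indicator {x. l < cmod (f x)} x)"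
  by (rule nn_integral_add) measurable
 also have "(NN x. ennreal (l powr s) * ennreal ((cmod (f x))^2)) = ennreal (l powr s * (L2_norm f)^2)"
  by (subst nn_integral_cmult) (auto simp: nn_integral_L2[OF f] ennreal_mult)
 finally show ?thesis .
qed

lemma pw_integrable:
 fixes f :: "real^'n::finite => complex"
 assumes sub: "subcritical CARD('n) s" and f: "lip2 K f"
 shows "integrable lborel (pw s f)"
proof -
 note fL = lip2_L2[OF f]
 have s: "0 <= s" using sub by (simp add: subcritical_def)
 define M where "M = max K (L2_norm f)"
 obtain l where l: "l > 0" "!!g :: real^'n => complex. lip2 M g ==> L2_norm g <= M \<Longrightarrow>
   (NN x. ennreal (pw s g x) * indicator {x. l < cmod (g x)} x) <= ennreal 1"
  using uniform_tail[OF sub, of 1 M] by auto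
 have "(NN x. ennreal (pw s f x)) <= ennreal (l powr s * (L2_norm f)^2) + ennreal 1"
  using pw_split[OF fL s l(1)] l(2)[OF lip2_mono[OF f]] unfolding M_def
  by (meson add_left_mono max.cobounded1 max.cobounded2 order_trans)
 also have "... < \<infinity>" by simp
 finally show ?thesis
  using pw_measurable[OF L2_measurable[OF fL], of s] by (simp add: integrable_iff_bounded pw_nonneg)
qed

text \<open>One application of \<open>cut_level_bound\<close> suffices for s < 4/n. It is linear in
  K, hence the tail is quadratic in K, with a coefficient that vanishes as the level grows; the part
  below the level is controlled by the mass alone. The small multiple of K^2 can then be absorbed by
  the kinetic energy.\<close>

lemma mass_subcritical_bound:
 assumes s: "0 < s" "s < 4 / real CARD('n::finite)" and \<eta>: "0 < \<eta>" and M: "0 <= M"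
 obtains A where "A >= 0" "!!(f :: real^'n => complex) K. lip2 K f ==> L2_norm f <= M \<Longrightarrow>
  (NN x. ennreal (pw s f x)) <= ennreal (\<eta> * K^2 + A)"
proof -
 define b where "b = 2 / real CARD('n)"
 define L where "L = (level_const TYPE('n))^2 * (2 * M) powr (2 * b)"
 have L: "0 <= L" by (simp add: L_def)
 have s2: "0 <= s" "s < 2 * b" using s by (auto simp: b_def)
 let ?c = "%l. L * 2 powr s * l powr (s - 2 * b) / (1 - 2 powr (s - 2 * b))"
 have "(?c \<longlongrightarrow> L * 2 powr s * 0 / (1 - 2 powr (s - 2 * b))) at_top"
  using s2 powr_less_mono[of "s - 2 * b" 0 2] by (intro tendsto_intros tendsto_neg_powr) (auto simp: filterlim_ident)
 then have "\<forall>\<^sub>F l in at_top. ?c l < \<eta>"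
  by (rule order_tendstoD) (use \<eta> in simp)
 then have "\<forall>\<^sub>F l in at_top. ?c l < \<eta> \<and> 0 < l"
  by (rule eventually_conj[OF _ eventually_gt_at_top])
 then obtain l where l: "?c l < \<eta>" "0 < l"
  using eventually_happens'[OF trivial_limit_at_top_linorder] by blast
 have "(NN x. ennreal (pw s f x)) <= ennreal (\<eta> * K^2 + l powr s * M^2)"
  if f: "lip2 K f" and fM: "L2_norm f <= M" for f :: "real^'n => complex" and K
 proof -
  note fL = lip2_L2[OF f]
  have "(NN x. ennreal (pw s f x) * indicator {x. l < cmod (f x)} x) \<le>
    ennreal ((K^2 * L) * 2 powr s * l powr (s - 2 * b) / (1 - 2 powr (s - 2 * b)))"
  proof (rule dyadic_tail_bound[OF fL l(2) _ s2])
   fix m assume "l <= m"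
   then have m: "0 < m" using l(2) by simp
   have "L2_norm (cut m f) <= level_const TYPE('n) * K * (2 * L2_norm f / m) powr b"
    unfolding b_def by (rule cut_level_bound[OF f m])
   also have "... <= level_const TYPE('n) * K * (2 * M / m) powr b"
    using fM m lip2_nonneg[OF f] level_const_nonneg[of "TYPE('n)"] by (intro mult_left_mono powr_mono2 divide_right_mono) (auto simp: b_def)
   finally have "(L2_norm (cut m f))^2 <= (level_const TYPE('n) * K * (2 * M / m) powr b)^2"
    by (rule power_mono) simp
   also have "... = (K^2 * L) * m powr (- 2 * b)"
    using m M by (simp add: L_def power_mult_distrib power_divide powr_sq powr_divide powr_minus_divide)
   finally show "(L2_norm (cut m f))^2 <= (K^2 * L) * m powr (- 2 * b)" .
  qed (use L in simp)
  also have "(K^2 * L) * 2 powr s * l powr (s - 2 * b) / (1 - 2 powr (s - 2 * b)) = ?c l * K^2"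
   by simp
  also have "ennreal (?c l * K^2) <= ennreal (\<eta> * K^2)"
   using l(1) by (intro ennreal_leI mult_right_mono) auto
  finally have 1: "(NN x. ennreal (pw s f x) * indicator {x. l < cmod (f x)} x) <= ennreal (\<eta> * K^2)" .
  have 2: "ennreal (l powr s * (L2_norm f)^2) <= ennreal (l powr s * M^2)"
   using fM by (intro ennreal_leI mult_left_mono power_mono) auto
  have "(NN x. ennreal (pw s f x)) <= ennreal (l powr s * M^2) + ennreal (\<eta> * K^2)"
   by (rule order_trans[OF pw_split[OF fL s2(1) l(2)] add_mono[OF 2 1]])
  then show ?thesis using \<eta> by (simp add: add.commute)
 qed
 then show ?thesis using that[of "l powr s * M^2"] by simp
qed

section \<open>Compactness in L2\<close>

lemma cball_sets_borel [measurable]: "cball a r \<in> sets borel"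
 by simp

text \<open>Ball averages of fixed radius are uniformly bounded and uniformly Lipschitz. A diagonal
  subsequence converges at a countable dense set of centres for every radius 1/(m + 1), hence
  uniformly on balls, and the averages approximate F in L2 at a rate common to all k. One
  subsequence serves all R.\<close>

lemma local_compactness:
 fixes F :: "nat => real^'n::finite => complex"
 assumes F: "!!k. lip2 M (F k)" "!!k. L2_norm (F k) <= M"
 shows "\<exists>r :: nat => nat. strict_mono r \<and> (\<forall>R. \<forall>e>0. \<exists>N. \<forall>k\<ge>N. \<forall>l\<ge>N.
  L2_norm (%x. cor (indicator (cball 0 R) x) * (F (r k) x - F (r l) x)) < e)"
proof -
 note FL = lip2_L2[OF F(1)]
 define h where "h m = inverse (real (Suc m))" for m
 have h: "h m > 0" "h m <= 1" for m by (simp_all add: h_def inverse_le_1_iff)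
 let ?V = "%e. measure lborel (ball (0::real^'n) e)"
 obtain D :: "(real^'n) set" where D: "countable D" "!!X. open X ==> X ~= {} ==> \<exists>d\<in>D. d \<in> X"
  using countable_dense_exists by blast
 have M: "0 <= M" using lip2_nonneg[OF F(1)] .
 define T where "T k p = (case p of (m, q) => ball_integral (h m) (F k) q)" for k and p :: "nat \<times> (real^'n)"
 have T: "norm (T k p) <= sqrt (?V 1) * M" for k p
 proof -
  obtain m q where p: "p = (m, q)" by (cases p)
  have "cmod (ball_integral (h m) (F k) q) <= sqrt (?V (h m)) * L2_norm (F k)" by (rule ball_integral_bound[OF FL h(1)])
  also have "... <= sqrt (?V 1) * M"
   using h[of m] by (intro mult_mono real_sqrt_le_mono measure_mono_fmeasurable F(2)) (auto intro!: fmeasurableI emeasure_bounded_finite)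
  finally show ?thesis by (simp add: p T_def)
 qed
 obtain r :: "nat => nat" where r: "strict_mono r" "!!p. p \<in> UNIV \<times> D ==> \<exists>l. (%k. T (r k) p) ----> l"
 proof (rule function_convergent_subsequence[of "UNIV \<times> D" T "sqrt (?V 1) * M"])
  show "countable ((UNIV :: nat set) \<times> D)" using D(1) by simp
  fix r :: "nat => nat"
  assume "strict_mono r" "!!p. p \<in> UNIV \<times> D ==> \<exists>l. (%k. T (r k) p) ----> l"
  then show thesis by (rule that)
 qed (rule T)
 have conv: "Cauchy (%k. ball_integral (h m) (F (r k)) q)" if q: "q \<in> D" for m q
 proof -
  have "(m, q) \<in> UNIV \<times> D" using q by simp
  from r(2)[OF this] obtain l where "(%k. T (r k) (m, q)) ----> l" ..
  then show ?thesis unfolding T_def prod.case by (rule LIMSEQ_imp_Cauchy)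
 qed
 have main: "\<exists>N. \<forall>k\<ge>N. \<forall>l\<ge>N. L2_norm (%x. cor (indicator (cball 0 R) x) * (F (r k) x - F (r l) x)) < e"
  if e: "0 < e" for R e
 proof -
  have "(%m. h m * M) ----> 0 * M"
   unfolding h_def by (intro tendsto_intros LIMSEQ_inverse_real_of_nat)
  then have "\<forall>\<^sub>F m in sequentially. h m * M < e / 4"
   by (rule order_tendstoD) (use e in simp)
  then obtain m where m: "h m * M < e / 4"
   using eventually_happens'[OF sequentially_bot] by blast
  let ?I = "%x. cor (indicator (cball (0::real^'n) R) x)"
  have IL: "?I \<in> L2" by (rule indicator_L2) auto
  define S where "S = L2_norm ?I"
  have S: "0 <= S" by (simp add: S_def)
  \<comment> \<open>Averages within d of each other on the ball cost at most d S <= e/4 in L2; the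
    two approximation errors cost e/4 each. The summand 1 covers S = 0.\<close>
  define d where "d = e / 4 / (S + 1)"
  have d: "d > 0" using e S by (simp add: d_def)
  define V where "V = ?V (h m)"
  have V: "V > 0" unfolding V_def by (rule content_ball_pos) (rule h)
  define L where "L = sqrt V * M"
  have L: "0 <= L" using M V by (simp add: L_def)
  \<comment> \<open>Moving to a centre within \<rho> changes each of the two ball integrals by at
    most d V/4, and convergence at the centres contributes d V/2, in total d V.\<close>
  define \<rho> where "\<rho> = d * V / (4 * (L + 1))"
  have \<rho>: "\<rho> > 0" using d V L by (simp add: \<rho>_def)
  have "4 * (L + 1) * \<rho> = d * V" using L by (simp add: \<rho>_def)
  then have L\<rho>: "L * \<rho> <= d * V / 4" using \<rho> by (simp add: algebra_simps)
  have cov: "cball 0 R \<subseteq> (\<Union>q\<in>D. ball q \<rho>)"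
  proof
   fix x :: "real^'n"
   obtain q where "q \<in> D" "q \<in> ball x \<rho>" using D(2)[of "ball x \<rho>"] \<rho> by auto
   then show "x \<in> (\<Union>q\<in>D. ball q \<rho>)" by (auto simp: dist_commute)
  qed
  obtain D' where D': "D' \<subseteq> D" "finite D'" "cball 0 R \<subseteq> (\<Union>q\<in>D'. ball q \<rho>)"
   by (rule compactE_image[OF compact_cball open_ball cov])
  have "\<forall>q. \<exists>N. q \<in> D --> (\<forall>k\<ge>N. \<forall>l\<ge>N. norm (ball_integral (h m) (F (r k)) q - ball_integral (h m) (F (r l)) q) < d * V / 2)"
   using conv[of _ m, unfolded Cauchy_iff] d V by (meson divide_pos_pos mult_pos_pos zero_less_numeral)
  then obtain N where N: "!!q k l. q \<in> D ==> k >= N q ==> l >= N q ==> norm (ball_integral (h m) (F (r k)) q - ball_integral (h m) (F (r l)) q) < d * V / 2"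
   by metis
  obtain N0 where N0: "!!q. q \<in> D' ==> N q <= N0"
   using finite_nat_set_iff_bounded_le[of "N ` D'"] D'(2) by blast
  have "L2_norm (%x. ?I x * (F (r k) x - F (r l) x)) < e" if kl: "k >= N0" "l >= N0" for k l
  proof -
   let ?P = "%k x. ball_integral (h m) (F (r k)) x / cor V"
   have Pm: "?P k \<in> borel_measurable borel" for k
    using ball_integral_measurable[OF L2_measurable[OF FL[of "r k"]], of "h m"] by measurable
   have bm: "(%x. ?I x * (?P k x - ?P l x)) \<in> borel_measurable borel"
    using Pm[of k] Pm[of l] by measurable
   have bd: "AE x in lborel. cmod (?I x * (?P k x - ?P l x)) <= d * cmod (?I x)"
   proof (rule AE_I2)
    fix x :: "real^'n"
    show "cmod (?I x * (?P k x - ?P l x)) <= d * cmod (?I x)"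
    proof (cases "norm x <= R")
     case True
     then obtain q where q: "q \<in> D'" "norm (x - q) < \<rho>" using D'(3) by (force simp: dist_norm norm_minus_commute)
     have lip: "cmod (ball_integral (h m) (F k) x - ball_integral (h m) (F k) q) <= d * V / 4" for k
      using ball_integral_lipschitz[OF F(1) h(1), of m k q "x - q"] mult_left_mono[OF less_imp_le[OF q(2)] L] L\<rho>
      by (simp add: L_def V_def)
     have "cmod (ball_integral (h m) (F (r k)) q - ball_integral (h m) (F (r l)) q) < d * V / 2"
      using N[of q k l] q(1) D'(1) N0[OF q(1)] kl by auto
     then have "cmod (ball_integral (h m) (F (r k)) x - ball_integral (h m) (F (r l)) x) <= d * V"
      using lip[of "r k"] lip[of "r l"]
       norm_triangle_ineq[of "(ball_integral (h m) (F (r k)) x - ball_integral (h m) (F (r k)) q) - (ball_integral (h m) (F (r l)) x - ball_integral (h m) (F (r l)) q)"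
        "ball_integral (h m) (F (r k)) q - ball_integral (h m) (F (r l)) q"]
       norm_triangle_ineq4[of "ball_integral (h m) (F (r k)) x - ball_integral (h m) (F (r k)) q" "ball_integral (h m) (F (r l)) x - ball_integral (h m) (F (r l)) q"]
      by simp
     then show ?thesis using True V by (simp add: diff_divide_distrib[symmetric] norm_divide divide_le_eq)
    qed simp
   qed
   note b = L2_dominated[OF IL bm bd less_imp_le[OF d]]
   have err: "(%x. ?I x * (?P k x - F (r k) x)) \<in> L2 \<and> L2_norm (%x. ?I x * (?P k x - F (r k) x)) <= e / 4" for k
   proof -
    have m1: "(%x. ?I x * (?P k x - F (r k) x)) \<in> borel_measurable borel"
     using Pm[of k] L2_measurable[OF FL[of "r k"]] by measurable
    have m2: "AE x in lborel. cmod (?I x * (?P k x - F (r k) x)) <= 1 * cmod (?P k x - F (r k) x)"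
     by (intro AE_I2) (auto simp: norm_mult split: split_indicator)
    have "L2_norm (%x. ?P k x - F (r k) x) <= e / 4"
     using lip2_ball_average_error(2)[OF F(1)[of "r k"] h(1)[of m]] m unfolding V_def by linarith
    then show ?thesis
     using L2_dominated[OF lip2_ball_average_error(1)[OF F(1)[of "r k"] h(1)[of m], folded V_def] m1 m2] by auto
   qed
   have "L2_norm (%x. ?I x * (F (r k) x - F (r l) x)) = L2_norm (%x. ?I x * (?P l x - F (r l) x) + (?I x * (?P k x - ?P l x) - ?I x * (?P k x - F (r k) x)))"
    by (rule arg_cong[where f=L2_norm]) (simp add: fun_eq_iff algebra_simps)
   also have "... <= L2_norm (%x. ?I x * (?P l x - F (r l) x)) + L2_norm (%x. ?I x * (?P k x - ?P l x) - ?I x * (?P k x - F (r k) x))"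
    by (rule L2_triangle[OF conjunct1[OF err] L2_diff[OF b(1) conjunct1[OF err]]])
   also have "... <= e / 4 + (d * S + e / 4)"
    by (rule add_mono[OF conjunct2[OF err[of l]]
       order_trans[OF L2_triangle_diff[OF b(1) conjunct1[OF err[of k]]] add_mono[OF b(2)[folded S_def] conjunct2[OF err[of k]]]]])
   also have "... < e"
   proof -
    have "d * S <= d * (S + 1)" using d by simp
    also have "... = e / 4" using S d_def nonzero_eq_divide_eq[of "S + 1" d "e / 4"] by simp
    finally show ?thesis using e by linarith
   qed
   finally show ?thesis .
  qed
  then show ?thesis by blast
 qed
 with r(1) show ?thesis by blast
qed

lemma tight_compactness:
 fixes F :: "nat => real^'n::finite => complex"
 assumes F: "!!k. lip2 M (F k)" "!!k. L2_norm (F k) <= M"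
  and tight: "!!e. 0 < e ==> \<exists>R. \<forall>k. L2_norm (%x. cor (1 - indicator (cball 0 R) x) * F k x) <= e"
 obtains r :: "nat => nat" and f where "strict_mono r" "f \<in> L2" "(%k. L2_norm (%x. F (r k) x - f x)) ----> 0"
proof -
 note FL = lip2_L2[OF F(1)]
 obtain r :: "nat => nat" where r: "strict_mono r"
  "!!R e. 0 < e ==> \<exists>N. \<forall>k\<ge>N. \<forall>l\<ge>N. L2_norm (%x. cor (indicator (cball 0 R) x) * (F (r k) x - F (r l) x)) < e"
  using local_compactness[of M F, OF F] by blast
 have "\<exists>N. \<forall>k\<ge>N. \<forall>l\<ge>N. L2_norm (%x. F (r k) x - F (r l) x) < e" if e: "0 < e" for e
 proof -
  obtain R where R: "!!k. L2_norm (%x. cor (1 - indicator (cball 0 R) x) * F k x) <= e / 4"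
   using tight[of "e / 4"] e by auto
  obtain N where N: "\<forall>k\<ge>N. \<forall>l\<ge>N. L2_norm (%x. cor (indicator (cball 0 R) x) * (F (r k) x - F (r l) x)) < e / 2"
   using r(2)[of "e / 2" R] e by auto
  let ?I = "%x. cor (indicator (cball (0::real^'n) R) x)"
  let ?J = "%x. cor (1 - indicator (cball (0::real^'n) R) x)"
  have "L2_norm (%x. F (r k) x - F (r l) x) < e" if kl: "k >= N" "l >= N" for k l
  proof -
   have dL: "(%x. F (r k) x - F (r l) x) \<in> L2" by (intro L2_diff FL)
   have I: "(%x. ?I x * g x) \<in> L2" if "g \<in> L2" for g
   proof (rule L2_dominated(1)[OF that, where K=1])
    show "(%x. ?I x * g x) \<in> borel_measurable borel" using L2_measurable[OF that] by measurable
   qed (auto simp: norm_mult split: split_indicator)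
   have J: "(%x. ?J x * g x) \<in> L2" if "g \<in> L2" for g
    using L2_diff[OF that I[OF that]] by (simp add: algebra_simps)
   have "L2_norm (%x. F (r k) x - F (r l) x) = L2_norm (%x. ?I x * (F (r k) x - F (r l) x) + (?J x * F (r k) x - ?J x * F (r l) x))"
    by (rule arg_cong[where f=L2_norm]) (simp add: fun_eq_iff algebra_simps)
   also have "... <= L2_norm (%x. ?I x * (F (r k) x - F (r l) x)) + L2_norm (%x. ?J x * F (r k) x - ?J x * F (r l) x)"
    by (rule L2_triangle[OF I[OF dL] L2_diff[OF J[OF FL] J[OF FL]]])
   also have "... < e / 2 + (e / 4 + e / 4)"
    by (rule add_less_le_mono[OF N[rule_format, OF kl] order_trans[OF L2_triangle_diff[OF J[OF FL[of "r k"]] J[OF FL[of "r l"]]] add_mono[OF R R]]])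
   finally show ?thesis by simp
  qed
  then show ?thesis by blast
 qed
 note Cau = this
 show ?thesis
 proof (rule L2_complete[of "%k. F (r k)", OF FL Cau])
  fix f :: "real^'n => complex" assume "f \<in> L2" "(%k. L2_norm (%x. F (r k) x - f x)) ----> 0"
  then show ?thesis by (rule that[OF r(1)])
 qed
qed

section \<open>The energy\<close>

lemma lip2_lincomb:
 assumes "lip2 K f" "lip2 L g"
 shows "lip2 (cmod a * K + cmod b * L) (%x. a * f x + b * g x)"
proof -
 note fL = lip2_L2[OF assms(1)] and gL = lip2_L2[OF assms(2)]
 have "shift_dist (%x. a * f x + b * g x) z <= (cmod a * K + cmod b * L) * norm z" for z
 proof -
  have "shift_dist (%x. a * f x + b * g x) z = L2_norm (%x. a * (f (x + z) - f x) + b * (g (x + z) - g x))"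
   unfolding shift_dist_def by (rule arg_cong[where f=L2_norm]) (simp add: fun_eq_iff algebra_simps)
  also have "... <= cmod a * shift_dist f z + cmod b * shift_dist g z"
   using L2_triangle[OF L2_cmult[OF L2_diff[OF L2_shift[OF fL] fL]] L2_cmult[OF L2_diff[OF L2_shift[OF gL] gL]], of a z b z]
   by (simp add: L2_norm_cmult shift_dist_def)
  also have "... <= cmod a * (K * norm z) + cmod b * (L * norm z)"
   by (intro add_mono mult_left_mono lip2_shift_dist assms) auto
  finally show ?thesis by (simp add: algebra_simps)
 qed
 then show ?thesis
  using lip2_nonneg[OF assms(1)] lip2_nonneg[OF assms(2)] L2_add[OF L2_cmult[OF fL] L2_cmult[OF gL]]
  by (simp add: lip2_def)
qed

section \<open>The energy space\<close>

definition radius_mult :: "(real^'n::finite => complex) => real^'n => complex" where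
 "radius_mult f x = cor (norm x) * f x"

lemma Sigma_H1: "f \<in> Sigma_space ==> f \<in> H1"
 and Sigma_radius_mult: "f \<in> Sigma_space ==> radius_mult f \<in> L2"
 by (auto simp: Sigma_space_def radius_mult_def[abs_def])

lemma Sigma_L2: "f \<in> Sigma_space ==> f \<in> L2"
 using Sigma_H1 H1_L2 by blast

lemma SigmaI: "f \<in> H1 ==> radius_mult f \<in> L2 ==> f \<in> Sigma_space"
 by (auto simp: Sigma_space_def radius_mult_def[abs_def])

lemma Sigma_norm_eq: "Sigma_norm f = sqrt (dirichlet f + (L2_norm (radius_mult f))^2 + (L2_norm f)^2)"
 by (simp add: Sigma_norm_def dirichlet_def radius_mult_def[abs_def])

lemma Sigma_norm_ge:
 "sqrt (dirichlet f) <= Sigma_norm f" "L2_norm (radius_mult f) <= Sigma_norm f" "L2_norm f <= Sigma_norm f"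
 unfolding Sigma_norm_eq using dirichlet_nonneg[of f] by (auto intro!: real_le_rsqrt)

lemma radius_mult_lincomb: "radius_mult (%x. a * f x + b * g x) = (%x. a * radius_mult f x + b * radius_mult g x)"
 by (auto simp: radius_mult_def fun_eq_iff algebra_simps)

lemma Sigma_lincomb:
 assumes "f \<in> Sigma_space" "g \<in> Sigma_space"
 shows "(%x. a * f x + b * g x) \<in> Sigma_space"
proof (rule SigmaI)
 show "(%x. a * f x + b * g x) \<in> H1" by (rule H1_lincomb(1)) (use assms Sigma_H1 in auto)
 show "radius_mult (%x. a * f x + b * g x) \<in> L2"
  unfolding radius_mult_lincomb by (intro L2_add L2_cmult Sigma_radius_mult assms)
qed

lemma Sigma_diff:
 assumes "f \<in> Sigma_space" "g \<in> Sigma_space"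
 shows "(%x. f x - g x) \<in> Sigma_space"
 using Sigma_lincomb[OF assms, of 1 "-1"] by simp

lemma Sigma_scale:
 assumes "f \<in> Sigma_space"
 shows "(%x. a * f x) \<in> Sigma_space"
 using Sigma_lincomb[OF assms assms, of a 0] by simp

lemma coord_mult_L2:
 assumes "radius_mult f \<in> L2" "f \<in> L2"
 shows "(%x. cor (x $ i) * f x) \<in> L2" "L2_norm (%x. cor (x $ i) * f x) <= L2_norm (radius_mult f)"
proof -
 have m: "(%x. cor (x $ i) * f x) \<in> borel_measurable borel"
  using L2_measurable[OF assms(2)] by measurable
 have ae: "AE x in lborel. cmod (cor (x $ i) * f x) <= 1 * cmod (radius_mult f x)"
  using component_le_norm_cart by (intro AE_I2) (auto simp: radius_mult_def norm_mult intro!: mult_right_mono)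
 show "(%x. cor (x $ i) * f x) \<in> L2" "L2_norm (%x. cor (x $ i) * f x) <= L2_norm (radius_mult f)"
  using L2_dominated[OF assms(1) m ae] by auto
qed

lemma half_sum_eq:
 fixes s1 s2 t1 t2 a b c d :: real
 assumes "s1 + s2 = a / 2 + b / 2" "t1 + t2 = c / 2 + d / 2"
 shows "(1/2 * s1 + t1) + (1/2 * s2 + t2) = (1/2 * a + c) / 2 + (1/2 * b + d) / 2"
 using assms by argo

text \<open>What the three cases have in common, with the range of p expressed through p - 1. The
  assumptions are also met by the pure power G(x, v) = v^(1 + s/2) without rotation, through which
  continuity of the integral of |f|^(s + 2) is obtained later.\<close>

locale rotating_nls =
 fixes e1 e2 :: "'n::finite"
  and \<gamma> \<Omega> \<kappa> p C' :: real
  and G :: "real ^ 'n => real => real"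
 assumes card2: "CARD('n) >= 2" and e12: "e1 ~= e2"
  and \<gamma>\<Omega>: "\<bar>\<Omega>\<bar> < \<gamma>" and \<kappa>: "\<kappa> \<in> {1, -1}"
  and G_nonneg: "!!x v. v >= 0 ==> G x v >= 0"
  and G_cont: "continuous_on (UNIV \<times> {0..}) (%(x, v). G x v)"
  and G_diff: "!!x. G x differentiable_on {0..}"
  and G_0: "!!x. G x 0 = 0"
  and C': "C' > 0" and sub: "subcritical CARD('n) (p - 1)"
  and G_deriv: "!!x v. v >= 0 ==> \<bar>deriv_v G x v\<bar> <= C' * (1 + v powr ((p - 1) / 2))"
begin

lemma p1: "p - 1 > 0"
 using sub by (simp add: subcritical_def)

lemma \<gamma>_pos: "0 < \<gamma>" and \<gamma>\<Omega>_sq: "\<Omega>^2 < \<gamma>^2"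
proof -
 show g: "0 < \<gamma>" using \<gamma>\<Omega> by linarith
 have "\<bar>\<Omega>\<bar>\<^sup>2 < \<gamma>^2" by (rule power_strict_mono[OF \<gamma>\<Omega>]) auto
 then show "\<Omega>^2 < \<gamma>^2" by simp
qed

text \<open>The mean value inequality on [0, m]. Since \<open>deriv_v\<close> is one-sided at 0, the
  derivative is taken within the half line and then restricted to the interval.\<close>

lemma G_difference:
 assumes "0 <= v" "v <= m" "0 <= w" "w <= m"
 shows "\<bar>G x v - G x w\<bar> <= C' * (1 + m powr ((p - 1) / 2)) * \<bar>v - w\<bar>"
proof -
 have hd: "(G x has_derivative (%h. h *\<^sub>R deriv_v G x u)) (at u within {0..})" if "0 <= u" for u
 proof -
  have "G x differentiable (at u within {0..})"
   using G_diff[of x] that by (simp add: differentiable_on_def)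
  then show ?thesis
   unfolding vector_derivative_works has_vector_derivative_def deriv_v_def .
 qed
 have "norm (G x v - G x w) <= C' * (1 + m powr ((p - 1) / 2)) * norm (v - w)"
 proof (rule differentiable_bound[where S="{0..m}" and f'="%u h. h *\<^sub>R deriv_v G x u"])
  fix u assume u: "u \<in> {0..m}"
  show "(G x has_derivative (%h. h *\<^sub>R deriv_v G x u)) (at u within {0..m})"
   by (rule has_derivative_subset[OF hd]) (use u in auto)
  show "onorm (%h. h *\<^sub>R deriv_v G x u) <= C' * (1 + m powr ((p - 1) / 2))"
  proof (rule onorm_bound)
   show "0 <= C' * (1 + m powr ((p - 1) / 2))" using C' by simp
   fix h
   have "\<bar>deriv_v G x u\<bar> <= C' * (1 + m powr ((p - 1) / 2))"
    using G_deriv[of u x] u C' p1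
    by (intro order_trans[OF G_deriv] mult_left_mono add_left_mono powr_mono2) auto
   then show "norm (h *\<^sub>R deriv_v G x u) <= C' * (1 + m powr ((p - 1) / 2)) * norm h"
    using mult_left_mono[of _ _ "\<bar>h\<bar>"] by (fastforce simp: abs_mult mult.commute)
  qed
 qed (use assms in auto)
 then show ?thesis by simp
qed

lemma sq_powr: "0 <= a ==> (a^2) powr ((p - 1) / 2) = a powr (p - 1)"
proof (cases "a = 0")
 case False
 assume "0 <= a"
 with False have "a^2 = a powr 2" by (simp add: powr_numeral)
 moreover have "2 * ((p - 1) / 2) = p - 1" by simp
 ultimately show ?thesis by (simp only: powr_powr)
qed simp

lemma G_bound: "0 <= a ==> G x (a^2) <= C' * (a^2 + a^2 * a powr (p - 1))"
 using G_difference[of "a^2" "a^2" 0 x] by (simp add: G_0 sq_powr algebra_simps)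

section \<open>The nonlinear term\<close>

definition potential :: "(real ^ 'n => complex) => real" where
 "potential f = (LBINT x. G x ((cmod (f x))^2))"

lemma G_measurable:
 assumes [measurable]: "f \<in> borel_measurable borel"
 shows "(%x. G x ((cmod (f x))^2)) \<in> borel_measurable borel"
proof -
 have "continuous_on UNIV (%z :: (real^'n) \<times> real. (fst z, max 0 (snd z)))"
  by (intro continuous_intros)
 from continuous_on_compose2[OF G_cont this]
 have "continuous_on UNIV (%z :: (real^'n) \<times> real. case (fst z, max 0 (snd z)) of (x, v) => G x v)"
  by (simp add: image_subset_iff)
 then have c: "continuous_on UNIV (%z :: (real^'n) \<times> real. G (fst z) (max 0 (snd z)))" by simp
 have "(%x. G x (max 0 ((cmod (f x))^2))) \<in> borel_measurable borel"
  by (rule borel_measurable_continuous_Pair[OF _ _ c]) measurable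
 then show ?thesis by simp
qed

lemma G_integrable:
 assumes "lip2 K f"
 shows "integrable lborel (%x. G x ((cmod (f x))^2))"
proof (rule Bochner_Integration.integrable_bound)
 show "integrable lborel (%x. C' * ((cmod (f x))^2 + pw (p - 1) f x))"
  by (intro integrable_mult_right Bochner_Integration.integrable_add L2_integrable[OF lip2_L2[OF assms]] pw_integrable[OF sub assms])
 show "(%x. G x ((cmod (f x))^2)) \<in> borel_measurable lborel"
  using G_measurable[OF L2_measurable[OF lip2_L2[OF assms]]] by simp
 show "AE x in lborel. norm (G x ((cmod (f x))^2)) <= norm (C' * ((cmod (f x))^2 + pw (p - 1) f x))"
  using G_bound[of "cmod (f x)" x for x] G_nonneg C' by (intro AE_I2) (simp add: pw_def)
qed

lemma pw_integral_eq:
 fixes f :: "real^'n => complex"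
 assumes "lip2 K f"
 shows "(NN x. ennreal (pw (p - 1) f x)) = ennreal (LBINT x. pw (p - 1) f x)"
 by (rule nn_integral_eq_integral[OF pw_integrable[OF sub assms]]) (simp add: pw_nonneg)

lemma potential_le:
 assumes "lip2 K f"
 shows "potential f <= C' * ((L2_norm f)^2 + (LBINT x. pw (p - 1) f x))"
proof -
 have "potential f <= (LBINT x. C' * ((cmod (f x))^2 + pw (p - 1) f x))"
  unfolding potential_def
 proof (rule integral_mono[OF G_integrable[OF assms]])
  show "integrable lborel (%x. C' * ((cmod (f x))^2 + pw (p - 1) f x))"
   by (intro integrable_mult_right Bochner_Integration.integrable_add L2_integrable[OF lip2_L2[OF assms]] pw_integrable[OF sub assms])
  show "G x ((cmod (f x))^2) <= C' * ((cmod (f x))^2 + pw (p - 1) f x)" for x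
   using G_bound[of "cmod (f x)" x] by (simp add: pw_def)
 qed
 also have "... = C' * ((L2_norm f)^2 + (LBINT x. pw (p - 1) f x))"
  using L2_integrable[OF lip2_L2[OF assms]] pw_integrable[OF sub assms] by (simp add: L2_norm_sq)
 finally show ?thesis .
qed

lemma potential_nonneg: "0 <= potential f"
 unfolding potential_def by (rule integral_nonneg_AE) (simp add: G_nonneg)

lemma potential_bounded:
 obtains B where "B >= 0" "!!f. lip2 M f ==> L2_norm f <= M ==> potential f <= B"
proof -
 obtain l where l: "l > 0" "!!f :: real^'n => complex. lip2 M f ==> L2_norm f <= M \<Longrightarrow>
  (NN x. ennreal (pw (p - 1) f x) * indicator {x. l < cmod (f x)} x) <= ennreal 1"
  using uniform_tail[OF sub, of 1 M] by auto
 define B where "B = C' * (M^2 + (l powr (p - 1) * M^2 + 1))"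
 have "potential f <= B" if f: "lip2 M f" and fM: "L2_norm f <= M" for f
 proof -
  have sq: "(L2_norm f)^2 <= M^2" using fM by (intro power_mono) auto
  have "ennreal (LBINT x. pw (p - 1) f x) <= ennreal (l powr (p - 1) * (L2_norm f)^2) + ennreal 1"
   unfolding pw_integral_eq[OF f, symmetric]
   by (rule order_trans[OF pw_split[OF lip2_L2[OF f] less_imp_le[OF p1] l(1)] add_left_mono[OF l(2)[OF f fM]]])
  also have "... = ennreal (l powr (p - 1) * (L2_norm f)^2 + 1)" by simp
  finally have "(LBINT x. pw (p - 1) f x) <= l powr (p - 1) * (L2_norm f)^2 + 1"
   by (subst (asm) ennreal_le_iff) auto
  also have "... <= l powr (p - 1) * M^2 + 1"
   by (intro add_right_mono mult_left_mono sq) simp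
  finally have "C' * ((L2_norm f)^2 + (LBINT x. pw (p - 1) f x)) <= B"
   unfolding B_def using sq C' by (intro mult_left_mono add_mono) auto
  then show ?thesis using potential_le[OF f] by linarith
 qed
 moreover have "B >= 0" using C' by (simp add: B_def)
 ultimately show ?thesis using that by blast
qed

text \<open>Below a level l the function G is Lipschitz in |f|^2, so the difference there is linear
  in the L2 distance; above it, both values are absorbed by the uniformly small tails. On bounded
  sets of H1, L2 closeness is therefore enough.\<close>

lemma potential_uniformly_continuous:
 assumes \<epsilon>: "0 < \<epsilon>" and M: "0 <= M"
 obtains \<delta> where "\<delta> > 0" "!!f g. lip2 M f ==> lip2 M g ==> L2_norm f <= M ==> L2_norm g <= M \<Longrightarrow>
  L2_norm (%x. f x - g x) <= \<delta> ==> \<bar>potential f - potential g\<bar> <= \<epsilon>"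
proof -
 \<comment> \<open>The two tails enter with total weight 4 C' \<eta> = \<epsilon>/2; the other half
   is left for the Lipschitz part.\<close>
 define \<eta> where "\<eta> = \<epsilon> / (8 * C')"
 have \<eta>: "\<eta> > 0" using \<epsilon> C' by (simp add: \<eta>_def)
 obtain l where l: "l > 0" "!!f :: real^'n => complex. lip2 M f ==> L2_norm f <= M \<Longrightarrow>
  (NN x. ennreal (pw (p - 1) f x) * indicator {x. l < cmod (f x)} x) <= ennreal \<eta>"
  using uniform_tail[OF sub \<eta>, of M] by auto
 define L where "L = C' * (1 + l powr (p - 1))"
 have L: "L > 0" using C' by (simp add: L_def add_pos_nonneg)
 define \<delta> where "\<delta> = (\<epsilon> / 2) / (L * (2 * M + 1))"
 have \<delta>: "\<delta> > 0" using \<epsilon> L M by (simp add: \<delta>_def)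
 let ?t = "%f x. pw (p - 1) f x * indicator {x. l < cmod (f x)} x"
 have tail: "integrable lborel (?t f)" "(LBINT x. ?t f x) <= \<eta>"
  if f: "lip2 M f" and fM: "L2_norm f <= M" for f :: "real^'n => complex"
 proof -
  have [measurable]: "f \<in> borel_measurable borel" by (rule L2_measurable[OF lip2_L2[OF f]])
  show i: "integrable lborel (?t f)"
   by (rule integrable_real_mult_indicator[OF _ pw_integrable[OF sub f]]) simp
  have "ennreal (LBINT x. ?t f x) = (NN x. ennreal (?t f x))"
   by (rule nn_integral_eq_integral[OF i, symmetric]) (simp add: pw_nonneg)
  also have "... = (NN x. ennreal (pw (p - 1) f x) * indicator {x. l < cmod (f x)} x)"
   by (intro nn_integral_cong) (auto split: split_indicator)
  also have "... <= ennreal \<eta>" by (rule l(2)[OF f fM])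
  finally show "(LBINT x. ?t f x) <= \<eta>" using \<eta> by (subst (asm) ennreal_le_iff) auto
 qed
 have "\<bar>potential f - potential g\<bar> <= \<epsilon>"
  if f: "lip2 M f" and g: "lip2 M g" and fM: "L2_norm f <= M" and gM: "L2_norm g <= M"
   and fg: "L2_norm (%x. f x - g x) <= \<delta>" for f g :: "real^'n => complex"
 proof -
  note fL = lip2_L2[OF f] and gL = lip2_L2[OF g]
  note dL = L2_diff[OF fL gL]
  let ?d = "%x. cmod (f x - g x) * cmod (f x) + cmod (f x - g x) * cmod (g x)"
  have id: "integrable lborel ?d"
   by (intro Bochner_Integration.integrable_add integrable_L2_cmod_mult dL fL gL)
  have pt: "\<bar>G x ((cmod (f x))^2) - G x ((cmod (g x))^2)\<bar> <= L * ?d x + C' * (2 * (?t f x + ?t g x))" for x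
  proof -
   define a b m where "a = cmod (f x)" and "b = cmod (g x)" and "m = max a b"
   have ab: "0 <= a" "0 <= b" "a <= m" "b <= m" "0 <= m" by (auto simp: a_def b_def m_def le_max_iff_disj)
   have m2: "a^2 <= m^2" "b^2 <= m^2" using ab by (auto intro: power_mono)
   have dab: "\<bar>a\<^sup>2 - b^2\<bar> <= ?d x"
   proof -
    have "\<bar>a\<^sup>2 - b^2\<bar> = \<bar>a - b\<bar> * (a + b)"
     using ab by (simp add: power2_eq_square square_diff_square_factored abs_mult)
    also have "... <= cmod (f x - g x) * (a + b)"
     using norm_triangle_ineq3[of "f x" "g x"] ab by (intro mult_right_mono) (auto simp: a_def b_def)
    finally show ?thesis by (simp add: a_def b_def distrib_left)
   qed
   have G1: "\<bar>G x (a^2) - G x (b^2)\<bar> <= C' * (1 + m powr (p - 1)) * \<bar>a\<^sup>2 - b^2\<bar>"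
    using G_difference[of "a^2" "m^2" "b^2" x] m2 by (simp add: sq_powr[OF ab(5)])
   have t0: "0 <= ?t f x" "0 <= ?t g x" by (auto simp: pw_nonneg)
   show ?thesis
   proof (cases "m <= l")
    case True
    have "C' * (1 + m powr (p - 1)) <= L"
     unfolding L_def using C' True ab p1 by (intro mult_left_mono add_left_mono powr_mono2) auto
    then have "C' * (1 + m powr (p - 1)) * \<bar>a\<^sup>2 - b^2\<bar> <= L * ?d x"
     using L dab by (intro mult_mono) auto
    moreover have "0 <= C' * (2 * (?t f x + ?t g x))" using t0 C' by simp
    ultimately show ?thesis using G1 by (simp add: a_def b_def)
   next
    case False
    \<comment> \<open>The larger of the two moduli exceeds l, so its own tail density already is
      m^(p + 1).\<close>
    have "m^2 * m powr (p - 1) <= ?t f x + ?t g x"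
    proof (cases "a <= b")
     case True
     then have "m = b" by (simp add: m_def)
     then have "?t g x = m^2 * m powr (p - 1)" using False by (simp add: pw_def b_def)
     then show ?thesis using t0 by simp
    next
     case False': False
     then have "m = a" by (simp add: m_def)
     then have "?t f x = m^2 * m powr (p - 1)" using False by (simp add: pw_def a_def)
     then show ?thesis using t0 by simp
    qed
    moreover have "\<bar>a\<^sup>2 - b^2\<bar> * m powr (p - 1) <= m^2 * m powr (p - 1)"
     using m2 ab by (intro mult_right_mono) (auto simp: abs_le_iff intro: order_trans[OF _ m2(1)] order_trans[OF _ m2(2)])
    ultimately have "\<bar>a\<^sup>2 - b^2\<bar> * m powr (p - 1) <= ?t f x + ?t g x" by (rule order_trans[rotated])
    also have "... <= 2 * (?t f x + ?t g x)" using add_nonneg_nonneg[OF t0] by (simp only: mult_2 le_add_same_cancel1)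
    finally have "\<bar>a\<^sup>2 - b^2\<bar> * m powr (p - 1) <= 2 * (?t f x + ?t g x)" .
    then have 1: "C' * (\<bar>a\<^sup>2 - b^2\<bar> * m powr (p - 1)) <= C' * (2 * (?t f x + ?t g x))"
     using C' by (intro mult_left_mono) auto
    have "C' <= L" using C' by (simp add: L_def)
    then have 2: "C' * \<bar>a\<^sup>2 - b^2\<bar> <= L * ?d x" using L dab by (intro mult_mono) auto
    have "C' * (1 + m powr (p - 1)) * \<bar>a\<^sup>2 - b^2\<bar> = C' * \<bar>a\<^sup>2 - b^2\<bar> + C' * (\<bar>a\<^sup>2 - b^2\<bar> * m powr (p - 1))"
     by (simp add: algebra_simps)
    then show ?thesis using G1 1 2 by (simp add: a_def b_def)
   qed
  qed
  have "\<bar>potential f - potential g\<bar> = \<bar>\<integral>x. G x ((cmod (f x))^2) - G x ((cmod (g x))^2) \<partial>lborel\<bar>"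
   unfolding potential_def using G_integrable[OF f] G_integrable[OF g] by simp
  also have "... <= (LBINT x. \<bar>G x ((cmod (f x))^2) - G x ((cmod (g x))^2)\<bar>)"
   by (rule integral_abs_bound)
  also have "... <= (LBINT x. L * ?d x + C' * (2 * (?t f x + ?t g x)))"
   using G_integrable[OF f] G_integrable[OF g] id tail(1)[OF f fM] tail(1)[OF g gM] by (intro integral_mono pt) auto
  also have "... = L * (LBINT x. ?d x) + C' * (2 * ((LBINT x. ?t f x) + (LBINT x. ?t g x)))"
  proof -
   have "(LBINT x. L * ?d x + C' * (2 * (?t f x + ?t g x))) = (LBINT x. L * ?d x) + (LBINT x. C' * (2 * (?t f x + ?t g x)))"
    by (intro Bochner_Integration.integral_add integrable_mult_right id Bochner_Integration.integrable_add tail(1) f g fM gM)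
   then show ?thesis
    unfolding integral_mult_right_zero Bochner_Integration.integral_add[OF tail(1)[OF f fM] tail(1)[OF g gM]] .
  qed
  also have "... <= L * (\<delta> * (2 * M)) + C' * (2 * (\<eta> + \<eta>))"
  proof (intro add_mono mult_left_mono tail f g fM gM)
   have "(LBINT x. ?d x) = (LBINT x. cmod (f x - g x) * cmod (f x)) + (LBINT x. cmod (f x - g x) * cmod (g x))"
    by (intro Bochner_Integration.integral_add integrable_L2_cmod_mult dL fL gL)
   also have "... <= L2_norm (%x. f x - g x) * L2_norm f + L2_norm (%x. f x - g x) * L2_norm g"
    by (intro add_mono L2_Cauchy_Schwarz_cmod dL fL gL)
   also have "... <= \<delta> * M + \<delta> * M"
    using fg fM gM \<delta> by (intro add_mono mult_mono) auto
   also have "... = \<delta> * (2 * M)" by simp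
   finally show "(LBINT x. ?d x) <= \<delta> * (2 * M)" .
  qed (use L C' in auto)
  also have "... <= \<epsilon>"
  proof -
   have "L * (2 * M + 1) ~= 0" using L M by simp
   then have "L * (2 * M + 1) * \<delta> = \<epsilon> / 2" using \<delta>_def nonzero_eq_divide_eq[of "L * (2 * M + 1)" \<delta> "\<epsilon> / 2"] by (metis mult.commute)
   moreover have "L * (\<delta> * (2 * M)) <= L * (2 * M + 1) * \<delta>" using L \<delta> by (simp add: algebra_simps)
   moreover have "C' * (2 * (\<eta> + \<eta>)) = \<epsilon> / 2" using C' by (simp add: \<eta>_def)
   ultimately show ?thesis by linarith
  qed
  finally show ?thesis .
 qed
 with \<delta> that show ?thesis by blast
qed

section \<open>Completion of the square\<close>

definition vector_potential :: "'n => real^'n => real" where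
 "vector_potential j x = (if j = e1 then - \<Omega> * x $ e2 else if j = e2 then \<Omega> * x $ e1 else 0)"

definition mag_grad :: "'n => (real^'n => complex) => real^'n => complex" where
 "mag_grad j f x = weak_partial j f x - \<i> * cor (vector_potential j x) * f x"

text \<open>The harmonic potential minus half the square of the vector potential, the amount that
  the completed square adds. As the vector potential acts in one plane only, the trap is
  anisotropic.\<close>

definition trap :: "real^'n => real" where
 "trap x = \<gamma>^2/2 * (norm x)^2 - \<Omega>^2/2 * ((x $ e1)^2 + (x $ e2)^2)"

definition trap_mult :: "(real^'n => complex) => real^'n => complex" where
 "trap_mult f x = cor (sqrt (trap x)) * f x"

definition quad :: "(real^'n => complex) => real" where
 "quad f = 1/2 * (\<Sum>j\<in>UNIV. (L2_norm (mag_grad j f))^2) + (L2_norm (trap_mult f))^2"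

lemma trap_bounds: "(\<gamma>^2 - \<Omega>^2)/2 * (norm x)^2 <= trap x" "trap x <= \<gamma>^2/2 * (norm x)^2" "0 <= trap x"
proof -
 have "(norm x)^2 = (\<Sum>i\<in>UNIV. (x $ i)^2)"
  unfolding norm_vec_def L2_set_def by (simp add: sum_nonneg)
 moreover have "(\<Sum>i\<in>{e1, e2}. (x $ i)^2) <= (\<Sum>i\<in>UNIV. (x $ i)^2)"
  by (intro sum_mono2) auto
 ultimately have "(x $ e1)^2 + (x $ e2)^2 <= (norm x)^2" using e12 by simp
 then have "\<Omega>^2/2 * ((x $ e1)^2 + (x $ e2)^2) <= \<Omega>^2/2 * (norm x)^2"
  by (intro mult_left_mono) auto
 then show 1: "(\<gamma>^2 - \<Omega>^2)/2 * (norm x)^2 <= trap x"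
  by (simp add: trap_def field_simps)
 show "trap x <= \<gamma>^2/2 * (norm x)^2" by (simp add: trap_def)
 have "0 <= (\<gamma>^2 - \<Omega>^2)/2 * (norm x)^2" using \<gamma>\<Omega>_sq by simp
 with 1 show "0 <= trap x" by linarith
qed

lemma trap_measurable [measurable]: "trap \<in> borel_measurable borel"
 unfolding trap_def[abs_def] by measurable

lemma vector_potential_measurable [measurable]: "vector_potential j \<in> borel_measurable borel"
 unfolding vector_potential_def[abs_def] by measurable

lemma vector_potential_bound: "\<bar>vector_potential j x\<bar> <= \<bar>\<Omega>\<bar> * norm x"
 using component_le_norm_cart[of x e1] component_le_norm_cart[of x e2]
 by (auto simp: vector_potential_def abs_mult intro: mult_left_mono)

lemma trap_mult_L2:
 assumes f: "f \<in> L2" and X: "radius_mult f \<in> L2"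
 shows "trap_mult f \<in> L2" "L2_norm (trap_mult f) <= \<gamma> * L2_norm (radius_mult f)"
  "(\<gamma>^2 - \<Omega>^2)/2 * (L2_norm (radius_mult f))^2 <= (L2_norm (trap_mult f))^2"
proof -
 have [measurable]: "f \<in> borel_measurable borel" by (rule L2_measurable[OF f])
 have m: "trap_mult f \<in> borel_measurable borel" unfolding trap_mult_def[abs_def] by measurable
 have "sqrt (trap x) <= \<gamma> * norm x" for x
 proof (rule real_le_lsqrt)
  have "trap x <= \<gamma>^2/2 * (norm x)^2" by (rule trap_bounds)
  also have "... <= (\<gamma> * norm x)^2" by (simp add: power_mult_distrib)
  finally show "trap x <= (\<gamma> * norm x)^2" .
 qed (use \<gamma>_pos in simp)
 then have "AE x in lborel. cmod (trap_mult f x) <= \<gamma> * cmod (radius_mult f x)"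
  using trap_bounds(3) \<gamma>_pos
  by (intro AE_I2) (auto simp: trap_mult_def radius_mult_def norm_mult mult.assoc[symmetric] intro!: mult_right_mono)
 from L2_dominated[OF X m this] \<gamma>_pos
 show L: "trap_mult f \<in> L2" and "L2_norm (trap_mult f) <= \<gamma> * L2_norm (radius_mult f)" by auto
 have "(\<gamma>^2 - \<Omega>^2)/2 * (L2_norm (radius_mult f))^2 = (LBINT x. (\<gamma>^2 - \<Omega>^2)/2 * (cmod (radius_mult f x))^2)"
  by (simp add: L2_norm_sq)
 also have "... <= (LBINT x. (cmod (trap_mult f x))^2)"
 proof (rule integral_mono)
  show "(\<gamma>^2 - \<Omega>^2)/2 * (cmod (radius_mult f x))^2 <= (cmod (trap_mult f x))^2" for x
   using mult_right_mono[OF trap_bounds(1)[of x], of "(cmod (f x))^2"] trap_bounds(3)[of x]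
   by (simp add: radius_mult_def trap_mult_def norm_mult power_mult_distrib mult.assoc)
 qed (use L2_integrable[OF X] L2_integrable[OF L] in auto)
 finally show "(\<gamma>^2 - \<Omega>^2)/2 * (L2_norm (radius_mult f))^2 <= (L2_norm (trap_mult f))^2"
  by (simp add: L2_norm_sq)
qed

lemma potential_mult_L2:
 assumes f: "f \<in> L2" and X: "radius_mult f \<in> L2"
 shows "(%x. \<i> * cor (vector_potential j x) * f x) \<in> L2"
  "L2_norm (%x. \<i> * cor (vector_potential j x) * f x) <= \<bar>\<Omega>\<bar> * L2_norm (radius_mult f)"
proof -
 have [measurable]: "f \<in> borel_measurable borel" by (rule L2_measurable[OF f])
 have m: "(%x. \<i> * cor (vector_potential j x) * f x) \<in> borel_measurable borel" by measurable
 have ae: "AE x in lborel. cmod (\<i> * cor (vector_potential j x) * f x) <= \<bar>\<Omega>\<bar> * cmod (radius_mult f x)"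
  using vector_potential_bound
  by (intro AE_I2) (auto simp: radius_mult_def norm_mult mult.assoc[symmetric] intro!: mult_right_mono)
 from L2_dominated[OF X m ae]
 show "(%x. \<i> * cor (vector_potential j x) * f x) \<in> L2"
  "L2_norm (%x. \<i> * cor (vector_potential j x) * f x) <= \<bar>\<Omega>\<bar> * L2_norm (radius_mult f)" by auto
qed

lemma mag_grad_L2:
 assumes "f \<in> Sigma_space"
 shows "mag_grad j f \<in> L2"
 unfolding mag_grad_def[abs_def]
 by (intro L2_diff H1_weak_partial(1) Sigma_H1 potential_mult_L2 Sigma_L2 Sigma_radius_mult assms)

lemma weak_partial_le_mag_grad:
 assumes f: "f \<in> Sigma_space"
 shows "L2_norm (weak_partial j f) <= L2_norm (mag_grad j f) + \<bar>\<Omega>\<bar> * L2_norm (radius_mult f)"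
  "L2_norm (mag_grad j f) <= L2_norm (weak_partial j f) + \<bar>\<Omega>\<bar> * L2_norm (radius_mult f)"
proof -
 note P = potential_mult_L2[OF Sigma_L2[OF f] Sigma_radius_mult[OF f], of j]
 show "L2_norm (weak_partial j f) <= L2_norm (mag_grad j f) + \<bar>\<Omega>\<bar> * L2_norm (radius_mult f)"
  using L2_triangle[OF mag_grad_L2[OF f, of j] P(1)] P(2) by (simp add: mag_grad_def)
 show "L2_norm (mag_grad j f) <= L2_norm (weak_partial j f) + \<bar>\<Omega>\<bar> * L2_norm (radius_mult f)"
  using L2_triangle_diff[OF H1_weak_partial(1)[OF Sigma_H1[OF f], of j] P(1)] P(2) by (simp add: mag_grad_def[abs_def])
qed

lemma quad_nonneg: "0 <= quad f"
 by (simp add: quad_def sum_nonneg)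

text \<open>The order matters: the trap bounds the norm of |x| f because \<Omega>^2 < \<gamma>^2,
  and only then can the vector potential, at most |\<Omega>| |x|, be moved from the magnetic
  gradient to recover the ordinary one.\<close>

lemma quad_coercive:
 obtains K where "K > 0" "!!f. f \<in> Sigma_space ==> dirichlet f + (L2_norm (radius_mult f))^2 <= K * quad f"
proof -
 define w where "w = 2 / (\<gamma>^2 - \<Omega>^2)"
 have w: "w > 0" using \<gamma>\<Omega>_sq by (simp add: w_def)
 define K where "K = 4 + 2 * real CARD('n) * \<Omega>^2 * w + w"
 have "dirichlet f + (L2_norm (radius_mult f))^2 <= K * quad f" if f: "f \<in> Sigma_space" for f
 proof -
  let ?X = "L2_norm (radius_mult f)"
  have t: "(L2_norm (trap_mult f))^2 <= quad f" by (simp add: quad_def sum_nonneg)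
  have "(\<gamma>^2 - \<Omega>^2)/2 * ?X^2 <= quad f"
   using trap_mult_L2(3)[OF Sigma_L2[OF f] Sigma_radius_mult[OF f]] t by linarith
  then have "w * ((\<gamma>^2 - \<Omega>^2)/2 * ?X^2) <= w * quad f"
   using w by (intro mult_left_mono) auto
  then have X: "?X^2 <= w * quad f"
   using \<gamma>\<Omega>_sq by (simp add: w_def)
  have "dirichlet f = (\<Sum>j\<in>UNIV. (L2_norm (weak_partial j f))^2)"
   by (rule dirichlet_eq[OF Sigma_H1[OF f]])
  also have "... <= (\<Sum>j\<in>UNIV. 2 * (L2_norm (mag_grad j f))^2 + 2 * (\<Omega>^2 * ?X^2))"
  proof (rule sum_mono)
   fix j
   have "(L2_norm (weak_partial j f))^2 <= (L2_norm (mag_grad j f) + \<bar>\<Omega>\<bar> * ?X)^2"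
    by (intro power_mono weak_partial_le_mag_grad(1)[OF f]) simp
   also have "... <= 2 * (L2_norm (mag_grad j f))^2 + 2 * (\<bar>\<Omega>\<bar> * ?X)^2"
    using sum_squares_bound[of "L2_norm (mag_grad j f)" "\<bar>\<Omega>\<bar> * ?X"] by (simp add: power2_sum)
   finally show "(L2_norm (weak_partial j f))^2 <= 2 * (L2_norm (mag_grad j f))^2 + 2 * (\<Omega>^2 * ?X^2)"
    by (simp add: power_mult_distrib)
  qed
  also have "... = 2 * (\<Sum>j\<in>UNIV. (L2_norm (mag_grad j f))^2) + real CARD('n) * (2 * (\<Omega>^2 * ?X^2))"
   by (simp add: sum.distrib sum_distrib_left)
  also have "... <= 4 * quad f + real CARD('n) * (2 * (\<Omega>^2 * (w * quad f)))"
   by (intro add_mono mult_left_mono X) (auto simp: quad_def)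
  finally show ?thesis using X by (simp add: K_def algebra_simps)
 qed
 moreover have "K > 0" using w by (auto simp: K_def intro!: add_pos_nonneg add_nonneg_pos)
 ultimately show ?thesis using that by blast
qed

text \<open>The weak derivatives are chosen representatives, linear only up to null sets; hence the
  identity is one of norms.\<close>

lemma mag_grad_lincomb:
 assumes "f \<in> Sigma_space" "g \<in> Sigma_space"
 shows "L2_norm (mag_grad j (%x. a * f x + b * g x)) = L2_norm (%x. a * mag_grad j f x + b * mag_grad j g x)"
proof (rule L2_norm_cong_AE)
 show "mag_grad j (%x. a * f x + b * g x) \<in> borel_measurable borel"
  by (rule L2_measurable[OF mag_grad_L2[OF Sigma_lincomb[OF assms]]])
 show "(%x. a * mag_grad j f x + b * mag_grad j g x) \<in> borel_measurable borel"
  by (rule L2_measurable[OF L2_add[OF L2_cmult[OF mag_grad_L2] L2_cmult[OF mag_grad_L2]]]) fact+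
 show "AE x in lborel. cmod (mag_grad j (%x. a * f x + b * g x) x) = cmod (a * mag_grad j f x + b * mag_grad j g x)"
  using H1_lincomb(2)[OF Sigma_H1[OF assms(1)] Sigma_H1[OF assms(2)], of j a b]
  by eventually_elim (simp add: mag_grad_def algebra_simps)
qed

lemma trap_mult_lincomb: "trap_mult (%x. a * f x + b * g x) = (%x. a * trap_mult f x + b * trap_mult g x)"
 by (auto simp: trap_mult_def fun_eq_iff algebra_simps)

lemma quad_parallelogram:
 assumes f: "f \<in> Sigma_space" and g: "g \<in> Sigma_space"
 shows "quad (%x. (1/2) * f x + (1/2) * g x) + quad (%x. (1/2) * f x + (-1/2) * g x) = quad f / 2 + quad g / 2"
proof -
 have p: "(L2_norm (%x. (1/2) * u x + (1/2) * v x))^2 + (L2_norm (%x. (1/2) * u x + (-1/2) * v x))^2 =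
   (L2_norm u)\<^sup>2 / 2 + (L2_norm v)^2 / 2" if "u \<in> L2" "v \<in> L2" for u v :: "real^'n => complex"
  using L2_parallelogram[OF L2_cmult[OF that(1), of "1/2"] L2_cmult[OF that(2), of "1/2"], unfolded L2_norm_cmult]
  by (simp add: power_divide)
 have t: "trap_mult u \<in> L2" if "u \<in> Sigma_space" for u
  by (intro trap_mult_L2 Sigma_L2 Sigma_radius_mult that)
 have "(\<Sum>j\<in>UNIV. (L2_norm (%x. (1/2) * mag_grad j f x + (1/2) * mag_grad j g x))^2)
   + (\<Sum>j\<in>UNIV. (L2_norm (%x. (1/2) * mag_grad j f x + (-1/2) * mag_grad j g x))^2)
   = (\<Sum>j\<in>UNIV. (L2_norm (mag_grad j f))^2 / 2 + (L2_norm (mag_grad j g))^2 / 2)"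
  unfolding sum.distrib[symmetric] by (intro sum.cong refl p mag_grad_L2 f g)
 also have "... = (\<Sum>j\<in>UNIV. (L2_norm (mag_grad j f))^2) / 2 + (\<Sum>j\<in>UNIV. (L2_norm (mag_grad j g))^2) / 2"
  by (simp add: sum.distrib sum_divide_distrib)
 finally show ?thesis
  unfolding quad_def mag_grad_lincomb[OF f g] trap_mult_lincomb
  by (rule half_sum_eq[OF _ p[OF t[OF f] t[OF g]]])
qed

lemma quad_scale:
 assumes f: "f \<in> Sigma_space"
 shows "quad (%x. a * f x) = (cmod a)^2 * quad f"
proof -
 have "L2_norm (mag_grad j (%x. a * f x)) = cmod a * L2_norm (mag_grad j f)" for j
  using mag_grad_lincomb[OF f f, of j a 0] by (simp add: L2_norm_cmult)
 moreover have "L2_norm (trap_mult (%x. a * f x)) = cmod a * L2_norm (trap_mult f)"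
  using trap_mult_lincomb[of a f 0 f] by (simp add: L2_norm_cmult)
 ultimately show ?thesis
  by (simp add: quad_def power_mult_distrib sum_distrib_left[symmetric] algebra_simps)
qed

lemma Sigma_lip2:
 assumes "f \<in> Sigma_space" "sqrt (dirichlet f) <= M"
 shows "lip2 M f"
 by (rule lip2_mono[OF lip2_H1[OF Sigma_H1[OF assms(1)]] assms(2)])

text \<open>Pointwise expansion of |d_j f - i A_j f|^2: the cross terms reproduce the rotation term,
  and the terms in A_j^2 are compensated in \<open>trap\<close>. The integral may be split because
  each term is separately integrable on the energy space.\<close>

lemma energy_eq:
 assumes f: "f \<in> Sigma_space"
 shows "energy e1 e2 \<Omega> \<gamma> \<kappa> G f = quad f - \<kappa> * potential f"
proof -
 note fL = Sigma_L2[OF f] and X = Sigma_radius_mult[OF f] and D = H1_weak_partial(1)[OF Sigma_H1[OF f]]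
 have Gi: "integrable lborel (%x. G x ((cmod (f x))^2))"
  by (rule G_integrable[OF Sigma_lip2[OF f order_refl]])
 have gi: "integrable lborel (%x. (norm (weak_grad f x))^2)"
  unfolding norm_vec_sq weak_grad_def by (simp add: L2_integrable[OF D])
 have xi: "integrable lborel (%x. (norm x)^2 * (cmod (f x))^2)"
  using L2_integrable[OF X] by (simp add: radius_mult_def norm_mult power_mult_distrib)
 have li: "integrable lborel (%x. cnj (f x) * Lz e1 e2 f x)"
 proof -
  have "integrable lborel (%x. cnj (cor (x $ i) * f x) * weak_partial j f x)" for i j
   by (intro integrable_L2_mult L2_cnj coord_mult_L2(1) X fL D)
  then have "integrable lborel (%x. \<i> * (cnj (cor (x $ e2) * f x) * weak_partial e1 f x
    - cnj (cor (x $ e1) * f x) * weak_partial e2 f x))"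
   by (intro integrable_mult_right Bochner_Integration.integrable_diff)
  then show ?thesis by (simp add: Lz_def algebra_simps)
 qed
 let ?r = "%x. 1/2 * (norm (weak_grad f x))^2 + \<gamma>^2/2 * (norm x)^2 * (cmod (f x))^2 - \<kappa> * G x ((cmod (f x))^2)"
 have ri: "integrable lborel ?r"
  using gi xi Gi by (intro Bochner_Integration.integrable_diff Bochner_Integration.integrable_add)
   (auto simp: mult.assoc)
 have ci: "integrable lborel (%x. cor (?r x) - cor \<Omega> * cnj (f x) * Lz e1 e2 f x)"
  using li ri by (intro Bochner_Integration.integrable_diff) (auto simp: mult.assoc simp del: of_real_diff of_real_add)
 let ?q = "%x. 1/2 * (\<Sum>j\<in>UNIV. (cmod (mag_grad j f x))^2) + (cmod (trap_mult f x))^2"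
 have pt: "Re (cor (?r x) - cor \<Omega> * cnj (f x) * Lz e1 e2 f x) = ?q x - \<kappa> * G x ((cmod (f x))^2)" for x
 proof -
  let ?d = "%j. weak_partial j f x" and ?A = "%j. vector_potential j x"
  have sq: "(cmod (mag_grad j f x))^2 = (cmod (?d j))^2 + ((?A j)^2 * (cmod (f x))^2 + 2 * ?A j * (Re (?d j) * Im (f x) - Im (?d j) * Re (f x)))" for j
   unfolding mag_grad_def cmod_power2 by (simp add: power2_eq_square algebra_simps)
  have s2: "(\<Sum>j\<in>UNIV. (?A j)^2 * (cmod (f x))^2 + 2 * ?A j * (Re (?d j) * Im (f x) - Im (?d j) * Re (f x))) =
    \<Omega>\<^sup>2 * ((x $ e1)^2 + (x $ e2)^2) * (cmod (f x))^2
    + 2 * (- \<Omega> * x $ e2) * (Re (?d e1) * Im (f x) - Im (?d e1) * Re (f x))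
    + 2 * (\<Omega> * x $ e1) * (Re (?d e2) * Im (f x) - Im (?d e2) * Re (f x))" (is "sum ?t UNIV = _")
  proof -
   have "sum ?t UNIV = sum ?t {e1, e2}"
    by (rule sum.mono_neutral_right) (auto simp: vector_potential_def)
   also have "... = ?t e1 + ?t e2" using e12 by simp
   also have "... = \<Omega>^2 * ((x $ e1)^2 + (x $ e2)^2) * (cmod (f x))^2
    + 2 * (- \<Omega> * x $ e2) * (Re (?d e1) * Im (f x) - Im (?d e1) * Re (f x))
    + 2 * (\<Omega> * x $ e1) * (Re (?d e2) * Im (f x) - Im (?d e2) * Re (f x))"
    using e12 by (simp add: vector_potential_def power_mult_distrib algebra_simps)
   finally show ?thesis .
  qed
  have tm: "(cmod (trap_mult f x))^2 = trap x * (cmod (f x))^2"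
   using trap_bounds(3)[of x] by (simp add: trap_mult_def norm_mult power_mult_distrib)
  have wg: "(norm (weak_grad f x))^2 = (\<Sum>j\<in>UNIV. (cmod (?d j))^2)"
   by (simp add: norm_vec_sq weak_grad_def)
  have lz: "Re (cor \<Omega> * cnj (f x) * Lz e1 e2 f x) =
   \<Omega> * (x $ e2 * (Re (?d e1) * Im (f x) - Im (?d e1) * Re (f x)) - x $ e1 * (Re (?d e2) * Im (f x) - Im (?d e2) * Re (f x)))"
   by (simp add: Lz_def algebra_simps)
  show ?thesis
   unfolding minus_complex.sel(1) Re_complex_of_real lz wg sq sum.distrib[of "%j. (cmod (?d j))^2"] s2 tm trap_def
   by (simp add: algebra_simps)
 qed
 have qi: "integrable lborel ?q"
  using L2_integrable[OF mag_grad_L2[OF f]] L2_integrable[OF trap_mult_L2(1)[OF fL X]]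
  by (intro Bochner_Integration.integrable_add integrable_mult_right Bochner_Integration.integrable_sum)
 have "energy e1 e2 \<Omega> \<gamma> \<kappa> G f = (LBINT x. Re (cor (?r x) - cor \<Omega> * cnj (f x) * Lz e1 e2 f x))"
  unfolding energy_def by (rule integral_Re[OF ci, symmetric])
 also have "... = (LBINT x. ?q x - \<kappa> * G x ((cmod (f x))^2))"
  unfolding pt ..
 also have "... = (LBINT x. ?q x) - \<kappa> * potential f"
  unfolding potential_def using Gi by (subst Bochner_Integration.integral_diff[OF qi]) auto
 also have "(LBINT x. ?q x) = quad f"
  unfolding quad_def L2_norm_sq
  using L2_integrable[OF mag_grad_L2[OF f]] L2_integrable[OF trap_mult_L2(1)[OF fL X]]
  by (subst Bochner_Integration.integral_add) (auto simp: Bochner_Integration.integral_sum)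
 finally show ?thesis .
qed

end

section \<open>Convergence in the energy space\<close>

lemma L2_norm_weak_partial_le:
 assumes "f \<in> H1"
 shows "L2_norm (weak_partial j f) <= sqrt (dirichlet f)"
proof (rule real_le_rsqrt)
 show "(L2_norm (weak_partial j f))^2 <= dirichlet f"
  unfolding dirichlet_eq[OF assms] by (rule member_le_sum) auto
qed

lemma weak_partial_diff_le:
 assumes "f \<in> H1" "g \<in> H1"
 shows "L2_norm (%x. weak_partial j f x - weak_partial j g x) <= sqrt (dirichlet (%x. f x - g x))"
proof -
 have h: "(%x. f x - g x) \<in> H1" using H1_lincomb(1)[OF assms, of 1 "-1"] by simp
 have "L2_norm (%x. weak_partial j f x - weak_partial j g x) = L2_norm (weak_partial j (%x. f x - g x))"
 proof (rule L2_norm_cong_AE)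
  show "(%x. weak_partial j f x - weak_partial j g x) \<in> borel_measurable borel"
   by (rule L2_measurable[OF L2_diff[OF H1_weak_partial(1) H1_weak_partial(1)]]) fact+
  show "weak_partial j (%x. f x - g x) \<in> borel_measurable borel"
   by (rule L2_measurable[OF H1_weak_partial(1)[OF h]])
  show "AE x in lborel. cmod (weak_partial j f x - weak_partial j g x) = cmod (weak_partial j (%x. f x - g x) x)"
   using H1_lincomb(2)[OF assms, of j 1 "-1"] by (auto elim!: eventually_mono)
 qed
 also have "... <= sqrt (dirichlet (%x. f x - g x))" by (rule L2_norm_weak_partial_le[OF h])
 finally show ?thesis .
qed

text \<open>Closedness of the gradient and of multiplication by |x|. The L2 limits of the gradients
  are identified by testing, those of |x| u_k through an a.e. convergent subsequence, and both must
  belong to the limit f already given.\<close>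

lemma Sigma_complete:
 fixes u :: "nat => real^'n::finite => complex"
 assumes u: "!!k. u k \<in> Sigma_space" and f: "f \<in> L2" "(%k. L2_norm (%x. u k x - f x)) ----> 0"
  and Cau: "!!e. 0 < e ==> \<exists>N. \<forall>k\<ge>N. \<forall>l\<ge>N.
   dirichlet (%x. u k x - u l x) + (L2_norm (radius_mult (%x. u k x - u l x)))^2 < e^2"
 shows "f \<in> Sigma_space" "(%k. Sigma_norm (%x. u k x - f x)) ----> 0"
proof -
 have uH: "u k \<in> H1" and uL: "u k \<in> L2" and uX: "radius_mult (u k) \<in> L2" and uD: "weak_partial j (u k) \<in> L2"
  and uW: "is_weak_partial j (u k) (weak_partial j (u k))" for k j
  using Sigma_H1[OF u] Sigma_L2[OF u] Sigma_radius_mult[OF u] H1_weak_partial[OF Sigma_H1[OF u]] by auto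
 have rd: "radius_mult (%x. u k x - u l x) = (%x. radius_mult (u k) x - radius_mult (u l) x)" for k l
  using radius_mult_lincomb[of 1 "u k" "-1" "u l"] by simp
 have "\<exists>g. g \<in> L2 \<and> (%k. L2_norm (%x. weak_partial j (u k) x - g x)) ----> 0" for j
 proof -
  have "\<exists>N. \<forall>k\<ge>N. \<forall>l\<ge>N. L2_norm (%x. weak_partial j (u k) x - weak_partial j (u l) x) < e" if e: "0 < e" for e
  proof -
   obtain N where N: "\<forall>k\<ge>N. \<forall>l\<ge>N. dirichlet (%x. u k x - u l x) + (L2_norm (radius_mult (%x. u k x - u l x)))^2 < e^2"
    using Cau[OF e] by blast
   have "L2_norm (%x. weak_partial j (u k) x - weak_partial j (u l) x) < e" if "k >= N" "l >= N" for k l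
   proof -
    have "dirichlet (%x. u k x - u l x) < e^2"
     by (rule le_less_trans[OF _ N[rule_format, OF that]]) simp
    then have "sqrt (dirichlet (%x. u k x - u l x)) < e"
     using e real_less_lsqrt dirichlet_nonneg by (metis less_imp_le)
    then show ?thesis using weak_partial_diff_le[OF uH[of k] uH[of l], of j] by simp
   qed
   then show ?thesis by blast
  qed
  note C = this
  show ?thesis
   by (rule L2_complete[of "%k. weak_partial j (u k)", OF uD C]) (assumption, rule exI, rule conjI)
 qed
 then obtain g where gL: "!!j. g j \<in> L2" and glim: "!!j. (%k. L2_norm (%x. weak_partial j (u k) x - g j x)) ----> 0"
  by metis
 have "\<exists>Y. Y \<in> L2 \<and> (%k. L2_norm (%x. radius_mult (u k) x - Y x)) ----> 0"
 proof -
  have "\<exists>N. \<forall>k\<ge>N. \<forall>l\<ge>N. L2_norm (%x. radius_mult (u k) x - radius_mult (u l) x) < e" if e: "0 < e" for e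
  proof -
   obtain N where N: "\<forall>k\<ge>N. \<forall>l\<ge>N. dirichlet (%x. u k x - u l x) + (L2_norm (radius_mult (%x. u k x - u l x)))^2 < e^2"
    using Cau[OF e] by blast
   have "L2_norm (%x. radius_mult (u k) x - radius_mult (u l) x) < e" if "k >= N" "l >= N" for k l
   proof (rule power_less_imp_less_base[of _ 2])
    show "(L2_norm (%x. radius_mult (u k) x - radius_mult (u l) x))^2 < e^2"
     using N[rule_format, OF that] dirichlet_nonneg[of "%x. u k x - u l x"] unfolding rd by simp
   qed (use e in simp)
   then show ?thesis by blast
  qed
  note C = this
  show ?thesis
   by (rule L2_complete[of "%k. radius_mult (u k)", OF uX C]) (assumption, rule exI, rule conjI)
 qed
 then obtain Y where YL: "Y \<in> L2" and Ylim: "(%k. L2_norm (%x. radius_mult (u k) x - Y x)) ----> 0"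
  by blast
 have gW: "is_weak_partial j f (g j)" for j
  unfolding is_weak_partial_def
 proof (intro allI impI)
  fix \<phi> :: "real^'n => complex" assume \<phi>: "test_function \<phi>"
  have 1: "(%k. \<integral>x. u k x * partial_deriv j \<phi> x \<partial>lborel) ----> (LBINT x. f x * partial_deriv j \<phi> x)"
   by (intro L2_mult_tendsto uL f test_function_L2 test_function_partial_deriv \<phi>)
  have "(%k. - (LBINT x. weak_partial j (u k) x * \<phi> x)) ----> - (LBINT x. g j x * \<phi> x)"
   by (intro tendsto_minus L2_mult_tendsto uD gL glim test_function_L2 \<phi>)
  moreover have "- (LBINT x. weak_partial j (u k) x * \<phi> x) = (LBINT x. u k x * partial_deriv j \<phi> x)" for k
   using uW[of j k] \<phi> by (simp add: is_weak_partial_def)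
  ultimately show "(LBINT x. f x * partial_deriv j \<phi> x) = - (LBINT x. g j x * \<phi> x)"
   using 1 LIMSEQ_unique by fastforce
 qed
 have fH: "f \<in> H1" by (rule H1I[OF f(1) gL gW])
 have XY: "AE x in lborel. radius_mult f x = Y x"
 proof -
  obtain r1 where r1: "strict_mono (r1 :: nat => nat)" "AE x in lborel. (%k. u (r1 k) x) ----> f x"
   using L2_tendsto_AE_subseq[OF uL f] .
  have "(%k. L2_norm (%x. radius_mult (u (r1 k)) x - Y x)) ----> 0"
   using LIMSEQ_subseq_LIMSEQ[OF Ylim r1(1)] by (simp add: comp_def)
  then obtain r2 where r2: "strict_mono (r2 :: nat => nat)" "AE x in lborel. (%k. radius_mult (u (r1 (r2 k))) x) ----> Y x"
   using L2_tendsto_AE_subseq[of "%k. radius_mult (u (r1 k))", OF uX YL] by blast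
  show ?thesis
   using r1(2) r2(2)
  proof eventually_elim
   case (elim x)
   have "(%k. u (r1 (r2 k)) x) ----> f x"
    using LIMSEQ_subseq_LIMSEQ[OF elim(1) r2(1)] by (simp add: comp_def)
   then have "(%k. radius_mult (u (r1 (r2 k))) x) ----> radius_mult f x"
    unfolding radius_mult_def by (intro tendsto_intros)
   then show ?case using elim(2) LIMSEQ_unique by blast
  qed
 qed
 have Xm: "radius_mult f \<in> borel_measurable borel"
 proof -
  have [measurable]: "f \<in> borel_measurable borel" by (rule L2_measurable[OF f(1)])
  show ?thesis unfolding radius_mult_def[abs_def] by measurable
 qed
 have fX: "radius_mult f \<in> L2"
  by (rule L2_cong_AE[OF YL Xm XY])
 show fS: "f \<in> Sigma_space" by (rule SigmaI[OF fH fX])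
 have "dirichlet (%x. u k x - f x) = (\<Sum>j\<in>UNIV. (L2_norm (%x. weak_partial j (u k) x - g j x))^2)" for k
 proof (rule dirichlet_eqI)
  show "(%x. u k x - f x) \<in> L2" by (rule L2_diff[OF uL f(1)])
  show "(%x. weak_partial j (u k) x - g j x) \<in> L2" for j by (rule L2_diff[OF uD gL])
  show "is_weak_partial j (%x. u k x - f x) (%x. weak_partial j (u k) x - g j x)" for j
   using is_weak_partial_lincomb[OF uL[of k] f(1) uD[of j k] gL[of j] uW[of j k] gW[of j], where a=1 and b="-1"] by simp
 qed
 moreover have "L2_norm (radius_mult (%x. u k x - f x)) = L2_norm (%x. radius_mult (u k) x - Y x)" for k
 proof (rule L2_norm_cong_AE)
  have eq: "radius_mult (%x. u k x - f x) = (%x. radius_mult (u k) x - radius_mult f x)"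
   using radius_mult_lincomb[of 1 "u k" "-1" f] by simp
  show "radius_mult (%x. u k x - f x) \<in> borel_measurable borel"
   unfolding eq by (rule L2_measurable[OF L2_diff[OF uX fX]])
  show "(%x. radius_mult (u k) x - Y x) \<in> borel_measurable borel" by (rule L2_measurable[OF L2_diff[OF uX YL]])
  show "AE x in lborel. cmod (radius_mult (%x. u k x - f x) x) = cmod (radius_mult (u k) x - Y x)"
   unfolding eq using XY by eventually_elim simp
 qed
 moreover have "(%k. sqrt ((\<Sum>j\<in>UNIV. (L2_norm (%x. weak_partial j (u k) x - g j x))^2)
   + (L2_norm (%x. radius_mult (u k) x - Y x))^2 + (L2_norm (%x. u k x - f x))^2)) ----> sqrt ((\<Sum>j\<in>(UNIV::'n set). 0^2) + 0^2 + 0^2)"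
  by (intro tendsto_real_sqrt tendsto_add tendsto_sum tendsto_power glim Ylim f)
 ultimately show "(%k. Sigma_norm (%x. u k x - f x)) ----> 0"
  by (simp add: Sigma_norm_eq)
qed

context rotating_nls
begin

abbreviation "E \<equiv> energy e1 e2 \<Omega> \<gamma> \<kappa> G"

lemma energy_continuous:
 assumes u: "!!k. u k \<in> Sigma_space" and f: "f \<in> Sigma_space"
  and lim: "(%k::nat. Sigma_norm (%x. u k x - f x)) ----> 0"
 shows "(%k. E (u k)) ----> E f" "(%k. L2_norm (u k)) ----> L2_norm f"
proof -
 let ?s = "%k. Sigma_norm (%x. u k x - f x)"
 have dS: "(%x. u k x - f x) \<in> Sigma_space" for k by (rule Sigma_diff[OF u f])
 have null: "X ----> x" if "!!k. \<bar>X k - x\<bar> <= c * ?s k" for X :: "nat => real" and x c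
 proof (rule LIM_zero_cancel, rule Lim_null_comparison)
  show "\<forall>\<^sub>F k in sequentially. norm (X k - x) <= c * ?s k" using that by simp
  show "(%k. c * ?s k) ----> 0" using tendsto_mult_left[OF lim, of c] by simp
 qed
 have l2: "L2_norm (%x. u k x - f x) <= ?s k" for k by (rule Sigma_norm_ge)
 show "(%k. L2_norm (u k)) ----> L2_norm f"
 proof (rule null[where c=1])
  show "\<bar>L2_norm (u k) - L2_norm f\<bar> <= 1 * ?s k" for k
   using L2_triangle_rev[OF Sigma_L2[OF u] Sigma_L2[OF f], of k] l2[of k] by simp
 qed
 have m: "(%k. L2_norm (mag_grad j (u k))) ----> L2_norm (mag_grad j f)" for j
 proof (rule null[where c="1 + \<bar>\<Omega>\<bar>"])
  fix k
  have "\<bar>L2_norm (mag_grad j (u k)) - L2_norm (mag_grad j f)\<bar> <= L2_norm (%x. mag_grad j (u k) x - mag_grad j f x)"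
   by (rule L2_triangle_rev[OF mag_grad_L2[OF u] mag_grad_L2[OF f]])
  also have "... = L2_norm (mag_grad j (%x. u k x - f x))"
   using mag_grad_lincomb[OF u f, of j 1 k "-1"] by simp
  also have "... <= L2_norm (weak_partial j (%x. u k x - f x)) + \<bar>\<Omega>\<bar> * L2_norm (radius_mult (%x. u k x - f x))"
   by (rule weak_partial_le_mag_grad(2)[OF dS])
  also have "... <= ?s k + \<bar>\<Omega>\<bar> * ?s k"
   by (intro add_mono mult_left_mono order_trans[OF L2_norm_weak_partial_le[OF Sigma_H1[OF dS]]] Sigma_norm_ge) auto
  finally show "\<bar>L2_norm (mag_grad j (u k)) - L2_norm (mag_grad j f)\<bar> <= (1 + \<bar>\<Omega>\<bar>) * ?s k"
   by (simp add: distrib_right)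
 qed
 have t: "(%k. L2_norm (trap_mult (u k))) ----> L2_norm (trap_mult f)"
 proof (rule null[where c=\<gamma>])
  fix k
  have "\<bar>L2_norm (trap_mult (u k)) - L2_norm (trap_mult f)\<bar> <= L2_norm (%x. trap_mult (u k) x - trap_mult f x)"
   by (intro L2_triangle_rev trap_mult_L2 Sigma_L2 Sigma_radius_mult u f)
  also have "... = L2_norm (trap_mult (%x. u k x - f x))"
   using trap_mult_lincomb[of 1 "u k" "-1" f] by simp
  also have "... <= \<gamma> * L2_norm (radius_mult (%x. u k x - f x))"
   by (rule trap_mult_L2(2)[OF Sigma_L2[OF dS] Sigma_radius_mult[OF dS]])
  also have "... <= \<gamma> * ?s k"
   using \<gamma>_pos by (intro mult_left_mono Sigma_norm_ge) auto
  finally show "\<bar>L2_norm (trap_mult (u k)) - L2_norm (trap_mult f)\<bar> <= \<gamma> * ?s k" .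
 qed
 have q: "(%k. quad (u k)) ----> quad f"
  unfolding quad_def by (intro tendsto_intros m t)
 have "(%k. potential (u k)) ----> potential f"
 proof (rule LIMSEQ_I)
  fix \<epsilon> :: real assume \<epsilon>: "0 < \<epsilon>"
  define M where "M = Sigma_norm f + 1"
  have M: "0 <= M" using Sigma_norm_ge(3)[of f] L2_norm_nonneg[of f] by (simp add: M_def del: L2_norm_nonneg)
  obtain \<delta> where \<delta>: "\<delta> > 0" "!!f g. lip2 M f ==> lip2 M g ==> L2_norm f <= M ==> L2_norm g <= M \<Longrightarrow>
   L2_norm (%x. f x - g x) <= \<delta> ==> \<bar>potential f - potential g\<bar> <= \<epsilon>/2"
   using potential_uniformly_continuous[of "\<epsilon>/2" M] \<epsilon> M by auto
  obtain N where "\<forall>k\<ge>N. norm (?s k - 0) < min 1 \<delta>"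
   using LIMSEQ_D[OF lim, of "min 1 \<delta>"] \<delta>(1) by auto
  then have N: "?s k < min 1 \<delta>" if "k >= N" for k
   using that by (fastforce simp: abs_less_iff)
  have "norm (potential (u k) - potential f) < \<epsilon>" if k: "k >= N" for k
  proof -
   have lf: "lip2 (Sigma_norm f) f" by (rule Sigma_lip2[OF f Sigma_norm_ge(1)])
   have ld: "lip2 1 (%x. u k x - f x)"
    by (rule Sigma_lip2[OF dS]) (use N[OF k] Sigma_norm_ge(1)[of "%x. u k x - f x"] in linarith)
   have lu: "lip2 M (u k)"
    using lip2_lincomb[OF lf ld, of 1 1] by (simp add: M_def)
   have nu: "L2_norm (u k) <= M"
    using L2_triangle[OF Sigma_L2[OF f] Sigma_L2[OF dS[of k]]] N[OF k] Sigma_norm_ge(3)[of f] l2[of k] by (simp add: M_def)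
   have nf: "L2_norm f <= M" using Sigma_norm_ge(3)[of f] by (simp add: M_def)
   have "\<bar>potential (u k) - potential f\<bar> <= \<epsilon>/2"
    by (rule \<delta>(2)[OF lu lip2_mono[OF lf] nu nf]) (use N[OF k] l2[of k] in "auto simp: M_def")
   then show ?thesis using \<epsilon> by simp
  qed
  then show "\<exists>no. \<forall>n\<ge>no. norm (potential (u n) - potential f) < \<epsilon>" by blast
 qed
 then show "(%k. E (u k)) ----> E f"
  unfolding energy_eq[OF u] energy_eq[OF f] by (intro tendsto_intros q)
qed

text \<open>The bound extends to masses up to some c' > c, because the sequences to which it is
  applied have masses that only converge to c.\<close>

definition coercive_near :: "real => bool" where
 "coercive_near c \<longleftrightarrow> (\<exists>c'>c. \<exists>\<delta>>0. \<exists>K. \<forall>f\<in>Sigma_space. L2_norm f <= c' --> \<delta> * quad f - K <= E f)"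

lemma \<kappa>_le: "a <= b + \<bar>x - y\<bar> ==> \<kappa> * x <= \<kappa> * y + \<bar>x - y\<bar>"
 using \<kappa> by auto

text \<open>Cauchyness of a minimising sequence for the quadratic part of the energy, obtained by comparing
 the mean of two members, rescaled to mass \<open>c\<close>, with the minimum.\<close>

lemma quad_midpoint:
 assumes c: "c > 0" and low: "!!f. f \<in> Sigma_space ==> L2_norm f = c ==> I <= E f"
  and M: "c <= M" and \<epsilon>: "\<epsilon> > 0"
 obtains \<tau> where "\<tau> > 0" "!!f g. f \<in> Sigma_space ==> g \<in> Sigma_space ==> lip2 M f ==> lip2 M g \<Longrightarrow>
  L2_norm f <= M ==> L2_norm g <= M ==> \<bar>L2_norm f - c\<bar> <= \<tau> ==> \<bar>L2_norm g - c\<bar> <= \<tau> \<Longrightarrow>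
  L2_norm (%x. f x - g x) <= \<tau> ==> E f <= I + \<epsilon> ==> E g <= I + \<epsilon> ==> quad (%x. f x - g x) <= 12 * \<epsilon>"
proof -
 have M0: "0 <= 2 * M" using M c by simp
 obtain B where B: "B >= 0" "!!f. lip2 (2 * M) f ==> L2_norm f <= 2 * M ==> potential f <= B"
  using potential_bounded[of "2 * M"] by blast
 obtain \<delta> where \<delta>: "\<delta> > 0" "!!f g. lip2 (2 * M) f ==> lip2 (2 * M) g ==> L2_norm f <= 2 * M ==> L2_norm g <= 2 * M \<Longrightarrow>
   L2_norm (%x. f x - g x) <= \<delta> ==> \<bar>potential f - potential g\<bar> <= \<epsilon>"
  using potential_uniformly_continuous[OF \<epsilon> M0] by blast
 define D where "D = \<bar>I\<bar> + B + 1"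
 have D: "D > 0" using B(1) by (simp add: D_def)
 \<comment> \<open>The bound c/4 keeps the mass of the mean between c/2 and 2 c; \<delta>/4 makes
   the distance from f or g to the rescaled mean, at most 3 \<tau>, admissible for
   \<open>potential\<close>; the last bound limits the error of rescaling \<open>quad\<close> to
   \<epsilon>, as D dominates |T|.\<close>
 define \<tau> where "\<tau> = min (c / 4) (min (\<delta> / 4) (\<epsilon> * c / (6 * D)))"
 have \<tau>: "\<tau> > 0" "\<tau> <= c / 4" "\<tau> <= \<delta> / 4" "\<tau> <= \<epsilon> * c / (6 * D)"
  using c \<delta>(1) \<epsilon> D by (auto simp: \<tau>_def)
 have "quad (%x. f x - g x) <= 12 * \<epsilon>"
  if f: "f \<in> Sigma_space" and g: "g \<in> Sigma_space" and lf: "lip2 M f" and lg: "lip2 M g"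
   and fM: "L2_norm f <= M" and gM: "L2_norm g <= M" and fc: "\<bar>L2_norm f - c\<bar> <= \<tau>" and gc: "\<bar>L2_norm g - c\<bar> <= \<tau>"
   and fg: "L2_norm (%x. f x - g x) <= \<tau>" and Ef: "E f <= I + \<epsilon>" and Eg: "E g <= I + \<epsilon>" for f g
 proof -
  note fL = Sigma_L2[OF f] and gL = Sigma_L2[OF g]
  define m where "m = (%x. (1/2) * f x + (1/2) * g x)"
  have m: "m \<in> Sigma_space" unfolding m_def by (rule Sigma_lincomb[OF f g])
  note mL = Sigma_L2[OF m]
  have mf: "L2_norm (%x. m x - f x) <= \<tau>"
  proof -
   have "(%x. m x - f x) = (%x. (-1/2) * (f x - g x))" by (simp add: m_def fun_eq_iff algebra_simps diff_divide_distrib add_divide_distrib)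
   then have "L2_norm (%x. m x - f x) = L2_norm (%x. (-1/2) * (f x - g x))" by simp
   also have "... = 1/2 * L2_norm (%x. f x - g x)" by (subst L2_norm_cmult) simp
   finally show ?thesis using fg L2_norm_nonneg[of "%x. f x - g x"] by linarith
  qed
  have mg: "L2_norm (%x. m x - g x) <= \<tau>"
  proof -
   have "(%x. m x - g x) = (%x. (1/2) * (f x - g x))" by (simp add: m_def fun_eq_iff algebra_simps diff_divide_distrib add_divide_distrib)
   then have "L2_norm (%x. m x - g x) = L2_norm (%x. (1/2) * (f x - g x))" by simp
   also have "... = 1/2 * L2_norm (%x. f x - g x)" by (subst L2_norm_cmult) simp
   finally show ?thesis using fg L2_norm_nonneg[of "%x. f x - g x"] by linarith
  qed
  define \<mu> where "\<mu> = L2_norm m"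
  have \<mu>c: "\<bar>\<mu> - c\<bar> <= 2 * \<tau>"
   using L2_triangle_rev[OF mL fL] mf fc unfolding \<mu>_def by linarith
  have \<mu>: "c / 2 <= \<mu>" "\<mu> <= 2 * c" "0 < \<mu>" using \<mu>c \<tau>(2) c by linarith+
  define s where "s = c / \<mu>"
  have s: "0 < s" "s <= 2" using \<mu> c by (auto simp: s_def pos_divide_le_eq)
  define h where "h = (%x. cor s * m x)"
  have h: "h \<in> Sigma_space" unfolding h_def by (rule Sigma_scale[OF m])
  have hc: "L2_norm h = c"
   unfolding h_def L2_norm_cmult norm_of_real using c \<mu>(3) by (simp add: s_def \<mu>_def[symmetric])
  have lm: "lip2 M m" using lip2_lincomb[OF lf lg, of "1/2" "1/2"] by (simp add: m_def)
  have lh: "lip2 (2 * M) h"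
  proof (rule lip2_mono)
   show "lip2 (s * M) h" using lip2_lincomb[OF lm lm, of "cor s" 0] s by (simp add: h_def)
   show "s * M <= 2 * M" using s M c by (intro mult_right_mono) auto
  qed
  have hm: "L2_norm (%x. h x - m x) <= 2 * \<tau>"
  proof -
   have "(%x. h x - m x) = (%x. cor (s - 1) * m x)" by (simp add: h_def fun_eq_iff algebra_simps)
   then have "L2_norm (%x. h x - m x) = L2_norm (%x. cor (s - 1) * m x)" by simp
   also have "... = \<bar>s - 1\<bar> * \<mu>" by (subst L2_norm_cmult) (simp only: norm_of_real \<mu>_def)
   also have "... = \<bar>(s - 1) * \<mu>\<bar>" using \<mu>(3) by (simp add: abs_mult)
   also have "(s - 1) * \<mu> = c - \<mu>" using \<mu>(3) by (simp add: s_def left_diff_distrib)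
   finally show ?thesis using \<mu>c by linarith
  qed
  have lf2: "lip2 (2 * M) f" and lg2: "lip2 (2 * M) g" using lip2_mono[OF lf] lip2_mono[OF lg] M c by auto
  have n2: "L2_norm f <= 2 * M" "L2_norm g <= 2 * M" "L2_norm h <= 2 * M" using fM gM hc M c by linarith+
  let ?P = "potential h"
  have Pf: "\<bar>potential f - ?P\<bar> <= \<epsilon>"
  proof (rule \<delta>(2)[OF lf2 lh n2(1,3)])
   have "L2_norm (%x. h x - f x) <= 2 * \<tau> + \<tau>"
    using L2_triangle3[OF Sigma_L2[OF h] mL fL] hm mf by linarith
   then show "L2_norm (%x. f x - h x) <= \<delta>" unfolding L2_norm_minus_commute[of f h] using \<tau>(3) \<tau>(1) by linarith
  qed
  have Pg: "\<bar>potential g - ?P\<bar> <= \<epsilon>"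
  proof (rule \<delta>(2)[OF lg2 lh n2(2,3)])
   have "L2_norm (%x. h x - g x) <= 2 * \<tau> + \<tau>"
    using L2_triangle3[OF Sigma_L2[OF h] mL gL] hm mg by linarith
   then show "L2_norm (%x. g x - h x) <= \<delta>" unfolding L2_norm_minus_commute[of g h] using \<tau>(3) \<tau>(1) by linarith
  qed
  \<comment> \<open>All potentials are compared with that of the rescaled mean h. Then
    \<open>quad\<close> is at least T at h and at most T + 2 \<epsilon> at f and g, so the
    parallelogram law leaves 2 \<epsilon>, plus \<epsilon> from undoing the rescaling. The factor 4
    in passing from (f - g)/2 to f - g gives 12 \<epsilon>.\<close>
  define T where "T = I + \<kappa> * ?P"
  have k1: "\<kappa> * potential f <= \<kappa> * ?P + \<epsilon>" "\<kappa> * potential g <= \<kappa> * ?P + \<epsilon>"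
   using \<kappa> Pf Pg by auto
  have TD: "\<bar>T\<bar> <= D"
   using \<kappa> potential_nonneg[of h] B(2)[OF lh n2(3)] by (auto simp: T_def D_def)
  have qf: "quad f <= T + 2 * \<epsilon>" "quad g <= T + 2 * \<epsilon>"
   using Ef Eg k1 unfolding energy_eq[OF f] energy_eq[OF g] T_def by linarith+
  have "I <= quad h - \<kappa> * ?P" using low[OF h hc] unfolding energy_eq[OF h] .
  then have "T <= s^2 * quad m"
   unfolding h_def quad_scale[OF m] using s by (simp add: T_def h_def)
  then have "(\<mu> / c)^2 * T <= (\<mu> / c)^2 * (s^2 * quad m)" by (intro mult_left_mono) auto
  also have "... = quad m"
   using \<mu>(3) c by (simp add: s_def power_divide)
  finally have qm: "(\<mu> / c)^2 * T <= quad m" .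
  have "\<bar>1 - (\<mu> / c)^2\<bar> * D <= \<epsilon>"
  proof -
   have "1 - (\<mu> / c)^2 = (c - \<mu>) * (c + \<mu>) / c^2"
    using c by (simp add: power2_eq_square field_simps)
   then have "\<bar>1 - (\<mu> / c)^2\<bar> = \<bar>c - \<mu>\<bar> * (c + \<mu>) / c^2"
    using c \<mu>(3) by (simp add: abs_mult)
   also have "... <= (2 * \<tau>) * (3 * c) / c^2"
    using \<mu>c \<mu> c by (intro divide_right_mono mult_mono) auto
   also have "... = 6 * \<tau> / c" using c by (simp add: power2_eq_square)
   finally have "\<bar>1 - (\<mu> / c)^2\<bar> * D <= 6 * \<tau> / c * D" using D by (intro mult_right_mono) auto
   also have "... <= \<epsilon>" using \<tau>(4) D c by (simp add: field_simps)
   finally show ?thesis .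
  qed
  moreover have "(1 - (\<mu> / c)^2) * T <= \<bar>1 - (\<mu> / c)^2\<bar> * D"
  proof -
   have "(1 - (\<mu> / c)^2) * T <= \<bar>1 - (\<mu> / c)^2\<bar> * \<bar>T\<bar>" by (simp add: abs_mult[symmetric])
   also have "... <= \<bar>1 - (\<mu> / c)^2\<bar> * D" using TD by (intro mult_left_mono) auto
   finally show ?thesis .
  qed
  ultimately have TT: "T - (\<mu> / c)^2 * T <= \<epsilon>" by (simp add: left_diff_distrib)
  have "quad (%x. (1/2) * f x + (-1/2) * g x) = quad f / 2 + quad g / 2 - quad m"
   using quad_parallelogram[OF f g] unfolding m_def by linarith
  also have "... <= 3 * \<epsilon>" using qf qm TT by linarith
  also have "quad (%x. (1/2) * f x + (-1/2) * g x) = (1/4) * quad (%x. f x - g x)"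
  proof -
   have "(%x. (1/2) * f x + (-1/2) * g x) = (%x. (1/2) * (f x - g x))" by (simp add: fun_eq_iff diff_divide_distrib)
   then show ?thesis using quad_scale[OF Sigma_diff[OF f g], of "1/2"] by (simp add: power_divide)
  qed
  finally show ?thesis by simp
 qed
 with \<tau>(1) that show ?thesis by blast
qed

end

section \<open>Orbital stability\<close>

context rotating_nls
begin

text \<open>Coercivity bounds the sequence in the energy space, and the bound on |x| v_k gives
  tightness, hence an L2 convergent subsequence. L2 closeness makes the potentials nearly equal, so
  near-minimality forces the quadratic parts to be Cauchy. The masses only have to converge to c,
  while I is a lower bound at mass exactly c.\<close>

theorem minimizing_sequence_compact:
 fixes v :: "nat => real^'n => complex"
 assumes c: "c > 0" and coer: "coercive_near c"
  and v: "!!k. v k \<in> Sigma_space" and vc: "(%k. L2_norm (v k)) ----> c" and vE: "(%k. E (v k)) ----> I"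
  and low: "!!f. f \<in> Sigma_space ==> L2_norm f = c ==> I <= E f"
 obtains r :: "nat => nat" and \<psi> where "\<psi> \<in> Sigma_space" "L2_norm \<psi> = c" "E \<psi> = I"
  "(%k. Sigma_norm (%x. v (r k) x - \<psi> x)) ----> 0"
proof -
 obtain c' \<delta> K where c': "c < c'" and \<delta>: "\<delta> > 0" and co: "!!f. f \<in> Sigma_space ==> L2_norm f <= c' ==> \<delta> * quad f - K <= E f"
  using coer unfolding coercive_near_def by blast
 obtain Kq where Kq: "Kq > 0" "!!f. f \<in> Sigma_space ==> dirichlet f + (L2_norm (radius_mult f))^2 <= Kq * quad f"
  using quad_coercive by blast
 have "\<forall>\<^sub>F k in sequentially. L2_norm (v k) < c'" by (rule order_tendstoD(2)[OF vc c'])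
 moreover have "\<forall>\<^sub>F k in sequentially. E (v k) < I + 1" by (rule order_tendstoD(2)[OF vE]) simp
 ultimately have "\<forall>\<^sub>F k in sequentially. L2_norm (v k) < c' \<and> E (v k) < I + 1" by (rule eventually_conj)
 then obtain k0 where k0: "!!k. k >= k0 ==> L2_norm (v k) < c' \<and> E (v k) < I + 1"
  unfolding eventually_sequentially by blast
 define w where "w k = v (k + k0)" for k
 have w: "w k \<in> Sigma_space" for k unfolding w_def by (rule v)
 have wc: "(%k. L2_norm (w k)) ----> c" and wE: "(%k. E (w k)) ----> I"
  unfolding w_def using LIMSEQ_ignore_initial_segment[OF vc, of k0] LIMSEQ_ignore_initial_segment[OF vE, of k0] by auto
 have wb: "L2_norm (w k) <= c'" "E (w k) <= I + 1" for k
  unfolding w_def using k0[of "k + k0"] by auto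
 define Q where "Q = max 0 ((I + 1 + K) / \<delta>)"
 have Q: "quad (w k) <= Q" for k
 proof -
  have "\<delta> * quad (w k) <= I + 1 + K" using co[OF w wb(1)] wb(2)[of k] by (smt (verit))
  then have "quad (w k) <= (I + 1 + K) / \<delta>" using \<delta> by (simp add: pos_le_divide_eq mult.commute)
  then show ?thesis by (simp add: Q_def)
 qed
 define M where "M = max c' (sqrt (Kq * Q))"
 have M: "c <= M" "0 < M" using c' c by (auto simp: M_def)
 have KQ: "dirichlet (w k) + (L2_norm (radius_mult (w k)))^2 <= Kq * Q" for k
  by (rule order_trans[OF Kq(2)[OF w] mult_left_mono[OF Q]]) (use Kq(1) in simp)
 have wl: "lip2 M (w k)" for k
 proof (rule Sigma_lip2[OF w])
  have "dirichlet (w k) <= Kq * Q" using KQ[of k] zero_le_power2[of "L2_norm (radius_mult (w k))"] by linarith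
  then have "sqrt (dirichlet (w k)) <= sqrt (Kq * Q)" by simp
  then show "sqrt (dirichlet (w k)) <= M" unfolding M_def by (rule max.coboundedI2)
 qed
 have wX: "L2_norm (radius_mult (w k)) <= M" for k
 proof -
  have "(L2_norm (radius_mult (w k)))^2 <= Kq * Q" using KQ[of k] dirichlet_nonneg[of "w k"] by linarith
  then have "L2_norm (radius_mult (w k)) <= sqrt (Kq * Q)" by (rule real_le_rsqrt)
  then show ?thesis unfolding M_def by (rule max.coboundedI2)
 qed
 have wM: "L2_norm (w k) <= M" for k using wb(1)[of k] by (simp add: M_def)
 have tight: "\<exists>R. \<forall>k. L2_norm (%x. cor (1 - indicator (cball 0 R) x) * w k x) <= e" if e: "0 < e" for e
 proof (intro exI[of _ "M / e"] allI)
  fix k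
  let ?R = "M / e"
  have R: "?R > 0" using M e by simp
  have "L2_norm (%x. cor (1 - indicator (cball 0 ?R) x) * w k x) <= (1 / ?R) * L2_norm (radius_mult (w k))"
  proof (rule L2_dominated(2)[OF Sigma_radius_mult[OF w]])
   show "(%x. cor (1 - indicator (cball 0 ?R) x) * w k x) \<in> borel_measurable borel"
    using L2_measurable[OF Sigma_L2[OF w[of k]]] by measurable
   show "AE x in lborel. cmod (cor (1 - indicator (cball 0 ?R) x) * w k x) <= (1 / ?R) * cmod (radius_mult (w k) x)"
   proof (rule AE_I2)
    fix x :: "real^'n"
    show "cmod (cor (1 - indicator (cball 0 ?R) x) * w k x) <= (1 / ?R) * cmod (radius_mult (w k) x)"
    proof (cases "norm x <= ?R")
     case False
     then have "(1 / ?R) * ?R <= (1 / ?R) * norm x" using R M e by (intro mult_left_mono) auto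
     then have "1 <= (1 / ?R) * norm x" using M e by simp
     then have "1 * cmod (w k x) <= ((1 / ?R) * norm x) * cmod (w k x)" by (rule mult_right_mono) simp
     then show ?thesis using False by (simp add: radius_mult_def norm_mult mult.assoc)
    qed (use M e in simp)
   qed
  qed (use M e in simp)
  also have "... <= (1 / ?R) * M" using M e by (intro mult_left_mono wX) simp
  also have "... = e" using M e by simp
  finally show "L2_norm (%x. cor (1 - indicator (cball 0 ?R) x) * w k x) <= e" .
 qed
 show ?thesis
 proof (rule tight_compactness[of M w, OF wl wM tight])
  fix r :: "nat => nat" and f :: "real^'n => complex"
  assume r: "strict_mono r" and f: "f \<in> L2" and lim: "(%k. L2_norm (%x. w (r k) x - f x)) ----> 0"
  define u where "u k = w (r k)" for k
  have u: "u k \<in> Sigma_space" for k by (simp add: u_def w)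
  have uc: "(%k. L2_norm (u k)) ----> c" and uE: "(%k. E (u k)) ----> I"
   unfolding u_def using LIMSEQ_subseq_LIMSEQ[OF wc r] LIMSEQ_subseq_LIMSEQ[OF wE r] by (auto simp: comp_def)
  have ulim: "(%k. L2_norm (%x. u k x - f x)) ----> 0" using lim by (simp add: u_def)
  have Cau: "\<exists>N. \<forall>k\<ge>N. \<forall>l\<ge>N. dirichlet (%x. u k x - u l x) + (L2_norm (radius_mult (%x. u k x - u l x)))^2 < e^2"
   if e: "0 < e" for e
  proof -
   \<comment> \<open>Chosen so that 12 Kq \<epsilon> = e^2/2, the size of the energy-space distance
     given by \<open>quad_midpoint\<close> and \<open>quad_coercive\<close>.\<close>
   define \<epsilon> where "\<epsilon> = e^2 / (24 * Kq)"
   have \<epsilon>: "\<epsilon> > 0" using e Kq(1) by (simp add: \<epsilon>_def)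
   show ?thesis
   proof (rule quad_midpoint[OF c low M(1) \<epsilon>])
    fix \<tau> :: real
    assume \<tau>: "\<tau> > 0" and mid: "!!f g. f \<in> Sigma_space ==> g \<in> Sigma_space ==> lip2 M f ==> lip2 M g \<Longrightarrow>
     L2_norm f <= M ==> L2_norm g <= M ==> \<bar>L2_norm f - c\<bar> <= \<tau> ==> \<bar>L2_norm g - c\<bar> <= \<tau> \<Longrightarrow>
     L2_norm (%x. f x - g x) <= \<tau> ==> E f <= I + \<epsilon> ==> E g <= I + \<epsilon> ==> quad (%x. f x - g x) <= 12 * \<epsilon>"
    have "\<forall>\<^sub>F k in sequentially. dist (L2_norm (u k)) c < \<tau>" by (rule tendstoD[OF uc \<tau>])
    moreover have "\<forall>\<^sub>F k in sequentially. E (u k) < I + \<epsilon>" by (rule order_tendstoD(2)[OF uE]) (use \<epsilon> in simp)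
    moreover have "\<forall>\<^sub>F k in sequentially. L2_norm (%x. u k x - f x) < \<tau> / 2" by (rule order_tendstoD(2)[OF ulim]) (use \<tau> in simp)
    ultimately have "\<forall>\<^sub>F k in sequentially. dist (L2_norm (u k)) c < \<tau> \<and> E (u k) < I + \<epsilon> \<and> L2_norm (%x. u k x - f x) < \<tau> / 2"
     by eventually_elim simp
    then obtain N where N: "!!k. k >= N ==> dist (L2_norm (u k)) c < \<tau> \<and> E (u k) < I + \<epsilon> \<and> L2_norm (%x. u k x - f x) < \<tau> / 2"
     unfolding eventually_sequentially by blast
    have "dirichlet (%x. u k x - u l x) + (L2_norm (radius_mult (%x. u k x - u l x)))^2 < e^2" if kl: "k >= N" "l >= N" for k l
    proof -
     have "L2_norm (%x. u k x - u l x) <= \<tau>"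
      using L2_triangle3[OF Sigma_L2[OF u[of k]] f Sigma_L2[OF u[of l]]] N[OF kl(1)] N[OF kl(2)]
      unfolding L2_norm_minus_commute[of f] by linarith
     then have "quad (%x. u k x - u l x) <= 12 * \<epsilon>"
      using N[OF kl(1)] N[OF kl(2)] wl wM by (intro mid u) (auto simp: u_def dist_real_def)
     then have "Kq * quad (%x. u k x - u l x) <= Kq * (12 * \<epsilon>)" using Kq(1) by (intro mult_left_mono) auto
     also have "... = e^2 / 2" using Kq(1) by (simp add: \<epsilon>_def)
     also have "... < e^2" using e by simp
     finally show ?thesis using Kq(2)[OF Sigma_diff[OF u u], of k l] by linarith
    qed
    then show ?thesis by blast
   qed
  qed
  note fin = Sigma_complete[of u f, OF u f ulim Cau]
  have "E f = I" using energy_continuous(1)[OF u fin] uE LIMSEQ_unique by blast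
  moreover have "L2_norm f = c" using energy_continuous(2)[OF u fin] uc LIMSEQ_unique by blast
  ultimately show ?thesis
   using that[of f "%k. r k + k0"] fin by (simp add: u_def w_def)
 qed
qed

text \<open>The difference of two a.e. equal functions has vanishing Sigma norm, so the constant
  sequence f converges to g and continuity gives equality. This makes the energy insensitive to the
  choice of representatives of a solution.\<close>

lemma energy_cong_AE:
 assumes f: "f \<in> Sigma_space" and g: "g \<in> Sigma_space" and ae: "AE x in lborel. f x = g x"
 shows "E f = E g" "L2_norm f = L2_norm g"
proof -
 note fL = Sigma_L2[OF f] and gL = Sigma_L2[OF g]
 have [measurable]: "f \<in> borel_measurable borel" "g \<in> borel_measurable borel"
  using L2_measurable[OF fL] L2_measurable[OF gL] .
 have dL: "(%x. f x - g x) \<in> L2" by (rule L2_diff[OF fL gL])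
 have d0: "AE x in lborel. f x - g x = 0" using ae by eventually_elim simp
 have "is_weak_partial j (%x. f x - g x) (%x. 0)" for j
  unfolding is_weak_partial_def
 proof (intro allI impI)
  fix \<phi> :: "real^'n => complex" assume "test_function \<phi>"
  then have [measurable]: "partial_deriv j \<phi> \<in> borel_measurable borel"
   by (intro test_function_measurable test_function_partial_deriv)
  have "(LBINT x. (f x - g x) * partial_deriv j \<phi> x) = (\<integral>x. 0 \<partial>(lborel :: (real^'n) measure))"
   by (rule integral_cong_AE) (measurable, use d0 in "auto elim!: eventually_mono")
  then show "(LBINT x. (f x - g x) * partial_deriv j \<phi> x) = - (LBINT x. 0 * \<phi> x)" by simp
 qed
 then have "dirichlet (%x. f x - g x) = (\<Sum>j\<in>(UNIV::'n set). (L2_norm (%x::real^'n. 0))^2)"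
  by (intro dirichlet_eqI dL) auto
 moreover have "L2_norm (%x. f x - g x) = 0" using L2_norm_eq_0[OF dL] d0 by simp
 moreover have "L2_norm (radius_mult (%x. f x - g x)) = 0"
 proof -
  have "AE x in lborel. radius_mult (%x. f x - g x) x = 0"
   using d0 by eventually_elim (simp add: radius_mult_def)
  then show ?thesis using L2_norm_eq_0[OF Sigma_radius_mult[OF Sigma_diff[OF f g]]] by simp
 qed
 ultimately have "Sigma_norm (%x. f x - g x) = 0" by (simp add: Sigma_norm_eq)
 then have z: "(%k::nat. Sigma_norm (%x. f x - g x)) ----> 0" by simp
 show "E f = E g" using energy_continuous(1)[OF f g z] by (simp add: LIMSEQ_const_iff)
 show "L2_norm f = L2_norm g" using energy_continuous(2)[OF f g z] by (simp add: LIMSEQ_const_iff)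
qed

text \<open>\<open>local_theory\<close> states the conservation laws for one maximal solution; any
  other one has the same lifespan and agrees with it a.e. at every time, which suffices for mass and
  energy.\<close>

lemma conservation:
 assumes loc: "local_theory e1 e2 \<Omega> \<gamma> \<kappa> G U" and u0: "u0 \<in> Sigma_space"
  and max: "maximal_solution \<kappa> G U u0 Tmin Tmax u" and t: "t \<in> time_interval Tmin Tmax"
 shows "u t \<in> Sigma_space" "L2_norm (u t) = L2_norm u0" "E (u t) = E u0"
proof -
 show uS: "u t \<in> Sigma_space"
  using max t by (simp add: maximal_solution_def is_solution_def)
 obtain Sm SM w where w: "maximal_solution \<kappa> G U u0 Sm SM w"
  and uniq: "!!Tm TM w'. maximal_solution \<kappa> G U u0 Tm TM w' \<Longrightarrow>
     Tm = Sm \<and> TM = SM \<and> (\<forall>t\<in>time_interval Sm SM. AE x in lborel. w' t x = w t x)"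
  and cons: "\<forall>t\<in>time_interval Sm SM. L2_norm (w t) = L2_norm u0 \<and> E (w t) = E u0"
  using bspec[OF loc[unfolded local_theory_def] u0] by blast
 have T: "t \<in> time_interval Sm SM" using uniq[OF max] t by simp
 have ae: "AE x in lborel. u t x = w t x" using uniq[OF max] T by blast
 have wS: "w t \<in> Sigma_space"
  using w T by (simp add: maximal_solution_def is_solution_def)
 show "L2_norm (u t) = L2_norm u0" "E (u t) = E u0"
  using energy_cong_AE[OF uS wS ae] cons T by simp_all
qed

text \<open>By contradiction: if data tending to \<phi> had orbits leaving the
  \<epsilon>-neighbourhood, the states reached would carry the masses and energies of the data. They
  would form a minimising sequence, which by compactness comes arbitrarily close to some minimiser,
  not necessarily \<phi>.\<close>

theorem orbitally_stable_if_coercive: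
 assumes c: "c > 0" and coer: "coercive_near c" and loc: "local_theory e1 e2 \<Omega> \<gamma> \<kappa> G U"
 shows "orbitally_stable \<kappa> G U (minimizers e1 e2 \<Omega> \<gamma> \<kappa> G c)"
 unfolding orbitally_stable_def
proof (intro ballI allI impI)
 fix \<phi> and \<epsilon> :: real
 assume \<phi>: "\<phi> \<in> minimizers e1 e2 \<Omega> \<gamma> \<kappa> G c" and \<epsilon>: "0 < \<epsilon>"
 let ?Z = "minimizers e1 e2 \<Omega> \<gamma> \<kappa> G c"
 have \<phi>S: "\<phi> \<in> Sigma_space" and \<phi>c: "L2_norm \<phi> = c" and \<phi>E: "ereal (E \<phi>) = min_energy e1 e2 \<Omega> \<gamma> \<kappa> G c"
  using \<phi> by (auto simp: minimizers_def)
 have low: "E \<phi> <= E f" if "f \<in> Sigma_space" "L2_norm f = c" for f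
 proof -
  have "ereal (E \<phi>) <= ereal (E f)"
   unfolding \<phi>E min_energy_def by (rule INF_lower) (use that in simp)
  then show ?thesis by simp
 qed
 show "\<exists>\<delta>>0. \<forall>u0\<in>Sigma_space. Sigma_norm (%x. u0 x - \<phi> x) < \<delta> \<longrightarrow>
    (\<forall>Tmin Tmax u. maximal_solution \<kappa> G U u0 Tmin Tmax u \<longrightarrow>
     (SUP t\<in>time_interval Tmin Tmax. INF \<psi>\<in>?Z. ereal (Sigma_norm (%x. u t x - \<psi> x))) < ereal \<epsilon>)"
 proof (rule ccontr)
  assume neg: "\<not> ?thesis"
  have "\<forall>k. \<exists>u0 v. u0 \<in> Sigma_space \<and> Sigma_norm (%x. u0 x - \<phi> x) < inverse (real (Suc k)) \<and> v \<in> Sigma_space \<and>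
    L2_norm v = L2_norm u0 \<and> E v = E u0 \<and> (\<forall>\<psi>\<in>?Z. \<epsilon> / 2 <= Sigma_norm (%x. v x - \<psi> x))"
  proof
   fix k :: nat
   have "0 < inverse (real (Suc k))" by simp
   with neg obtain u0 Tmin Tmax u where u0: "u0 \<in> Sigma_space" "Sigma_norm (%x. u0 x - \<phi> x) < inverse (real (Suc k))"
    and max: "maximal_solution \<kappa> G U u0 Tmin Tmax u"
    and sup: "\<not> (SUP t\<in>time_interval Tmin Tmax. INF \<psi>\<in>?Z. ereal (Sigma_norm (%x. u t x - \<psi> x))) < ereal \<epsilon>"
    by blast
   \<comment> \<open>The negation only says that the supremum is at least \<epsilon>, perhaps
     unattained; halving gives a time at which the distance is strictly larger.\<close>
   have "ereal (\<epsilon> / 2) < ereal \<epsilon>" using \<epsilon> by simp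
   also have "... <= (SUP t\<in>time_interval Tmin Tmax. INF \<psi>\<in>?Z. ereal (Sigma_norm (%x. u t x - \<psi> x)))"
    using sup by simp
   finally obtain t where t: "t \<in> time_interval Tmin Tmax" "ereal (\<epsilon> / 2) < (INF \<psi>\<in>?Z. ereal (Sigma_norm (%x. u t x - \<psi> x)))"
    unfolding less_SUP_iff by blast
   have "\<epsilon> / 2 <= Sigma_norm (%x. u t x - \<psi> x)" if "\<psi> \<in> ?Z" for \<psi>
   proof -
    have "ereal (\<epsilon> / 2) <= ereal (Sigma_norm (%x. u t x - \<psi> x))"
     using t(2) INF_lower[OF that, of "%\<psi>. ereal (Sigma_norm (%x. u t x - \<psi> x))"] by (rule less_imp_le[OF less_le_trans])
    then show ?thesis by simp
   qed
   then show "\<exists>u0 v. u0 \<in> Sigma_space \<and> Sigma_norm (%x. u0 x - \<phi> x) < inverse (real (Suc k)) \<and> v \<in> Sigma_space \<and>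
     L2_norm v = L2_norm u0 \<and> E v = E u0 \<and> (\<forall>\<psi>\<in>?Z. \<epsilon> / 2 <= Sigma_norm (%x. v x - \<psi> x))"
    using u0 conservation[OF loc u0(1) max t(1)] by blast
  qed
  from this[THEN choice] obtain u0 where "\<forall>k. \<exists>v. u0 k \<in> Sigma_space \<and> Sigma_norm (%x. u0 k x - \<phi> x) < inverse (real (Suc k)) \<and> v \<in> Sigma_space \<and>
    L2_norm v = L2_norm (u0 k) \<and> E v = E (u0 k) \<and> (\<forall>\<psi>\<in>?Z. \<epsilon> / 2 <= Sigma_norm (%x. v x - \<psi> x))" by blast
  from this[THEN choice] obtain v where u0: "!!k. u0 k \<in> Sigma_space" "!!k. Sigma_norm (%x. u0 k x - \<phi> x) < inverse (real (Suc k))"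
   and v: "!!k. v k \<in> Sigma_space" "!!k. L2_norm (v k) = L2_norm (u0 k)" "!!k. E (v k) = E (u0 k)"
   and far: "!!k \<psi>. \<psi> \<in> ?Z ==> \<epsilon> / 2 <= Sigma_norm (%x. v k x - \<psi> x)"
   by blast
  have "(%k. Sigma_norm (%x. u0 k x - \<phi> x)) ----> 0"
  proof (rule Lim_null_comparison[OF _ LIMSEQ_inverse_real_of_nat])
   show "\<forall>\<^sub>F k in sequentially. norm (Sigma_norm (%x. u0 k x - \<phi> x)) <= inverse (real (Suc k))"
   proof (rule always_eventually, rule allI)
    fix k
    show "norm (Sigma_norm (%x. u0 k x - \<phi> x)) <= inverse (real (Suc k))"
     using less_imp_le[OF u0(2)[of k]] order_trans[OF L2_norm_nonneg Sigma_norm_ge(3)[of "%x. u0 k x - \<phi> x"]] by simp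
   qed
  qed
  note cont = energy_continuous[OF u0(1) \<phi>S this]
  have vc: "(%k. L2_norm (v k)) ----> c" and vE: "(%k. E (v k)) ----> E \<phi>"
   using cont by (simp_all add: v \<phi>c)
  show False
  proof (rule minimizing_sequence_compact[of c v "E \<phi>", OF c coer v(1) vc vE low])
   fix r :: "nat => nat" and \<psi>
   assume \<psi>: "\<psi> \<in> Sigma_space" "L2_norm \<psi> = c" "E \<psi> = E \<phi>" and lim: "(%k. Sigma_norm (%x. v (r k) x - \<psi> x)) ----> 0"
   have "\<psi> \<in> ?Z" using \<psi> \<phi>E by (simp add: minimizers_def)
   then have "\<epsilon> / 2 <= 0"
    by (intro LIMSEQ_le_const[OF lim]) (use far in blast)
   then show False using \<epsilon> by simp
  qed
 qed
qed

section \<open>Coercivity in the defocusing and the mass-subcritical cases\<close>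

lemma coercive_defocusing:
 assumes "\<kappa> = -1"
 shows "coercive_near c"
 unfolding coercive_near_def
proof (intro exI conjI ballI impI)
 fix f :: "real^'n => complex" assume "f \<in> Sigma_space"
 from energy_eq[OF this] show "1 * quad f - 0 <= E f"
  using potential_nonneg[of f] unfolding assms by linarith
qed (auto intro: less_add_one)

lemma coercive_mass_subcritical:
 assumes \<kappa>1: "\<kappa> = 1" and p: "p < 1 + 4 / real CARD('n)" and c: "c > 0"
 shows "coercive_near c"
proof -
 obtain Kq where Kq: "Kq > 0" "!!f. f \<in> Sigma_space ==> dirichlet f + (L2_norm (radius_mult f))^2 <= Kq * quad f"
  using quad_coercive by blast
 \<comment> \<open>With this \<eta> the kinetic part of the bound on \<open>potential\<close> is
   exactly one half of \<open>quad\<close>.\<close>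
 define \<eta> where "\<eta> = 1 / (2 * C' * Kq)"
 have \<eta>: "\<eta> > 0" using C' Kq(1) by (simp add: \<eta>_def)
 have s: "p - 1 < 4 / real CARD('n)" using p by simp
 have M0: "0 <= c + 1" using c by simp
 obtain A where A: "A >= 0" "!!(f :: real^'n => complex) K. lip2 K f ==> L2_norm f <= c + 1 \<Longrightarrow>
  (NN x. ennreal (pw (p - 1) f x)) <= ennreal (\<eta> * K^2 + A)"
  using mass_subcritical_bound[OF p1 s \<eta> M0] by blast
 define K where "K = C' * ((c + 1)^2 + A)"
 have "1/2 * quad f - K <= E f" if f: "f \<in> Sigma_space" and fc: "L2_norm f <= c + 1" for f
 proof -
  have l: "lip2 (sqrt (dirichlet f)) f" by (rule Sigma_lip2[OF f order_refl])
  have "ennreal (LBINT x. pw (p - 1) f x) <= ennreal (\<eta> * dirichlet f + A)"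
   using A(2)[OF l fc] by (simp add: pw_integral_eq[OF l] dirichlet_nonneg)
  then have P: "(LBINT x. pw (p - 1) f x) <= \<eta> * dirichlet f + A"
   using \<eta> A(1) dirichlet_nonneg[of f] by (subst (asm) ennreal_le_iff) auto
  have "dirichlet f <= Kq * quad f" using Kq(2)[OF f] zero_le_power2[of "L2_norm (radius_mult f)"] by linarith
  then have "\<eta> * dirichlet f <= \<eta> * (Kq * quad f)" using \<eta> by (intro mult_left_mono) auto
  then have P2: "(LBINT x. pw (p - 1) f x) <= \<eta> * (Kq * quad f) + A" using P by linarith
  have sq: "(L2_norm f)^2 <= (c + 1)^2" using fc by (intro power_mono) auto
  have "potential f <= C' * ((c + 1)^2 + (\<eta> * (Kq * quad f) + A))"
   by (rule order_trans[OF potential_le[OF l] mult_left_mono[OF add_mono[OF sq P2]]]) (use C' in simp)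
  also have "... = K + (C' * \<eta> * Kq) * quad f" by (simp add: K_def algebra_simps)
  also have "C' * \<eta> * Kq = 1/2" using C' Kq(1) by (simp add: \<eta>_def)
  finally have "potential f <= K + 1/2 * quad f" .
  then show ?thesis unfolding energy_eq[OF f] unfolding \<kappa>1 by linarith
 qed
 then show ?thesis
  unfolding coercive_near_def by (intro exI[of _ "c + 1"] conjI exI[of _ "1/2"] exI[of _ K]) auto
qed

end

section \<open>Polarization and symmetrization\<close>

text \<open>Fatou's lemma in both variables of the double integral. It replaces weak lower
  semicontinuity of the Dirichlet integral and asks only for a.e. convergence.\<close>

lemma nonlocal_form_le_liminf:
 fixes F :: "nat => real^'n::finite => complex"
 assumes F: "!!k. F k \<in> L2" and f: "f \<in> L2" and e: "e > 0" and lim: "AE x in lborel. (%k. F k x) ----> f x"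
 shows "nonlocal_form e f <= liminf (%k. nonlocal_form e (F k))"
proof -
 have [measurable]: "f \<in> borel_measurable borel" "F k \<in> borel_measurable borel" for k
  using L2_measurable[OF f] L2_measurable[OF F] by auto
 let ?c = "ennreal (inverse e ^ CARD('n) * (1 / e^2))"
 let ?h = "%u x y. ?c * (indicator (ball 0 e) (y - x :: real^'n) * ennreal ((cmod (u y - u x))^2))"
 have nl: "nonlocal_form e u = (NN x. (NN y. ?h u x y))" if "u \<in> L2" for u
 proof -
  have [measurable]: "u \<in> borel_measurable borel" using that by (rule L2_measurable)
  show ?thesis unfolding nonlocal_form_kernel[OF that e]
   by (simp add: nn_integral_cmult)
 qed
 have hl: "?h f x y = liminf (%k. ?h (F k) x y)" if "(%k. F k x) ----> f x" "(%k. F k y) ----> f y" for x y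
 proof -
  have "(%k. (cmod (F k y - F k x))^2) ----> (cmod (f y - f x))\<^sup>2" by (intro tendsto_intros that)
  then have t: "(%k. ennreal ((cmod (F k y - F k x))^2)) ----> ennreal ((cmod (f y - f x))^2)" by (rule tendsto_ennrealI)
  have "(%k. ?h (F k) x y) ----> ?h f x y"
   using ennreal_tendsto_cmult[OF _ t, of ?c] by (auto split: split_indicator)
  from lim_imp_Liminf[OF _ this] show ?thesis by simp
 qed
 have "(NN x. (NN y. ?h f x y)) <= (NN x. liminf (%k. \<integral>\<^sup>+y. ?h (F k) x y \<partial>lborel))"
 proof (rule nn_integral_mono_AE, use lim in eventually_elim)
  fix x assume x: "(%k. F k x) ----> f x"
  have "(NN y. ?h f x y) <= (NN y. liminf (%k. ?h (F k) x y))"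
   by (rule nn_integral_mono_AE, use lim in eventually_elim) (simp only: hl[OF x] order_refl)
  also have "... <= liminf (%k. \<integral>\<^sup>+y. ?h (F k) x y \<partial>lborel)"
   by (rule nn_integral_liminf) measurable
  finally show "(NN y. ?h f x y) <= liminf (%k. \<integral>\<^sup>+y. ?h (F k) x y \<partial>lborel)" .
 qed
 also have "... <= liminf (%k. \<integral>\<^sup>+x. (NN y. ?h (F k) x y) \<partial>lborel)"
  by (rule nn_integral_liminf) measurable
 finally show ?thesis by (simp only: nl[OF f] nl[OF F])
qed

text \<open>Here a and b are the kernel at a pair of points and at the pair with one point
  reflected. Sums and sums of squares are unchanged by sorting, so the claim reduces to (a - b)(p r
  + p' r') not decreasing: the rearrangement inequality for two pairs, with like or opposite order
  according to the sign of a - b.\<close>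

lemma two_point_inequality:
 fixes a b :: real
 assumes "b <= a \<and> (P = max p p' \<and> P' = min p p' \<and> R = max r r' \<and> R' = min r r' \<or> P = min p p' \<and> P' = max p p' \<and> R = min r r' \<and> R' = max r r')
  \<or> a <= b \<and> (P = max p p' \<and> P' = min p p' \<and> R = min r r' \<and> R' = max r r' \<or> P = min p p' \<and> P' = max p p' \<and> R = max r r' \<and> R' = min r r')"
 shows "a * (P - R)^2 + a * (P' - R')^2 + (b * (P - R')^2 + b * (P' - R)^2)
  <= a * (p - r)^2 + a * (p' - r')^2 + (b * (p - r')^2 + b * (p' - r)^2)"
proof -
 have "(a - b) * (P * R + P' * R') + b * (P + P') * (R + R') >= (a - b) * (p * r + p' * r') + b * (p + p') * (r + r')"
 proof -
  have s: "P + P' = p + p'" "R + R' = r + r'" using assms by auto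
  have m: "0 <= (max p p' - min p p') * (max r r' - min r r')" by simp
  have "(a - b) * (p * r + p' * r') <= (a - b) * (P * R + P' * R')"
   using assms m by (elim disjE conjE; intro mult_left_mono mult_left_mono_neg)
    (auto simp: max_def min_def algebra_simps split: if_splits)
  then show ?thesis unfolding s mult.assoc by simp
 qed
 moreover have "P^2 + P'^2 = p^2 + p'^2" "R^2 + R'^2 = r^2 + r'^2" using assms by (auto simp: max_def min_def)
 then have "(a + b) * (P^2 + P'^2 + (R^2 + R'^2)) = (a + b) * (p^2 + p'^2 + (r^2 + r'^2))" by simp
 ultimately show ?thesis by (simp add: power2_eq_square algebra_simps)
qed

definition reflect :: "'a::euclidean_space => real => 'a => 'a" where
 "reflect e s x = x - (2 * (x \<bullet> e - s)) *\<^sub>R e"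

text \<open>Of the two values at mirror points the larger goes to the side x . e <= s. For s > 0
  this side contains the origin.\<close>

definition polarize :: "'a::euclidean_space => real => ('a => real) => 'a => real" where
 "polarize e s W x = (if x \<bullet> e <= s then max (W x) (W (reflect e s x)) else min (W x) (W (reflect e s x)))"

context
 fixes e :: "'a::euclidean_space" and s :: real
 assumes e1: "norm e = 1"
begin

lemma ee1: "e \<bullet> e = 1"
 using e1 by (simp add: dot_square_norm)

lemma reflect_inner: "reflect e s x \<bullet> e = 2 * s - x \<bullet> e"
 by (simp add: reflect_def inner_diff_left ee1)

lemma reflect_reflect: "reflect e s (reflect e s x) = x"
 unfolding reflect_def[of e s "reflect e s x"] reflect_inner unfolding reflect_def by (simp add: algebra_simps)

text \<open>The one computation behind all distance comparisons: reflecting one of two points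
  increases their distance when they lie on the same side and decreases it when they lie on opposite
  sides.\<close>

lemma reflect_diff_sq: "(norm (x - reflect e s y))^2 = (norm (x - y))^2 + 4 * (x \<bullet> e - s) * (y \<bullet> e - s)"
proof -
 define c where "c = 2 * (y \<bullet> e - s)"
 have eq: "x - reflect e s y = (x - y) + c *\<^sub>R e" by (simp add: reflect_def c_def)
 have "(norm (x - reflect e s y))^2 = (norm (x - y))^2 + 2 * c * ((x - y) \<bullet> e) + c^2"
  unfolding power2_norm_eq_inner eq by (simp add: inner_add_left inner_add_right ee1 inner_commute power2_eq_square)
 then show ?thesis by (simp add: c_def inner_diff_left power2_eq_square algebra_simps)
qed

lemma reflect_norm_sq: "(norm (reflect e s x))^2 = (norm x)^2 + 4 * s * (s - x \<bullet> e)"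
 using reflect_diff_sq[of 0 x] by (simp add: algebra_simps)

lemma reflect_dist_sq: "(norm (reflect e s x - reflect e s y))^2 = (norm (x - y))^2"
 using reflect_diff_sq[of "reflect e s x" y] reflect_diff_sq[of y x]
 by (simp add: reflect_inner norm_minus_commute algebra_simps)

lemma preserves_lborel_reflect: "preserves_lborel (reflect e s)"
proof -
 define \<rho> where "\<rho> x = x - (2 * (x \<bullet> e)) *\<^sub>R e" for x
 have "linear \<rho>" by (rule linearI) (simp_all add: \<rho>_def inner_add_left algebra_simps)
 moreover have "norm (\<rho> x) = norm x" for x
 proof -
  have "\<rho> x \<bullet> \<rho> x = x \<bullet> x"
   by (simp add: \<rho>_def inner_diff_left inner_diff_right ee1 inner_commute algebra_simps)
  then show ?thesis by (simp add: norm_eq)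
 qed
 moreover have "\<rho> (\<rho> x) = x" for x
  by (simp add: \<rho>_def inner_diff_left ee1 algebra_simps)
 ultimately have "preserves_lborel \<rho>" by (rule preserves_lborel_isometry)
 from preserves_lborel_compose[OF preserves_lborel_add[of "(2 * s) *\<^sub>R e"] this]
 show ?thesis by (simp add: \<rho>_def reflect_def[abs_def] algebra_simps)
qed

lemma reflect_measurable [measurable]: "reflect e s \<in> borel_measurable borel"
 by (rule preserves_lborel_measurable[OF preserves_lborel_reflect])

lemma polarize_measurable:
 assumes [measurable]: "W \<in> borel_measurable borel"
 shows "polarize e s W \<in> borel_measurable borel"
 unfolding polarize_def[abs_def] by measurable

lemma polarize_pair:
 "polarize e s W x = W x \<and> polarize e s W (reflect e s x) = W (reflect e s x) \<or>
 polarize e s W x = W (reflect e s x) \<and> polarize e s W (reflect e s x) = W x"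
proof (cases "x \<bullet> e = s")
 case True
 then show ?thesis by (simp add: polarize_def reflect_def)
next
 case False
 then show ?thesis by (auto simp: polarize_def reflect_inner reflect_reflect max_def min_def)
qed

lemma polarize_nn_integral:
 assumes [measurable]: "W \<in> borel_measurable borel" "F \<in> borel_measurable borel"
 shows "(NN x. ennreal (F (polarize e s W x))) = (NN x. ennreal (F (W x)))"
proof -
 note [measurable] = polarize_measurable[OF assms(1)]
 have d: "(NN x. ennreal (F (V x)) + ennreal (F (V (reflect e s x)))) = 2 * (NN x. ennreal (F (V x)))"
  if [measurable]: "V \<in> borel_measurable borel" for V
  using preserves_lborel_nn_integral[OF preserves_lborel_reflect, of "%x. ennreal (F (V x))"]
  by (simp add: nn_integral_add mult_2)
 have "2 * (NN x. ennreal (F (polarize e s W x))) = 2 * (NN x. ennreal (F (W x)))"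
  unfolding d[OF polarize_measurable[OF assms(1)], symmetric] d[OF assms(1), symmetric]
  by (rule nn_integral_cong) (use polarize_pair[of W] in "metis add.commute")
 then show ?thesis by (simp add: ennreal_mult_cancel_left)
qed

text \<open>The difference of squares is odd under the reflection, so only the odd part of the
  weight h contributes. When h is ordered across the hyperplane the resulting integrand has a sign;
  this is used for the tail weights and for a Gaussian.\<close>

lemma polarize_weighted:
 assumes [measurable]: "W \<in> borel_measurable borel" "h \<in> borel_measurable borel"
  and int: "integrable lborel (%x. (W x)^2)" and h: "!!x. \<bar>h x\<bar> <= 1"
 shows "2 * ((LBINT x. h x * (W x)^2) - (LBINT x. h x * (polarize e s W x)^2)) =
  (LBINT x. (h x - h (reflect e s x)) * ((W x)^2 - (polarize e s W x)^2))"
  and "integrable lborel (%x. (h x - h (reflect e s x)) * ((W x)^2 - (polarize e s W x)^2))"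
proof -
 note [measurable] = polarize_measurable[OF assms(1)]
 let ?P = "polarize e s W" and ?\<sigma> = "reflect e s"
 have iP: "integrable lborel (%x. (?P x)^2)"
  using int polarize_nn_integral[OF assms(1), of "%t. t^2"] by (simp add: integrable_iff_bounded)
 have ih: "integrable lborel (%x. g x * V x)" if "integrable lborel V" "g \<in> borel_measurable borel" "!!x. \<bar>g x\<bar> <= 1"
  for g V :: "'a => real"
 proof (rule Bochner_Integration.integrable_bound[OF that(1)])
  show "(%x. g x * V x) \<in> borel_measurable lborel" using that by measurable
  show "AE x in lborel. norm (g x * V x) <= norm (V x)"
   using that(3) by (intro AE_I2) (simp add: abs_mult mult_left_le_one_le)
 qed
 let ?D = "%x. (W x)^2 - (?P x)^2"
 have iD: "integrable lborel ?D" by (intro Bochner_Integration.integrable_diff int iP)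
 have D: "?D (?\<sigma> x) = - ?D x" for x using polarize_pair[of W x] by auto
 have hD: "integrable lborel (%x. h x * ?D x)" by (rule ih[OF iD]) (use h in auto)
 have h\<sigma>: "integrable lborel (%x. h (?\<sigma> x) * ?D x)" by (rule ih[OF iD]) (use h in auto)
 have "(LBINT x. h x * ?D x) = (LBINT x. h (?\<sigma> x) * ?D (?\<sigma> x))"
  by (rule preserves_lborel_integral[OF preserves_lborel_reflect, symmetric]) measurable
 also have "... = - (LBINT x. h (?\<sigma> x) * ?D x)" unfolding D mult_minus_right by (rule Bochner_Integration.integral_minus)
 finally have "2 * (LBINT x. h x * ?D x) = (LBINT x. h x * ?D x) - (LBINT x. h (?\<sigma> x) * ?D x)" by simp
 also have "... = (LBINT x. h x * ?D x - h (?\<sigma> x) * ?D x)"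
  by (rule Bochner_Integration.integral_diff[OF hD h\<sigma>, symmetric])
 also have "(%x. h x * ?D x - h (?\<sigma> x) * ?D x) = (%x. (h x - h (?\<sigma> x)) * ?D x)" by (simp add: left_diff_distrib)
 finally have e1: "2 * (LBINT x. h x * ?D x) = (LBINT x. (h x - h (?\<sigma> x)) * ?D x)" .
 have "(LBINT x. h x * ?D x) = (LBINT x. h x * (W x)^2 - h x * (?P x)^2)" by (simp add: right_diff_distrib)
 also have "... = (LBINT x. h x * (W x)^2) - (LBINT x. h x * (?P x)^2)"
  by (rule Bochner_Integration.integral_diff) (intro ih int iP assms(2) h)+
 finally show "2 * ((LBINT x. h x * (W x)^2) - (LBINT x. h x * (?P x)^2)) = (LBINT x. (h x - h (?\<sigma> x)) * ?D x)"
  using e1 by simp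
 show "integrable lborel (%x. (h x - h (?\<sigma> x)) * ?D x)"
  using Bochner_Integration.integrable_diff[OF hD h\<sigma>] by (simp add: left_diff_distrib)
qed

lemma polarize_weighted_nonneg:
 assumes W: "!!x. 0 <= W x" and h: "!!x. x \<bullet> e <= s ==> h x <= h (reflect e s x)"
 shows "0 <= (h x - h (reflect e s x)) * ((W x)^2 - (polarize e s W x)^2)"
proof (cases "x \<bullet> e <= s")
 case True
 then have "W x <= polarize e s W x" by (simp add: polarize_def)
 then have "(W x)^2 <= (polarize e s W x)^2" using W by (intro power_mono)
 then show ?thesis using h[OF True] by (intro mult_nonpos_nonpos) auto
next
 case False
 then have "polarize e s W x <= W x" "0 <= polarize e s W x" using W by (auto simp: polarize_def)
 then have "(polarize e s W x)^2 <= (W x)^2" by (intro power_mono)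
 moreover have "h (reflect e s x) <= h x" using h[of "reflect e s x"] False by (simp add: reflect_inner reflect_reflect)
 ultimately show ?thesis by (intro mult_nonneg_nonneg) auto
qed

end

abbreviation cr :: "('a => real) => 'a => complex" where
 "cr W \<equiv> (%x. cor (W x))"

lemma polarize_L2:
 fixes W :: "real^'n::finite => real"
 assumes e: "norm e = 1" and W: "W \<in> borel_measurable borel" "cr W \<in> L2"
 shows "cr (polarize e s W) \<in> L2" "L2_norm (cr (polarize e s W)) = L2_norm (cr W)"
proof -
 note [measurable] = polarize_measurable[OF e W(1)]
 have "(NN x. ennreal ((polarize e s W x)^2)) = (NN x. ennreal ((W x)^2))"
  by (rule polarize_nn_integral[OF e W(1), where F="%t. t^2"]) measurable
 then have eq: "(NN x. ennreal ((cmod (cr (polarize e s W) x))^2)) = (NN x. ennreal ((cmod (cr W x))^2))"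
  by simp
 have m: "cr (polarize e s W) \<in> borel_measurable borel" by measurable
 show L: "cr (polarize e s W) \<in> L2"
  unfolding L2_iff eq using W(2) m by (simp add: L2_iff)
 have "ennreal ((L2_norm (cr (polarize e s W)))^2) = ennreal ((L2_norm (cr W))^2)"
  using eq unfolding nn_integral_L2[OF L] nn_integral_L2[OF W(2)] .
 then show "L2_norm (cr (polarize e s W)) = L2_norm (cr W)" by (simp add: L2_norm_nonneg)
qed

text \<open>The double integral is folded over the four pairs obtained by reflecting x, y, both or
  neither. For each such quadruple the claim is \<open>two_point_inequality\<close>, since the
  indicator of a ball is a nonincreasing function of the distance.\<close>

lemma polarize_nonlocal_form:
 fixes W :: "real^'n::finite => real"
 assumes e: "norm e = 1" and [measurable]: "W \<in> borel_measurable borel" and W: "cr W \<in> L2" and \<epsilon>: "\<epsilon> > 0"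
 shows "nonlocal_form \<epsilon> (cr (polarize e s W)) <= nonlocal_form \<epsilon> (cr W)"
proof -
 note [measurable] = polarize_measurable[OF e assms(2)] reflect_measurable[OF e]
 let ?\<sigma> = "reflect e s" and ?P = "polarize e s W"
 let ?k = "%z. indicator (ball 0 \<epsilon>) z :: real"
 define \<Phi> where "\<Phi> V x y = ?k (y - x) * (V y - V x)^2" for V and x y :: "real^'n"
 define I where "I V = (NN x. (NN y. ennreal (\<Phi> V x y)))" for V
 let ?S = "%V x y. \<Phi> V x y + \<Phi> V (?\<sigma> x) (?\<sigma> y) + (\<Phi> V (?\<sigma> x) y + \<Phi> V x (?\<sigma> y))"
 have nn: "0 <= \<Phi> V x y" for V x y by (simp add: \<Phi>_def)
 have four: "(NN x. (NN y. ennreal (?S V x y))) = 4 * I V" if [measurable]: "V \<in> borel_measurable borel" for V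
 proof -
  have [measurable]: "(%z. ennreal (\<Phi> V (fst z) (snd z))) \<in> borel_measurable (borel \<Otimes>\<^sub>M borel)"
   unfolding \<Phi>_def by measurable
  have [measurable]: "\<Phi> V x \<in> borel_measurable borel" for x
   unfolding \<Phi>_def[abs_def] by measurable
  have [measurable]: "(%x. \<integral>\<^sup>+y. ennreal (\<Phi> V x y) \<partial>lborel) \<in> borel_measurable borel"
   unfolding \<Phi>_def by measurable
  have i: "(NN y. ennreal (\<Phi> V x (?\<sigma> y))) = (NN y. ennreal (\<Phi> V x y))" for x
   by (rule preserves_lborel_nn_integral[OF preserves_lborel_reflect[OF e], of "%y. ennreal (\<Phi> V x y)"]) measurable
  have o: "(NN x. (NN y. ennreal (\<Phi> V (?\<sigma> x) y))) = I V"
   unfolding I_def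
   by (rule preserves_lborel_nn_integral[OF preserves_lborel_reflect[OF e], of "%x. \<integral>\<^sup>+y. ennreal (\<Phi> V x y) \<partial>lborel"]) measurable
  have "(NN y. ennreal (?S V x y)) = 2 * (NN y. ennreal (\<Phi> V x y)) + 2 * (NN y. ennreal (\<Phi> V (?\<sigma> x) y))" for x
   using i[of x] i[of "?\<sigma> x"] by (simp add: nn nn_integral_add mult_2 add_ac)
  then have "(NN x. (NN y. ennreal (?S V x y))) =
    (NN x. 2 * (NN y. ennreal (\<Phi> V x y)) + 2 * (NN y. ennreal (\<Phi> V (?\<sigma> x) y)))" by simp
  also have "... = (NN x. 2 * (NN y. ennreal (\<Phi> V x y))) + (NN x. 2 * (NN y. ennreal (\<Phi> V (?\<sigma> x) y)))"
   by (rule nn_integral_add) measurable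
  also have "... = 2 * I V + 2 * I V"
   by (simp add: nn_integral_cmult o) (simp add: I_def)
  also have "... = 4 * I V" by (simp add: distrib_right[symmetric])
  finally show ?thesis .
 qed
 have le: "?S ?P x y <= ?S W x y" for x y
 proof -
  have "(norm (y - ?\<sigma> x))^2 = (norm (?\<sigma> y - x))^2"
   using reflect_diff_sq[OF e, of y s x] reflect_diff_sq[OF e, of x s y]
   by (simp only: norm_minus_commute[of y x] norm_minus_commute[of "?\<sigma> y"] mult_ac)
  then have c: "?k (?\<sigma> y - ?\<sigma> x) = ?k (y - x)" "?k (y - ?\<sigma> x) = ?k (?\<sigma> y - x)"
   using reflect_dist_sq[OF e, of s y x] by (simp_all add: indicator_def power2_eq_iff_nonneg)
  have d: "(norm (?\<sigma> y - x))^2 = (norm (y - x))^2 + 4 * ((x \<bullet> e - s) * (y \<bullet> e - s))"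
   using reflect_diff_sq[OF e, of x s y] by (simp add: norm_minus_commute)
  have k1: "?k (?\<sigma> y - x) <= ?k (y - x)" if "0 <= (x \<bullet> e - s) * (y \<bullet> e - s)"
  proof -
   have "norm (y - x) <= norm (?\<sigma> y - x)" by (rule power2_le_imp_le) (use d that in auto)
   then show ?thesis by (auto split: split_indicator)
  qed
  have k2: "?k (y - x) <= ?k (?\<sigma> y - x)" if "(x \<bullet> e - s) * (y \<bullet> e - s) <= 0"
  proof -
   have "norm (?\<sigma> y - x) <= norm (y - x)" by (rule power2_le_imp_le) (use d that in auto)
   then show ?thesis by (auto split: split_indicator)
  qed
  have H: "(x \<bullet> e <= s \<and> ?P x = max (W x) (W (?\<sigma> x)) \<and> ?P (?\<sigma> x) = min (W x) (W (?\<sigma> x))) \<or>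
    (s <= x \<bullet> e \<and> ?P x = min (W x) (W (?\<sigma> x)) \<and> ?P (?\<sigma> x) = max (W x) (W (?\<sigma> x)))" for x
  proof (cases "x \<bullet> e = s")
   case True
   then show ?thesis by (simp add: polarize_def reflect_def)
  next
   case False
   then show ?thesis by (auto simp: polarize_def reflect_inner[OF e] reflect_reflect[OF e] max.commute min.commute)
  qed
  \<comment> \<open>Points on the hyperplane belong to both sides. The implications overlap
    consistently, since for such points both kernel inequalities hold.\<close>
  have k: "(x \<bullet> e <= s \<and> y \<bullet> e <= s \<or> s <= x \<bullet> e \<and> s <= y \<bullet> e --> ?k (?\<sigma> y - x) <= ?k (y - x)) \<and>
    (x \<bullet> e <= s \<and> s <= y \<bullet> e \<or> s <= x \<bullet> e \<and> y \<bullet> e <= s --> ?k (y - x) <= ?k (?\<sigma> y - x))"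
   by (intro conjI impI k1 k2; elim disjE conjE) (auto simp: mult_nonpos_nonpos mult_nonneg_nonpos mult_nonpos_nonneg)
  have "?k (?\<sigma> y - x) <= ?k (y - x) \<and> (?P y = max (W y) (W (?\<sigma> y)) \<and> ?P (?\<sigma> y) = min (W y) (W (?\<sigma> y)) \<and> ?P x = max (W x) (W (?\<sigma> x)) \<and> ?P (?\<sigma> x) = min (W x) (W (?\<sigma> x)) \<or>
     ?P y = min (W y) (W (?\<sigma> y)) \<and> ?P (?\<sigma> y) = max (W y) (W (?\<sigma> y)) \<and> ?P x = min (W x) (W (?\<sigma> x)) \<and> ?P (?\<sigma> x) = max (W x) (W (?\<sigma> x)))
   \<or> ?k (y - x) <= ?k (?\<sigma> y - x) \<and> (?P y = max (W y) (W (?\<sigma> y)) \<and> ?P (?\<sigma> y) = min (W y) (W (?\<sigma> y)) \<and> ?P x = min (W x) (W (?\<sigma> x)) \<and> ?P (?\<sigma> x) = max (W x) (W (?\<sigma> x)) \<or>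
     ?P y = min (W y) (W (?\<sigma> y)) \<and> ?P (?\<sigma> y) = max (W y) (W (?\<sigma> y)) \<and> ?P x = max (W x) (W (?\<sigma> x)) \<and> ?P (?\<sigma> x) = min (W x) (W (?\<sigma> x)))"
   using H[of x] H[of y] k by satx
  then show ?thesis unfolding \<Phi>_def c by (rule two_point_inequality)
 qed
 have "4 * I ?P <= 4 * I W"
  unfolding four[OF polarize_measurable[OF e assms(2)], symmetric] four[OF assms(2), symmetric]
  by (rule nn_integral_mono, rule nn_integral_mono, rule ennreal_leI, rule le)
 then have I: "I ?P <= I W"
  using ennreal_mult_le_mult_iff[of 4 "I ?P" "I W"] by simp
 have K: "nonlocal_form \<epsilon> (cr V) = ennreal (inverse \<epsilon> ^ CARD('n) * (1 / \<epsilon>^2)) * I V" if "cr V \<in> L2" for V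
 proof -
  have "indicator (ball 0 \<epsilon>) (y - x) * ennreal ((cmod (cr V y - cr V x))^2) = ennreal (\<Phi> V x y)" for x y
   by (simp add: \<Phi>_def of_real_diff[symmetric] split: split_indicator del: of_real_diff)
  then show ?thesis unfolding nonlocal_form_kernel[OF that \<epsilon>] I_def by simp
 qed
 show ?thesis
  unfolding K[OF W] K[OF polarize_L2(1)[OF e assms(2) W]] by (rule mult_left_mono[OF I]) simp
qed

text \<open>A single exceptional set for all pairs of points; off it, equality of norms forces
  equality of values, so radial symmetry is included.\<close>

definition radially_decreasing :: "(real^'n::finite => real) => bool" where
 "radially_decreasing v \<longleftrightarrow>
  (\<exists>N\<in>null_sets lborel. \<forall>x y. x \<notin> N --> y \<notin> N --> norm x <= norm y --> v y <= v x)"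

text \<open>Each hyperplane has its own null set and there are uncountably many of them, so values
  cannot be compared directly. Ball averages can be compared at every pair of centres, and they
  converge to v off one null set along a subsequence of radii.\<close>

lemma radially_decreasing_if_polarized:
 fixes v :: "real^'n::finite => real"
 assumes v: "cr v \<in> H1" and m [measurable]: "v \<in> borel_measurable borel"
  and pol: "!!e s. norm e = 1 ==> s > 0 ==> AE x in lborel. x \<bullet> e < s --> v (reflect e s x) <= v x"
 shows "radially_decreasing v"
proof -
 note vL = H1_L2[OF v]
 obtain k :: 'n where True by simp
 have int: "integrable lborel (%z. indicator (ball x r) z * v z)" for x and r :: real
  using integrable_Re[OF integrable_L2_mult[OF ball_indicator_L2 vL], of x r] by simp
 have Re: "Re (ball_integral r (cr v) x) = (LBINT z. indicator (ball x r) z * v z)" for r x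
  unfolding ball_integral_def of_real_mult[symmetric] integral_complex_of_real by simp
 have lt: "Re (ball_integral r (cr v) y) <= Re (ball_integral r (cr v) x)" if xy: "norm x < norm y" for r and x y :: "real^'n"
 proof -
  define e where "e = (1 / norm (y - x)) *\<^sub>R (y - x)"
  have ne: "norm (y - x) > 0" using xy by auto
  then have e: "norm e = 1" by (simp add: e_def)
  \<comment> \<open>The hyperplane is the perpendicular bisector of x and y; |x| < |y| puts the
    origin strictly on the side of x, which is s > 0.\<close>
  define s where "s = ((norm y)^2 - (norm x)^2) / (2 * norm (y - x))"
  have s: "s > 0" using ne xy by (simp add: s_def power_strict_mono)
  let ?\<sigma> = "reflect e s"
  have e0: "(y - x) = norm (y - x) *\<^sub>R e" using ne by (simp add: e_def)
  have xe: "x \<bullet> e - s = - norm (y - x) / 2"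
  proof -
   have ns: "norm (y - x) * s = ((norm y)^2 - (norm x)^2) / 2" using ne by (simp add: s_def)
   have "norm (y - x) * (x \<bullet> e - s) = x \<bullet> (y - x) - ((norm y)^2 - (norm x)^2) / 2"
    unfolding right_diff_distrib ns using ne by (simp add: e_def inner_diff_right)
   also have "... = - (norm (y - x))\<^sup>2 / 2"
    by (simp add: power2_norm_eq_inner inner_diff_left inner_diff_right inner_commute field_simps)
   also have "... = norm (y - x) * (- norm (y - x) / 2)" by (simp add: power2_eq_square)
   finally show ?thesis using ne by (simp only: mult_left_cancel)
  qed
  have \<sigma>x: "?\<sigma> x = y" unfolding reflect_def xe using e0 by (simp add: algebra_simps)
  have ib: "indicator (ball y r) (?\<sigma> z) = (indicator (ball x r) z :: real)"
   "indicator (ball x r) (?\<sigma> z) = (indicator (ball y r) z :: real)" for z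
  proof -
   have "norm (y - ?\<sigma> z) = norm (x - z)" using reflect_dist_sq[OF e, of s x z] by (simp add: \<sigma>x)
   moreover have "norm (x - ?\<sigma> z) = norm (y - z)"
    using reflect_dist_sq[OF e, of s "?\<sigma> x" z] by (simp add: \<sigma>x reflect_reflect[OF e, of s x, unfolded \<sigma>x])
   ultimately show "indicator (ball y r) (?\<sigma> z) = (indicator (ball x r) z :: real)"
    "indicator (ball x r) (?\<sigma> z) = (indicator (ball y r) z :: real)" by (simp_all add: indicator_def dist_norm)
  qed
  note [measurable] = reflect_measurable[OF e, of s]
  let ?I = "%x z. indicator (ball x r) z * v z"
  let ?J = "%x z. indicator (ball x r) z * v (?\<sigma> z)"
  have sw: "(LBINT z. ?I x z) = (LBINT z. ?J y z)" "(LBINT z. ?I y z) = (LBINT z. ?J x z)"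
   "integrable lborel (?J x)" "integrable lborel (?J y)"
   using preserves_lborel_integral[OF preserves_lborel_reflect[OF e, of s], of "?I x"] preserves_lborel_integral[OF preserves_lborel_reflect[OF e, of s], of "?I y"]
    preserves_lborel_integrable[OF preserves_lborel_reflect[OF e, of s], of "?I x"] preserves_lborel_integrable[OF preserves_lborel_reflect[OF e, of s], of "?I y"] int
   by (simp_all add: ib)
  have "0 <= (LBINT z. (?I x z - ?I y z) - (?J x z - ?J y z))"
  proof (rule integral_nonneg_AE)
   have a1: "AE z in lborel. z \<bullet> e < s --> v (?\<sigma> z) <= v z" by (rule pol[OF e s])
   have a2: "AE z in lborel. s < z \<bullet> e --> v z <= v (?\<sigma> z)"
    using preserves_lborel_AE[OF preserves_lborel_reflect[OF e, of s] a1]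
    by eventually_elim (simp add: reflect_inner[OF e] reflect_reflect[OF e])
   show "AE z in lborel. 0 <= (?I x z - ?I y z) - (?J x z - ?J y z)"
    using a1 a2
   proof eventually_elim
    fix z assume z: "z \<bullet> e < s --> v (?\<sigma> z) <= v z" "s < z \<bullet> e --> v z <= v (?\<sigma> z)"
    have d: "(norm (z - y))^2 = (norm (z - x))^2 + 4 * ((x \<bullet> e - s) * (z \<bullet> e - s))"
     using reflect_diff_sq[OF e, of z s x] by (simp add: \<sigma>x)
    have xs: "x \<bullet> e - s < 0" using ne by (simp add: xe)
    have "0 <= (indicator (ball x r) z - indicator (ball y r) z) * (v z - v (?\<sigma> z))"
    proof (cases "z \<bullet> e" s rule: linorder_cases)
     case less
     then have "0 <= (x \<bullet> e - s) * (z \<bullet> e - s)" using xs by (intro mult_nonpos_nonpos) auto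
     then have "norm (z - x) <= norm (z - y)" using d by (intro power2_le_imp_le[OF _ norm_ge_zero]) linarith
     then have "indicator (ball y r) z <= (indicator (ball x r) z :: real)" by (auto simp: dist_norm norm_minus_commute split: split_indicator)
     then show ?thesis using z(1) less by (intro mult_nonneg_nonneg) auto
    next
     case greater
     then have "(x \<bullet> e - s) * (z \<bullet> e - s) <= 0" using xs by (intro mult_nonpos_nonneg) auto
     then have "norm (z - y) <= norm (z - x)" using d by (intro power2_le_imp_le[OF _ norm_ge_zero]) linarith
     then have "indicator (ball x r) z <= (indicator (ball y r) z :: real)" by (auto simp: dist_norm norm_minus_commute split: split_indicator)
     then show ?thesis using z(2) greater by (intro mult_nonpos_nonpos) auto
    qed (simp add: reflect_def)
    then show "0 <= (?I x z - ?I y z) - (?J x z - ?J y z)" by (simp add: algebra_simps)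
   qed
  qed
  also have "... = ((LBINT z. ?I x z) - (LBINT z. ?I y z)) - ((LBINT z. ?J x z) - (LBINT z. ?J y z))"
   by (simp add: int sw(3,4))
  finally show ?thesis unfolding Re using sw(1,2) by linarith
 qed
 define K where "K = sqrt (dirichlet (cr v))"
 have l: "lip2 K (cr v)" unfolding K_def by (rule lip2_H1[OF v])
 have le: "Re (ball_integral r (cr v) y) <= Re (ball_integral r (cr v) x)" if r: "r > 0" and xy: "norm x <= norm y" for r and x y :: "real^'n"
 proof (cases "y = 0")
  case False
  let ?c = "sqrt (measure lborel (ball (0::real^'n) r)) * K * norm y"
  \<comment> \<open>Equal norms are reached by moving y slightly outwards, at a cost controlled by
    the Lipschitz bound for ball integrals.\<close>
  have "Re (ball_integral r (cr v) y) <= Re (ball_integral r (cr v) x) + t * ?c" if t: "t > 0" for t :: real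
  proof -
   have "norm x < norm (y + t *\<^sub>R y)"
   proof -
    have "norm (y + t *\<^sub>R y) = (1 + t) * norm y" using t by (simp add: scaleR_left_distrib[symmetric, of 1, simplified])
    then show ?thesis using xy t False by (simp add: distrib_right add_pos_pos le_less_trans[OF xy])
   qed
   then have "Re (ball_integral r (cr v) (y + t *\<^sub>R y)) <= Re (ball_integral r (cr v) x)" by (rule lt)
   moreover have "\<bar>Re (ball_integral r (cr v) (y + t *\<^sub>R y) - ball_integral r (cr v) y)\<bar> <= t * ?c"
    using order_trans[OF abs_Re_le_cmod ball_integral_lipschitz[OF l r, of y "t *\<^sub>R y"]] t by (simp add: mult_ac)
   ultimately show ?thesis by (simp add: abs_le_iff)
  qed
  then show ?thesis
  proof -
   assume h: "!!t. t > 0 ==> Re (ball_integral r (cr v) y) <= Re (ball_integral r (cr v) x) + t * ?c"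
   have "((%t. Re (ball_integral r (cr v) x) + t * ?c) \<longlongrightarrow> Re (ball_integral r (cr v) x) + 0 * ?c) (at_right 0)"
    by (intro tendsto_intros)
   then show ?thesis
    by (intro tendsto_lowerbound[of _ "Re (ball_integral r (cr v) x)" "at_right (0::real)"]) (auto intro: eventually_at_right_less[THEN eventually_mono] h)
  qed
 qed (use xy in simp)
 define D where "D = ball_moment k * dirichlet (cr v)"
 have D: "0 <= D" using ball_moment_pos[of k] dirichlet_nonneg[of "cr v"] by (simp add: D_def)
 let ?V = "%e. measure lborel (ball (0::real^'n) e)"
 let ?A = "%j x. ball_integral (inverse (real (Suc j))) (cr v) x / cor (?V (inverse (real (Suc j))))"
 have err: "(%x. ?A j x - v x) \<in> L2" "L2_norm (%x. ?A j x - v x) <= inverse (real (Suc j)) * sqrt (D / ?V 1)" for j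
  using ball_average_error[OF vL _ D nonlocal_form_le_dirichlet[OF v, of "inverse (real (Suc j))" k, folded D_def]] by simp_all
 have AL: "?A j \<in> L2" for j using L2_add[OF err(1)[of j] vL] by simp
 have "(%j. inverse (real (Suc j)) * sqrt (D / ?V 1)) ----> 0 * sqrt (D / ?V 1)"
  by (intro tendsto_intros LIMSEQ_inverse_real_of_nat)
 then have lim0: "(%j. inverse (real (Suc j)) * sqrt (D / ?V 1)) ----> 0" by simp
 have lim: "(%j. L2_norm (%x. ?A j x - v x)) ----> 0"
 proof (rule Lim_null_comparison[OF always_eventually lim0], rule allI)
  show "norm (L2_norm (%x. ?A j x - v x)) <= inverse (real (Suc j)) * sqrt (D / ?V 1)" for j
   unfolding real_norm_def abs_of_nonneg[OF L2_norm_nonneg] by (rule err(2))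
 qed
 obtain r :: "nat => nat" where "AE x in lborel. (%j. ?A (r j) x) ----> cr v x"
 proof (rule L2_tendsto_AE_subseq[of ?A "cr v", OF AL vL lim])
  fix r :: "nat => nat"
  assume "AE x in lborel. (%j. ?A (r j) x) ----> cr v x"
  then show thesis by (rule that)
 qed
 then obtain N where N: "N \<in> null_sets lborel" "!!x. x \<notin> N ==> (%j. ?A (r j) x) ----> cr v x"
  by (auto elim!: AE_E3)
 have "v y <= v x" if "x \<notin> N" "y \<notin> N" "norm x <= norm y" for x y
 proof (rule LIMSEQ_le)
  show "(%j. Re (?A (r j) y)) ----> v y" "(%j. Re (?A (r j) x)) ----> v x"
   using tendsto_Re[OF N(2)[OF that(2)]] tendsto_Re[OF N(2)[OF that(1)]] by simp_all
  show "\<exists>N. \<forall>n\<ge>N. Re (?A (r n) y) <= Re (?A (r n) x)"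
   using le[OF _ that(3)] by (auto intro!: divide_right_mono simp: Re_divide_of_real simp del: of_nat_Suc)
 qed
 then show ?thesis unfolding radially_decreasing_def using N(1) by blast
qed

lemma vector_derivative_powr_at_0:
 assumes "1 < q" "0 <= v"
 shows "((%v. v powr q) has_vector_derivative (q * v powr (q - 1))) (at (v::real) within {0..})"
proof (cases "v = 0")
 case True
 have "((%y. (y powr q - 0 powr q) / (y - 0)) \<longlongrightarrow> 0) (at 0 within {0..})"
 proof -
  have "((%y::real. y powr (q - 1)) \<longlongrightarrow> 0 powr (q - 1)) (at 0 within {0..})"
   by (rule tendsto_powr') (use assms in "auto intro: tendsto_intros simp: eventually_at_filter")
  moreover have "y powr (q - 1) = (y powr q - 0 powr q) / (y - 0)" if "y \<in> {0..}" "y ~= 0" for y :: real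
   using that by (simp add: powr_diff)
  ultimately show ?thesis
   using assms(1) by (subst Lim_cong_within[where g="%y. y powr (q - 1)"]) auto
 qed
 then show ?thesis
  unfolding has_real_derivative_iff_has_vector_derivative[symmetric] has_field_derivative_iff True by simp
next
 case False
 then have "((%v. v powr q) has_real_derivative (q * v powr (q - 1))) (at v)"
  using assms by (intro has_real_derivative_powr) auto
 then show ?thesis
  unfolding has_real_derivative_iff_has_vector_derivative[symmetric] by (rule has_field_derivative_at_within)
qed

text \<open>An instance of \<open>potential_uniformly_continuous\<close>: the integral of |f|^(s +
  2) is the potential of G(x, v) = v^(1 + s/2), with \<gamma> = 1, \<Omega> = 0 and p = 1 + s. Two
  distinct coordinates exist because subcriticality includes n >= 2.\<close>

lemma pw_integral_tendsto:
 fixes f :: "real^'n::finite => complex"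
 assumes sub: "subcritical CARD('n) s"
  and F: "!!k. lip2 M (F k)" "!!k. L2_norm (F k) <= M" and f: "lip2 M f" "L2_norm f <= M"
  and lim: "(%k::nat. L2_norm (%x. F k x - f x)) ----> 0"
 shows "(%k. \<integral>x. pw s (F k) x \<partial>lborel) ----> (LBINT x. pw s f x)"
proof -
 have s: "0 < s" and n2: "2 <= CARD('n)" using sub by (auto simp: subcritical_def)
 from n2 obtain e1 e2 :: 'n where e12: "e1 ~= e2"
  by (metis One_nat_def card_1_singleton_iff card_le_Suc0_iff_eq finite not_less_eq_eq numeral_2_eq_2 UNIV_I)
 let ?q = "1 + s / 2"
 have q: "1 < ?q" using s by simp
 interpret rotating_nls e1 e2 1 0 1 "1 + s" ?q "%x v. v powr ?q"
 proof
  show "continuous_on (UNIV \<times> {0..}) (%(x :: real^'n, v :: real). v powr ?q)"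
   unfolding case_prod_beta using q by (intro continuous_intros continuous_on_powr') auto
  show "(%v::real. v powr ?q) differentiable_on {0..}"
   unfolding differentiable_on_def
   using vector_derivative_powr_at_0[OF q] by (auto intro: differentiableI_vector)
  show "\<bar>deriv_v (%x v. v powr ?q) x v\<bar> <= ?q * (1 + v powr ((1 + s - 1) / 2))" if "0 <= v" for x :: "real^'n" and v
  proof -
   have "deriv_v (%x v. v powr ?q) x v = ?q * v powr (?q - 1)"
    unfolding deriv_v_def
   proof (rule vector_derivative_within)
    show "at v within {0..} ~= bot"
    proof
     assume "at v within {0..} = bot"
     moreover have "{v<..} \<subseteq> {0..}" using that by auto
     ultimately have "at_right v <= bot" using at_le[of "{v<..}" "{0..}" v] by simp
     then have "at_right v = bot" by (rule bot.extremum_uniqueI)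
     then show False using trivial_limit_at_right_real[of v] by simp
    qed
    show "((%v. v powr ?q) has_vector_derivative (?q * v powr (?q - 1))) (at v within {0..})"
     by (rule vector_derivative_powr_at_0[OF q that])
   qed
   then show ?thesis using q by (simp add: abs_mult)
  qed
 qed (use n2 e12 q sub in auto)
 have pot: "potential g = (LBINT x. pw s g x)" for g
  unfolding potential_def
 proof (rule Bochner_Integration.integral_cong[OF refl])
  fix x
  show "((cmod (g x))^2) powr ?q = pw s g x"
  proof (cases "g x = 0")
   case False
   have "((cmod (g x))^2) powr (1 + s / 2) = (cmod (g x))^2 * ((cmod (g x))^2) powr (s / 2)"
    using False by (simp add: powr_add)
   also have "((cmod (g x))^2) powr (s / 2) = cmod (g x) powr s"
    using sq_powr[of "cmod (g x)"] by simp
   finally show ?thesis by (simp add: pw_def)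
  qed (simp add: pw_def)
 qed
 have M: "0 <= M" using lip2_nonneg[OF f(1)] .
 show ?thesis
 proof (rule LIMSEQ_I)
  fix \<epsilon> :: real assume "0 < \<epsilon>"
  then have h: "0 < \<epsilon> / 2" by simp
  show "\<exists>no. \<forall>k\<ge>no. norm ((LBINT x. pw s (F k) x) - (LBINT x. pw s f x)) < \<epsilon>"
  proof (rule potential_uniformly_continuous[OF h M])
   fix \<delta> :: real
   assume \<delta>: "\<delta> > 0" and uc: "!!f g. lip2 M f ==> lip2 M g ==> L2_norm f <= M ==> L2_norm g <= M \<Longrightarrow>
    L2_norm (%x. f x - g x) <= \<delta> ==> \<bar>potential f - potential g\<bar> <= \<epsilon> / 2"
   obtain no where no: "!!k. k >= no ==> L2_norm (%x. F k x - f x) < \<delta>"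
    using order_tendstoD(2)[OF lim \<delta>] unfolding eventually_sequentially by blast
   have "norm ((LBINT x. pw s (F k) x) - (LBINT x. pw s f x)) < \<epsilon>" if "k >= no" for k
    using uc[OF F(1) f(1) F(2) f(2) less_imp_le[OF no[OF that]]] \<open>0 < \<epsilon>\<close> by (simp add: pot)
   then show ?thesis by blast
  qed
 qed
qed

lemma nonlocal_form_mono:
 assumes "!!z. shift_dist f z <= shift_dist g z"
 shows "nonlocal_form e f <= nonlocal_form e g"
 unfolding nonlocal_form_def
 by (intro nn_integral_mono mult_left_mono mult_right_mono ennreal_leI power_mono assms shift_dist_nonneg) auto

lemma shift_dist_cmod:
 assumes "f \<in> L2"
 shows "shift_dist (%x. cor (cmod (f x))) z <= shift_dist f z"
proof -
 have d: "(%x. f (x + z) - f x) \<in> L2" by (rule L2_diff[OF L2_shift[OF assms] assms])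
 have m: "(%x. cor (cmod (f (x + z))) - cor (cmod (f x))) \<in> borel_measurable borel"
  by (rule L2_measurable[OF L2_diff[OF L2_cmod[OF L2_shift[OF assms]] L2_cmod[OF assms]]])
 have "L2_norm (%x. cor (cmod (f (x + z))) - cor (cmod (f x))) <= 1 * L2_norm (%x. f (x + z) - f x)"
  by (rule L2_dominated(2)[OF d m])
   (auto simp: norm_triangle_ineq3 of_real_diff[symmetric] simp del: of_real_diff)
 then show ?thesis by (simp add: shift_dist_def)
qed

lemma twice_diff_eqD:
 fixes a b c :: real
 assumes "2 * (a - b) = c"
 shows "0 <= c ==> b <= a" "a <= b ==> c <= 0"
 using assms by auto

text \<open>Instead of iterating polarizations towards the rearrangement, a weighted mass is
  optimised over a class \<open>P\<close> that is stable under polarization and under L2 limits. An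
  optimal member cannot be improved by any polarization, so it coincides a.e. with its polarizations
  and is radially decreasing.\<close>

theorem symmetrization:
 fixes u :: "real^'n::finite => complex"
 assumes u: "u \<in> H1" and sub: "subcritical CARD('n) s"
 obtains v :: "real^'n => real" where "v \<in> borel_measurable borel" "!!x. 0 <= v x" "cr v \<in> H1" "dirichlet (cr v) <= dirichlet u"
  "L2_norm (cr v) = L2_norm u" "(LBINT x. pw s (cr v) x) = (LBINT x. pw s u x)" "radially_decreasing v"
proof -
 obtain k :: 'n where True by simp
 note uL = H1_L2[OF u]
 define D where "D = dirichlet u"
 have D: "0 <= D" by (simp add: D_def dirichlet_nonneg)
 let ?h = "%R x. 1 - indicator (cball 0 R) (x :: real^'n) :: real"
 let ?g = "%x. exp (- (norm (x::real^'n))\<^sup>2 / 2) :: real"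
 \<comment> \<open>The bounds on the mass outside every ball make the class tight. Polarization
   preserves them for s > 0, because it moves larger values to the mirror point nearer the origin;
   all other clauses are invariant or nonincreasing.\<close>
 define P where "P = {W :: real^'n => real. W \<in> borel_measurable borel \<and> (\<forall>x. 0 <= W x) \<and> cr W \<in> L2 \<and> L2_norm (cr W) = L2_norm u
  \<and> (\<forall>e>0. nonlocal_form e (cr W) <= ennreal (ball_moment k * D))
  \<and> (\<forall>R. (LBINT x. (?h R x)^2 * (W x)^2) <= (LBINT x. (?h R x)^2 * (cmod (u x))^2))
  \<and> (NN x. ennreal (pw s (cr W) x)) = (NN x. ennreal (pw s u x))}"
 have PH: "cr W \<in> H1" "dirichlet (cr W) <= D" if "W \<in> P" for W
  using H1_if_nonlocal_form_le[of "cr W" D k] that D by (auto simp: P_def)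
 have uP: "(%x. cmod (u x)) \<in> P"
 proof -
  have "nonlocal_form e (%x. cor (cmod (u x))) <= ennreal (ball_moment k * D)" if "e > 0" for e
   unfolding D_def by (rule order_trans[OF nonlocal_form_mono[OF shift_dist_cmod[OF uL]] nonlocal_form_le_dirichlet[OF u that]])
  moreover have "(%x. cmod (u x)) \<in> borel_measurable borel"
   by (rule measurable_compose[OF L2_measurable[OF uL]]) measurable
  ultimately show ?thesis using L2_cmod[OF uL] by (simp add: P_def L2_norm_cmod pw_def)
 qed
 have wt: "(LBINT x. (g x)^2 * (W x)^2) = (L2_norm (%x. cor (g x) * cr W x))^2" for g W :: "real^'n => real"
  by (simp add: L2_norm_sq norm_mult power_mult_distrib)
 have wtL: "(%x. cor (g x) * f x) \<in> L2" "L2_norm (%x. cor (g x) * f x) <= L2_norm f"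
  if "g \<in> borel_measurable borel" "!!x. \<bar>g x\<bar> <= 1" "f \<in> L2" for g :: "real^'n => real" and f
 proof -
  have [measurable]: "g \<in> borel_measurable borel" "f \<in> borel_measurable borel" using that(1) L2_measurable[OF that(3)] by auto
  have "(%x. cor (g x) * f x) \<in> borel_measurable borel" by measurable
  moreover have "AE x in lborel. cmod (cor (g x) * f x) <= 1 * cmod (f x)"
   using that(2) by (intro AE_I2) (simp add: norm_mult mult_left_le_one_le)
  ultimately have r: "(%x. cor (g x) * f x) \<in> L2 \<and> L2_norm (%x. cor (g x) * f x) <= 1 * L2_norm f"
   using L2_dominated[OF that(3), of "%x. cor (g x) * f x" 1] by simp
  then show "(%x. cor (g x) * f x) \<in> L2" "L2_norm (%x. cor (g x) * f x) <= L2_norm f" by auto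
 qed
 have hm [measurable]: "?h R \<in> borel_measurable borel" and h1: "\<bar>?h R x\<bar> <= 1" for R x
  by (intro borel_measurable_diff borel_measurable_const borel_measurable_indicator cball_sets_borel) (simp split: split_indicator)
 have gm [measurable]: "?g \<in> borel_measurable borel" by measurable
 have g1: "\<bar>?g x\<bar> <= 1" for x by simp
 \<comment> \<open>Minimising T maximises the mass weighted by exp(-|x|^2). The weight is strictly
   decreasing in |x|, so any effective polarization would lower T strictly.\<close>
 define T where "T W = (LBINT x. - (?g x)\<^sup>2 * (W x)^2)" for W
 have Teq: "T W = - (L2_norm (%x. cor (?g x) * cr W x))\<^sup>2" for W
  unfolding T_def wt[symmetric] by simp
 have Tb: "- (L2_norm u)\<^sup>2 <= T W" if "W \<in> P" for W
  using wtL(2)[OF gm g1, of "cr W"] that unfolding Teq by (auto simp: P_def intro!: power_mono L2_norm_nonneg)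
 define I where "I = Inf (T ` P)"
 have bdd: "bdd_below (T ` P)" using Tb by (auto intro!: bdd_belowI)
 have IT: "I <= T W" if "W \<in> P" for W
  unfolding I_def by (rule cInf_lower[OF imageI[OF that] bdd])
 have "\<exists>W\<in>P. T W < I + inverse (real (Suc j))" for j
  using cInf_lessD[of "T ` P" "I + inverse (real (Suc j))"] uP by (auto simp: I_def)
 then obtain W where W: "!!j. W j \<in> P" "!!j. T (W j) < I + inverse (real (Suc j))" by metis
 have WL: "cr (W j) \<in> L2" and Wn: "L2_norm (cr (W j)) = L2_norm u" for j using W(1)[of j] by (auto simp: P_def)
 define M where "M = max (sqrt D) (L2_norm u)"
 have lipM: "lip2 M (cr V)" if "V \<in> P" for V
  by (rule lip2_mono[OF lip2_H1[OF PH(1)[OF that]]])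
   (use PH(2)[OF that] in "simp add: M_def le_max_iff_disj")
 have uM: "L2_norm u <= M" by (simp add: M_def)
 have tight: "\<exists>R. \<forall>j. L2_norm (%x. cor (?h R x) * cr (W j) x) <= \<eta>" if \<eta>: "0 < \<eta>" for \<eta>
 proof -
  have "(%i. \<integral>x. (?h (real i) x)^2 * (cmod (u x))^2 \<partial>lborel) ----> (\<integral>x. 0 \<partial>(lborel :: (real^'n) measure))"
  proof (rule integral_dominated_convergence)
   show "integrable lborel (%x. (cmod (u x))^2)" by (rule L2_integrable[OF uL])
   have [measurable]: "u \<in> borel_measurable borel" by (rule L2_measurable[OF uL])
   show "(%x. (?h (real i) x)^2 * (cmod (u x))^2) \<in> borel_measurable lborel" for i by measurable
   show "AE x in lborel. (%i. (?h (real i) x)^2 * (cmod (u x))^2) ----> 0"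
   proof (rule AE_I2, rule tendsto_eventually)
    fix x :: "real^'n"
    have "\<forall>\<^sub>F i in sequentially. norm x <= real i"
     using filterlim_real_sequentially unfolding filterlim_at_top by blast
    then show "\<forall>\<^sub>F i in sequentially. (?h (real i) x)^2 * (cmod (u x))^2 = 0" by eventually_elim simp
   qed
   show "AE x in lborel. norm ((?h (real i) x)^2 * (cmod (u x))^2) <= (cmod (u x))^2" for i
    by (intro AE_I2) (auto split: split_indicator)
  qed auto
  then have "\<forall>\<^sub>F i in sequentially. (LBINT x. (?h (real i) x)^2 * (cmod (u x))^2) < \<eta>^2"
   by (rule order_tendstoD(2)) (use \<eta> in simp)
  then obtain i where i: "(LBINT x. (?h (real i) x)^2 * (cmod (u x))^2) < \<eta>^2"
   unfolding eventually_sequentially by blast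
  have "L2_norm (%x. cor (?h (real i) x) * cr (W j) x) <= \<eta>" for j
  proof (rule power2_le_imp_le)
   have "(LBINT x. (?h (real i) x)^2 * (W j x)^2) <= (LBINT x. (?h (real i) x)^2 * (cmod (u x))^2)"
    using W(1)[of j] unfolding P_def by blast
   with i show "(L2_norm (%x. cor (?h (real i) x) * cr (W j) x))^2 <= \<eta>^2" unfolding wt by linarith
  qed (use \<eta> in simp)
  then show ?thesis by blast
 qed
 obtain r :: "nat => nat" and f where r: "strict_mono r" and f: "f \<in> L2" and lim: "(%j. L2_norm (%x. cr (W (r j)) x - f x)) ----> 0"
  by (rule tight_compactness[of M "%j. cr (W j)"]) (use lipM[OF W(1)] Wn uM tight in "auto")
 define v where "v x = cmod (f x)" for x
 have vL: "cr v \<in> L2" using L2_cmod[OF f] by (simp add: v_def)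
 have vm: "v \<in> borel_measurable borel" unfolding v_def[abs_def] by (rule measurable_compose[OF L2_measurable[OF f]]) measurable
 have v0: "0 <= v x" for x by (simp add: v_def)
 have limv: "(%j. L2_norm (%x. cr (W (r j)) x - cr v x)) ----> 0"
 proof (rule Lim_null_comparison[OF always_eventually lim], rule allI)
  fix j
  have "L2_norm (%x. cr (W (r j)) x - cr v x) <= 1 * L2_norm (%x. cr (W (r j)) x - f x)"
  proof (rule L2_dominated(2)[OF L2_diff[OF WL f] L2_measurable[OF L2_diff[OF WL vL]]])
   have "\<bar>W (r j) x - cmod (f x)\<bar> <= cmod (cr (W (r j)) x - f x)" for x
    using norm_triangle_ineq3[of "cr (W (r j)) x" "f x"] W(1)[of "r j"] by (simp add: P_def)
   then show "AE x in lborel. cmod (cr (W (r j)) x - cr v x) <= 1 * cmod (cr (W (r j)) x - f x)"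
    by (simp add: v_def of_real_diff[symmetric] del: of_real_diff)
  qed simp
  then show "norm (L2_norm (%x. cr (W (r j)) x - cr v x)) <= L2_norm (%x. cr (W (r j)) x - f x)"
   by (simp add: L2_norm_nonneg)
 qed
 have wlim: "(%j. (L2_norm (%x. cor (g x) * cr (W (r j)) x))^2) ----> (L2_norm (%x. cor (g x) * cr v x))\<^sup>2"
  if g: "g \<in> borel_measurable borel" "!!x. \<bar>g x\<bar> <= 1" for g :: "real^'n => real"
 proof (intro tendsto_power L2_norm_tendsto wtL(1)[OF g WL] wtL(1)[OF g vL])
  show "(%j. L2_norm (%x. cor (g x) * cr (W (r j)) x - cor (g x) * cr v x)) ----> 0"
  proof (rule Lim_null_comparison[OF always_eventually limv], rule allI)
   show "norm (L2_norm (%x. cor (g x) * cr (W (r j)) x - cor (g x) * cr v x)) <= L2_norm (%x. cr (W (r j)) x - cr v x)" for j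
    using wtL(2)[OF g L2_diff[OF WL vL]] by (simp add: right_diff_distrib L2_norm_nonneg)
  qed
 qed
 have vP: "v \<in> P"
 proof -
  have n: "L2_norm (cr v) = L2_norm u"
   using LIMSEQ_unique[OF L2_norm_tendsto[OF WL vL limv]] by (simp add: Wn)
  obtain r' :: "nat => nat" where ae: "AE x in lborel. (%j. cr (W (r (r' j))) x) ----> cr v x"
   by (rule L2_tendsto_AE_subseq[of "%j. cr (W (r j))", OF WL vL limv])
  have nl: "nonlocal_form e (cr v) <= ennreal (ball_moment k * D)" if "e > 0" for e
   by (rule order_trans[OF nonlocal_form_le_liminf[OF WL vL that ae]], rule Liminf_le)
    (use W(1) that in "auto simp: P_def")
  have vH: "cr v \<in> H1" "dirichlet (cr v) <= D"
   using H1_if_nonlocal_form_le[OF vL D nl] by auto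
  have lv: "lip2 M (cr v)"
   by (rule lip2_mono[OF lip2_H1[OF vH(1)]]) (use vH(2) in "simp add: M_def le_max_iff_disj")
  have tails: "(LBINT x. (?h R x)^2 * (v x)^2) <= (LBINT x. (?h R x)^2 * (cmod (u x))^2)" for R
  proof (rule LIMSEQ_le_const2)
   show "(%j. \<integral>x. (?h R x)^2 * (W (r j) x)^2 \<partial>lborel) ----> (LBINT x. (?h R x)^2 * (v x)^2)"
    unfolding wt by (rule wlim[OF hm h1])
   show "\<exists>N. \<forall>j\<ge>N. (LBINT x. (?h R x)^2 * (W (r j) x)^2) <= (LBINT x. (?h R x)^2 * (cmod (u x))^2)"
    using W(1) unfolding P_def by blast
  qed
  have pwe: "(NN x. ennreal (pw s g x)) = ennreal (LBINT x. pw s g x)" if "lip2 K g" for K and g :: "real^'n => complex"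
   by (rule nn_integral_eq_integral[OF pw_integrable[OF sub that]]) (simp add: pw_nonneg)
  have pwn: "0 <= (LBINT x. pw s g x)" for g :: "real^'n => complex"
   by (rule integral_nonneg_AE) (simp add: pw_nonneg)
  have "(LBINT x. pw s (cr (W (r j))) x) = (LBINT x. pw s u x)" for j
  proof -
   have "(NN x. ennreal (pw s (cr (W (r j))) x)) = (NN x. ennreal (pw s u x))"
    using W(1)[of "r j"] unfolding P_def by blast
   then show ?thesis unfolding pwe[OF lipM[OF W(1)]] pwe[OF lip2_H1[OF u]] by (simp add: pwn)
  qed
  moreover have "(%j. \<integral>x. pw s (cr (W (r j))) x \<partial>lborel) ----> (LBINT x. pw s (cr v) x)"
   by (rule pw_integral_tendsto[OF sub lipM[OF W(1)] _ lv _ limv]) (simp_all add: Wn n uM)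
  ultimately have "(LBINT x. pw s (cr v) x) = (LBINT x. pw s u x)"
   using LIMSEQ_unique by (simp add: LIMSEQ_const_iff)
  then have "(NN x. ennreal (pw s (cr v) x)) = (NN x. ennreal (pw s u x))"
   unfolding pwe[OF lv] pwe[OF lip2_H1[OF u]] by simp
  then show ?thesis unfolding P_def using vm v0 vL n nl tails by blast
 qed
 have TI: "T v <= I"
 proof (rule LIMSEQ_le)
  show "(%j. T (W (r j))) ----> T v" unfolding Teq by (intro tendsto_minus wlim gm g1)
  have "(%j. I + inverse (real (Suc j))) ----> I + 0" by (intro tendsto_intros LIMSEQ_inverse_real_of_nat)
  from LIMSEQ_subseq_LIMSEQ[OF this r] show "(%j. I + inverse (real (Suc (r j)))) ----> I" by (simp add: comp_def)
  show "\<exists>N. \<forall>j\<ge>N. T (W (r j)) <= I + inverse (real (Suc (r j)))" using W(2) less_imp_le by blast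
 qed
 have vi: "integrable lborel (%x. (v x)^2)" using L2_integrable[OF vL] by simp
 have "AE x in lborel. x \<bullet> e < t --> v (reflect e t x) <= v x" if e: "norm e = 1" and t: "t > 0" for e t
 proof -
  have nr: "norm x <= norm (reflect e t x)" if "x \<bullet> e <= t" for x
   by (rule power2_le_imp_le) (use reflect_norm_sq[OF e, of t x] that t in auto)
  let ?p = "polarize e t v"
  note pm = polarize_measurable[OF e vm]
  have p0: "0 <= ?p x" for x using v0 by (simp add: polarize_def le_max_iff_disj)
  have "?p \<in> P"
  proof -
   have "(LBINT x. (?h R x)^2 * (?p x)^2) <= (LBINT x. (?h R x)^2 * (v x)^2)" for R
   proof -
    have b: "\<bar>(?h R x)\<^sup>2\<bar> <= 1" for x by (simp split: split_indicator)
    have m: "(%x. (?h R x)^2) \<in> borel_measurable borel" by measurable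
    have "0 <= (LBINT x. ((?h R x)^2 - (?h R (reflect e t x))^2) * ((v x)^2 - (?p x)^2))"
     by (intro integral_nonneg_AE AE_I2 polarize_weighted_nonneg[OF e v0])
      (use nr in "force split: split_indicator")
    then show ?thesis by (rule twice_diff_eqD(1)[OF polarize_weighted(1)[OF e vm m vi b, of t]])
   qed
   moreover have "(NN x. ennreal (pw s (cr ?p) x)) = (NN x. ennreal (pw s (cr v) x))"
    unfolding pw_def
    using polarize_nn_integral[OF e vm, of "%a. (cmod (cor a))^2 * cmod (cor a) powr s"] by simp
   moreover note vP
   ultimately show ?thesis
    using pm[of t] p0 polarize_L2[OF e vm vL, of t] polarize_nonlocal_form[OF e vm vL, of _ t] unfolding P_def mem_Collect_eq
    by (metis (no_types, lifting) order_trans)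
  qed
  \<comment> \<open>Minimality against the general inequality T ?p <= T v: the nonnegative integrand
    of \<open>polarize_weighted\<close> has integral zero, and its weight factor is nonzero off the
    hyperplane.\<close>
  then have Tp: "T v <= T ?p" using IT TI by (meson order_trans)
  let ?f = "%x. - (?g x)\<^sup>2"
  have fm: "?f \<in> borel_measurable borel" by measurable
  have f1: "\<bar>?f x\<bar> <= 1" for x by (simp add: power_le_one)
  have flt: "?f x < ?f (reflect e t x)" if "x \<bullet> e < t" for x
  proof -
   have "(norm x)^2 < (norm (reflect e t x))^2" using reflect_norm_sq[OF e, of t x] that t by simp
   then show ?thesis by (simp add: power_strict_mono)
  qed
  have fle: "?f x <= ?f (reflect e t x)" if "x \<bullet> e <= t" for x
   using nr[OF that] by (auto intro!: power_mono)
  note pw = polarize_weighted[OF e vm fm vi f1, of t]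
  have nn: "0 <= (?f x - ?f (reflect e t x)) * ((v x)^2 - (?p x)^2)" for x
   by (rule polarize_weighted_nonneg[where h="?f", OF e v0]) (rule fle)
  have "(LBINT x. (?f x - ?f (reflect e t x)) * ((v x)^2 - (?p x)^2)) = 0"
   by (intro antisym twice_diff_eqD(2)[OF pw(1)] Tp[unfolded T_def] integral_nonneg_AE AE_I2 nn)
  then have "AE x in lborel. (?f x - ?f (reflect e t x)) * ((v x)^2 - (?p x)^2) = 0"
   using integral_nonneg_eq_0_iff_AE[OF pw(2)] nn by simp
  then show ?thesis
  proof eventually_elim
   fix x assume z: "(?f x - ?f (reflect e t x)) * ((v x)^2 - (?p x)^2) = 0"
   show "x \<bullet> e < t --> v (reflect e t x) <= v x"
   proof
    assume x: "x \<bullet> e < t"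
    then have "(v x)^2 = (?p x)^2" using z flt[OF x] by auto
    then have "v x = ?p x" using v0 p0 by (simp add: power2_eq_iff_nonneg)
    then show "v (reflect e t x) <= v x" using x by (simp add: polarize_def max_def split: if_splits)
   qed
  qed
 qed
 then have "radially_decreasing v" by (rule radially_decreasing_if_polarized[OF PH(1)[OF vP] vm])
 moreover have "(LBINT x. pw s (cr v) x) = (LBINT x. pw s u x)"
 proof -
  have "(NN x. ennreal (pw s (cr v) x)) = (NN x. ennreal (pw s u x))" using vP unfolding P_def by blast
  then have "enn2real (NN x. ennreal (pw s (cr v) x)) = enn2real (NN x. ennreal (pw s u x))" by simp
  then show ?thesis
   using integral_eq_nn_integral[of "pw s (cr v)" lborel] integral_eq_nn_integral[of "pw s u" lborel]
    pw_measurable[OF L2_measurable[OF vL], of s] pw_measurable[OF L2_measurable[OF uL], of s] by (simp add: pw_nonneg)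
 qed
 ultimately show ?thesis
  using that[of v] vm v0 PH[OF vP] vP unfolding D_def P_def by blast
qed

section \<open>Extremal functions of the Gagliardo--Nirenberg inequality\<close>

lemma H1_scale:
 fixes f :: "real^'n::finite => complex"
 assumes "f \<in> H1"
 shows "(%x. a * f x) \<in> H1" "dirichlet (%x. a * f x) = (cmod a)^2 * dirichlet f"
proof -
 show "(%x. a * f x) \<in> H1" using H1_lincomb(1)[OF assms assms, of a 0] by simp
 have "is_weak_partial j (%x. a * f x) (%x. a * weak_partial j f x)" for j
  using is_weak_partial_lincomb[OF H1_L2[OF assms] H1_L2[OF assms] H1_weak_partial(1)[OF assms] H1_weak_partial(1)[OF assms]
    H1_weak_partial(2)[OF assms] H1_weak_partial(2)[OF assms], where a=a and b=0] by simp
 from dirichlet_eqI[OF L2_cmult[OF H1_L2[OF assms]] L2_cmult[OF H1_weak_partial(1)[OF assms]] this]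
 show "dirichlet (%x. a * f x) = (cmod a)^2 * dirichlet f"
  by (simp add: L2_norm_cmult power_mult_distrib sum_distrib_left dirichlet_eq[OF assms])
qed

lemma pw_scale: "0 <= c ==> pw s (%x. cor c * f x) = (%x. c^2 * c powr s * pw s f x)"
 by (rule ext) (simp add: pw_def norm_mult power_mult_distrib powr_mult)

lemma L2_Fatou:
 assumes F: "!!k. F k \<in> L2" and [measurable]: "f \<in> borel_measurable borel"
  and ae: "AE x in lborel. (%k::nat. F k x) ----> f x" and lim: "(%k. L2_norm (F k)) ----> Y"
 shows "f \<in> L2" "L2_norm f <= Y"
proof -
 have [measurable]: "F k \<in> borel_measurable borel" for k using L2_measurable[OF F] .
 have Y: "0 <= Y" by (rule LIMSEQ_le_const[OF lim]) (simp add: L2_norm_nonneg)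
 have "(NN x. ennreal ((cmod (f x))^2)) <= (NN x. liminf (%k. ennreal ((cmod (F k x))^2)))"
 proof (rule nn_integral_mono_AE, use ae in eventually_elim)
  fix x assume "(%k. F k x) ----> f x"
  then have "(%k. ennreal ((cmod (F k x))^2)) ----> ennreal ((cmod (f x))^2)" by (intro tendsto_intros tendsto_ennrealI)
  from lim_imp_Liminf[OF _ this] show "ennreal ((cmod (f x))^2) <= liminf (%k. ennreal ((cmod (F k x))^2))" by simp
 qed
 also have "... <= liminf (%k. \<integral>\<^sup>+x. ennreal ((cmod (F k x))^2) \<partial>lborel)" by (rule nn_integral_liminf) measurable
 also have "... = liminf (%k. ennreal ((L2_norm (F k))^2))" by (simp add: nn_integral_L2[OF F])
 also have "... = ennreal (Y^2)"
  by (rule lim_imp_Liminf) (auto intro!: tendsto_ennrealI tendsto_power lim)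
 finally show "f \<in> L2" "L2_norm f <= Y" using L2_norm_leI[OF _ Y, of f] by auto
qed

text \<open>On the ball of radius R the function is at least v(x), so v(x)^2 times the volume of the
  ball is at most the squared mass.\<close>

lemma radially_decreasing_decay:
 fixes v :: "real^'n::finite => real"
 assumes v: "radially_decreasing v" "!!x. 0 <= v x" "cr v \<in> L2" and M: "L2_norm (cr v) <= M" and R: "R > 0"
 shows "AE x in lborel. R <= norm x --> v x <= M / sqrt (R ^ CARD('n) * measure lborel (ball (0::real^'n) 1))"
proof -
 let ?V = "R ^ CARD('n) * measure lborel (ball (0::real^'n) 1)"
 have V: "?V > 0" using R content_ball_pos[of 1 "0::real^'n"] by simp
 have M0: "0 <= M" using M L2_norm_nonneg order_trans by blast
 obtain N where N: "N \<in> null_sets lborel" "!!x y. x \<notin> N ==> y \<notin> N ==> norm x <= norm y ==> v y <= v x"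
  using v(1) unfolding radially_decreasing_def by blast
 have "v x <= M / sqrt ?V" if x: "x \<notin> N" "R <= norm x" for x
 proof -
  have "cmod (cor (indicator (ball 0 R) y * v x)) <= 1 * cmod (cr v y)" if "y \<notin> N" for y
   using N(2)[OF that x(1)] x(2) v(2)[of x] v(2)[of y] by (auto split: split_indicator)
  then have "AE y in lborel. cmod (cor (indicator (ball 0 R) y * v x)) <= 1 * cmod (cr v y)"
   by (intro AE_I'[OF N(1)]) auto
  from L2_dominated(2)[OF v(3) _ this]
  have "L2_norm (%y::real^'n. cor (indicator (ball 0 R) y * v x)) <= 1 * L2_norm (cr v)" by simp
  also have "L2_norm (%y::real^'n. cor (indicator (ball 0 R) y * v x)) = v x * L2_norm (%y::real^'n. cor (indicator (ball 0 R) y))"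
   using L2_norm_cmult[of "cor (v x)" "%y::real^'n. cor (indicator (ball 0 R) y)"] v(2)[of x]
   by (simp add: mult.commute)
  also have "L2_norm (%y::real^'n. cor (indicator (ball 0 R) y)) = sqrt ?V"
   using ball_indicator_L2_norm[of "0::real^'n" R] content_ball_conv_unit_ball[of R "0::real^'n"] R
   by (metis L2_norm_nonneg less_imp_le real_sqrt_unique DIM_cart DIM_real mult.right_neutral)
  finally show ?thesis using M V by (simp add: pos_le_divide_eq)
 qed
 then show ?thesis by (intro AE_I'[OF N(1)]) auto
qed

text \<open>The decay of radially decreasing functions, uniform for bounded mass, replaces tightness.\<close>

lemma pw_integral_ge_if_AE_tendsto:
 fixes w :: "nat => real^'n::finite => real"
 assumes sub: "subcritical CARD('n) s" and w: "!!k. radially_decreasing (w k)" "!!k x. 0 <= w k x"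
  and l: "!!k. lip2 M (cr (w k))" "!!k. L2_norm (cr (w k)) <= M" and v: "!!x. 0 <= v x" "lip2 K (cr v)"
  and ae: "AE x in lborel. (%k. w k x) ----> v x" and ge: "!!k. 1 <= (LBINT x. pw s (cr (w k)) x)"
 shows "1 <= (LBINT x. pw s (cr v) x)"
proof (rule field_le_epsilon)
 fix \<eta>' :: real assume "0 < \<eta>'"
 define \<eta> where "\<eta> = \<eta>' / 2"
 have \<eta>: "\<eta> > 0" using \<open>0 < \<eta>'\<close> by (simp add: \<eta>_def)
 have s: "s > 0" and n: "0 < CARD('n)" using sub by (auto simp: subcritical_def)
 have M: "0 <= M" using lip2_nonneg[OF l(1)] .
 note wL = lip2_L2[OF l(1)] and vL = lip2_L2[OF v(2)]
 have cm: "w k \<in> borel_measurable borel" "v \<in> borel_measurable borel" for k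
  using measurable_compose[OF L2_measurable[OF wL] borel_measurable_Re] measurable_compose[OF L2_measurable[OF vL] borel_measurable_Re] by simp_all
 note [measurable] = cm pw_measurable
 obtain L where L: "L > 0" "!!f :: real^'n => complex. lip2 M f ==> L2_norm f <= M \<Longrightarrow>
  (NN x. ennreal (pw s f x) * indicator {x. L < cmod (f x)} x) <= ennreal \<eta>"
  using uniform_tail[OF sub \<eta>, of M] by blast
 let ?V1 = "measure lborel (ball (0::real^'n) 1)"
 have V1: "?V1 > 0" by (rule content_ball_pos) simp
 let ?d = "%R. M / sqrt (R ^ CARD('n) * ?V1)"
 \<comment> \<open>Outside radius R the density is at most \<open>?d R powr s\<close> times |w|^2,
   so its integral is below \<eta> for large R, uniformly in k.\<close>
 obtain R where R: "R > 0" "?d R powr s * M^2 < \<eta>"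
 proof -
  have "((%R. ?d R powr s * M^2) \<longlongrightarrow> 0 powr s * M^2) at_top"
  proof (intro tendsto_mult tendsto_powr' tendsto_const)
   have "filterlim (%R::real. R ^ CARD('n)) at_top at_top" using n by (intro filterlim_pow_at_top filterlim_ident)
   then have "filterlim (%R. ?V1 * R ^ CARD('n)) at_top at_top" by (rule filterlim_tendsto_pos_mult_at_top[OF tendsto_const V1])
   then have "filterlim (%R. sqrt (R ^ CARD('n) * ?V1)) at_top at_top"
    by (intro filterlim_compose[OF sqrt_at_top]) (simp add: mult.commute)
   then show "(?d \<longlongrightarrow> 0) at_top"
    by (intro tendsto_divide_0[OF tendsto_const] filterlim_mono[OF _ at_top_le_at_infinity order_refl])
   show "0 ~= (0::real) \<or> 0 < s \<and> (\<forall>\<^sub>F R in at_top. 0 <= ?d R)"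
    using s M V1 by (auto intro!: eventually_mono[OF eventually_ge_at_top[of 0]])
  qed
  then have "\<forall>\<^sub>F R in at_top. ?d R powr s * M^2 < \<eta>" using s \<eta> by (intro order_tendstoD(2)) auto
  then have "\<forall>\<^sub>F R in at_top. 0 < R \<and> ?d R powr s * M^2 < \<eta>" by (rule eventually_conj[OF eventually_gt_at_top])
  then show ?thesis using that eventually_happens[of _ "at_top::real filter"] by auto
 qed
 \<comment> \<open>What remains after discarding high values and large |x|: bounded with bounded
   support, hence accessible to dominated convergence. The two discarded pieces cost \<eta>
   each.\<close>
 let ?T = "%u x. indicator (cball 0 R) x * pw s (cr (%x. min (u x) L)) (x :: real^'n)"
 have Tm [measurable]: "?T u \<in> borel_measurable borel" if [measurable]: "u \<in> borel_measurable borel" for u :: "real^'n => real"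
  unfolding pw_def by measurable
 have T0: "0 <= ?T u x" for u x by (simp add: pw_nonneg)
 have mono: "pw s (cr (%x. min (u x) L)) x <= pw s (cr u) x" "pw s (cr (%x. min (u x) L)) x <= L^2 * L powr s"
  if "!!x. 0 <= u x" for u and x :: "real^'n"
  unfolding pw_def using that[of x] L(1) s by (auto intro!: mult_mono power_mono powr_mono2 simp: abs_of_nonneg)
 let ?b = "%x::real^'n. (L^2 * L powr s) * indicator (cball 0 R) x"
 have bi: "integrable lborel ?b"
  by (intro integrable_mult_right integrable_real_indicator emeasure_bounded_finite) auto
 have Ti: "integrable lborel (?T u)" if "!!x. 0 <= u x" "u \<in> borel_measurable borel" for u
  by (rule Bochner_Integration.integrable_bound[OF bi])
   (use Tm[OF that(2)] mono(2)[OF that(1)] T0 L(1) in "auto split: split_indicator simp: pw_nonneg")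
 have step: "1 <= 2 * \<eta> + (LBINT x. ?T (w k) x)" for k
 proof -
  have "ennreal 1 <= ennreal (LBINT x. pw s (cr (w k)) x)" by (rule ennreal_leI[OF ge])
  also have "... = (NN x. ennreal (pw s (cr (w k)) x))"
   by (rule nn_integral_eq_integral[symmetric, OF pw_integrable[OF sub l(1)]]) (simp add: pw_nonneg)
  also have "... <= (NN x. ennreal (pw s (cr (w k)) x) * indicator {x. L < cmod (cr (w k) x)} x
    + (ennreal (?d R powr s) * ennreal ((cmod (cr (w k) x))^2) + ennreal (?T (w k) x)))"
  proof (rule nn_integral_mono_AE, use radially_decreasing_decay[OF w(1)[of k] w(2) wL l(2) R(1)] in eventually_elim)
   fix x assume d: "R <= norm x --> w k x <= ?d R"
   consider "L < w k x" | "w k x <= L" "norm x <= R" | "R < norm x" by linarith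
   then show "ennreal (pw s (cr (w k)) x) <= ennreal (pw s (cr (w k)) x) * indicator {x. L < cmod (cr (w k) x)} x
    + (ennreal (?d R powr s) * ennreal ((cmod (cr (w k) x))^2) + ennreal (?T (w k) x))"
   proof cases
    case 1
    then show ?thesis using w(2)[of k x] by simp
   next
    case 2
    then show ?thesis using w(2)[of k x] by (simp add: pw_def add_increasing)
   next
    case 3
    then have "(w k x) powr s <= ?d R powr s" using d w(2)[of k x] s by (intro powr_mono2) auto
    then have "pw s (cr (w k)) x <= ?d R powr s * (cmod (cr (w k) x))^2"
     unfolding pw_def using w(2)[of k x] mult_right_mono[of "w k x powr s" "?d R powr s" "(w k x)^2"] by (simp add: mult.commute)
    then have "ennreal (pw s (cr (w k)) x) <= ennreal (?d R powr s) * ennreal ((cmod (cr (w k) x))^2)"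
     by (simp add: ennreal_mult[symmetric] ennreal_leI del: norm_of_real)
    then show ?thesis by (rule order_trans) (simp add: add_increasing)
   qed
  qed
  also have "... = (NN x. ennreal (pw s (cr (w k)) x) * indicator {x. L < cmod (cr (w k) x)} x)
    + (ennreal (?d R powr s) * (NN x. ennreal ((cmod (cr (w k) x))^2)) + (NN x. ennreal (?T (w k) x)))"
   by (simp add: nn_integral_add nn_integral_cmult pw_def)
  also have "... <= ennreal \<eta> + (ennreal (?d R powr s) * ennreal (M^2) + ennreal (LBINT x. ?T (w k) x))"
  proof (intro add_mono mult_left_mono L(2) l)
   show "(NN x. ennreal ((cmod (cr (w k) x))^2)) <= ennreal (M^2)"
    unfolding nn_integral_L2[OF wL] by (intro ennreal_leI power_mono l(2) L2_norm_nonneg)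
   show "(NN x. ennreal (?T (w k) x)) <= ennreal (LBINT x. ?T (w k) x)"
    by (subst nn_integral_eq_integral[OF Ti]) (use w(2) cm T0 in auto)
  qed simp
  also have "... = ennreal (\<eta> + (?d R powr s * M^2 + (LBINT x. ?T (w k) x)))"
   using \<eta> integral_nonneg_AE[where M=lborel and f="?T (w k)"] T0 by (simp add: ennreal_mult[symmetric])
  finally have "1 <= \<eta> + (?d R powr s * M^2 + (LBINT x. ?T (w k) x))"
   using \<eta> integral_nonneg_AE[where M=lborel and f="?T (w k)"] T0 by (subst (asm) ennreal_le_iff) auto
  then show ?thesis using R(2) by linarith
 qed
 have "(%k. \<integral>x. ?T (w k) x \<partial>lborel) ----> (LBINT x. ?T v x)"
 proof (rule integral_dominated_convergence[OF _ _ bi])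
  show "AE x in lborel. (%k. ?T (w k) x) ----> ?T v x"
   using ae
  proof eventually_elim
   fix x assume "(%k. w k x) ----> v x"
   then have m: "(%k. min (w k x) L) ----> min (v x) L" by (intro tendsto_intros)
   have "(%k. cmod (cor (min (w k x) L)) powr s) ----> cmod (cor (min (v x) L)) powr s"
    by (rule tendsto_powr') (use s in "auto intro!: tendsto_intros m simp del: norm_of_real")
   then show "(%k. ?T (w k) x) ----> ?T v x"
    unfolding pw_def by (intro tendsto_mult tendsto_const tendsto_power tendsto_norm tendsto_of_real m)
  qed
  show "AE x in lborel. norm (?T (w k) x) <= ?b x" for k
   using mono(2)[of "w k", OF w(2)] by (intro AE_I2) (auto split: split_indicator simp: pw_nonneg)
 qed (use cm in "auto intro!: Tm")
 then have "1 <= 2 * \<eta> + (LBINT x. ?T v x)"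
  by (intro LIMSEQ_le_const[OF tendsto_add[OF tendsto_const]]) (use step in auto)
 moreover have "(LBINT x. ?T v x) <= (LBINT x. pw s (cr v) x)"
  by (rule integral_mono[OF Ti pw_integrable[OF sub v(2)]]) (use v(1) cm mono(1)[OF v(1)] in "auto split: split_indicator simp: pw_nonneg")
 ultimately show "1 <= (LBINT x. pw s (cr v) x) + \<eta>'" by (simp add: \<eta>_def)
qed

text \<open>The sum of the two quadratic terms is minimised, with the constraint relaxed to an
  integral of at least 1. After symmetrisation an a.e. limit exists; mass may escape to infinity,
  but both terms are lower semicontinuous and the constraint survives by radial decay. Homogeneity
  restores equality in the constraint and extends the inequality to all of H1.\<close>

theorem minimizer_exists:
 fixes u0 :: "real^'n::finite => complex"
 assumes sub: "subcritical CARD('n) s" and u0: "u0 \<in> H1" "0 < (LBINT x. pw s u0 x)"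
 obtains v :: "real^'n => real" and m :: real
 where "v \<in> borel_measurable borel" "!!x. 0 <= v x" "cr v \<in> H1" "radially_decreasing v"
  "(LBINT x. pw s (cr v) x) = 1" "0 < m" "dirichlet (cr v) / 2 + (L2_norm (cr v))^2 = m"
  "!!u :: real^'n => complex. u \<in> H1 ==> m * (LBINT x. pw s u x) powr (2 / (s + 2)) <= dirichlet u / 2 + (L2_norm u)^2"
proof -
 obtain j :: 'n where True by simp
 define b where "b = ball_moment j"
 have b: "b > 0" unfolding b_def by (rule ball_moment_pos)
 have s: "s > 0" using sub by (simp add: subcritical_def)
 define \<Phi> where "\<Phi> u = dirichlet u / 2 + (L2_norm u)^2" for u :: "real^'n => complex"
 define N where "N u = (LBINT x. pw s u x)" for u :: "real^'n => complex"
 have \<Phi>0: "0 <= \<Phi> u" for u unfolding \<Phi>_def using dirichlet_nonneg[of u] by simp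
 have N0: "0 <= N u" for u unfolding N_def by (rule integral_nonneg_AE) (simp add: pw_nonneg)
 let ?\<theta> = "2 / (s + 2)"
 have scale: "\<exists>c. c^2 = N u powr (- ?\<theta>) \<and> N (%x. cor c * u x) = 1" if "N u > 0" for u
 proof (intro exI conjI)
  let ?c = "N u powr (- (1 / (s + 2)))"
  show "?c^2 = N u powr (- ?\<theta>)" by (simp add: powr_sq)
  have "N (%x. cor ?c * u x) = ?c^2 * ?c powr s * N u"
   unfolding N_def by (simp add: pw_scale)
  also have "?c^2 * ?c powr s = N u powr (- 1)"
  proof -
   define d where "d = 1 / (s + 2)"
   have "(s + 2) * d = 1" using s by (simp add: d_def)
   then have "2 * (- d) + - d * s = - 1" by (simp add: algebra_simps)
   then have "2 * (- (1 / (s + 2))) + - (1 / (s + 2)) * s = - 1" by (simp only: d_def)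
   then show ?thesis unfolding powr_sq powr_powr powr_add[symmetric] by (simp only:)
  qed
  finally show "N (%x. cor ?c * u x) = 1" using that by (simp add: powr_minus)
 qed
 have \<Phi>s: "\<Phi> (%x. cor c * u x) = c^2 * \<Phi> u" if "u \<in> H1" for u c
  by (simp add: \<Phi>_def H1_scale(2)[OF that] L2_norm_cmult power_mult_distrib algebra_simps)
 define A where "A = {u :: real^'n => complex. u \<in> H1 \<and> 1 <= N u}"
 have "A ~= {}"
 proof -
  obtain c where "N (%x. cor c * u0 x) = 1" using scale[of u0] u0(2) by (auto simp: N_def)
  then have "(%x. cor c * u0 x) \<in> A" using H1_scale(1)[OF u0(1)] by (simp add: A_def)
  then show ?thesis by blast
 qed
 define m where "m = Inf (\<Phi> ` A)"
 have bdd: "bdd_below (\<Phi> ` A)" using \<Phi>0 by (auto intro!: bdd_belowI)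
 have low: "m <= \<Phi> u" if "u \<in> A" for u unfolding m_def by (rule cInf_lower[OF imageI[OF that] bdd])
 have "\<exists>v. (\<forall>x. 0 <= v x) \<and> cr v \<in> A \<and> radially_decreasing v \<and> \<Phi> (cr v) < m + inverse (real (Suc k))" for k
 proof -
  obtain u where u: "u \<in> A" "\<Phi> u < m + inverse (real (Suc k))"
   using cInf_lessD[of "\<Phi> ` A" "m + inverse (real (Suc k))"] \<open>A ~= {}\<close> by (auto simp: m_def)
  then have uH: "u \<in> H1" by (simp add: A_def)
  show ?thesis
  proof (rule symmetrization[OF uH sub])
   fix v :: "real^'n => real"
   assume v: "!!x. 0 <= v x" "cr v \<in> H1" "dirichlet (cr v) <= dirichlet u" "L2_norm (cr v) = L2_norm u"
    "(LBINT x. pw s (cr v) x) = (LBINT x. pw s u x)" "radially_decreasing v"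
   then have "cr v \<in> A" "\<Phi> (cr v) <= \<Phi> u" using u(1) by (auto simp: A_def N_def \<Phi>_def)
   then show ?thesis using v u(2) by (intro exI[of _ v]) auto
  qed
 qed
 then obtain w0 where w0: "!!k x. 0 <= w0 k x" "!!k. cr (w0 k) \<in> A" "!!k. radially_decreasing (w0 k)"
  "!!k. \<Phi> (cr (w0 k)) < m + inverse (real (Suc k))" by metis
 have w0H: "cr (w0 k) \<in> H1" for k using w0(2)[of k] by (simp add: A_def)
 define M where "M = sqrt (2 * (m + 1))"
 have half: "d / 2 + a <= b ==> 0 <= a ==> d <= 2 * b" "d / 2 + a <= b ==> 0 <= d ==> 0 <= a ==> a <= 2 * b" "d / 2 + a <= b ==> 0 <= d ==> a <= b" for a b d :: real
  by linarith+
 have \<Phi>b: "\<Phi> (cr (w0 k)) <= m + 1" for k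
  using w0(4)[of k] by (simp add: inverse_eq_divide) (smt (verit) divide_le_eq_1 of_nat_0_le_iff)
 have lip: "lip2 M (cr (w0 k))" for k
 proof (rule lip2_mono[OF lip2_H1[OF w0H]])
  show "sqrt (dirichlet (cr (w0 k))) <= M"
   unfolding M_def by (intro real_sqrt_le_mono half(1)[OF \<Phi>b[unfolded \<Phi>_def] zero_le_power2])
 qed
 have nM: "L2_norm (cr (w0 k)) <= M" for k
  unfolding M_def by (intro real_le_rsqrt half(2)[OF \<Phi>b[unfolded \<Phi>_def] dirichlet_nonneg zero_le_power2])
 obtain r1 :: "nat => nat" where r1: "strict_mono r1" "!!R e. 0 < e ==> \<exists>N. \<forall>k\<ge>N. \<forall>l\<ge>N.
  L2_norm (%x. cor (indicator (cball 0 R) x) * (cr (w0 (r1 k)) x - cr (w0 (r1 l)) x)) < e"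
  using local_compactness[of M "%k. cr (w0 k)", OF lip nM] by blast
 \<comment> \<open>The weight turns local convergence on every ball, with bounded norms, into L2
   convergence of one weighted sequence, from which an a.e. convergent subsequence is drawn.\<close>
 let ?g = "%x. exp (- (norm (x::real^'n))) :: real"
 let ?F = "%k x. cor (?g x) * cr (w0 (r1 k)) x"
 note wL = H1_L2[OF w0H]
 have dL: "(%x. cr (w0 k) x - cr (w0 l) x) \<in> L2" for k l by (rule L2_diff[OF wL wL])
 have FL: "?F k \<in> L2" for k
 proof (rule L2_dominated(1)[OF wL[of "r1 k"], where K=1])
  show "?F k \<in> borel_measurable borel" using L2_measurable[OF wL, of "r1 k"] by measurable
 qed (auto simp: norm_mult mult_left_le_one_le)
 have "\<exists>N. \<forall>k\<ge>N. \<forall>l\<ge>N. L2_norm (%x. ?F k x - ?F l x) < e" if e: "0 < e" for e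
 proof -
  have "((%R::real. exp (- R) * (2 * M)) \<longlongrightarrow> 0) at_top" by real_asymp
  then have "\<forall>\<^sub>F R in at_top. exp (- R) * (2 * M) < e / 2" by (rule order_tendstoD(2)) (use e in simp)
  then obtain R :: real where R: "exp (- R) * (2 * M) < e / 2"
   using eventually_happens[of _ "at_top::real filter"] by auto
  obtain n where n: "!!k l. k >= n ==> l >= n \<Longrightarrow>
   L2_norm (%x. cor (indicator (cball 0 R) x) * (cr (w0 (r1 k)) x - cr (w0 (r1 l)) x)) < e / 2"
   using r1(2)[of "e / 2" R] e by auto
  have "L2_norm (%x. ?F k x - ?F l x) < e" if kl: "k >= n" "l >= n" for k l
  proof -
   let ?d = "%x. cr (w0 (r1 k)) x - cr (w0 (r1 l)) x"
   let ?a = "%x. cor (?g x * indicator (cball 0 R) x) * ?d x"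
   let ?b = "%x. cor (?g x * (1 - indicator (cball 0 R) x)) * ?d x"
   have [measurable]: "?d \<in> borel_measurable borel" by (rule L2_measurable[OF dL])
   note dkl = dL[of "r1 k" "r1 l"]
   have dn: "L2_norm ?d <= 2 * M" using L2_triangle_diff[OF wL wL, of "r1 k" "r1 l"] nM[of "r1 k"] nM[of "r1 l"] by linarith
   have iL: "(%x. cor (indicator (cball 0 R) x) * ?d x) \<in> L2"
   proof (rule L2_dominated(1)[OF dkl, where K=1])
    show "(%x. cor (indicator (cball 0 R) x) * ?d x) \<in> borel_measurable borel" by measurable
   qed (auto split: split_indicator)
   have a: "?a \<in> L2" "L2_norm ?a <= 1 * L2_norm (%x. cor (indicator (cball 0 R) x) * ?d x)"
   proof -
    have "?a \<in> borel_measurable borel" by measurable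
    moreover have "AE x in lborel. cmod (?a x) <= 1 * cmod (cor (indicator (cball 0 R) x) * ?d x)"
     by (rule AE_I2) (auto simp: norm_mult mult_left_le_one_le split: split_indicator)
    ultimately show "?a \<in> L2" "L2_norm ?a <= 1 * L2_norm (%x. cor (indicator (cball 0 R) x) * ?d x)"
     using L2_dominated[OF iL, of ?a 1] by simp_all
   qed
   have c: "?b \<in> L2" "L2_norm ?b <= exp (- R) * L2_norm ?d"
   proof -
    have "?b \<in> borel_measurable borel" by measurable
    moreover have "AE x in lborel. cmod (?b x) <= exp (- R) * cmod (?d x)"
     by (rule AE_I2) (auto simp: norm_mult intro!: mult_right_mono split: split_indicator)
    ultimately show "?b \<in> L2" "L2_norm ?b <= exp (- R) * L2_norm ?d"
     using L2_dominated[OF dkl, of ?b "exp (- R)"] by simp_all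
   qed
   have "(%x. ?F k x - ?F l x) = (%x. ?a x + ?b x)" by (simp add: fun_eq_iff algebra_simps)
   then have "L2_norm (%x. ?F k x - ?F l x) <= L2_norm ?a + L2_norm ?b" using L2_triangle[OF a(1) c(1)] by simp
   moreover have "exp (- R) * L2_norm ?d <= exp (- R) * (2 * M)" using dn by (intro mult_left_mono) auto
   ultimately show ?thesis using a(2) c(2) n[OF kl] R by linarith
  qed
  then show ?thesis by blast
 qed
 then obtain f and r2 :: "nat => nat" where f: "f \<in> L2" and r2: "strict_mono r2" "AE x in lborel. (%k. ?F (r2 k) x) ----> f x"
  by (rule L2_complete[of ?F, OF FL]) 
 have "\<exists>l r3. strict_mono (r3 :: nat => nat) \<and> (%k. L2_norm (cr (w0 (r1 (r2 (r3 k)))))) ----> l"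
 proof -
  have "bounded (range (%k. L2_norm (cr (w0 (r1 (r2 k))))))"
   using nM by (intro boundedI[of _ M]) (auto simp: L2_norm_nonneg)
  from bounded_imp_convergent_subsequence[OF this] show ?thesis by (auto simp: comp_def)
 qed
 then obtain Y and r3 :: "nat => nat" where r3: "strict_mono r3" "(%k. L2_norm (cr (w0 (r1 (r2 (r3 k)))))) ----> Y" by blast
 define r where "r k = r1 (r2 (r3 k))" for k
 have r: "strict_mono r" unfolding r_def using r1(1) r2(1) r3(1) by (simp add: strict_mono_def)
 define w where "w k = w0 (r k)" for k
 have wH: "cr (w k) \<in> H1" for k by (simp add: w_def w0H)
 have limY: "(%k. L2_norm (cr (w k))) ----> Y" using r3(2) by (simp add: w_def r_def)
 have lim\<Phi>: "(%k. \<Phi> (cr (w k))) ----> m"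
 proof (rule tendsto_sandwich[OF always_eventually always_eventually tendsto_const])
  show "\<forall>k. m <= \<Phi> (cr (w k))" unfolding w_def using low[OF w0(2)] by blast
  show "\<forall>k. \<Phi> (cr (w k)) <= m + inverse (real (Suc (r k)))" unfolding w_def using less_imp_le[OF w0(4)] by blast
  have "(%k. m + inverse (real (Suc k))) ----> m + 0" by (intro tendsto_intros LIMSEQ_inverse_real_of_nat)
  from LIMSEQ_subseq_LIMSEQ[OF this r] show "(%k. m + inverse (real (Suc (r k)))) ----> m" by (simp add: comp_def)
 qed
 define v where "v x = max 0 (Re (f x) / ?g x)" for x
 have v0: "0 <= v x" for x by (simp add: v_def)
 have ae: "AE x in lborel. (%k. w k x) ----> v x"
  using r2(2)
 proof eventually_elim
  fix x assume "(%k. ?F (r2 k) x) ----> f x"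
  from tendsto_Re[OF LIMSEQ_subseq_LIMSEQ[OF this r3(1)]] have "(%k. ?g x * w k x) ----> Re (f x)"
   by (simp add: comp_def w_def r_def)
  then have "(%k. max 0 (?g x * w k x / ?g x)) ----> v x" unfolding v_def by (intro tendsto_intros) auto
  then show "(%k. w k x) ----> v x" using w0(1) by (simp add: w_def max_absorb2)
 qed
 have vm [measurable]: "v \<in> borel_measurable borel"
  using L2_measurable[OF f] unfolding v_def[abs_def] by measurable
 have aec: "AE x in lborel. (%k. cr (w k) x) ----> cr v x" using ae by eventually_elim (rule tendsto_of_real)
 note v2 = L2_Fatou[OF H1_L2[OF wH] _ aec limY]
 have vL: "cr v \<in> L2" and vY: "L2_norm (cr v) <= Y" using v2 by simp_all
 have eq: "2 * (\<Phi> u - (L2_norm u)^2) = dirichlet u" for u by (simp add: \<Phi>_def)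
 \<comment> \<open>The mass and the functional both converge, hence so do the Dirichlet integrals;
   each term then has its own lower semicontinuity, with total at most m.\<close>
 have "(%k. 2 * (\<Phi> (cr (w k)) - (L2_norm (cr (w k)))^2)) ----> 2 * (m - Y^2)" by (intro tendsto_intros lim\<Phi> limY)
 then have limX: "(%k. dirichlet (cr (w k))) ----> 2 * (m - Y^2)"
  unfolding eq .
 have X0: "0 <= 2 * (m - Y^2)" by (rule LIMSEQ_le_const[OF limX]) (simp add: dirichlet_nonneg)
 have nl: "nonlocal_form e (cr v) <= ennreal (ball_moment j * (2 * (m - Y^2)))" if e: "e > 0" for e
 proof -
  have "nonlocal_form e (cr v) <= liminf (%k. nonlocal_form e (cr (w k)))"
   by (rule nonlocal_form_le_liminf[OF H1_L2[OF wH] vL e aec])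
  also have "... <= liminf (%k. ennreal (ball_moment j * dirichlet (cr (w k))))"
   by (intro Liminf_mono always_eventually allI nonlocal_form_le_dirichlet wH e)
  also have "... = ennreal (ball_moment j * (2 * (m - Y^2)))"
   by (rule lim_imp_Liminf) (simp, intro tendsto_ennrealI tendsto_mult tendsto_const limX)
  finally show ?thesis .
 qed
 have vH: "cr v \<in> H1" "dirichlet (cr v) <= 2 * (m - Y^2)"
  using H1_if_nonlocal_form_le[OF vL X0 nl] by auto
 have \<Phi>v: "\<Phi> (cr v) <= m"
 proof -
  have "(L2_norm (cr v))^2 <= Y^2" using vY by (intro power_mono) (auto simp: L2_norm_nonneg)
  moreover have "d <= 2 * (c - y) ==> a <= y ==> d / 2 + a <= c" for a c d y :: real by (simp add: field_simps)
  ultimately show ?thesis using vH(2) unfolding \<Phi>_def by blast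
 qed
 have rd: "radially_decreasing v"
 proof -
  have "\<forall>k. \<exists>Z\<in>null_sets lborel. \<forall>x y. x \<notin> Z --> y \<notin> Z --> norm x <= norm y --> w k y <= w k x"
   using w0(3) unfolding w_def radially_decreasing_def by blast
  then obtain Z where Z: "!!k. Z k \<in> null_sets lborel" "!!k x y. x \<notin> Z k ==> y \<notin> Z k ==> norm x <= norm y ==> w k y <= w k x"
   by metis
  obtain Z' where Z': "Z' \<in> null_sets lborel" "!!x. x \<notin> Z' ==> (%k. w k x) ----> v x"
   using ae by (auto elim!: AE_E3)
  have "Z' \<union> (\<Union>k. Z k) \<in> null_sets lborel" using Z(1) Z'(1) by auto
  moreover have "v y <= v x" if "x \<notin> Z' \<union> (\<Union>k. Z k)" "y \<notin> Z' \<union> (\<Union>k. Z k)" "norm x <= norm y" for x y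
   by (rule LIMSEQ_le[OF Z'(2) Z'(2)]) (use that Z(2) in auto)
  ultimately show ?thesis unfolding radially_decreasing_def by blast
 qed
 have "1 <= N (cr v)"
  unfolding N_def
 proof (rule pw_integral_ge_if_AE_tendsto[OF sub _ _ _ _ v0 lip2_H1[OF vH(1)] ae, of M])
  show "1 <= (LBINT x. pw s (cr (w k)) x)" for k using w0(2)[of "r k"] by (simp add: A_def N_def w_def)
 qed (use w0 lip nM in "auto simp: w_def")
 then have vA: "cr v \<in> A" using vH(1) by (simp add: A_def)
 have m0: "0 < m"
 proof (rule ccontr)
  assume "\<not> 0 < m"
  then have "(L2_norm (cr v))^2 <= 0" 
   by (intro order_trans[OF half(3)[OF \<Phi>v[unfolded \<Phi>_def] dirichlet_nonneg]]) simp
  then have "AE x in lborel. cr v x = 0" using L2_norm_eq_0[OF vL] by simp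
  then have "N (cr v) = 0" unfolding N_def by (intro integral_eq_zero_AE) (auto simp: pw_def)
  then show False using \<open>1 <= N (cr v)\<close> by simp
 qed
 have main: "m * N u powr ?\<theta> <= \<Phi> u" if u: "u \<in> H1" for u
 proof (cases "N u = 0")
  case False
  then have Nu: "N u > 0" using N0[of u] by simp
  obtain c where c: "c^2 = N u powr (- ?\<theta>)" "N (%x. cor c * u x) = 1" using scale[OF Nu] by blast
  have "m <= c^2 * \<Phi> u" unfolding \<Phi>s[OF u, symmetric] using c(2) H1_scale(1)[OF u] by (intro low) (simp add: A_def)
  then have "m * N u powr ?\<theta> <= (c^2 * \<Phi> u) * N u powr ?\<theta>" by (rule mult_right_mono) simp
  also have "... = (N u powr (- ?\<theta>) * N u powr ?\<theta>) * \<Phi> u" by (simp add: c(1))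
  also have "N u powr (- ?\<theta>) * N u powr ?\<theta> = 1" using Nu by (simp add: powr_add[symmetric])
  finally show ?thesis by simp
 qed (simp add: \<Phi>0)
 have N1: "N (cr v) = 1"
 proof (rule ccontr)
  assume "N (cr v) ~= 1"
  \<comment> \<open>An integral above 1 would, by the scaled inequality, force a value of the
    functional above m.\<close>
  then have "1 < N (cr v)" using \<open>1 <= N (cr v)\<close> by simp
  then have "1 < N (cr v) powr ?\<theta>" using s powr_less_mono2[of ?\<theta> 1 "N (cr v)"] by simp
  then have "m * 1 < m * N (cr v) powr ?\<theta>" using m0 by (intro mult_strict_left_mono)
  then show False using main[OF vH(1)] \<Phi>v by simp
 qed
 show ?thesis
  by (rule that[OF vm v0 vH(1) rd N1[unfolded N_def] m0 _ main[unfolded N_def \<Phi>_def]])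
   (use \<Phi>v low[OF vA] in "simp_all add: \<Phi>_def")
qed

section \<open>The Euler-Lagrange equation\<close>

lemma integral_partial_deriv_test:
 fixes F :: "real^'n::finite => complex"
 assumes F: "test_function F"
 shows "(LBINT x. partial_deriv j F x) = 0"
proof -
 obtain R where R: "R > 0" "!!x. F x ~= 0 ==> norm x <= R" using test_function_support[OF F] by blast
 \<comment> \<open>A square integrable stand-in for the constant 1: the radius R + 1 contains the
   supports of all shifts of F by less than 1, so the pairing is independent of r there.\<close>
 let ?f = "%x. cor (indicator (cball 0 (R + 1)) x)" and ?z = "axis j 1 :: real^'n"
 have f: "?f \<in> L2" by (rule indicator_L2) auto
 have c: "(LBINT y. ?f y * twist 0 ?z F r y) = (LBINT y. F y)" if "r \<in> ball 0 1" for r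
 proof -
  have "?f y * twist 0 ?z F r y = F (y - r *\<^sub>R ?z)" for y
  proof (cases "F (y - r *\<^sub>R ?z) = 0")
   case False
   then have "norm (y - r *\<^sub>R ?z) <= R" by (rule R(2))
   then have "norm y <= R + 1" using norm_triangle_sub[of y "r *\<^sub>R ?z"] that by (simp add: norm_axis_1)
   then show ?thesis by (simp add: twist_def)
  qed (simp add: twist_def)
  then have "(LBINT y. ?f y * twist 0 ?z F r y) = (LBINT y. F (y - r *\<^sub>R ?z))" by simp
  also have "... = (LBINT y. F y)"
   by (rule preserves_lborel_integral[OF preserves_lborel_diff test_function_measurable[OF F]])
  finally show ?thesis .
 qed
 have "((%r. \<integral>y. F y \<partial>lborel) has_vector_derivative (LBINT y. ?f y * dtwist 0 ?z F 0 y)) (at (0::real))"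
  by (rule has_vector_derivative_transform_within_open[where S="ball 0 1", OF twist_pairing_has_vector_derivative[OF f F]])
   (use c in auto)
 then have "(LBINT y. ?f y * dtwist 0 ?z F 0 y) = 0"
  by (rule vector_derivative_unique_at) simp
 moreover have "?f y * dtwist 0 ?z F 0 y = - partial_deriv j F y" for y
 proof -
  have "(\<Sum>i\<in>UNIV. cor (?z $ i) * partial_deriv i F y) = partial_deriv j F y"
   by (simp add: axis_def if_distrib[of cor] if_distrib[of "%a. a * _"] cong: if_cong)
  moreover have "partial_deriv j F y = 0" if "\<not> norm y <= R + 1"
   by (rule partial_deriv_eq_0[OF F R(2)]) (use that in auto)
  ultimately show ?thesis by (auto simp: dtwist_def split: split_indicator)
 qed
 ultimately show ?thesis by simp
qed

lemma partial_deriv_mult: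
 assumes "f differentiable (at x)" "g differentiable (at x)"
 shows "partial_deriv j (%x. f x * g x) x = f x * partial_deriv j g x + partial_deriv j f x * g x"
 using partial_deriv_eqI[OF has_derivative_mult[OF assms[THEN frechet_derivative_works[THEN iffD1]]]]
 by (simp add: partial_deriv_def)

lemma test_function_weak_partial:
 fixes \<phi> :: "real^'n::finite => complex"
 assumes "test_function \<phi>"
 shows "is_weak_partial j \<phi> (partial_deriv j \<phi>)"
 unfolding is_weak_partial_def
proof (intro allI impI)
 fix \<psi> :: "real^'n => complex" assume \<psi>: "test_function \<psi>"
 have i: "integrable lborel (%x. \<phi> x * partial_deriv j \<psi> x)" "integrable lborel (%x. partial_deriv j \<phi> x * \<psi> x)"
  by (intro integrable_L2_mult test_function_L2 test_function_partial_deriv assms \<psi>)+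
 have "0 = (LBINT x. partial_deriv j (%x. \<phi> x * \<psi> x) x)"
  by (rule integral_partial_deriv_test[symmetric]) (intro test_function_mult \<psi> test_function_Ck[OF assms])
 also have "... = (LBINT x. \<phi> x * partial_deriv j \<psi> x + partial_deriv j \<phi> x * \<psi> x)"
  by (simp add: partial_deriv_mult[OF test_function_differentiable[OF assms] test_function_differentiable[OF \<psi>]])
 also have "... = (LBINT x. \<phi> x * partial_deriv j \<psi> x) + (LBINT x. partial_deriv j \<phi> x * \<psi> x)"
  by (rule Bochner_Integration.integral_add[OF i])
 finally show "(LBINT x. \<phi> x * partial_deriv j \<psi> x) = - (LBINT x. partial_deriv j \<phi> x * \<psi> x)"
  by (simp add: eq_neg_iff_add_eq_0)
qed

lemma partial_deriv_cnj:
 assumes "test_function \<phi>"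
 shows "partial_deriv j (%x. cnj (\<phi> x)) x = cnj (partial_deriv j \<phi> x)"
 using partial_deriv_eqI[OF bounded_linear.has_derivative[OF bounded_linear_cnj frechet_derivative_works[THEN iffD1, OF test_function_differentiable[OF assms]]]]
 by (simp add: partial_deriv_def)

text \<open>The expansion in t is exact, being quadratic. Perturbing by the conjugate of \<phi>
  makes the linear terms bilinear pairings with \<phi>, the form in which the distributional
  equation is stated.\<close>

lemma energy_first_variation:
 fixes u \<phi> :: "real^'n::finite => complex"
 assumes u: "u \<in> H1" and \<phi>: "test_function \<phi>"
 obtains P where "!!t. (%x. u x + cor t * cnj (\<phi> x)) \<in> H1"
  "!!t. dirichlet (%x. u x + cor t * cnj (\<phi> x)) / 2 + (L2_norm (%x. u x + cor t * cnj (\<phi> x)))^2 =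
   dirichlet u / 2 + (L2_norm u)^2 + t * (2 * Re (LBINT x. u x * \<phi> x) - Re (LBINT x. u x * laplacian \<phi> x)) + t^2 * P"
proof -
 define \<xi> where "\<xi> x = cnj (\<phi> x)" for x
 have \<xi>: "test_function \<xi>" unfolding \<xi>_def[abs_def] by (rule test_function_cnj[OF \<phi>])
 note uL = H1_L2[OF u] and \<xi>L = test_function_L2[OF \<xi>]
 note dL = test_function_L2[OF test_function_partial_deriv[OF \<xi>]]
 let ?w = "%j. weak_partial j u"
 let ?P = "(\<Sum>j\<in>(UNIV::'n set). (L2_norm (partial_deriv j \<xi>))^2) / 2 + (L2_norm \<xi>)^2"
 have cL: "(%x. cor t * g x) \<in> L2" if "g \<in> L2" for t and g :: "real^'n => complex" by (rule L2_cmult[OF that])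
 have exp: "(L2_norm (%x. f x + cor t * g x))^2 = (L2_norm f)^2 + 2 * t * Re (LBINT x. f x * cnj (g x)) + t^2 * (L2_norm g)^2"
  if "f \<in> L2" "g \<in> L2" for f g :: "real^'n => complex" and t
 proof -
  have "(LBINT x. f x * cnj (cor t * g x)) = cor t * (LBINT x. f x * cnj (g x))"
   unfolding integral_mult_right_zero[symmetric] by (simp add: mult_ac)
  then show ?thesis by (simp add: L2_norm_add_sq[OF that(1) cL[OF that(2)]] L2_norm_cmult power_mult_distrib)
 qed
 have wp: "is_weak_partial j (%x. u x + cor t * \<xi> x) (%x. ?w j x + cor t * partial_deriv j \<xi> x)" for j t
  using is_weak_partial_lincomb[OF uL \<xi>L H1_weak_partial(1)[OF u] dL H1_weak_partial(2)[OF u] test_function_weak_partial[OF \<xi>], where a=1 and b="cor t"]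
  by simp
 have gL: "(%x. u x + cor t * \<xi> x) \<in> L2" "(%x. ?w j x + cor t * partial_deriv j \<xi> x) \<in> L2" for j t
  by (intro L2_add uL cL \<xi>L dL H1_weak_partial(1)[OF u])+
 have wj: "(LBINT x. ?w j x * cnj (partial_deriv j \<xi> x)) = - (LBINT x. u x * partial_deriv j (partial_deriv j \<phi>) x)" for j
 proof -
  have "cnj (partial_deriv j \<xi> x) = partial_deriv j \<phi> x" for x
   unfolding \<xi>_def[abs_def] partial_deriv_cnj[OF \<phi>] by simp
  then show ?thesis
   using H1_weak_partial(2)[OF u, of j] test_function_partial_deriv[OF \<phi>, of j] by (simp add: is_weak_partial_def)
 qed
 have lap: "(\<Sum>j\<in>UNIV. Re (LBINT x. ?w j x * cnj (partial_deriv j \<xi> x))) = - Re (LBINT x. u x * laplacian \<phi> x)"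
  unfolding wj laplacian_def sum_distrib_left
  by (subst Bochner_Integration.integral_sum)
   (auto simp: sum_negf intro!: integrable_L2_mult uL test_function_L2 test_function_partial_deriv \<phi>)
 show ?thesis
 proof (rule that)
  fix t
  show "(%x. u x + cor t * cnj (\<phi> x)) \<in> H1"
   using H1I[OF gL(1) gL(2) wp] by (simp add: \<xi>_def)
  have "dirichlet (%x. u x + cor t * \<xi> x) = (\<Sum>j\<in>UNIV. (L2_norm (?w j))^2 + 2 * t * Re (LBINT x. ?w j x * cnj (partial_deriv j \<xi> x))
    + t^2 * (L2_norm (partial_deriv j \<xi>))^2)"
   unfolding dirichlet_eqI[OF gL(1) gL(2) wp] exp[OF H1_weak_partial(1)[OF u] dL] ..
  also have "... = dirichlet u + 2 * t * (- Re (LBINT x. u x * laplacian \<phi> x)) + t^2 * (\<Sum>j\<in>UNIV. (L2_norm (partial_deriv j \<xi>))^2)"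
   unfolding dirichlet_eq[OF u] lap[symmetric] by (simp add: sum.distrib sum_distrib_left)
  finally have d: "dirichlet (%x. u x + cor t * \<xi> x) = ..." .
  have "(L2_norm (%x. u x + cor t * \<xi> x))^2 = (L2_norm u)^2 + 2 * t * Re (LBINT x. u x * \<phi> x) + t^2 * (L2_norm \<xi>)^2"
   unfolding exp[OF uL \<xi>L] by (simp add: \<xi>_def)
  with d show "dirichlet (%x. u x + cor t * cnj (\<phi> x)) / 2 + (L2_norm (%x. u x + cor t * cnj (\<phi> x)))^2 =
   dirichlet u / 2 + (L2_norm u)^2 + t * (2 * Re (LBINT x. u x * \<phi> x) - Re (LBINT x. u x * laplacian \<phi> x)) + t^2 * ?P"
   by (simp add: \<xi>_def algebra_simps add_divide_distrib)
 qed
qed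

text \<open>The tangent inequality for |z|^(s + 2) at a >= 0, from Young's inequality. It bounds the
  constraint from below by a function linear in t, so no derivative under the integral is
  required.\<close>

lemma pw_convex:
 fixes b :: complex
 assumes a: "0 <= a" and s: "0 < s"
 shows "a^2 * a powr s + (s + 2) * (a * a powr s) * Re b <= (cmod (cor a + b))^2 * cmod (cor a + b) powr s"
proof (cases "a = 0")
 case False
 then have a0: "a > 0" using a by simp
 define r where "r = cmod (cor a + b)"
 define q where "q = s + 2"
 have q: "q > 1" using s by (simp add: q_def)
 have sq: "x^2 * x powr s = x powr q" if "0 <= x" for x :: real
  using that by (cases "x = 0") (simp_all add: q_def powr_add)
 have sq1: "a * a powr s = a powr (q - 1)" using powr_mult_base[of a s] a0 by (simp add: q_def add.commute)
 have "r * a powr (q - 1) <= r powr q / q + (a powr (q - 1)) powr (q / (q - 1)) / (q / (q - 1))"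
  by (rule Youngs_inequality) (use q in "auto simp: r_def field_simps")
 also have "(a powr (q - 1)) powr (q / (q - 1)) = a powr q" using q by (simp add: powr_powr)
 finally have "q * (r * a powr (q - 1)) <= r powr q + (q - 1) * a powr q" using q by (simp add: field_simps)
 moreover have "a powr q = a * a powr (q - 1)" using powr_mult_base[of a "q - 1"] a0 by simp
 ultimately have "a powr q + q * a powr (q - 1) * (r - a) <= r powr q" by (simp add: algebra_simps)
 moreover have "Re b <= r - a" using complex_Re_le_cmod[of "cor a + b"] by (simp add: r_def)
 then have "q * a powr (q - 1) * Re b <= q * a powr (q - 1) * (r - a)" using q by (intro mult_left_mono) auto
 moreover have "0 <= r" by (simp add: r_def)
 ultimately show ?thesis unfolding r_def[symmetric] sq1 sq[OF a] sq[OF \<open>0 <= r\<close>] q_def[symmetric] by linarith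
qed simp

lemma test_function_integrable:
 assumes \<phi>: "test_function \<phi>"
 shows "integrable lborel \<phi>"
proof -
 obtain R where R: "!!x. \<phi> x ~= 0 ==> norm x <= R" using test_function_support[OF \<phi>] by blast
 have "\<phi> = (%x. cor (indicator (cball 0 R) x) * \<phi> x)" using R by (auto simp: fun_eq_iff split: split_indicator)
 moreover have "integrable lborel (%x. cor (indicator (cball 0 R) x) * \<phi> x)"
  by (intro integrable_L2_mult indicator_L2 test_function_L2 \<phi>) auto
 ultimately show ?thesis by simp
qed

text \<open>The power v^(s + 1) is at most 1 where v <= 1 and at most v^(s + 2) elsewhere; a bounded
  test function of bounded support makes both integrable.\<close>

lemma power_test_integrable:
 fixes v :: "real^'n::finite => real"
 assumes i: "integrable lborel (pw s (cr v))" and v: "!!x. 0 <= v x" "v \<in> borel_measurable borel" and s: "0 < s" and \<phi>: "test_function \<phi>"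
 shows "integrable lborel (%x. cor (v x * v x powr s) * \<phi> x)"
proof -
 obtain B where B: "B > 0" "!!x. cmod (\<phi> x) <= B" using test_function_bounded[OF \<phi>] by blast
 note [measurable] = v(2) test_function_measurable[OF \<phi>]
 have le: "v x * v x powr s <= 1 + pw s (cr v) x" for x
 proof (cases "v x <= 1")
  case True
  then have "v x * v x powr s <= 1 * 1" using v(1)[of x] s powr_mono2[of s "v x" 1] by (intro mult_mono) auto
  then show ?thesis using pw_nonneg[of s "cr v" x] by simp
 next
  case False
  then have "v x <= (v x)^2" by (simp add: power2_eq_square)
  then have "v x * v x powr s <= (v x)^2 * v x powr s" by (rule mult_right_mono) simp
  then show ?thesis using v(1)[of x] by (simp add: pw_def)
 qed
 show ?thesis
 proof (rule Bochner_Integration.integrable_bound)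
  show "integrable lborel (%x. cmod (\<phi> x) + B * pw s (cr v) x)"
   by (intro Bochner_Integration.integrable_add integrable_mult_right i integrable_norm test_function_integrable \<phi>)
  show "(%x. cor (v x * v x powr s) * \<phi> x) \<in> borel_measurable lborel" by measurable
  have "(v x * v x powr s) * cmod (\<phi> x) <= cmod (\<phi> x) + B * pw s (cr v) x" for x
  proof -
   have "(v x * v x powr s) * cmod (\<phi> x) <= (1 + pw s (cr v) x) * cmod (\<phi> x)" by (rule mult_right_mono[OF le]) simp
   moreover have "pw s (cr v) x * cmod (\<phi> x) <= pw s (cr v) x * B" by (intro mult_left_mono B pw_nonneg)
   ultimately show ?thesis by (simp add: algebra_simps)
  qed
  then show "AE x in lborel. norm (cor (v x * v x powr s) * \<phi> x) <= norm (cmod (\<phi> x) + B * pw s (cr v) x)"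
   using v(1) B(1) pw_nonneg[of s "cr v"] by (intro AE_I2) (simp add: norm_mult abs_mult)
 qed
qed

text \<open>The minimum is compared with its perturbations through \<open>pw_convex\<close>. The
  multiplier is m itself, thanks to the normalisation of the integral to 1. Multiplying \<phi> by -i
  gives the imaginary part of the identity.\<close>

lemma euler_lagrange:
 fixes v :: "real^'n::finite => real"
 assumes sub: "subcritical CARD('n) s" and vm: "v \<in> borel_measurable borel" and v0: "!!x. 0 <= v x" and vH: "cr v \<in> H1"
  and N1: "(LBINT x. pw s (cr v) x) = 1" and m: "0 < m" and vm1: "dirichlet (cr v) / 2 + (L2_norm (cr v))^2 = m"
  and low: "!!u :: real^'n => complex. u \<in> H1 ==> m * (LBINT x. pw s u x) powr (2 / (s + 2)) <= dirichlet u / 2 + (L2_norm u)^2"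
  and \<phi>: "test_function \<phi>"
 shows "- (1/2) * (LBINT x. cr v x * laplacian \<phi> x) + (LBINT x. cr v x * \<phi> x) =
  cor m * (LBINT x. cor (v x * v x powr s) * \<phi> x)"
proof -
 have s: "s > 0" using sub by (simp add: subcritical_def)
 note vL = H1_L2[OF vH]
 have re: "2 * Re (LBINT x. cr v x * \<phi> x) - Re (LBINT x. cr v x * laplacian \<phi> x) =
   2 * m * Re (LBINT x. cor (v x * v x powr s) * \<phi> x)" if \<phi>: "test_function \<phi>" for \<phi>
 proof (rule energy_first_variation[OF vH \<phi>])
  fix P :: real
  let ?u = "%t x. cr v x + cor t * cnj (\<phi> x)"
  let ?B = "2 * Re (LBINT x. cr v x * \<phi> x) - Re (LBINT x. cr v x * laplacian \<phi> x)"
  let ?A = "Re (LBINT x. cor (v x * v x powr s) * \<phi> x)"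
  assume uH: "!!t. ?u t \<in> H1" and ex: "!!t. dirichlet (?u t) / 2 + (L2_norm (?u t))^2 = dirichlet (cr v) / 2 + (L2_norm (cr v))^2 + t * ?B + t^2 * P"
  let ?I = "%x. cor (v x * v x powr s) * \<phi> x"
  have iI: "integrable lborel ?I"
   by (rule power_test_integrable[OF pw_integrable[OF sub lip2_H1[OF vH]] v0 vm s \<phi>])
  have N: "1 + (s + 2) * (t * ?A) <= (LBINT x. pw s (?u t) x)" for t
  proof -
   have "(LBINT x. pw s (cr v) x + (s + 2) * (t * Re (?I x))) <= (LBINT x. pw s (?u t) x)"
   proof (rule integral_mono)
    show "integrable lborel (%x. pw s (cr v) x + (s + 2) * (t * Re (?I x)))"
     by (intro Bochner_Integration.integrable_add integrable_mult_right integrable_Re[OF iI] pw_integrable[OF sub lip2_H1[OF vH]])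
    show "integrable lborel (pw s (?u t))" by (rule pw_integrable[OF sub lip2_H1[OF uH]])
    show "pw s (cr v) x + (s + 2) * (t * Re (?I x)) <= pw s (?u t) x" for x
     using pw_convex[OF v0[of x] s, of "cor t * cnj (\<phi> x)"] v0[of x] by (simp add: pw_def mult_ac)
   qed
   also have "(LBINT x. pw s (cr v) x + (s + 2) * (t * Re (?I x))) = 1 + (s + 2) * (t * ?A)"
    using N1 pw_integrable[OF sub lip2_H1[OF vH]] integrable_Re[OF iI] integral_Re[OF iI] by simp
   finally show ?thesis .
  qed
  \<comment> \<open>A minorant argument: this function vanishes at 0 and is nonnegative nearby,
    since the true constraint is at least its tangent. Its derivative at 0 is ?B - 2 m ?A.\<close>
  let ?f = "%t. m + t * ?B + t^2 * P - m * (1 + (s + 2) * (t * ?A)) powr (2 / (s + 2))"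
  have d: "(?f has_real_derivative (?B - m * (2 * ?A))) (at 0)"
   by (auto intro!: derivative_eq_intros) (use s in "simp add: field_simps")
  \<comment> \<open>For |t| < 1/K the base of the power stays positive, so that monotonicity of the
    power may be used.\<close>
  define K where "K = (s + 2) * \<bar>?A\<bar> + 1"
  have K: "K > 0" using s by (simp add: K_def add_nonneg_pos)
  have e: "0 < 1 + (s + 2) * (t * ?A)" if "\<bar>t\<bar> < 1 / K" for t
  proof -
   have "\<bar>(s + 2) * (t * ?A)\<bar> = \<bar>t\<bar> * ((s + 2) * \<bar>?A\<bar>)" using s by (simp add: abs_mult)
   also have "... <= \<bar>t\<bar> * K" by (intro mult_left_mono) (simp_all add: K_def)
   also have "... < 1" using that K by (simp add: pos_less_divide_eq)
   finally show ?thesis by linarith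
  qed
  have "?f 0 <= ?f t" if "\<bar>0 - t\<bar> < 1 / K" for t
  proof -
   have "m * (1 + (s + 2) * (t * ?A)) powr (2 / (s + 2)) <= m * (LBINT x. pw s (?u t) x) powr (2 / (s + 2))"
    using m s e[of t] that N[of t] by (intro mult_left_mono powr_mono2) auto
   also have "... <= m + t * ?B + t^2 * P" using low[OF uH] unfolding ex vm1 .
   finally show ?thesis by simp
  qed
  then have "?B - m * (2 * ?A) = 0" by (intro DERIV_local_min[OF d, of "1 / K"]) (use K in auto)
  then show ?thesis by simp
 qed
 have lin: "laplacian (%x. c * \<phi> x) = (%x. c * laplacian \<phi> x)" for c
 proof -
  have "partial_deriv j (%x. c * \<psi> x) = (%x. c * partial_deriv j \<psi> x)" if "test_function \<psi>" for j and \<psi> :: "real^'n => complex"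
  proof
   fix x :: "real^'n"
   have "(%x. c) differentiable at x" by simp
   from partial_deriv_mult[OF this test_function_differentiable[OF that]]
   show "partial_deriv j (%x. c * \<psi> x) x = c * partial_deriv j \<psi> x" by (simp add: partial_deriv_def)
  qed
  then show ?thesis using \<phi> by (simp add: laplacian_def[abs_def] test_function_partial_deriv sum_distrib_left)
 qed
 let ?X = "LBINT x. cr v x * laplacian \<phi> x" and ?Y = "LBINT x. cr v x * \<phi> x" and ?Z = "LBINT x. cor (v x * v x powr s) * \<phi> x"
 have "2 * Re (- \<i> * ?Y) - Re (- \<i> * ?X) = 2 * m * Re (- \<i> * ?Z)"
  using re[OF test_function_cmult[OF \<phi>, of "- \<i>"]] unfolding lin mult.left_commute[of _ "- \<i>"] integral_mult_right_zero .
 then have "2 * Im ?Y - Im ?X = 2 * m * Im ?Z" by simp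
 moreover note re[OF \<phi>]
 ultimately show ?thesis by (auto simp: complex_eq_iff)
qed

section \<open>Positivity and identification with the ground state\<close>

lemma laplacian_radial:
 assumes d1: "!!t. (\<theta> has_real_derivative \<theta>1 t) (at t)" and d2: "!!t. (\<theta>1 has_real_derivative \<theta>2 t) (at t)"
 shows "laplacian (%x::real^'n::finite. cor (\<theta> (x \<bullet> x))) x =
  cor (2 * real CARD('n) * \<theta>1 (x \<bullet> x) + 4 * (x \<bullet> x) * \<theta>2 (x \<bullet> x))"
proof -
 have c: "((%x. f (x \<bullet> x)) has_derivative (%h. f' (x \<bullet> x) * (2 * (x \<bullet> h)))) (at x)"
  if "!!t. (f has_real_derivative f' t) (at t)" for f f' and x :: "real^'n"
  by (rule has_derivative_compose[OF _ that[unfolded has_field_derivative_def], of "%x. x \<bullet> x" "%h. 2 * (x \<bullet> h)"])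
   (auto intro!: derivative_eq_intros simp: inner_commute)
 have 1: "partial_deriv j (%x::real^'n. cor (\<theta> (x \<bullet> x))) = (%x. cor (\<theta>1 (x \<bullet> x) * (2 * x $ j)))" for j
  using partial_deriv_eqI[OF bounded_linear.has_derivative[OF bounded_linear_of_real c[OF d1]], of j]
  by (simp add: fun_eq_iff inner_axis)
 have 2: "partial_deriv j (%x::real^'n. cor (\<theta>1 (x \<bullet> x) * (2 * x $ j))) x =
   cor (2 * \<theta>1 (x \<bullet> x) + 4 * (x $ j * x $ j) * \<theta>2 (x \<bullet> x))" for j and x :: "real^'n"
 proof -
  have "((%x. 2 * x $ j) has_derivative (%h. 2 * h $ j)) (at x)"
   by (intro has_derivative_mult_right bounded_linear.has_derivative[OF bounded_linear_vec_nth has_derivative_ident])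
  from partial_deriv_eqI[OF bounded_linear.has_derivative[OF bounded_linear_of_real has_derivative_mult[OF c[OF d2] this]], of j]
  show ?thesis by (simp add: inner_axis algebra_simps)
 qed
 have "(\<Sum>j\<in>UNIV. x $ j * x $ j) = x \<bullet> x" by (simp add: inner_vec_def)
 then show ?thesis
  unfolding laplacian_def 1 2
  by (simp add: sum.distrib of_real_sum[symmetric] sum_distrib_left[symmetric] sum_distrib_right[symmetric] del: of_real_sum of_real_mult of_real_add)
qed

lemma flat_exp_values:
 "flat_exp (flat_exp_deriv 1) t = (1/t)^2 * flat_exp 1 t"
 "flat_exp (flat_exp_deriv (flat_exp_deriv 1)) t = ((1/t)^4 - 2 * (1/t)^3) * flat_exp 1 t"
 by (auto simp: flat_exp_def flat_exp_deriv_def pderiv_pCons eval_nat_numeral algebra_simps)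

context
 fixes s0 s1 \<delta> :: real
 assumes \<delta>: "0 < \<delta>" "\<delta> <= 1/8" "\<delta> <= s0" and s1: "s1 = s0 + \<delta> + 1"
begin

text \<open>A function of t = |x|^2 supported in [s0, s1]. The first factor is the actual barrier;
  the second cuts off at s1, at distance at least 1 from the range t <= s0 + \<delta> where the
  differential inequality is needed, so there its logarithmic derivatives are at most 1.\<close>

definition "barrier t = flat_exp 1 (t - s0) * flat_exp 1 (s1 - t)"
definition "barrier1 t = flat_exp (flat_exp_deriv 1) (t - s0) * flat_exp 1 (s1 - t)
 - flat_exp 1 (t - s0) * flat_exp (flat_exp_deriv 1) (s1 - t)"
definition "barrier2 t = flat_exp (flat_exp_deriv (flat_exp_deriv 1)) (t - s0) * flat_exp 1 (s1 - t)
 - 2 * (flat_exp (flat_exp_deriv 1) (t - s0) * flat_exp (flat_exp_deriv 1) (s1 - t))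
 + flat_exp 1 (t - s0) * flat_exp (flat_exp_deriv (flat_exp_deriv 1)) (s1 - t)"

lemma barrier_deriv:
 "(barrier has_real_derivative barrier1 t) (at t)" "(barrier1 has_real_derivative barrier2 t) (at t)"
proof -
 have 1: "((%t. flat_exp p (t - s0)) has_real_derivative flat_exp (flat_exp_deriv p) (t - s0)) (at t)" for p
  by (rule DERIV_chain2[OF flat_exp_has_derivative, of _ 1, simplified]) (auto intro!: derivative_eq_intros)
 have 2: "((%t. flat_exp p (s1 - t)) has_real_derivative - flat_exp (flat_exp_deriv p) (s1 - t)) (at t)" for p
  by (rule DERIV_chain2[OF flat_exp_has_derivative, of _ "-1", simplified]) (auto intro!: derivative_eq_intros)
 show "(barrier has_real_derivative barrier1 t) (at t)" "(barrier1 has_real_derivative barrier2 t) (at t)"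
  unfolding barrier_def[abs_def] barrier1_def[abs_def] barrier1_def barrier2_def
  by (auto intro!: derivative_eq_intros 1 2 simp: algebra_simps)
qed

lemma barrier_nonneg: "0 <= barrier t" and barrier_zero: "t <= s0 ==> barrier t = 0 \<and> barrier1 t = 0 \<and> barrier2 t = 0"
 and barrier_pos: "s0 < t ==> t <= s0 + \<delta> ==> 0 < barrier t" and barrier_support: "barrier t ~= 0 ==> t <= s1"
 unfolding barrier_def barrier1_def barrier2_def using s1 \<delta>
 by (auto simp: flat_exp_values flat_exp_1 split: if_splits)

text \<open>At t = |x|^2 the right side is half the Laplacian in dimension n. With a = 1/(t - s0) >=
  1/\<delta> >= 8, the term a^4 from the second derivative dominates all others, and 2 t (a^4/2) >=
  \<delta> a^4 >= a^3 >= 1 because t >= s0 >= \<delta>.\<close>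

lemma barrier_subsolution:
 assumes t: "t <= s0 + \<delta>"
 shows "barrier t <= real n * barrier1 t + 2 * t * barrier2 t"
proof (cases "t <= s0")
 case False
 define a c where "a = 1 / (t - s0)" and "c = 1 / (s1 - t)"
 have a\<delta>: "1 <= \<delta> * a" using False t \<delta> by (simp add: a_def)
 have c: "0 <= c" "c <= 1" using t by (simp_all add: c_def s1)
 have a: "8 <= a" using False t \<delta> by (simp add: a_def field_simps)
 have a3: "8 * a^2 <= a^3" using mult_right_mono[OF a zero_le_power2[of a]] by (simp add: eval_nat_numeral)
 have a4: "8 * a^3 <= a^4" using mult_right_mono[OF a, of "a^3"] a by (simp add: eval_nat_numeral)
 have a2: "64 <= a^2" using power_mono[OF a, of 2] by simp
 have c2: "c^2 <= 1" "c^3 <= 1" "0 <= c^4" using c by (auto intro: power_le_one)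
 have "a^2 * c^2 <= a^2 * 1" using c2 by (intro mult_left_mono) auto
 then have B: "a^4 / 2 <= a^4 - 2 * a^3 - 2 * (a^2 * c^2) + c^4 - 2 * c^3" using a2 a3 a4 c2 by linarith
 have "1 <= a^3" using a2 a3 by linarith
 also have "a^3 <= (\<delta> * a) * a^3" using mult_right_mono[OF a\<delta>, of "a^3"] a by simp
 also have "... = \<delta> * a^4" by (simp add: eval_nat_numeral)
 also have "... <= t * a^4" using False \<delta> by (intro mult_right_mono) auto
 also have "... = 2 * t * (a^4 / 2)" by simp
 also have "... <= 2 * t * (a^4 - 2 * a^3 - 2 * (a^2 * c^2) + c^4 - 2 * c^3)" using False \<delta> by (intro mult_left_mono B) auto
 finally have "1 <= real n * (a^2 - c^2) + 2 * t * (a^4 - 2 * a^3 - 2 * (a^2 * c^2) + c^4 - 2 * c^3)"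
  using a2 c2 by (intro add_increasing mult_nonneg_nonneg) auto
 from mult_right_mono[OF this barrier_nonneg[of t]]
 show ?thesis
  by (simp add: barrier_def barrier1_def barrier2_def flat_exp_values a_def[symmetric] c_def[symmetric] algebra_simps)
qed (simp add: barrier_zero)

lemma barrier_test_function: "test_function (%x::real^'n::finite. cor (barrier (x \<bullet> x)))"
proof (rule test_functionI)
 have sq: "Ck k (%x::real^'n. cor (a + b * (x \<bullet> x)))" for k a b
  unfolding inner_vec_def inner_real_def of_real_add of_real_mult of_real_sum by (intro Ck_add Ck_mult Ck_sum Ck_const Ck_coord)
 show "Ck k (%x::real^'n. cor (barrier (x \<bullet> x)))" for k
  using Ck_mult[OF Ck_flat_exp[OF sq[of _ "- s0" 1]] Ck_flat_exp[OF sq[of _ s1 "-1"]], of k 1 1]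
  by (simp add: barrier_def)
 show "norm x <= sqrt s1" if "cor (barrier (x \<bullet> x)) ~= 0" for x :: "real^'n"
  using barrier_support[of "x \<bullet> x"] that by (intro real_le_rsqrt) (simp add: power2_norm_eq_inner)
qed

end

text \<open>If a radially decreasing \<open>v\<close> vanished outside a ball of minimal radius \<open>R\<close>, testing the equation
 with the barrier, a subsolution near the sphere of radius \<open>R\<close>, would give a contradiction.\<close>

lemma radially_decreasing_positive:
 fixes v :: "real^'n::finite => real"
 assumes vm: "v \<in> borel_measurable borel" and v0: "!!x. 0 <= v x" and vL: "cr v \<in> L2"
  and s: "0 < s" and m: "0 < m" and i: "integrable lborel (pw s (cr v))" and N1: "(LBINT x. pw s (cr v) x) = 1"
  and el: "!!\<phi>. test_function \<phi> ==> - (1/2) * (LBINT x. cr v x * laplacian \<phi> x) + (LBINT x. cr v x * \<phi> x) =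
   cor m * (LBINT x. cor (v x * v x powr s) * \<phi> x)"
  and N: "N \<in> null_sets lborel" "!!x y. x \<notin> N ==> y \<notin> N ==> norm x <= norm y ==> v y <= v x"
 shows "\<exists>y. y \<notin> N \<and> r <= norm y \<and> 0 < v y"
proof (rule ccontr)
 assume neg: "\<not> ?thesis"
 \<comment> \<open>Radii beyond which v vanishes off N. Their infimum R is the radius of the
   support: v is positive a.e. inside and zero a.e. outside.\<close>
 define S where "S = {r. 0 <= r \<and> (\<forall>y. y \<notin> N --> r <= norm y --> v y = 0)}"
 have "max 0 r \<in> S" using neg v0 by (force simp: S_def less_le)
 then have S0: "S ~= {}" by blast
 have bdd: "bdd_below S" by (rule bdd_belowI[of _ 0]) (simp add: S_def)
 define R where "R = Inf S"
 have R0: "0 <= R" unfolding R_def by (rule cInf_greatest[OF S0]) (simp add: S_def)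
 have out: "v y = 0" if "y \<notin> N" "R < norm y" for y
  using cInf_lessD[OF S0 that(2)[unfolded R_def]] that(1) by (force simp: S_def)
 have inn: "0 < v x" if x: "x \<notin> N" "norm x < R" for x
 proof -
  have "norm x \<notin> S" using cInf_lower[OF _ bdd, of "norm x"] x(2) by (auto simp: R_def)
  then obtain y where "y \<notin> N" "norm x <= norm y" "v y ~= 0" by (auto simp: S_def)
  then show ?thesis using N(2)[OF x(1), of y] v0[of y] by (simp add: less_le)
 qed
 have R: "0 < R"
 proof (rule ccontr)
  assume "\<not> 0 < R"
  then have "v x = 0" if "x \<notin> N" "x ~= 0" for x using out[OF that(1)] that(2) R0 by simp
  then have "AE x in lborel. pw s (cr v) x = 0"
   by (intro AE_I'[OF null_sets.Un[OF N(1) finite_imp_null_set_lborel[of "{0}"]]]) (auto simp: pw_def)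
  then have "(LBINT x. pw s (cr v) x) = 0" by (rule integral_eq_zero_AE)
  then show False using N1 by simp
 qed
 \<comment> \<open>The barrier starts just inside the sphere, at |x|^2 = s0 = R^2 - \<delta>, so
   that s0 + \<delta> = R^2; the bound R^2/2 ensures \<delta> <= s0, and 1/8 is what
   \<open>barrier_subsolution\<close> asks for.\<close>
 define \<delta> where "\<delta> = min (1/8) (R^2 / 2)"
 define s0 where "s0 = R^2 - \<delta>"
 have \<delta>: "0 < \<delta>" "\<delta> <= 1/8" "\<delta> <= s0" using R by (auto simp: \<delta>_def s0_def min_def)
 define s1 where "s1 = s0 + \<delta> + 1"
 note \<delta>1 = \<delta> s1_def
 let ?p = "%x::real^'n. barrier s0 s1 (x \<bullet> x)"
 let ?l = "%x::real^'n. 2 * real CARD('n) * barrier1 s0 s1 (x \<bullet> x) + 4 * (x \<bullet> x) * barrier2 s0 s1 (x \<bullet> x)"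
 let ?q = "%x. v x * v x powr s * ?p x"
 have test: "test_function (cr ?p)" by (rule barrier_test_function[OF \<delta>1])
 have lap: "laplacian (cr ?p) = cr ?l" by (rule ext, rule laplacian_radial) (rule barrier_deriv[OF \<delta>1])+
 have lL: "cr ?l \<in> L2"
  unfolding lap[symmetric] laplacian_def[abs_def] by (intro L2_sum test_function_L2 test_function_partial_deriv test)
 have iv: "integrable lborel (%x. v x * ?l x)" "integrable lborel (%x. v x * ?p x)" "integrable lborel ?q"
  using integrable_Re[OF integrable_L2_mult[OF vL lL]] integrable_Re[OF integrable_L2_mult[OF vL test_function_L2[OF test]]]
   integrable_Re[OF power_test_integrable[OF i v0 vm s test]] by simp_all
 have cc: "(LBINT x. cor (f x) * cor (g x)) = cor (LBINT x. f x * g x)" for f g :: "real^'n => real"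
  unfolding of_real_mult[symmetric] by (rule integral_complex_of_real)
 have "cor (- (1/2) * (LBINT x. v x * ?l x) + (LBINT x. v x * ?p x)) = cor (m * (LBINT x. ?q x))"
  using el[OF test] unfolding lap cc by simp
 then have eq: "- (1/2) * (LBINT x. v x * ?l x) + (LBINT x. v x * ?p x) = m * (LBINT x. ?q x)"
  by (simp only: of_real_eq_iff)
 \<comment> \<open>Where the barrier fails to be a subsolution v vanishes. The equation then makes m
   times the integral of v^(s + 1) ?p nonpositive, whereas v and ?p are positive on the shell
   \<open>?U\<close>.\<close>
 have "(LBINT x. v x * ?p x) <= (LBINT x. (1/2) * (v x * ?l x))"
 proof (rule integral_mono_AE[OF iv(2) integrable_mult_right[OF iv(1)]])
  have "v x * ?p x <= (1/2) * (v x * ?l x)" if "x \<notin> N" for x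
  proof (cases "R < norm x")
   case False
   then have "x \<bullet> x <= s0 + \<delta>" using power_mono[of "norm x" R 2] by (simp add: s0_def power2_norm_eq_inner)
   from mult_left_mono[OF barrier_subsolution[OF \<delta>1 this, of "CARD('n)"] v0[of x]]
   show ?thesis by (simp add: algebra_simps)
  qed (simp add: out that)
  then show "AE x in lborel. v x * ?p x <= (1/2) * (v x * ?l x)" by (intro AE_I'[OF N(1)]) auto
 qed
 then have "m * (LBINT x. ?q x) <= 0" unfolding eq[symmetric] by simp
 then have "(LBINT x. ?q x) <= 0" using m by (simp add: mult_le_0_iff)
 moreover have q0: "0 <= ?q x" for x using v0 barrier_nonneg[OF \<delta>1] by simp
 ultimately have "(LBINT x. ?q x) = 0" by (intro antisym integral_nonneg_AE AE_I2)
 then have "AE x in lborel. ?q x = 0" using integral_nonneg_eq_0_iff_AE[OF iv(3)] q0 by simp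
 then obtain N' where N': "N' \<in> null_sets lborel" "!!x. x \<notin> N' ==> ?q x = 0" by (auto elim!: AE_E3)
 let ?U = "{x::real^'n. s0 < x \<bullet> x} \<inter> {x. x \<bullet> x < R^2}"
 have "?U \<subseteq> N \<union> N'"
 proof
  fix x assume x: "x \<in> ?U"
  show "x \<in> N \<union> N'"
  proof (rule ccontr)
   assume nx: "x \<notin> N \<union> N'"
   have "norm x < R" using x R by (intro power2_less_imp_less[of _ R]) (auto simp: power2_norm_eq_inner)
   then have "0 < v x" using inn nx by simp
   moreover have "0 < ?p x" by (rule barrier_pos[OF \<delta>1]) (use x in "auto simp: s0_def")
   ultimately show False using N'(2)[of x] nx by simp
  qed
 qed
 moreover have "negligible (N \<union> N')"
  using N(1) N'(1) by (auto simp: negligible_iff_null_sets intro: null_sets_completionI)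
 ultimately have "negligible ?U" by (rule negligible_subset[rotated])
 moreover have "open ?U" by (intro open_Int open_Collect_less continuous_intros)
 moreover have "?U ~= {}"
 proof -
  obtain k :: 'n where True by simp
  let ?x = "axis k (sqrt ((s0 + R^2) / 2)) :: real^'n"
  have "?x \<bullet> ?x = (s0 + R^2) / 2" using \<delta> by (simp add: inner_axis_axis)
  then have "?x \<in> ?U" using \<delta>(1) by (simp add: s0_def)
  then show ?thesis by blast
 qed
 ultimately show False using open_not_negligible by blast
qed

text \<open>\<open>positive_radial_solution\<close> asks for radiality and positivity at every
  point. The representative is the supremum of v over points off N at least as far out; the bounded
  increasing map t/(1 + t) keeps suprema finite. The default 1, for supremum 1, can occur only on N,
  as off N the value is that of v.\<close>

lemma radial_representative:
 fixes v :: "real^'n::finite => real"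
 assumes v0: "!!x. 0 <= v x" and N: "N \<in> null_sets lborel" "!!x y. x \<notin> N ==> y \<notin> N ==> norm x <= norm y ==> v y <= v x"
  and pos: "!!r. \<exists>y. y \<notin> N \<and> r <= norm y \<and> 0 < v y"
 obtains V :: "real^'n => real" where "V \<in> borel_measurable borel" "!!x. 0 < V x" "!!x y. norm x = norm y ==> V x = V y"
  "AE x in lborel. V x = v x"
proof -
 let ?b = "%t::real. t / (1 + t)"
 have b: "0 <= ?b t" "?b t < 1" if "0 <= t" for t using that by simp_all
 have bm: "?b t <= ?b t'" if "0 <= t" "t <= t'" for t t' using that by (simp add: field_simps)
 define A where "A r = {?b (v y) |y. y \<notin> N \<and> r <= norm y}" for r
 define \<mu> where "\<mu> r = Sup (A r)" for r
 have Ane: "A r ~= {}" for r using pos[of r] by (auto simp: A_def)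
 have Abd: "bdd_above (A r)" for r by (rule bdd_aboveI[of _ 1]) (use b(2)[OF v0] in "auto simp: A_def less_imp_le")
 have \<mu>0: "0 < \<mu> r" for r
 proof -
  obtain y where y: "y \<notin> N" "r <= norm y" "0 < v y" using pos by blast
  then have "?b (v y) <= \<mu> r" unfolding \<mu>_def by (intro cSup_upper Abd) (auto simp: A_def)
  moreover have "0 < ?b (v y)" using y(3) by simp
  ultimately show ?thesis by linarith
 qed
 have "mono (%r. - \<mu> r)"
 proof (rule monoI)
  fix r r' :: real assume "r <= r'"
  then have "A r' \<subseteq> A r" by (auto simp: A_def)
  then show "- \<mu> r <= - \<mu> r'" unfolding \<mu>_def using cSup_subset_mono[OF Ane Abd] by simp
 qed
 then have "(%r. - \<mu> r) \<in> borel_measurable borel" by (rule borel_measurable_mono)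
 then have "(%r. - (- \<mu> r)) \<in> borel_measurable borel" by (rule borel_measurable_uminus)
 then have [measurable]: "\<mu> \<in> borel_measurable borel" by simp
 define V where "V x = (if \<mu> (norm x) < 1 then \<mu> (norm x) / (1 - \<mu> (norm x)) else 1)" for x :: "real^'n"
 show ?thesis
 proof (rule that)
  show "V \<in> borel_measurable borel" unfolding V_def[abs_def] by measurable
  show "0 < V x" for x using \<mu>0[of "norm x"] by (simp add: V_def)
  show "V x = V y" if "norm x = norm y" for x y using that by (simp add: V_def)
  have "V x = v x" if x: "x \<notin> N" for x
  proof -
   have "\<mu> (norm x) = ?b (v x)"
    unfolding \<mu>_def
   proof (rule cSup_eq_maximum)
    show "?b (v x) \<in> A (norm x)" using x by (auto simp: A_def)
    show "!!t. t \<in> A (norm x) ==> t <= ?b (v x)" using bm[OF v0 N(2)[OF x]] by (auto simp: A_def)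
   qed
   moreover have "1 - ?b (v x) = 1 / (1 + v x)" using v0[of x] by (simp add: field_simps)
   ultimately show ?thesis using b(2)[OF v0[of x]] v0[of x] by (simp add: V_def)
  qed
  then show "AE x in lborel. V x = v x" by (intro AE_I'[OF N(1)]) auto
 qed
qed

text \<open>The minimiser solves -(1/2) \<Delta>v + v = m v^(1 + s), so a v with \<mu> a^s = m
  solves the equation of Q and equals Q a.e. by uniqueness. Only the resulting relation between the
  two norms is passed on, besides the properties of v.\<close>

theorem ground_state_minimizer:
 fixes Q :: "real^'n::finite => real"
 assumes n: "s = 4 / real CARD('n)" and sub: "subcritical CARD('n) s" and \<mu>: "0 < \<mu>" and Q: "is_ground_state \<mu> Q"
 obtains v :: "real^'n => real" and m :: real
 where "cr v \<in> H1" "(LBINT x. pw s (cr v) x) = 1" "0 < m" "dirichlet (cr v) / 2 + (L2_norm (cr v))^2 = m"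
  "!!u :: real^'n => complex. u \<in> H1 ==> m * (LBINT x. pw s u x) powr (2 / (s + 2)) <= dirichlet u / 2 + (L2_norm u)^2"
  "(L2_norm (cr Q)) powr s * \<mu> = m * (L2_norm (cr v)) powr s" "0 < L2_norm (cr Q)"
proof -
 have s: "s > 0" using sub by (simp add: subcritical_def)
 have QH: "cr Q \<in> H1" and Qp: "!!x. 0 < Q x" 
  using Q unfolding is_ground_state_def positive_radial_solution_def by blast+
 have iQ: "integrable lborel (pw s (cr Q))" by (rule pw_integrable[OF sub lip2_H1[OF QH]])
 have Q0: "0 < L2_norm (cr Q)"
 proof -
  have "\<not> (AE x in lborel. cr Q x = 0)" using Qp by (simp add: less_imp_neq[THEN not_sym] eventually_False ae_filter_eq_bot_iff)
  then show ?thesis using L2_norm_eq_0[OF H1_L2[OF QH]] L2_norm_nonneg[of "cr Q"] by (simp add: less_le)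
 qed
 have NQ: "0 < (LBINT x. pw s (cr Q) x)"
 proof -
  have "\<not> (AE x in lborel. pw s (cr Q) x = 0)" using Qp by (simp add: pw_def less_imp_neq[THEN not_sym] eventually_False ae_filter_eq_bot_iff)
  then show ?thesis using integral_nonneg_eq_0_iff_AE[OF iQ] integral_nonneg_AE[where M=lborel and f="pw s (cr Q)"] by (simp add: pw_nonneg less_le)
 qed
 show ?thesis
 proof (rule minimizer_exists[OF sub QH NQ])
  fix v :: "real^'n => real" and m
  assume v: "v \<in> borel_measurable borel" "!!x. 0 <= v x" "cr v \<in> H1" "radially_decreasing v"
   "(LBINT x. pw s (cr v) x) = 1" "0 < m" "dirichlet (cr v) / 2 + (L2_norm (cr v))^2 = m"
   "!!u :: real^'n => complex. u \<in> H1 ==> m * (LBINT x. pw s u x) powr (2 / (s + 2)) <= dirichlet u / 2 + (L2_norm u)^2"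
  have el: "- (1/2) * (LBINT x. cr v x * laplacian \<phi> x) + (LBINT x. cr v x * \<phi> x) =
    cor m * (LBINT x. cor (v x * v x powr s) * \<phi> x)" if "test_function \<phi>" for \<phi>
   by (rule euler_lagrange[OF sub v(1,2,3,5,6,7) v(8) that])
  obtain N where N: "N \<in> null_sets lborel" "!!x y. x \<notin> N ==> y \<notin> N ==> norm x <= norm y ==> v y <= v x"
   using v(4) unfolding radially_decreasing_def by blast
  have pos: "\<exists>y. y \<notin> N \<and> r <= norm y \<and> 0 < v y" for r
   by (rule radially_decreasing_positive[OF v(1,2) H1_L2[OF v(3)] s v(6) pw_integrable[OF sub lip2_H1[OF v(3)]] v(5) el N])
  show ?thesis
  proof (rule radial_representative[OF v(2) N pos])
   fix V :: "real^'n => real"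
   assume V: "V \<in> borel_measurable borel" "!!x. 0 < V x" "!!x y. norm x = norm y ==> V x = V y" "AE x in lborel. V x = v x"
   note [measurable] = V(1) v(1)
   define a where "a = (m / \<mu>) powr (1 / s)"
   have a: "0 < a" using v(6) \<mu> by (simp add: a_def)
   have as: "a powr s * \<mu> = m" using v(6) \<mu> s by (simp add: a_def powr_powr)
   let ?W = "%x. a * V x"
   have VL: "cr V \<in> L2" by (rule L2_cong_AE[OF H1_L2[OF v(3)]]) (measurable, use V(4) in "auto elim!: eventually_mono")
   have int: "(LBINT x. cor (F (V x)) * f x) = (LBINT x. cor (F (v x)) * f x)"
    if [measurable]: "F \<in> borel_measurable borel" "f \<in> borel_measurable borel" for F and f :: "real^'n => complex"
    by (rule integral_cong_AE) (measurable, use V(4) in "auto elim!: eventually_mono")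
   have "is_weak_partial j (cr V) (weak_partial j (cr v))" for j
    unfolding is_weak_partial_def
   proof (intro allI impI)
    fix \<phi> :: "real^'n => complex" assume \<phi>: "test_function \<phi>"
    show "(LBINT x. cr V x * partial_deriv j \<phi> x) = - (LBINT x. weak_partial j (cr v) x * \<phi> x)"
     using H1_weak_partial(2)[OF v(3), of j] \<phi> int[of "%t. t", OF _ test_function_measurable[OF test_function_partial_deriv[OF \<phi>]]]
     by (simp add: is_weak_partial_def)
   qed
   then have VH: "cr V \<in> H1" by (rule H1I[OF VL H1_weak_partial(1)[OF v(3)]])
   have "positive_radial_solution \<mu> ?W"
    unfolding positive_radial_solution_def
   proof (intro conjI allI impI)
    show "cr ?W \<in> H1" using H1_scale(1)[OF VH, of "cor a"] by simp
    show "0 < ?W x" for x using a V(2) by simp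
    show "?W x = ?W y" if "norm x = norm y" for x y using V(3)[OF that] by simp
    fix \<phi> :: "real^'n => complex" assume \<phi>: "test_function \<phi>"
    have [measurable]: "\<phi> \<in> borel_measurable borel" "laplacian \<phi> \<in> borel_measurable borel"
     unfolding laplacian_def[abs_def]
     by (intro borel_measurable_sum test_function_measurable test_function_partial_deriv \<phi>)+
    have p: "cor (\<bar>?W x\<bar> powr (4 / real CARD('n)) * ?W x) = cor (a powr s * a) * cor (V x * V x powr s)" for x
     using a V(2)[of x] by (simp add: n[symmetric] powr_mult abs_mult mult_ac)
    have e: "- (1/2) * (LBINT x. cr V x * laplacian \<phi> x) + (LBINT x. cr V x * \<phi> x) =
      cor (a powr s * \<mu>) * (LBINT x. cor (V x * V x powr s) * \<phi> x)"
     using el[OF \<phi>] int[of "%t. t" "laplacian \<phi>"] int[of "%t. t" \<phi>] int[of "%t. t * t powr s" \<phi>] unfolding as by simp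
    have sc: "(LBINT x. cor (?W x) * f x) = cor a * (LBINT x. cr V x * f x)" for f :: "real^'n => complex"
     unfolding integral_mult_right_zero[symmetric] by (simp add: mult.assoc)
    have sp: "(LBINT x. cor (\<bar>?W x\<bar> powr (4 / real CARD('n)) * ?W x) * \<phi> x) =
      cor (a powr s * a) * (LBINT x. cor (V x * V x powr s) * \<phi> x)"
     unfolding p integral_mult_right_zero[symmetric] by (simp add: mult.assoc)
    have "cor a * (- (1/2) * (LBINT x. cr V x * laplacian \<phi> x) + (LBINT x. cr V x * \<phi> x)) =
     cor \<mu> * (cor (a powr s * a) * (LBINT x. cor (V x * V x powr s) * \<phi> x))"
     unfolding e by simp
    then show "- (1/2) * (LBINT x. cor (?W x) * laplacian \<phi> x)
     - cor \<mu> * (LBINT x. cor (\<bar>?W x\<bar> powr (4 / real CARD('n)) * ?W x) * \<phi> x)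
     = - (LBINT x. cor (?W x) * \<phi> x)"
     unfolding sc sp by (simp add: algebra_simps)
   qed
   then have WQ: "AE x in lborel. a * V x = Q x" using Q unfolding is_ground_state_def by blast
   have "L2_norm (cr Q) = L2_norm (%x. cor a * cr v x)"
   proof (rule L2_norm_cong_AE)
    show "AE x in lborel. cmod (cr Q x) = cmod (cor a * cr v x)"
     using WQ V(4) by eventually_elim (metis of_real_mult)
   qed (use L2_measurable[OF H1_L2[OF QH]] in measurable)
   then have "L2_norm (cr Q) = a * L2_norm (cr v)" using a by (simp add: L2_norm_cmult)
   then have "(L2_norm (cr Q)) powr s * \<mu> = m * (L2_norm (cr v)) powr s"
    using a as by (simp add: powr_mult L2_norm_nonneg mult_ac)
   then show ?thesis by (intro that[OF v(3,5,6,7) v(8) _ Q0])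
  qed
 qed
qed

section \<open>The sharp inequality and the critical case\<close>

lemma L2_norm_dilation:
 fixes u :: "real^'n::finite => complex"
 assumes u: "u \<in> L2" and b: "b > 0"
 shows "(%x. u (b *\<^sub>R x)) \<in> L2" "(L2_norm (%x. u (b *\<^sub>R x)))^2 = inverse b ^ CARD('n) * (L2_norm u)^2"
proof -
 note [measurable] = L2_measurable[OF u]
 have e: "(NN x. ennreal ((cmod (u (b *\<^sub>R x)))^2)) = ennreal (inverse b ^ CARD('n) * (L2_norm u)^2)"
  using nn_integral_lborel_scale[of "%x. ennreal ((cmod (u x))^2)" b] b by (simp add: nn_integral_L2[OF u] ennreal_mult)
 have "(%x. u (b *\<^sub>R x)) \<in> borel_measurable borel" by measurable
 then show L: "(%x. u (b *\<^sub>R x)) \<in> L2" unfolding L2_iff e by simp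
 show "(L2_norm (%x. u (b *\<^sub>R x)))^2 = inverse b ^ CARD('n) * (L2_norm u)^2"
  using e b unfolding nn_integral_L2[OF L] by (subst (asm) ennreal_inj) auto
qed

text \<open>Read off the scaling of \<open>shift_dist\<close> and of the averaged form, so that no
  chain rule for weak derivatives enters. The inequality is the direction in which dilates are used
  as competitors.\<close>

lemma dirichlet_dilation_le:
 fixes u :: "real^'n::finite => complex"
 assumes u: "u \<in> H1" and b: "b > 0"
 shows "(%x. u (b *\<^sub>R x)) \<in> H1" "dirichlet (%x. u (b *\<^sub>R x)) <= inverse b ^ CARD('n) * b^2 * dirichlet u"
proof -
 obtain k :: 'n where True by simp
 note uL = H1_L2[OF u]
 let ?f = "%x. u (b *\<^sub>R x)" and ?i = "inverse b ^ CARD('n)"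
 have sd: "(shift_dist ?f z)^2 = ?i * (shift_dist u (b *\<^sub>R z))^2" for z
  using L2_norm_dilation(2)[OF L2_diff[OF L2_shift[OF uL] uL] b, of "b *\<^sub>R z"]
  by (simp add: shift_dist_def scaleR_add_right)
 have nl: "nonlocal_form e ?f <= ennreal (ball_moment k * (?i * b^2 * dirichlet u))" if e: "e > 0" for e
 proof -
  have "nonlocal_form e ?f = (NN w. ennreal (?i * b^2) * (indicator (ball 0 1) w * (ennreal ((shift_dist u ((b * e) *\<^sub>R w))^2) * ennreal (1 / (b * e)^2))))"
   unfolding nonlocal_form_def sd
   using b e by (intro nn_integral_cong) (auto simp: ennreal_mult[symmetric] power_mult_distrib divide_simps split: split_indicator)
  also have "... = ennreal (?i * b^2) * nonlocal_form (b * e) u"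
   unfolding nonlocal_form_def by (rule nn_integral_cmult) (use uL in measurable)
  also have "... <= ennreal (?i * b^2) * ennreal (ball_moment k * dirichlet u)"
   using b e by (intro mult_left_mono nonlocal_form_le_dirichlet u) auto
  also have "... = ennreal (ball_moment k * (?i * b^2 * dirichlet u))"
   using b by (subst ennreal_mult'[symmetric]) (auto simp: mult_ac)
  finally show ?thesis .
 qed
 have "0 <= ?i * b^2 * dirichlet u" using b dirichlet_nonneg[of u] by simp
 from H1_if_nonlocal_form_le[OF L2_norm_dilation(1)[OF uL b] this nl]
 show "?f \<in> H1" "dirichlet ?f <= ?i * b^2 * dirichlet u" by auto
qed

lemma pw_integral_dilation:
 fixes u :: "real^'n::finite => complex"
 assumes u: "u \<in> L2" and b: "b > 0"
 shows "(LBINT x. pw s (%x. u (b *\<^sub>R x)) x) = inverse b ^ CARD('n) * (LBINT x. pw s u x)"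
proof -
 note [measurable] = L2_measurable[OF u]
 have m: "pw s u \<in> borel_measurable borel" "pw s (%x. u (b *\<^sub>R x)) \<in> borel_measurable borel"
  unfolding pw_def[abs_def] by measurable
 have "(NN x. ennreal (pw s (%x. u (b *\<^sub>R x)) x)) = ennreal (inverse b ^ CARD('n)) * (NN x. ennreal (pw s u x))"
  using nn_integral_lborel_scale[of "%x. ennreal (pw s u x)" b] b m by (simp add: pw_def)
 then show ?thesis
  using integral_eq_nn_integral[of "pw s u" lborel] integral_eq_nn_integral[of "pw s (%x. u (b *\<^sub>R x))" lborel] m b
  by (simp add: pw_nonneg enn2real_mult)
qed

text \<open>Optimisation over t of (t X + Y)/t^\<theta>, turning the additive inequality into its
  product form with the exact constant.\<close>

lemma optimize_scaling:
 fixes \<theta> m X Y N :: real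
 assumes \<theta>: "0 < \<theta>" "\<theta> < 1" and m: "0 < m" and X: "0 <= X" and Y: "0 < Y" and N: "0 <= N"
  and le: "!!t. 0 < t ==> m * N powr \<theta> * t powr \<theta> <= t * X + Y"
 shows "\<theta> * m * ((1 - \<theta>) * m) powr (1/\<theta> - 1) * N <= X * Y powr (1/\<theta> - 1)"
proof (cases "N = 0 \<or> X = 0")
 case True
 have "N = 0"
 proof (rule ccontr)
  assume "N ~= 0"
  then have M: "0 < m * N powr \<theta>" using m N by simp
  \<comment> \<open>For X = 0 the right side does not grow with t; this t makes the left side equal
    to Y + 1.\<close>
  define t where "t = ((Y + 1) / (m * N powr \<theta>)) powr (1 / \<theta>)"
  have "0 < t" using M Y m \<open>N ~= 0\<close> by (simp add: t_def)
  from le[OF this] have "m * N powr \<theta> * t powr \<theta> <= Y" using True \<open>N ~= 0\<close> by simp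
  moreover have "t powr \<theta> = (Y + 1) / (m * N powr \<theta>)" using M Y m \<open>N ~= 0\<close> \<theta> by (simp add: t_def powr_powr)
  ultimately show False using m \<open>N ~= 0\<close> by simp
 qed
 then show ?thesis using X by simp
next
 case False
 then have X0: "0 < X" and N0: "0 < N" using X N by auto
 define k where "k = 1/\<theta> - 1"
 have k1: "1/\<theta> = k + 1" by (simp add: k_def)
 \<comment> \<open>The critical point of (t X + Y)/t^\<theta>, where t X and Y stand in the ratio
   \<theta> to 1 - \<theta>.\<close>
 define t where "t = \<theta> * Y / ((1 - \<theta>) * X)"
 have t: "0 < t" using \<theta> X0 Y by (simp add: t_def)
 have tX: "t * X * (1 - \<theta>) = \<theta> * Y" using \<theta> X0 by (simp add: t_def)
 define Z where "Z = Y / (1 - \<theta>)"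
 have Z: "0 < Z" using \<theta> Y by (simp add: Z_def)
 have "(t * X + Y) * (1 - \<theta>) = Y" unfolding distrib_right tX by (simp add: algebra_simps)
 then have "t * X + Y = Z" using \<theta> by (simp add: Z_def nonzero_eq_divide_eq)
 then have "(m * N powr \<theta> * t powr \<theta>) powr (1/\<theta>) <= Z powr (1/\<theta>)"
  using le[OF t] m \<theta> by (intro powr_mono2) auto
 also have "(m * N powr \<theta> * t powr \<theta>) powr (1/\<theta>) = m powr (1/\<theta>) * N * t"
  using m N0 t \<theta> by (simp add: powr_mult powr_powr)
 finally have "m powr (1/\<theta>) * N * t <= Z powr (1/\<theta>)" .
 then have "(m * m powr k) * N * t <= Z * Z powr k" unfolding k1 using m Z by (simp add: powr_add mult.commute)
 then have "((1 - \<theta>) * ((1 - \<theta>) powr k * X)) * ((m * m powr k) * N * t) <= ((1 - \<theta>) * ((1 - \<theta>) powr k * X)) * (Z * Z powr k)"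
  using \<theta> X0 by (intro mult_left_mono) auto
 also have "((1 - \<theta>) * ((1 - \<theta>) powr k * X)) * ((m * m powr k) * N * t) = (t * X * (1 - \<theta>)) * (m * ((1 - \<theta>) powr k * m powr k) * N)"
  by (simp only: mult_ac)
 also have "... = Y * (\<theta> * m * ((1 - \<theta>) * m) powr k * N)"
  unfolding tX using \<theta> m by (simp add: powr_mult mult_ac)
 also have "((1 - \<theta>) * ((1 - \<theta>) powr k * X)) * (Z * Z powr k) = ((1 - \<theta>) * Z) * (X * ((1 - \<theta>) powr k * Z powr k))"
  by (simp only: mult_ac)
 also have "... = Y * (X * Y powr k)"
  using \<theta> Z by (simp add: powr_mult[symmetric] Z_def)
 finally show ?thesis using Y by (simp add: k_def)
qed

text \<open>Dilations by b turn the additive inequality into a family with parameter t = b^2, using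
  n (1 - \<theta>) = 2 \<theta>. Optimising gives the product form, whose constant is expressed
  first through the mass of the minimiser v and then, by the norm relation and \<theta>\<mu> = C,
  through that of Q.\<close>

theorem gagliardo_nirenberg:
 fixes Q :: "real^'n::finite => real" and u :: "real^'n => complex"
 assumes n2: "2 <= CARD('n)" and C: "0 < C" and Q: "is_ground_state ((real CARD('n) + 2) / real CARD('n) * C) Q" and u: "u \<in> H1"
 shows "C * (L2_norm (cr Q)) powr (4 / real CARD('n)) * (LBINT x. pw (4 / real CARD('n)) u x) \<le>
  dirichlet u / 2 * (L2_norm u) powr (4 / real CARD('n))" "0 < L2_norm (cr Q)"
proof -
 define n where "n = real CARD('n)"
 have n: "2 <= n" using n2 by (simp add: n_def)
 define s where "s = 4 / n"
 define \<theta> where "\<theta> = n / (n + 2)"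
 define \<mu> where "\<mu> = (n + 2) / n * C"
 have sub: "subcritical CARD('n) s"
  using n2 n by (auto simp: subcritical_def s_def n_def[symmetric] intro!: divide_strict_left_mono) (auto simp: n_def)
 have \<mu>: "0 < \<mu>" and \<theta>: "0 < \<theta>" "\<theta> < 1" using C n by (auto simp: \<mu>_def \<theta>_def)
 have \<theta>\<mu>: "\<theta> * \<mu> = C" using n by (simp add: \<theta>_def \<mu>_def)
 have \<theta>s: "2 / (s + 2) = \<theta>" using n by (simp add: s_def \<theta>_def field_simps)
 have ks: "1/\<theta> - 1 = s / 2" using n by (simp add: s_def \<theta>_def field_simps)
 have sq: "(x^2) powr (s / 2) = x powr s" if "0 <= x" for x :: real
  using that powr_powr[of x 2 "s / 2"] by (cases "x = 0") (simp_all add: powr_numeral)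
 show Q0: "0 < L2_norm (cr Q)"
  by (rule ground_state_minimizer[OF s_def[unfolded n_def] sub \<mu> Q[folded n_def, folded \<mu>_def]])
 show "C * (L2_norm (cr Q)) powr (4 / real CARD('n)) * (LBINT x. pw (4 / real CARD('n)) u x) \<le>
  dirichlet u / 2 * (L2_norm u) powr (4 / real CARD('n))"
  unfolding n_def[symmetric] s_def[symmetric]
 proof (rule ground_state_minimizer[OF s_def[unfolded n_def] sub \<mu> Q[folded n_def, folded \<mu>_def]])
  fix v :: "real^'n => real" and m
  assume vH: "cr v \<in> H1" and vN: "(LBINT x. pw s (cr v) x) = 1" and m: "0 < m" and vm: "dirichlet (cr v) / 2 + (L2_norm (cr v))^2 = m"
   and low: "!!u :: real^'n => complex. u \<in> H1 ==> m * (LBINT x. pw s u x) powr (2 / (s + 2)) <= dirichlet u / 2 + (L2_norm u)^2"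
   and vQ: "(L2_norm (cr Q)) powr s * \<mu> = m * (L2_norm (cr v)) powr s"
  have dil: "m * (LBINT x. pw s u x) powr \<theta> * t powr \<theta> <= t * (dirichlet u / 2) + (L2_norm u)^2"
   if u: "u \<in> H1" and t: "0 < t" for u :: "real^'n => complex" and t
  proof -
   define b where "b = sqrt t"
   have b: "0 < b" "b^2 = t" using t by (simp_all add: b_def)
   define i where "i = inverse b ^ CARD('n)"
   have i: "0 < i" using b by (simp add: i_def)
   have ib: "i = b powr (- n)" using b by (simp add: i_def n_def powr_minus powr_realpow power_inverse)
   let ?N = "LBINT x. pw s u x"
   have N0: "0 <= ?N" by (rule integral_nonneg_AE) (simp add: pw_nonneg)
   have "m * (i * ?N) powr \<theta> <= dirichlet (%x. u (b *\<^sub>R x)) / 2 + i * (L2_norm u)^2"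
    using low[OF dirichlet_dilation_le(1)[OF u b(1)]]
    unfolding \<theta>s pw_integral_dilation[OF H1_L2[OF u] b(1)] L2_norm_dilation(2)[OF H1_L2[OF u] b(1)] i_def .
   also have "... <= (i * b^2 * dirichlet u) / 2 + i * (L2_norm u)^2"
    using dirichlet_dilation_le(2)[OF u b(1)] by (simp add: i_def)
   also have "... = i * (t * (dirichlet u / 2) + (L2_norm u)^2)" by (simp add: b(2) algebra_simps)
   also have "(i * ?N) powr \<theta> = i * (?N powr \<theta> * t powr \<theta>)"
   proof -
    have "t powr \<theta> = b powr (2 * \<theta>)" using b t powr_powr[of b 2 \<theta>] by (simp add: powr_numeral)
    moreover have "i powr \<theta> = b powr (- n) * b powr (2 * \<theta>)"
    proof -
     have "- n * \<theta> = - n + 2 * \<theta>" using n by (simp add: \<theta>_def field_simps)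
     then show ?thesis by (simp add: ib powr_powr powr_add[symmetric])
    qed
    ultimately show ?thesis using i N0 by (simp add: powr_mult ib)
   qed
   finally have "i * (m * ?N powr \<theta> * t powr \<theta>) <= i * (t * (dirichlet u / 2) + (L2_norm u)^2)" by (simp add: mult_ac)
   then show ?thesis using i by simp
  qed
  let ?X = "dirichlet (cr v) / 2" and ?Y = "(L2_norm (cr v))^2"
  \<comment> \<open>Along dilations of v the inequality is attained at t = 1. The vanishing
    derivative is the Pohozaev identity: m splits into \<theta> m for half the Dirichlet integral
    and (1 - \<theta>) m for the squared mass.\<close>
  have "?X - m * \<theta> = 0"
  proof (rule DERIV_local_min[of "%t. t * ?X + ?Y - m * t powr \<theta>" _ 1 1])
   show "((%t. t * ?X + ?Y - m * t powr \<theta>) has_real_derivative ?X - m * \<theta>) (at 1)"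
    by (auto intro!: derivative_eq_intros)
   show "\<forall>t. \<bar>1 - t\<bar> < 1 --> 1 * ?X + ?Y - m * 1 powr \<theta> <= t * ?X + ?Y - m * t powr \<theta>"
    using dil[OF vH] vm vN by auto
  qed simp
  then have Yv: "?Y = (1 - \<theta>) * m" using vm by (simp add: algebra_simps)
  have kv: "((1 - \<theta>) * m) powr (s / 2) = (L2_norm (cr v)) powr s"
   unfolding Yv[symmetric] by (rule sq) (rule L2_norm_nonneg)
  have "\<theta> * m * (L2_norm (cr v)) powr s * (LBINT x. pw s u x) <= dirichlet u / 2 * (L2_norm u) powr s"
  proof (cases "L2_norm u = 0")
   case True
   then have "AE x in lborel. u x = 0" using L2_norm_eq_0[OF H1_L2[OF u]] by simp
   then have "(LBINT x. pw s u x) = 0" by (intro integral_eq_zero_AE) (auto simp: pw_def)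
   then show ?thesis using dirichlet_nonneg[of u] by simp
  next
   case False
   have "\<theta> * m * ((1 - \<theta>) * m) powr (1/\<theta> - 1) * (LBINT x. pw s u x) <= dirichlet u / 2 * ((L2_norm u)^2) powr (1/\<theta> - 1)"
    by (rule optimize_scaling[OF \<theta> m _ _ _ dil[OF u]])
     (use False dirichlet_nonneg[of u] in "auto intro!: integral_nonneg_AE simp: pw_nonneg")
   then show ?thesis unfolding ks kv sq[OF L2_norm_nonneg] .
  qed
  moreover have "\<theta> * m * (L2_norm (cr v)) powr s = C * (L2_norm (cr Q)) powr s"
   unfolding \<theta>\<mu>[symmetric] using vQ by (simp add: mult_ac)
  ultimately show "C * (L2_norm (cr Q)) powr s * (LBINT x. pw s u x) <= dirichlet u / 2 * (L2_norm u) powr s" by simp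
 qed
qed

section \<open>Coercivity in the mass-critical case\<close>

context rotating_nls
begin

text \<open>The diamagnetic inequality for the linear vector potential. For a fixed direction z its
  component along z is a linear form a . x, so one exact phase serves each translation, and
  averaging over directions assembles the full magnetic gradient.\<close>

lemma dirichlet_cmod_le:
 assumes f: "f \<in> Sigma_space"
 shows "(%x. cor (cmod (f x))) \<in> H1"
  "dirichlet (%x. cor (cmod (f x))) <= (\<Sum>j\<in>UNIV. (L2_norm (mag_grad j f))^2)"
proof -
 obtain k :: 'n where True by simp
 note fH = Sigma_H1[OF f]
 note fL = H1_L2[OF fH]
 have sd: "shift_dist (%x. cor (cmod (f x))) z <= L2_norm (%x. \<Sum>j\<in>UNIV. cor (z $ j) * mag_grad j f x)" for z
 proof -
  \<comment> \<open>Chosen so that a . x is the sum of z_j times the j-th component of the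
    potential; the antisymmetry of the rotation gives a . z = 0, as the magnetic translations
    require.\<close>
  define a where "a = (\<Omega> * z $ e2) *\<^sub>R axis e1 1 - (\<Omega> * z $ e1) *\<^sub>R (axis e2 1 :: real^'n)"
  have az: "a \<bullet> y = \<Omega> * z $ e2 * y $ e1 - \<Omega> * z $ e1 * y $ e2" for y
   by (simp add: a_def inner_diff_left inner_axis')
  have vp: "(\<Sum>j\<in>UNIV. z $ j * vector_potential j x) = a \<bullet> x" for x
  proof -
   have "z $ j * vector_potential j x = (if j = e1 then - \<Omega> * z $ e1 * x $ e2 else 0) + (if j = e2 then \<Omega> * z $ e2 * x $ e1 else 0)" for j
    using e12 by (auto simp: vector_potential_def)
   then show ?thesis by (simp add: sum.distrib az)
  qed
  have eq: "(\<Sum>j\<in>UNIV. cor (z $ j) * mag_grad j f x) =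
    (\<Sum>j\<in>UNIV. cor (z $ j) * weak_partial j f x) - \<i> * cor (a \<bullet> x) * f x" for x
   by (simp add: mag_grad_def right_diff_distrib sum_subtractf sum_distrib_left sum_distrib_right of_real_sum[symmetric] of_real_mult[symmetric] mult_ac
     del: of_real_sum of_real_mult flip: vp)
    (simp add: sum_distrib_left sum_distrib_right mult_ac)
  have "(%x. \<Sum>j\<in>UNIV. cor (z $ j) * mag_grad j f x) \<in> L2"
   by (intro L2_sum L2_cmult mag_grad_L2 f)
  from diamagnetic_translation_le[OF fL H1_weak_partial[OF fH], of a z] this show ?thesis
   unfolding eq by (simp add: az shift_dist_def)
 qed
 have "nonlocal_form e (%x. cor (cmod (f x))) <= ennreal (ball_moment k * (\<Sum>j\<in>UNIV. (L2_norm (mag_grad j f))^2))" if "e > 0" for e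
  by (rule nonlocal_form_le[OF L2_cmod[OF fL] mag_grad_L2[OF f] that sd])
 from H1_if_nonlocal_form_le[OF L2_cmod[OF fL] sum_nonneg[OF zero_le_power2] this]
 show "(%x. cor (cmod (f x))) \<in> H1"
  "dirichlet (%x. cor (cmod (f x))) <= (\<Sum>j\<in>UNIV. (L2_norm (mag_grad j f))^2)"
  by auto
qed

text \<open>The sharp inequality is applied to |f|, so that its Dirichlet integral is paid for by
  the magnetic one. The potential then takes at most the fraction \<rho> = (c'/|Q|)^(4/n) of
  \<open>quad\<close>, with |Q| the L2 norm, up to a constant from the term linear in v.\<close>

lemma coercive_mass_critical:
 fixes Q :: "real^'n => real"
 assumes \<kappa>1: "\<kappa> = 1" and p: "p = 1 + 4 / real CARD('n)" and C: "C > 0"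
  and GC: "!!x v. 0 <= v ==> G x v <= C * (v + v powr ((p + 1) / 2))"
  and Q: "is_ground_state ((real CARD('n) + 2) / real CARD('n) * C) Q" and c: "0 < c" "c < L2_norm (cr Q)"
 shows "coercive_near c"
proof -
 let ?Q = "L2_norm (cr Q)"
 \<comment> \<open>Strictly between c and the mass of Q: above c as coercivity near c demands, below
   it so that \<rho> < 1.\<close>
 define c' where "c' = (c + ?Q) / 2"
 have c': "c < c'" "c' < ?Q" "0 < c'" using c by (auto simp: c'_def)
 define \<rho> where "\<rho> = (c' / ?Q) powr (p - 1)"
 have \<rho>: "\<rho> < 1" unfolding \<rho>_def using c' p1 powr_less_mono2[of "p - 1" "c' / ?Q" 1] by simp
 have "(1 - \<rho>) * quad f - C * c'^2 <= E f" if f: "f \<in> Sigma_space" and fc: "L2_norm f <= c'" for f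
 proof -
  have l: "lip2 (sqrt (dirichlet f)) f" by (rule Sigma_lip2[OF f order_refl])
  let ?N = "LBINT x. pw (p - 1) f x" and ?T = "\<Sum>j\<in>UNIV. (L2_norm (mag_grad j f))^2"
  have "potential f <= (LBINT x. C * ((cmod (f x))^2 + pw (p - 1) f x))"
   unfolding potential_def
  proof (rule integral_mono[OF G_integrable[OF l]])
   show "integrable lborel (%x. C * ((cmod (f x))^2 + pw (p - 1) f x))"
    by (intro integrable_mult_right Bochner_Integration.integrable_add L2_integrable[OF lip2_L2[OF l]] pw_integrable[OF sub l])
   fix x
   have "((cmod (f x))^2) powr ((p + 1) / 2) = pw (p - 1) f x"
   proof (cases "f x = 0")
    case False
    have "(p + 1) / 2 = 1 + (p - 1) / 2" by (simp add: field_simps)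
    then show ?thesis using False sq_powr[of "cmod (f x)"] by (simp only: powr_add) (simp add: pw_def)
   qed (simp add: pw_def)
   then show "G x ((cmod (f x))^2) <= C * ((cmod (f x))^2 + pw (p - 1) f x)" using GC[of "(cmod (f x))^2" x] by simp
  qed
  also have "... = C * ((L2_norm f)^2 + ?N)"
   using L2_integrable[OF lip2_L2[OF l]] pw_integrable[OF sub l] by (simp add: L2_norm_sq)
  also have "... <= C * c'^2 + \<rho> * quad f"
  proof -
   have a: "C * (L2_norm f)^2 <= C * c'^2" using C fc by (intro mult_left_mono power_mono) (auto simp: L2_norm_nonneg)
   have sp: "4 / real CARD('n) = p - 1" using p by simp
   have "C * ?Q powr (p - 1) * (LBINT x. pw (p - 1) (%x. cor (cmod (f x))) x)
     <= dirichlet (%x. cor (cmod (f x))) / 2 * (L2_norm (%x. cor (cmod (f x)))) powr (p - 1)"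
    using gagliardo_nirenberg(1)[OF card2 C Q dirichlet_cmod_le(1)[OF f]] unfolding sp .
   also have "(LBINT x. pw (p - 1) (%x. cor (cmod (f x))) x) = ?N" by (simp add: pw_def)
   also have "L2_norm (%x. cor (cmod (f x))) = L2_norm f" by (rule L2_norm_cmod)
   also have "dirichlet (%x. cor (cmod (f x))) / 2 * L2_norm f powr (p - 1) <= quad f * c' powr (p - 1)"
   proof (rule mult_mono)
    have "dirichlet (%x. cor (cmod (f x))) / 2 <= 1/2 * ?T" using dirichlet_cmod_le(2)[OF f] by simp
    then show "dirichlet (%x. cor (cmod (f x))) / 2 <= quad f" unfolding quad_def by (rule add_increasing2[OF zero_le_power2])
    show "L2_norm f powr (p - 1) <= c' powr (p - 1)" using fc p1 by (intro powr_mono2) (auto simp: L2_norm_nonneg)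
   qed (simp_all add: quad_nonneg)
   finally have "C * ?N <= quad f * c' powr (p - 1) / ?Q powr (p - 1)" using c by (simp add: pos_le_divide_eq mult_ac)
   also have "... = \<rho> * quad f" using c c' by (simp add: \<rho>_def powr_divide)
   finally show ?thesis using a by (simp add: distrib_left)
  qed
  finally have "potential f <= C * c'^2 + \<rho> * quad f" .
  then show ?thesis unfolding energy_eq[OF f] unfolding \<kappa>1 by (simp add: algebra_simps)
 qed
 then show ?thesis
  unfolding coercive_near_def using c'(1) \<rho> by (intro exI[of _ c'] conjI exI[of _ "1 - \<rho>"] exI[of _ "C * c'^2"]) auto
qed

end

theorem theorem8p3:
  fixes e1 e2 :: "'n::finite"
    and \<gamma> \<Omega> \<kappa> c p C' :: real
    and G :: "real ^ 'n \<Rightarrow> real \<Rightarrow> real"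
    and U :: "real \<Rightarrow> (real ^ 'n \<Rightarrow> complex) \<Rightarrow> real ^ 'n \<Rightarrow> complex"
  assumes "CARD('n) \<ge> 2" and "e1 \<noteq> e2"
    and "\<gamma> > 0" and "\<bar>\<Omega>\<bar> < \<gamma>" and "\<kappa> \<in> {1, -1}" and "c > 0"
    and "\<And>x v. v \<ge> 0 \<Longrightarrow> G x v \<ge> 0"
    and "continuous_on (UNIV \<times> {0..}) (\<lambda>(x, v). G x v)"
    and "\<And>x. G x differentiable_on {0..}"
    and "\<And>x. G x 0 = 0"
    and "C' > 0" and "1 \<le> p" and "ereal p < energy_critical CARD('n)"
    and "\<And>x v. v \<ge> 0 \<Longrightarrow> \<bar>deriv_v G x v\<bar> \<le> C' * (1 + v powr ((p - 1) / 2))"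
    and "schroedinger_group e1 e2 \<Omega> \<gamma> U"
    and "local_theory e1 e2 \<Omega> \<gamma> \<kappa> G U"
    and "\<kappa> = 1 \<and> 1 < p \<and> p < 1 + 4 / real CARD('n)
       \<or> \<kappa> = 1 \<and> p = 1 + 4 / real CARD('n) \<and>
           (\<exists>C Q. C > 0 \<and>
              (\<forall>x. \<forall>v\<ge>0. 0 \<le> G x v \<and> G x v \<le> C * (v + v powr ((p + 1) / 2))) \<and>
              is_ground_state ((real CARD('n) + 2) / real CARD('n) * C) (Q :: real ^ 'n \<Rightarrow> real) \<and>
              c < L2_norm (\<lambda>x. complex_of_real (Q x)))
       \<or> \<kappa> = -1 \<and> 1 < p \<and> ereal p < energy_critical CARD('n)"
  shows "orbitally_stable \<kappa> G U (minimizers e1 e2 \<Omega> \<gamma> \<kappa> G c)"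
proof -
 have "4 / real CARD('n) > 0" by simp
 \<comment> \<open>In the critical case this comes from 4/n > 0; the strict inequality is part of
   subcriticality of p - 1.\<close>
 then have p: "1 < p" using assms(17) by linarith
 have sub: "subcritical CARD('n) (p - 1)"
  using assms(1,13) p by (auto simp: subcritical_def energy_critical_def split: if_splits)
 interpret rotating_nls e1 e2 \<gamma> \<Omega> \<kappa> p C' G
  by unfold_locales (fact assms(1,2,4,5,7,8,9,10,11,14) sub)+
 show ?thesis
 proof (rule orbitally_stable_if_coercive[OF assms(6) _ assms(16)])
  from assms(17) consider "\<kappa> = 1" "p < 1 + 4 / real CARD('n)"
   | C Q where "\<kappa> = 1" "p = 1 + 4 / real CARD('n)" "C > 0"
     "!!x v. 0 <= v ==> G x v <= C * (v + v powr ((p + 1) / 2))"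
     "is_ground_state ((real CARD('n) + 2) / real CARD('n) * C) (Q :: real ^ 'n => real)" "c < L2_norm (cr Q)"
   | "\<kappa> = -1" by blast
  then show "coercive_near c"
  proof cases
   case 1
   then show ?thesis by (rule coercive_mass_subcritical) (rule assms(6))
  next
   case 2
   then show ?thesis by (intro coercive_mass_critical[OF 2(1-5) assms(6)])
  next
   case 3
   then show ?thesis by (rule coercive_defocusing)
  qed
 qed
qed

end
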